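(* Let $m,n\in\mathbb{N}$ with $m\le n$ and let $\mathcal{O}$ be the ring of integers of a number field. For all non-zero prime ideals $\mathfrak{p}$ of $\mathcal{O}$, the topological representation zeta function of $G_{m,n}(\mathcal{O}_{\mathfrak{p}})$ is $$\prod_{i=0}^{m-1}\frac{s-i}{s-n-i}.$$
   Context: $\mathbb{N}$ is the set of positive integers, and $\mathcal{O}_{\mathfrak p}$ is the completion of $\mathcal{O}$ at $\mathfrak p$. The group scheme $G_{m,n}$: let $\Lambda_{m,n}$ be the $\mathbb{Z}$-Lie lattice with $\mathbb{Z}$-basis $x_1,\dots,x_{m+n}$, $z_{ij}$ ($1\le i\le m$, $1\le j\le n$) and brackets $[x_i,x_{m+j}]=z_{ij}$, all brackets not following formally from these being zero. $G_{m,n}$ is the unipotent group scheme associated with the class-2 nilpotent Lie lattice $\Lambda_{m,n}$. Concretely, for a commutative ring $R$, $G_{m,n}(R)$ is the set $R^m\times R^n\times \mathrm{Mat}_{m\times n}(R)$ with multiplication $(a,b,c)(a',b',c')=(a+a',\,b+b',\,c+c'+a\,(b')^{T})$, where $a,b$ are column vectors. Local representation zeta function: for a topological group $G$, $\mathrm{Irr}_i(G)$ is the set of characters of continuous irreducible complex representations of dimension $i$; $\theta_1\sim\theta_2$ if $\theta_1=\chi\theta_2$ for some $\chi\in\mathrm{Irr}_1(G)$; $\tilde a_i(G)=\#(\mathrm{Irr}_i(G)/\sim)$ and $\zeta_G(s)=\sum_{i\ge1}\tilde a_i(G)i^{-s}$. Topological representation zeta function (Rossmann): suppose there is a rational function $W(X,Y)\in\mathbb{Q}(X,Y)$,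 which can be written with a denominator that is a product of factors of the form $1-X^aY^b$ with $(a,b)\in\mathbb{Z}^2\smallsetminus\{(0,0)\}$, such that $\zeta_{G_{m,n}(\mathcal{O}_{\mathfrak p})}(s)=W(q,q^{-s})$ for every non-zero prime $\mathfrak p$ of the ring of integers $\mathcal{O}$ of every number field, where $q$ is the residue field cardinality of $\mathfrak p$. Expand $W(q,q^{-s})$ as a Laurent series in $q-1$ over $\mathbb{Q}(s)$ by using $q^{a-bs}=\sum_{k\ge 0}\binom{a-bs}{k}(q-1)^k$. The topological representation zeta function is the constant term (the ``limit $q\to1$'') of this expansion, provided that the expansion is a power series in $q-1$; it is a rational function in $s$. *)

theory Defs
  imports
    "HOL-Analysis.Function_Topology"
    "HOL-Analysis.Complex_Transcendental"
    "HOL-Algebra.Embedded_Algebras"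
    "HOL-Algebra.Ideal_Product"
    "HOL-Algebra.QuotRing"
    "HOL-Computational_Algebra.Polynomial_Factorial"
    "HOL-Computational_Algebra.Normalized_Fraction"
    "HOL-Computational_Algebra.Field_as_Ring"
    "HOL-Computational_Algebra.Formal_Laurent_Series"
    "Jordan_Normal_Form.Matrix"
begin

subsection \<open>Number fields and completions of their rings of integers\<close>

definition complex_ring :: "complex ring" where
  "complex_ring = \<lparr>carrier = UNIV, monoid.mult = (*), one = 1, ring.zero = 0, add = (+)\<rparr>"

text \<open>Every number field embeds into the complex numbers, so we take number fields to be
  subfields of the complex numbers; this allows quantification over all of them.\<close>

definition number_field :: "complex set \<Rightarrow> bool" where
  "number_field K \<longleftrightarrow> subfield K complex_ring \<and> ring.finite_dimension complex_ring \<rat> K"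

definition ring_of_integers :: "complex set \<Rightarrow> complex ring" where
  "ring_of_integers K = complex_ring\<lparr>carrier := {x \<in> K. algebraic_int x}\<rparr>"

definition nonzero_prime :: "complex set \<Rightarrow> complex set \<Rightarrow> bool" where
  "nonzero_prime K p \<longleftrightarrow> primeideal p (ring_of_integers K) \<and> p \<noteq> {0}"

definition residue_cardinality :: "complex set \<Rightarrow> complex set \<Rightarrow> nat" where
  "residue_cardinality K p = card (carrier (ring_of_integers K Quot p))"

text \<open>\<open>quotient_by_power K p k\<close> is the quotient of the ring of integers by the \<open>k\<close>-th power of the
  ideal \<open>p\<close>; \<open>ideals_set\<close> is the library's monoid of ideals under ideal multiplication.\<close>

definition quotient_by_power :: "complex set \<Rightarrow> complex set \<Rightarrow> nat \<Rightarrow> complex set ring" where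
  "quotient_by_power K p k =
     ring_of_integers K Quot (p [^]\<^bsub>ideals_set (ring_of_integers K)\<^esub> k)"

text \<open>The completion is the inverse limit of these quotients. For cosets \<open>A\<close> of the \<open>k\<close>-th and
  \<open>B\<close> of the \<open>(k+1)\<close>-st power, \<open>B\<close> is mapped to \<open>A\<close> by the projection iff \<open>B \<subseteq> A\<close>.\<close>

definition completion :: "complex set \<Rightarrow> complex set \<Rightarrow> (nat \<Rightarrow> complex set) ring" where
  "completion K p =
     \<lparr>carrier = {f. \<forall>k. f k \<in> carrier (quotient_by_power K p k) \<and> f (Suc k) \<subseteq> f k},
      monoid.mult = (\<lambda>f g k. f k \<otimes>\<^bsub>quotient_by_power K p k\<^esub> g k),
      one = (\<lambda>k. \<one>\<^bsub>quotient_by_power K p k\<^esub>),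
      ring.zero = (\<lambda>k. \<zero>\<^bsub>quotient_by_power K p k\<^esub>),
      add = (\<lambda>f g k. f k \<oplus>\<^bsub>quotient_by_power K p k\<^esub> g k)\<rparr>"

definition completion_topology ::
    "complex set \<Rightarrow> complex set \<Rightarrow> (nat \<Rightarrow> complex set) topology" where
  "completion_topology K p =
     subtopology
       (product_topology (\<lambda>k. discrete_topology (carrier (quotient_by_power K p k))) UNIV)
       (carrier (completion K p))"

subsection \<open>The groups of points of the unipotent group schemes\<close>

type_synonym 'a triple = "(nat \<Rightarrow> 'a) \<times> (nat \<Rightarrow> 'a) \<times> (nat \<times> nat \<Rightarrow> 'a)"

definition unipotent_group :: "nat \<Rightarrow> nat \<Rightarrow> ('a, 'b) ring_scheme \<Rightarrow> 'a triple monoid" where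
  "unipotent_group m n R =
     \<lparr>carrier = ({..<m} \<rightarrow>\<^sub>E carrier R) \<times> ({..<n} \<rightarrow>\<^sub>E carrier R) \<times>
                ({..<m} \<times> {..<n} \<rightarrow>\<^sub>E carrier R),
      monoid.mult = (\<lambda>(a, b, c) (a', b', c').
        (\<lambda>i\<in>{..<m}. a i \<oplus>\<^bsub>R\<^esub> a' i,
         \<lambda>j\<in>{..<n}. b j \<oplus>\<^bsub>R\<^esub> b' j,
         \<lambda>(i, j)\<in>{..<m} \<times> {..<n}. c (i, j) \<oplus>\<^bsub>R\<^esub> c' (i, j) \<oplus>\<^bsub>R\<^esub> a i \<otimes>\<^bsub>R\<^esub> b' j)),
      one = (\<lambda>i\<in>{..<m}. \<zero>\<^bsub>R\<^esub>, \<lambda>j\<in>{..<n}. \<zero>\<^bsub>R\<^esub>, \<lambda>ij\<in>{..<m} \<times> {..<n}. \<zero>\<^bsub>R\<^esub>)\<rparr>"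

definition unipotent_topology :: "nat \<Rightarrow> nat \<Rightarrow> 'a topology \<Rightarrow> 'a triple topology" where
  "unipotent_topology m n T =
     prod_topology (product_topology (\<lambda>_. T) {..<m})
       (prod_topology (product_topology (\<lambda>_. T) {..<n})
         (product_topology (\<lambda>_. T) ({..<m} \<times> {..<n})))"

subsection \<open>Characters and twist classes\<close>

text \<open>A topological group is given by a group \<open>G\<close> and a topology \<open>T\<close> on its carrier.
  A representation is continuous iff all its matrix coefficients are.\<close>

definition continuous_representation ::
    "'g monoid \<Rightarrow> 'g topology \<Rightarrow> nat \<Rightarrow> ('g \<Rightarrow> complex mat) \<Rightarrow> bool" where
  "continuous_representation G T d \<rho> \<longleftrightarrow>
     \<rho> \<in> hom G (units_of (ring_mat TYPE(complex) d ())) \<and>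
     (\<forall>j<d. \<forall>k<d. continuous_map T euclidean (\<lambda>g. \<rho> g $$ (j, k)))"

definition irreducible_representation ::
    "'g monoid \<Rightarrow> nat \<Rightarrow> ('g \<Rightarrow> complex mat) \<Rightarrow> bool" where
  "irreducible_representation G d \<rho> \<longleftrightarrow>
     d > 0 \<and>
     (\<forall>W. submodule W complex_ring (module_vec TYPE(complex) d) \<and>
          (\<forall>g\<in>carrier G. \<forall>w\<in>W. \<rho> g *\<^sub>v w \<in> W)
          \<longrightarrow> W = {0\<^sub>v d} \<or> W = carrier_vec d)"

definition Irr :: "'g monoid \<Rightarrow> 'g topology \<Rightarrow> nat \<Rightarrow> ('g \<Rightarrow> complex) set" where
  "Irr G T d =
     {\<lambda>g\<in>carrier G. \<Sum>j<d. \<rho> g $$ (j, j) | \<rho>.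
        continuous_representation G T d \<rho> \<and> irreducible_representation G d \<rho>}"

definition twist_relation ::
    "'g monoid \<Rightarrow> 'g topology \<Rightarrow> nat \<Rightarrow> (('g \<Rightarrow> complex) \<times> ('g \<Rightarrow> complex)) set" where
  "twist_relation G T d =
     {(\<theta>1, \<theta>2). \<theta>1 \<in> Irr G T d \<and> \<theta>2 \<in> Irr G T d \<and>
        (\<exists>\<psi>\<in>Irr G T 1. \<forall>g\<in>carrier G. \<theta>1 g = \<psi> g * \<theta>2 g)}"

definition twist_classes :: "'g monoid \<Rightarrow> 'g topology \<Rightarrow> nat \<Rightarrow> ('g \<Rightarrow> complex) set set" where
  "twist_classes G T d = Irr G T d // twist_relation G T d"

text \<open>The representation zeta function of \<open>G\<close> is defined and equal to \<open>F\<close>, as functions on some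
  right half-plane. Finiteness of the sets of twist classes is part of being defined.\<close>

definition has_representation_zeta ::
    "'g monoid \<Rightarrow> 'g topology \<Rightarrow> (complex \<Rightarrow> complex) \<Rightarrow> bool" where
  "has_representation_zeta G T F \<longleftrightarrow>
     (\<forall>d\<ge>1. finite (twist_classes G T d)) \<and>
     (\<exists>\<sigma>. \<forall>s. Re s > \<sigma> \<longrightarrow>
        (\<lambda>d. of_nat (card (twist_classes G T (Suc d))) * of_nat (Suc d) powr (- s)) sums F s)"

subsection \<open>Rational functions in two variables\<close>

text \<open>The field of rational functions in \<open>X\<close> and \<open>Y\<close> over the rationals is
  \<open>rat poly poly fract\<close>, where \<open>X\<close> is the inner and \<open>Y\<close> the outer polynomial variable.
  Via \<open>quot_of_fract\<close> its elements are evaluated as reduced fractions.\<close>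

definition ratfun_X :: "rat poly poly fract" where "ratfun_X = to_fract [:[:0, 1:]:]"

definition ratfun_Y :: "rat poly poly fract" where "ratfun_Y = to_fract [:0, 1:]"

definition cyclotomic_like_denominator :: "rat poly poly fract \<Rightarrow> bool" where
  "cyclotomic_like_denominator W \<longleftrightarrow>
     (\<exists>N. \<exists>es :: (int \<times> int) list. (0, 0) \<notin> set es \<and>
        W = to_fract N / (\<Prod>(a, b)\<leftarrow>es. 1 - ratfun_X powi a * ratfun_Y powi b))"

definition eval_poly2 :: "rat poly poly \<Rightarrow> complex \<Rightarrow> complex \<Rightarrow> complex" where
  "eval_poly2 P x y = poly (map_poly (\<lambda>c. poly (map_poly of_rat c) x) P) y"

definition eval_ratfun :: "rat poly poly fract \<Rightarrow> complex \<Rightarrow> complex \<Rightarrow> complex" where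
  "eval_ratfun W x y =
     eval_poly2 (fst (quot_of_fract W)) x y / eval_poly2 (snd (quot_of_fract W)) x y"

text \<open>The field of rational functions in \<open>s\<close> over the rationals is \<open>rat poly fract\<close>.
  In the following Laurent series the formal variable is \<open>q - 1\<close>; the series
  \<open>fps_binomial (a - b * s)\<close> is the expansion of \<open>q\<close> to the power \<open>a - b * s\<close>.\<close>

definition ratfun_s :: "rat poly fract" where "ratfun_s = to_fract [:0, 1:]"

definition expand_poly2 :: "rat poly poly \<Rightarrow> rat poly fract fls" where
  "expand_poly2 P =
     (\<Sum>b\<le>degree P. \<Sum>a\<le>degree (coeff P b).
        fls_const (of_rat (coeff (coeff P b) a)) *
        fps_to_fls (fps_binomial (of_nat a - of_nat b * ratfun_s)))"

definition expand_ratfun :: "rat poly poly fract \<Rightarrow> rat poly fract fls" where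
  "expand_ratfun W =
     expand_poly2 (fst (quot_of_fract W)) / expand_poly2 (snd (quot_of_fract W))"

subsection \<open>Topological representation zeta functions\<close>

text \<open>Here \<open>G K p\<close> with topology \<open>T K p\<close> is the group of points of a group scheme over the
  completion at \<open>p\<close> of the ring of integers of \<open>K\<close>.\<close>

definition uniform_representation_zeta ::
    "(complex set \<Rightarrow> complex set \<Rightarrow> 'g monoid) \<Rightarrow>
     (complex set \<Rightarrow> complex set \<Rightarrow> 'g topology) \<Rightarrow> rat poly poly fract \<Rightarrow> bool" where
  "uniform_representation_zeta G T W \<longleftrightarrow>
     cyclotomic_like_denominator W \<and>
     (\<forall>K p. number_field K \<and> nonzero_prime K p \<longrightarrow>
        has_representation_zeta (G K p) (T K p)
          (\<lambda>s. let q = of_nat (residue_cardinality K p) in eval_ratfun W q (q powr (- s))))"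

text \<open>The topological zeta function depends on the group scheme only. The universal quantifier
  makes it independent of the choice of \<open>W\<close>.\<close>

definition has_topological_representation_zeta ::
    "(complex set \<Rightarrow> complex set \<Rightarrow> 'g monoid) \<Rightarrow>
     (complex set \<Rightarrow> complex set \<Rightarrow> 'g topology) \<Rightarrow> rat poly fract \<Rightarrow> bool" where
  "has_topological_representation_zeta G T Z \<longleftrightarrow>
     (\<exists>W. uniform_representation_zeta G T W) \<and>
     (\<forall>W. uniform_representation_zeta G T W \<longrightarrow>
        fls_subdegree (expand_ratfun W) \<ge> 0 \<and> fls_nth (expand_ratfun W) 0 = Z)"

end

theory Submission
  imports Defs
    "HOL-Library.Function_Algebras"
    "Jordan_Normal_Form.Char_Poly"
    "Jordan_Normal_Form.VS_Connect"
    "Jordan_Normal_Form.Spectral_Radius"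
begin

subsection \<open>Subgroups of finite index and their characters\<close>

text \<open>Let q be the size of the residue field at the prime. The group of points is of
  Heisenberg type: triples (a, b, c) multiplied with the help of a bilinear map A x B -> C, here the
  outer product of two vectors. An irreducible representation acts on the central subgroup C through
  a character psi. Its degree is the index in B of the radical of psi, the set of all b that pair
  trivially with A under psi (\<open>degree_eq_index\<close>). Two irreducible characters with the
  same psi differ by a twist (\<open>twist_exists\<close>), every psi occurs
  (\<open>exists_irrep\<close>), and twisting keeps psi because the outer products generate C. So
  twist classes of degree d correspond to smooth characters psi of the m x n matrices whose radical
  has index d (\<open>twist_classes_bij\<close>).

  Such a psi is an m-tuple of characters of the row space, and its radical arises from the full
  lattice by cutting with one row character after another. Let a lattice of rank n have index q^l. A
  character cuts it down by index at most q^j exactly when it is trivial on pi^j times the lattice,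
  and there are q^l q^(nj) such characters (\<open>card_cut_index\<close>). Hence each row
  multiplies the count by a quantity that depends only on the index reached so far
  (\<open>card_tuples_Suc\<close>). The generating functions F_m in the variable t = q^(-s)
  therefore satisfy F_(m+1)(t) = F_m(q t) (1 - t) / (1 - q^n t), so the zeta function is the product
  over i < m of (1 - q^(i-s)) / (1 - q^(n+i-s)) (\<open>tuples_sums\<close>,
  \<open>zeta_sums\<close>).

  The expansion of 1 - q^(a-s) in powers of q - 1 starts with (s - a)(q - 1). Numerator and
  denominator have m such factors each, so the powers of q - 1 cancel and the constant term is the
  asserted product (\<open>expand_zeta_ratfun\<close>). The rational function W is unique: the
  rational primes supply infinitely many q, and for each q there are infinitely many values of
  q^(-s) (\<open>uniform_zeta_unique\<close>).

  Two reductions make this elementary. First, an element of the completion is approximated, modulo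
  each power of the prime, by elements of the localization D, a discrete valuation ring inside the
  complex numbers (\<open>uniformizer_exists\<close>, \<open>ideal_power_eq\<close>). Second, a
  continuous representation is trivial on some congruence subgroup, since complex matrix groups have
  no small subgroups (\<open>continuous_rep_level\<close>). All representation theory thus takes
  place on lattices over D, with subgroups of finite index and their finitely many
  characters.\<close>

definition add_subgroup :: "'a::ab_group_add set \<Rightarrow> bool" where
  "add_subgroup H \<longleftrightarrow> 0 \<in> H \<and> (\<forall>x\<in>H. \<forall>y\<in>H. x - y \<in> H)"

definition cosets_in :: "'a::ab_group_add set \<Rightarrow> 'a set \<Rightarrow> 'a set set" where
  "cosets_in G H = (\<lambda>x. {y \<in> G. y - x \<in> H}) ` G"

definition finite_index :: "'a::ab_group_add set \<Rightarrow> 'a set \<Rightarrow> bool" where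
  "finite_index G H \<longleftrightarrow> finite (cosets_in G H)"

definition subgroup_index :: "'a::ab_group_add set \<Rightarrow> 'a set \<Rightarrow> nat" where
  "subgroup_index G H = card (cosets_in G H)"

definition transversal :: "'a::ab_group_add set \<Rightarrow> 'a set \<Rightarrow> 'a set \<Rightarrow> bool" where
  "transversal G H T \<longleftrightarrow> T \<subseteq> G \<and> (\<forall>g\<in>G. \<exists>t\<in>T. g - t \<in> H) \<and> (\<forall>s\<in>T. \<forall>t\<in>T. s - t \<in> H \<longrightarrow> s = t)"

lemma add_subgroup_zero: "add_subgroup H \<Longrightarrow> 0 \<in> H"
  and add_subgroup_diff: "add_subgroup H \<Longrightarrow> x \<in> H \<Longrightarrow> y \<in> H \<Longrightarrow> x - y \<in> H"
  by (auto simp: add_subgroup_def)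

lemma add_subgroup_uminus: "add_subgroup H \<Longrightarrow> x \<in> H \<Longrightarrow> - x \<in> H"
  using add_subgroup_diff[of H 0 x] by (simp add: add_subgroup_zero)

lemma add_subgroup_add: "add_subgroup H \<Longrightarrow> x \<in> H \<Longrightarrow> y \<in> H \<Longrightarrow> x + y \<in> H"
  using add_subgroup_diff[of H x "- y"] by (simp add: add_subgroup_uminus)

lemmas add_subgroup_closed = add_subgroup_zero add_subgroup_diff add_subgroup_uminus add_subgroup_add

lemma add_subgroup_diff_swap: "add_subgroup H \<Longrightarrow> x - y \<in> H \<longleftrightarrow> y - x \<in> H"
  using add_subgroup_uminus[of H "x - y"] add_subgroup_uminus[of H "y - x"] by auto

lemma add_subgroup_diff_trans:
  "add_subgroup H \<Longrightarrow> x - y \<in> H \<Longrightarrow> y - z \<in> H \<Longrightarrow> x - z \<in> H"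
  using add_subgroup_add[of H "x - y" "y - z"] by simp

lemma add_subgroup_sum:
  "add_subgroup H \<Longrightarrow> (\<And>i. i \<in> I \<Longrightarrow> f i \<in> H) \<Longrightarrow> (\<Sum>i\<in>I. f i) \<in> H"
  by (induction I rule: infinite_finite_induct) (auto simp: add_subgroup_closed)

lemma coset_eq_iff:
  assumes "add_subgroup H" "x \<in> G" "y \<in> G"
  shows "{z \<in> G. z - x \<in> H} = {z \<in> G. z - y \<in> H} \<longleftrightarrow> x - y \<in> H"
proof
  assume "{z \<in> G. z - x \<in> H} = {z \<in> G. z - y \<in> H}"
  moreover have "x \<in> {z \<in> G. z - x \<in> H}" using assms by (simp add: add_subgroup_zero)
  ultimately show "x - y \<in> H" by blast
next
  assume "x - y \<in> H"
  then have "z - x \<in> H \<longleftrightarrow> z - y \<in> H" for z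
    using add_subgroup_diff_trans[OF assms(1), of z x y] add_subgroup_diff_trans[OF assms(1), of z y x]
      add_subgroup_diff_swap[OF assms(1), of x y] by auto
  then show "{z \<in> G. z - x \<in> H} = {z \<in> G. z - y \<in> H}" by simp
qed

lemma transversal_sub: "transversal G H T \<Longrightarrow> T \<subseteq> G"
  and transversal_ex: "transversal G H T \<Longrightarrow> g \<in> G \<Longrightarrow> \<exists>t\<in>T. g - t \<in> H"
  and transversal_unique: "transversal G H T \<Longrightarrow> s \<in> T \<Longrightarrow> t \<in> T \<Longrightarrow> s - t \<in> H \<Longrightarrow> s = t"
  unfolding transversal_def by blast+

lemma transversal_bij:
  assumes "add_subgroup H" "transversal G H T"
  shows "bij_betw (\<lambda>x. {y \<in> G. y - x \<in> H}) T (cosets_in G H)"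
proof (rule bij_betwI')
  fix x y assume "x \<in> T" "y \<in> T"
  then show "({z \<in> G. z - x \<in> H} = {z \<in> G. z - y \<in> H}) = (x = y)"
    using assms coset_eq_iff[of H x G y] unfolding transversal_def by blast
next
  fix x assume "x \<in> T"
  then show "{y \<in> G. y - x \<in> H} \<in> cosets_in G H"
    using assms by (auto simp: transversal_def cosets_in_def)
next
  fix C assume "C \<in> cosets_in G H"
  then obtain g where g: "g \<in> G" "C = {y \<in> G. y - g \<in> H}" by (auto simp: cosets_in_def)
  then obtain t where "t \<in> T" "g - t \<in> H" using assms by (auto simp: transversal_def)
  then show "\<exists>x\<in>T. C = {y \<in> G. y - x \<in> H}"
    using g assms coset_eq_iff[of H g G t] by (auto simp: transversal_def)
qed

lemma transversal_index:
  assumes "add_subgroup H" "transversal G H T"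
  shows "subgroup_index G H = card T" "finite_index G H \<longleftrightarrow> finite T"
  using bij_betw_same_card[OF transversal_bij[OF assms]] bij_betw_finite[OF transversal_bij[OF assms]]
  by (auto simp: subgroup_index_def finite_index_def)

lemma obtain_transversal:
  assumes "add_subgroup H"
  obtains T where "transversal G H T"
proof
  define f where "f C = (SOME x. x \<in> G \<and> C = {y \<in> G. y - x \<in> H})" for C
  have f: "f C \<in> G \<and> C = {y \<in> G. y - f C \<in> H}" if "C \<in> cosets_in G H" for C
    unfolding f_def by (rule someI_ex) (use that in \<open>auto simp: cosets_in_def\<close>)
  show "transversal G H (f ` cosets_in G H)"
    unfolding transversal_def
  proof (intro conjI ballI impI)
    show "f ` cosets_in G H \<subseteq> G" using f by blast
  next
    fix g assume g: "g \<in> G"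
    let ?C = "{y \<in> G. y - g \<in> H}"
    have C: "?C \<in> cosets_in G H" using g by (auto simp: cosets_in_def)
    then have "g - f ?C \<in> H"
      using f[OF C] coset_eq_iff[OF assms g, of "f ?C"] by auto
    then show "\<exists>t\<in>f ` cosets_in G H. g - t \<in> H" using C by blast
  next
    fix s t assume "s \<in> f ` cosets_in G H" "t \<in> f ` cosets_in G H" "s - t \<in> H"
    then obtain C C' where C: "C \<in> cosets_in G H" "C' \<in> cosets_in G H" "s = f C" "t = f C'" by blast
    have "C = C'" using f[OF C(1)] f[OF C(2)] coset_eq_iff[OF assms, of "f C" G "f C'"]
        C \<open>s - t \<in> H\<close> by auto
    then show "s = t" using C by simp
  qed
qed

lemma subgroup_index_pos:
  assumes "finite_index G H" "G \<noteq> {}" shows "subgroup_index G H > 0"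
  using assms by (auto simp: finite_index_def subgroup_index_def card_gt_0_iff cosets_in_def)

lemma subgroup_index_refl:
  assumes "add_subgroup G" shows "subgroup_index G G = 1" "finite_index G G"
proof -
  have "transversal G G {0}" using assms by (auto simp: transversal_def add_subgroup_closed)
  from transversal_index[OF assms this] show "subgroup_index G G = 1" "finite_index G G" by auto
qed

lemma subgroup_index_eq_1:
  assumes "add_subgroup G" "add_subgroup H" "H \<subseteq> G" "subgroup_index G H = 1"
  shows "G = H"
proof -
  obtain T where T: "transversal G H T" using obtain_transversal assms by blast
  then have "card T = 1" using transversal_index[OF assms(2) T] assms by simp
  then obtain t where t: "T = {t}" by (auto simp: card_1_singleton_iff)
  have "g \<in> H" if "g \<in> G" for g
  proof -
    have "0 - t \<in> H" "g - t \<in> H"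
      using T t that add_subgroup_zero[OF assms(1)] unfolding transversal_def by blast+
    then show ?thesis using add_subgroup_diff[OF assms(2), of "g - t" "0 - t"] by simp
  qed
  then show ?thesis using assms by blast
qed

text \<open>Sums of representatives, one from a transversal of \<open>M\<close> in \<open>G\<close>
  and one from a transversal of \<open>H\<close> in \<open>M\<close>, form a transversal of
  \<open>H\<close> in \<open>G\<close> without repetition.\<close>

lemma subgroup_index_mult:
  assumes "add_subgroup G" "add_subgroup M" "add_subgroup H" "M \<subseteq> G" "H \<subseteq> M"
    and fin: "finite_index G M" "finite_index M H"
  shows "finite_index G H" "subgroup_index G H = subgroup_index G M * subgroup_index M H"
proof -
  obtain S where S: "transversal G M S" using obtain_transversal assms by blast
  obtain T where T: "transversal M H T" using obtain_transversal assms by blast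
  let ?f = "\<lambda>(s, t). s + t"
  have inj: "s = s' \<and> t = t'" if "s \<in> S" "s' \<in> S" "t \<in> T" "t' \<in> T" "(s + t) - (s' + t') \<in> H" for s s' t t'
  proof -
    have "t' - t \<in> M" using that T by (intro add_subgroup_diff[OF assms(2)]) (auto simp: transversal_def)
    moreover have "(s + t) - (s' + t') \<in> M" using that(5) assms(5) by blast
    ultimately have "((s + t) - (s' + t')) + (t' - t) \<in> M" using add_subgroup_add[OF assms(2)] by blast
    moreover have "((s + t) - (s' + t')) + (t' - t) = s - s'" by simp
    ultimately have "s - s' \<in> M" by simp
    then have "s = s'" using that S unfolding transversal_def by blast
    moreover have "t - t' \<in> H" using that(5) \<open>s = s'\<close> by simp
    ultimately show ?thesis using that T unfolding transversal_def by blast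
  qed
  have tr: "transversal G H (?f ` (S \<times> T))"
    unfolding transversal_def
  proof (intro conjI ballI impI)
    show "?f ` (S \<times> T) \<subseteq> G"
      using S T assms(4) by (auto simp: transversal_def intro!: add_subgroup_add[OF assms(1)])
  next
    fix g assume "g \<in> G"
    then obtain s where s: "s \<in> S" "g - s \<in> M" using S by (auto simp: transversal_def)
    then obtain t where t: "t \<in> T" "g - s - t \<in> H" using T by (auto simp: transversal_def)
    have "g - (s + t) \<in> H" using t by (simp add: diff_diff_eq)
    then show "\<exists>t\<in>?f ` (S \<times> T). g - t \<in> H" using s t by auto
  next
    fix x y assume "x \<in> ?f ` (S \<times> T)" "y \<in> ?f ` (S \<times> T)" "x - y \<in> H"
    then obtain s t s' t' where "x = s + t" "y = s' + t'" "s \<in> S" "t \<in> T" "s' \<in> S" "t' \<in> T"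
      by auto
    then show "x = y" using inj[of s s' t t'] \<open>x - y \<in> H\<close> by simp
  qed
  have "inj_on ?f (S \<times> T)"
  proof (rule inj_onI, clarify)
    fix s t s' t' assume "s \<in> S" "t \<in> T" "s' \<in> S" "t' \<in> T" "s + t = s' + t'"
    then show "s = s' \<and> t = t'" using inj[of s s' t t'] add_subgroup_zero[OF assms(3)] by simp
  qed
  then have "card (?f ` (S \<times> T)) = card S * card T" by (simp add: card_image card_cartesian_product)
  then show "subgroup_index G H = subgroup_index G M * subgroup_index M H"
    using transversal_index[OF _ tr] transversal_index[OF _ S] transversal_index[OF _ T] assms by simp
  show "finite_index G H"
    using transversal_index[OF _ tr] transversal_index[OF _ S] transversal_index[OF _ T] assms by auto
qed


lemma finite_index_mono:
  assumes "add_subgroup M" "add_subgroup H" "M \<subseteq> G" "H \<subseteq> M" "finite_index G H"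
  shows "finite_index G M" "finite_index M H"
proof -
  have "cosets_in G M \<subseteq> (\<lambda>C. {y \<in> G. \<exists>x\<in>C. y - x \<in> M}) ` cosets_in G H"
  proof
    fix C assume "C \<in> cosets_in G M"
    then obtain g where g: "g \<in> G" "C = {y \<in> G. y - g \<in> M}" by (auto simp: cosets_in_def)
    have "C = {y \<in> G. \<exists>x\<in>{y \<in> G. y - g \<in> H}. y - x \<in> M}"
    proof (intro Set.set_eqI iffI)
      fix z assume "z \<in> C"
      then show "z \<in> {y \<in> G. \<exists>x\<in>{y \<in> G. y - g \<in> H}. y - x \<in> M}"
        using g assms by (auto simp: add_subgroup_zero intro!: bexI[of _ g])
    next
      fix z assume "z \<in> {y \<in> G. \<exists>x\<in>{y \<in> G. y - g \<in> H}. y - x \<in> M}"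
      then obtain x where "z \<in> G" "x - g \<in> H" "z - x \<in> M" by auto
      then have "z - g \<in> M" using add_subgroup_diff_trans[OF assms(1), of z x g] assms(4) by auto
      then show "z \<in> C" using g \<open>z \<in> G\<close> by auto
    qed
    then show "C \<in> (\<lambda>C. {y \<in> G. \<exists>x\<in>C. y - x \<in> M}) ` cosets_in G H"
      using g unfolding cosets_in_def by blast
  qed
  then show "finite_index G M"
    using assms(5) unfolding finite_index_def by (meson finite_imageI finite_subset)
  have "cosets_in M H \<subseteq> (\<lambda>C. C \<inter> M) ` cosets_in G H"
  proof
    fix C assume "C \<in> cosets_in M H"
    then obtain g where g: "g \<in> M" "C = {y \<in> M. y - g \<in> H}" by (auto simp: cosets_in_def)
    then have "C = {y \<in> G. y - g \<in> H} \<inter> M" "g \<in> G" using assms(3) by auto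
    then show "C \<in> (\<lambda>C. C \<inter> M) ` cosets_in G H" by (auto simp: cosets_in_def)
  qed
  then show "finite_index M H"
    using assms(5) unfolding finite_index_def by (meson finite_imageI finite_subset)
qed

text \<open>\<open>f\<close> carries a transversal to a transversal. It will be the inclusion of a
  ring into its localization or the multiplication by a scalar.\<close>

lemma subgroup_index_cong:
  assumes "add_subgroup H" "add_subgroup H'"
    and f: "\<And>x. x \<in> G \<Longrightarrow> f x \<in> G'"
    and iff: "\<And>x y. x \<in> G \<Longrightarrow> y \<in> G \<Longrightarrow> x - y \<in> H \<longleftrightarrow> f x - f y \<in> H'"
    and surj: "\<And>z. z \<in> G' \<Longrightarrow> \<exists>x\<in>G. z - f x \<in> H'"
  shows "subgroup_index G H = subgroup_index G' H'" "finite_index G H \<longleftrightarrow> finite_index G' H'"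
proof -
  obtain T where T: "transversal G H T" using obtain_transversal assms by blast
  then have TG: "T \<subseteq> G" by (simp add: transversal_def)
  have inj: "s = t" if "s \<in> T" "t \<in> T" "f s - f t \<in> H'" for s t
    using that T TG iff[of s t] by (auto simp: transversal_def)
  have tr: "transversal G' H' (f ` T)"
    unfolding transversal_def
  proof (intro conjI ballI impI)
    show "f ` T \<subseteq> G'" using TG f by blast
  next
    fix z assume "z \<in> G'"
    then obtain x where x: "x \<in> G" "z - f x \<in> H'" using surj by blast
    then obtain t where t: "t \<in> T" "x - t \<in> H" using T by (auto simp: transversal_def)
    have "f x - f t \<in> H'" using iff[of x t] x t TG by auto
    then show "\<exists>t\<in>f ` T. z - t \<in> H'" using x t add_subgroup_diff_trans[OF assms(2), of z "f x" "f t"] by auto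
  next
    fix u v assume "u \<in> f ` T" "v \<in> f ` T" "u - v \<in> H'"
    then show "u = v" using inj by blast
  qed
  have inj': "inj_on f T" using inj assms(2) by (auto simp: inj_on_def add_subgroup_zero)
  then show "subgroup_index G H = subgroup_index G' H'"
    using transversal_index[OF _ tr] transversal_index[OF _ T] assms by (simp add: card_image)
  show "finite_index G H \<longleftrightarrow> finite_index G' H'"
    using transversal_index[OF _ tr] transversal_index[OF _ T] assms inj' finite_image_iff by auto
qed

text \<open>Applied to the powers of a ring element, this produces congruences between two of them.
  They take the place of chain conditions in the arithmetic of the localization.\<close>

lemma finite_index_pigeonhole:
  fixes f :: "nat \<Rightarrow> 'a::ab_group_add"
  assumes "add_subgroup H" "finite_index G H" "\<And>i. f i \<in> G"
  obtains i j where "i < j" "f j - f i \<in> H"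
proof -
  let ?c = "\<lambda>i. {y \<in> G. y - f i \<in> H}"
  have "finite (range ?c)"
    using assms(2,3) unfolding finite_index_def cosets_in_def by (auto elim: finite_subset[rotated])
  then have "\<not> inj ?c" using finite_imageD by blast
  then obtain i j where "i \<noteq> j" "?c i = ?c j" by (auto simp: inj_on_def)
  then have ij: "i \<noteq> j" "f i - f j \<in> H" "f j - f i \<in> H"
    using coset_eq_iff[OF assms(1,3,3), of i j] coset_eq_iff[OF assms(1,3,3), of j i] by auto
  show ?thesis
    by (cases "i < j") (use ij that[of i j] that[of j i] in auto)
qed

lemma finite_index_if_finite_reps:
  assumes "add_subgroup H" "finite T" "\<And>g. g \<in> G \<Longrightarrow> \<exists>t\<in>T. g - t \<in> H"
  shows "finite_index G H"
proof -
  have "cosets_in G H \<subseteq> (\<lambda>t. {y \<in> G. y - t \<in> H}) ` T"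
  proof
    fix C assume "C \<in> cosets_in G H"
    then obtain g where g: "g \<in> G" "C = {y \<in> G. y - g \<in> H}" by (auto simp: cosets_in_def)
    obtain t where t: "t \<in> T" "g - t \<in> H" using assms(3)[OF g(1)] by blast
    then have "y - g \<in> H \<longleftrightarrow> y - t \<in> H" for y
      using add_subgroup_diff_trans[OF assms(1), of y g t] add_subgroup_diff_trans[OF assms(1), of y t g]
        add_subgroup_diff_swap[OF assms(1), of g t] by auto
    then show "C \<in> (\<lambda>t. {y \<in> G. y - t \<in> H}) ` T" using g t by auto
  qed
  then show ?thesis using assms(2) unfolding finite_index_def by (meson finite_imageI finite_subset)
qed

text \<open>The value 0 outside \<open>G\<close> makes equality of characters the same as equality
  of functions.\<close>

definition add_char :: "'a::ab_group_add set \<Rightarrow> ('a \<Rightarrow> complex) \<Rightarrow> bool" where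
  "add_char G \<theta> \<longleftrightarrow> (\<forall>x\<in>G. \<forall>y\<in>G. \<theta> (x + y) = \<theta> x * \<theta> y) \<and> (\<forall>x\<in>G. \<theta> x \<noteq> 0) \<and> (\<forall>x. x \<notin> G \<longrightarrow> \<theta> x = 0)"

definition chars_trivial_on :: "'a::ab_group_add set \<Rightarrow> 'a set \<Rightarrow> ('a \<Rightarrow> complex) set" where
  "chars_trivial_on G M = {\<theta>. add_char G \<theta> \<and> (\<forall>x\<in>M. \<theta> x = 1)}"

lemma add_char_add: "add_char G \<theta> \<Longrightarrow> x \<in> G \<Longrightarrow> y \<in> G \<Longrightarrow> \<theta> (x + y) = \<theta> x * \<theta> y"
  and add_char_nonzero: "add_char G \<theta> \<Longrightarrow> x \<in> G \<Longrightarrow> \<theta> x \<noteq> 0"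
  and add_char_outside: "add_char G \<theta> \<Longrightarrow> x \<notin> G \<Longrightarrow> \<theta> x = 0"
  by (auto simp: add_char_def)

lemma add_char_zero: "add_char G \<theta> \<Longrightarrow> add_subgroup G \<Longrightarrow> \<theta> 0 = 1"
  using add_char_add[of G \<theta> 0 0] add_char_nonzero[of G \<theta> 0] by (auto simp: add_subgroup_zero)

lemma add_char_diff:
  assumes "add_char G \<theta>" "add_subgroup G" "x \<in> G" "y \<in> G"
  shows "\<theta> (x - y) = \<theta> x / \<theta> y"
  using add_char_add[OF assms(1), of "x - y" y] assms add_char_nonzero[OF assms(1,4)]
  by (simp add: add_subgroup_closed field_simps)

lemma add_char_uminus:
  assumes "add_char G \<theta>" "add_subgroup G" "x \<in> G"
  shows "\<theta> (- x) = inverse (\<theta> x)"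
  using add_char_diff[OF assms(1,2), of 0 x] assms
  by (simp add: add_subgroup_closed add_char_zero inverse_eq_divide)

lemma add_char_sum:
  assumes "add_char G \<theta>" "add_subgroup G" "\<And>i. i \<in> I \<Longrightarrow> f i \<in> G"
  shows "\<theta> (\<Sum>i\<in>I. f i) = (\<Prod>i\<in>I. \<theta> (f i))"
  using assms(3)
proof (induction I rule: infinite_finite_induct)
  case (insert i I)
  then have "f i \<in> G" "(\<Sum>j\<in>I. f j) \<in> G" by (auto intro!: add_subgroup_sum[OF assms(2)])
  then show ?case using insert add_char_add[OF assms(1)] by simp
qed (simp_all add: add_char_zero[OF assms(1,2)])

lemma add_char_eqI:
  assumes "add_char G \<theta>" "add_char G \<theta>'" "\<And>x. x \<in> G \<Longrightarrow> \<theta> x = \<theta>' x"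
  shows "\<theta> = \<theta>'"
  using assms by (metis add_char_outside ext)

lemma add_char_restrict:
  assumes "add_char G \<theta>" "H \<subseteq> G" "add_subgroup H"
  shows "add_char H (\<lambda>x. if x \<in> H then \<theta> x else 0)"
  using assms by (auto simp: add_char_def add_subgroup_closed subset_iff)

context
  fixes H :: "'a::ab_group_add set" and g :: 'a and G :: "'a set"
  assumes H: "add_subgroup H" and G: "add_subgroup G" and HG: "H \<subseteq> G" and g: "g \<in> G"
    and fin: "finite_index G H"
begin

private definition mul :: "nat \<Rightarrow> 'a" where "mul k = (\<Sum>i<k. g)"

private lemma mul_simps: "mul 0 = 0" "mul (Suc k) = mul k + g"
  by (simp_all add: mul_def)

private lemma mul_add: "mul (k + l) = mul k + mul l"
  by (induction l) (simp_all add: mul_simps)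

private lemma mul_diff: "l \<le> k \<Longrightarrow> mul (k - l) = mul k - mul l"
  using mul_add[of "k - l" l] by simp

private lemma mul_G: "mul k \<in> G"
  using g G by (induction k) (auto simp: mul_simps add_subgroup_closed)

text \<open>The order of \<open>g\<close> modulo \<open>H\<close>, which is finite because the index
  is.\<close>

private definition r :: nat where "r = (LEAST k. k > 0 \<and> mul k \<in> H)"

private lemma ex_mul: "\<exists>k>0. mul k \<in> H"
proof -
  obtain i j where "i < j" "mul j - mul i \<in> H"
    using finite_index_pigeonhole[OF H fin, of mul] mul_G by blast
  then show ?thesis using mul_diff[of i j] by (intro exI[of _ "j - i"]) auto
qed

private lemma r_pos: "r > 0" and mul_r: "mul r \<in> H"
  using LeastI_ex[OF ex_mul] unfolding r_def by auto

private lemma mul_multiple: "mul (r * k) \<in> H"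
  by (induction k) (simp_all add: mul_add mul_simps mul_r add_subgroup_zero[OF H] add_subgroup_add[OF H])

text \<open>Division with remainder: the remainder also gives a multiple of \<open>g\<close> in
  \<open>H\<close> and is smaller than \<open>r\<close>, so it is 0.\<close>

private lemma dvd_mul: assumes "mul k \<in> H" shows "r dvd k"
proof -
  have "k = r * (k div r) + k mod r" by simp
  then have "mul k = mul (r * (k div r)) + mul (k mod r)" by (metis mul_add)
  then have "mul (k mod r) = mul k - mul (r * (k div r))" by simp
  then have "mul (k mod r) \<in> H" using assms mul_multiple H by (simp add: add_subgroup_closed)
  then have "k mod r = 0"
    using not_less_Least[of "k mod r" "\<lambda>k. k > 0 \<and> mul k \<in> H"] r_pos
    unfolding r_def[symmetric] by auto
  then show ?thesis by auto
qed

text \<open>The subgroup generated by \<open>H\<close> and \<open>g\<close>. Natural multiples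
  account for the negative ones too, because \<open>mul r\<close> lies in \<open>H\<close>.\<close>

private definition M :: "'a set" where "M = {h + mul k | h k. h \<in> H}"

private lemma M_I: "h \<in> H \<Longrightarrow> h + mul k \<in> M"
  by (auto simp: M_def)

private lemma M_subgroup: "add_subgroup M"
  unfolding add_subgroup_def
proof (intro conjI ballI)
  show "0 \<in> M" using M_I[of 0 0] H by (simp add: mul_simps add_subgroup_zero)
  fix x y assume "x \<in> M" "y \<in> M"
  then obtain h k h' k' where x: "x = h + mul k" "h \<in> H" and y: "y = h' + mul k'" "h' \<in> H"
    by (auto simp: M_def)
  \<comment> \<open>\<open>- mul k'\<close> is a natural multiple of \<open>g\<close> minus
    \<open>mul (r * k')\<close>, and the latter lies in \<open>H\<close>.\<close>
  have "k' \<le> r * k'" using r_pos by simp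
  then have "mul (k + (r * k' - k')) = mul k + (mul (r * k') - mul k')"
    by (simp only: mul_add mul_diff)
  then have "x - y = (h - h' - mul (r * k')) + mul (k + (r * k' - k'))"
    using x y by (simp add: algebra_simps)
  moreover have "h - h' - mul (r * k') \<in> H"
    using x y H mul_multiple by (simp add: add_subgroup_closed)
  ultimately show "x - y \<in> M" using M_I by metis
qed

private lemma HM: "H \<subseteq> M" and MG: "M \<subseteq> G" and gM: "g \<in> M"
proof -
  show "H \<subseteq> M" using M_I[of _ 0] by (auto simp: mul_simps)
  show "M \<subseteq> G" using mul_G HG by (auto simp: M_def intro!: add_subgroup_add[OF G])
  show "g \<in> M" using M_I[of 0 1] H by (simp add: mul_simps add_subgroup_zero)
qed

private lemma index_M: "subgroup_index M H = r"
proof -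
  have eq: "k = l" if "k < r" "l < r" "mul k - mul l \<in> H" for k l
  proof -
    have *: "k = l" if "k < r" "l \<le> k" "mul k - mul l \<in> H" for k l
    proof (rule ccontr)
      assume "k \<noteq> l"
      have "r dvd k - l" using that dvd_mul[of "k - l"] mul_diff[of l k] by simp
      then have "r \<le> k - l" using \<open>k \<noteq> l\<close> that by (intro dvd_imp_le) auto
      then show False using that by auto
    qed
    show ?thesis using *[of k l] *[of l k] that add_subgroup_diff_swap[OF H, of "mul k" "mul l"]
      by (cases "k \<le> l") auto
  qed
  have "transversal M H (mul ` {..<r})"
    unfolding transversal_def
  proof (intro conjI ballI impI)
    show "mul ` {..<r} \<subseteq> M" using M_I[of 0] H by (auto simp: add_subgroup_zero)
  next
    fix x assume "x \<in> M"
    then obtain h k where x: "x = h + mul k" "h \<in> H" by (auto simp: M_def)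
    have "k = r * (k div r) + k mod r" by simp
    then have "mul k = mul (r * (k div r)) + mul (k mod r)" by (metis mul_add)
    then have eq: "x - mul (k mod r) = h + mul (r * (k div r))" using x by simp
    have "x - mul (k mod r) \<in> H" unfolding eq using x H mul_multiple by (intro add_subgroup_add)
    then show "\<exists>t\<in>mul ` {..<r}. x - t \<in> H" using r_pos by auto
  next
    fix s t assume "s \<in> mul ` {..<r}" "t \<in> mul ` {..<r}" "s - t \<in> H"
    then show "s = t" using eq by auto
  qed
  moreover have "inj_on mul {..<r}"
    using eq H by (auto simp: inj_on_def add_subgroup_zero)
  ultimately show ?thesis using transversal_index(1)[OF H] by (simp add: card_image)
qed

private lemma char_mul: "add_char M \<theta> \<Longrightarrow> \<theta> (mul k) = \<theta> g ^ k"
proof (induction k)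
  case 0 then show ?case using M_subgroup by (simp add: mul_simps add_char_zero)
next
  case (Suc k)
  have "mul k \<in> M" using M_I[of 0 k] H by (simp add: add_subgroup_zero)
  then show ?case using Suc by (simp add: mul_simps add_char_add[OF Suc.prems _ gM])
qed

text \<open>An extension to \<open>M\<close> is determined by its value \<open>z\<close> at
  \<open>g\<close>, and \<open>z\<close> may be any \<open>r\<close>-th root of the value already
  prescribed at \<open>mul r\<close>.\<close>

private lemma card_extensions_M:
  assumes "add_char H \<theta>"
  shows "bij_betw (\<lambda>\<theta>'. \<theta>' g) {\<theta>'. add_char M \<theta>' \<and> (\<forall>x\<in>H. \<theta>' x = \<theta> x)} {z. z ^ r = \<theta> (mul r)}"
proof (rule bij_betw_imageI)
  show "inj_on (\<lambda>\<theta>'. \<theta>' g) {\<theta>'. add_char M \<theta>' \<and> (\<forall>x\<in>H. \<theta>' x = \<theta> x)}"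
  proof (rule inj_onI, clarify)
    fix \<theta>1 \<theta>2 assume c: "add_char M \<theta>1" "\<forall>x\<in>H. \<theta>1 x = \<theta> x" "add_char M \<theta>2" "\<forall>x\<in>H. \<theta>2 x = \<theta> x"
      and eq: "\<theta>1 g = \<theta>2 g"
    show "\<theta>1 = \<theta>2"
    proof (rule add_char_eqI[OF c(1,3)])
      fix x assume "x \<in> M"
      then obtain h k where x: "x = h + mul k" "h \<in> H" by (auto simp: M_def)
      have "h \<in> M" "mul k \<in> M" using x HM M_I[of 0 k] H by (auto simp: add_subgroup_zero)
      then show "\<theta>1 x = \<theta>2 x" using x c eq
        by (simp add: add_char_add[OF c(1)] add_char_add[OF c(3)] char_mul)
    qed
  qed
next
  have *: "z \<in> (\<lambda>\<theta>'. \<theta>' g) ` {\<theta>'. add_char M \<theta>' \<and> (\<forall>x\<in>H. \<theta>' x = \<theta> x)}" if z: "z ^ r = \<theta> (mul r)" for z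
  proof -
    have zn: "z \<noteq> 0" using z r_pos add_char_nonzero[OF assms mul_r] by (auto simp: zero_power)
    have mulr: "\<theta> (mul (r * k)) = z ^ (r * k)" for k
    proof (induction k)
      case 0 then show ?case using add_char_zero[OF assms H] by (simp add: mul_simps)
    next
      case (Suc k)
      then show ?case using add_char_add[OF assms mul_r mul_multiple[of k]] z
        by (simp add: mul_add power_add power_mult)
    qed
    \<comment> \<open>Two expressions of one element differ by moving some
      \<open>mul (r * d)\<close> from one summand to the other. The products agree because
      \<open>z ^ r\<close> is the value prescribed at \<open>mul r\<close>.\<close>
    have wd: "\<theta> h * z ^ k = \<theta> h' * z ^ k'" if "h \<in> H" "h' \<in> H" "h + mul k = h' + mul k'" for h h' k k'
    proof -
      have le: "\<theta> h * z ^ k = \<theta> h' * z ^ k'"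
        if "h \<in> H" "h' \<in> H" "h + mul k = h' + mul k'" "k \<le> k'" for h h' k k'
      proof -
        have "mul (k' - k) = mul k' - mul k" using that(4) by (rule mul_diff)
        moreover have "h = h' + mul k' - mul k" using that(3) by (simp add: eq_diff_eq)
        ultimately have h: "h = h' + mul (k' - k)" by simp
        then have "mul (k' - k) \<in> H" using that H add_subgroup_diff[OF H, of h h'] by simp
        with dvd_mul obtain d where d: "k' - k = r * d" by blast
        have "\<theta> h = \<theta> h' * z ^ (r * d)"
          using h d mulr add_char_add[OF assms \<open>h' \<in> H\<close> mul_multiple] by simp
        moreover have "k' = r * d + k" using d that by simp
        then have "z ^ k' = z ^ (r * d) * z ^ k" by (simp only: power_add)
        ultimately show ?thesis by simp
      qed
      show ?thesis
        by (cases "k \<le> k'") (use that le[of h h' k k'] le[of h' h k' k] in auto)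
    qed
    define \<theta>' where "\<theta>' x = (if x \<in> M then (SOME w. \<exists>h k. h \<in> H \<and> x = h + mul k \<and> w = \<theta> h * z ^ k) else 0)" for x
    have chi': "\<theta>' (h + mul k) = \<theta> h * z ^ k" if "h \<in> H" for h k
    proof -
      let ?P = "\<lambda>w. \<exists>h' k'. h' \<in> H \<and> h + mul k = h' + mul k' \<and> w = \<theta> h' * z ^ k'"
      have "?P (SOME w. ?P w)" by (rule someI_ex) (use that in blast)
      then obtain h' k' where "h' \<in> H" "h + mul k = h' + mul k'" "(SOME w. ?P w) = \<theta> h' * z ^ k'"
        by blast
      then have "(SOME w. ?P w) = \<theta> h * z ^ k" using wd[OF that] by metis
      then show ?thesis using M_I[OF that, of k] by (simp only: \<theta>'_def if_True)
    qed
    have "add_char M \<theta>'"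
      unfolding add_char_def
    proof (intro conjI ballI allI impI)
      fix x y assume "x \<in> M" "y \<in> M"
      then obtain h k h' k' where x: "x = h + mul k" "h \<in> H" and y: "y = h' + mul k'" "h' \<in> H"
        by (auto simp: M_def)
      have "x + y = (h + h') + mul (k + k')" using x y by (simp add: mul_add algebra_simps)
      then have "\<theta>' (x + y) = \<theta> (h + h') * z ^ (k + k')"
        using chi'[of "h + h'" "k + k'"] x y add_subgroup_add[OF H] by (simp only:)
      then show "\<theta>' (x + y) = \<theta>' x * \<theta>' y"
        using x y chi' add_char_add[OF assms] by (simp add: power_add)
    next
      fix x assume "x \<in> M"
      then show "\<theta>' x \<noteq> 0" using chi' zn add_char_nonzero[OF assms] by (auto simp: M_def)
    next
      fix x assume "x \<notin> M" then show "\<theta>' x = 0" by (simp add: \<theta>'_def)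
    qed
    moreover have "\<theta>' x = \<theta> x" if "x \<in> H" for x
      using chi'[OF that, of 0] by (simp add: mul_simps)
    moreover have "\<theta>' g = z" using chi'[of 0 1] H add_char_zero[OF assms H]
      by (simp add: mul_simps add_subgroup_zero)
    ultimately show ?thesis by blast
  qed
  have "\<theta>' g ^ r = \<theta> (mul r)" if "add_char M \<theta>'" "\<forall>x\<in>H. \<theta>' x = \<theta> x" for \<theta>'
    using that char_mul[of \<theta>' r] mul_r by simp
  with * show "(\<lambda>\<theta>'. \<theta>' g) ` {\<theta>'. add_char M \<theta>' \<and> (\<forall>x\<in>H. \<theta>' x = \<theta> x)} = {z. z ^ r = \<theta> (mul r)}"
    by blast
qed

text \<open>A nonzero number has \<open>r\<close> distinct \<open>r\<close>-th roots, and
  \<open>r\<close> is the index of \<open>H\<close> in \<open>M\<close>. One existence statement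
  collects the facts about \<open>M\<close>, so that they can be used without the auxiliary
  constants of the context.\<close>

lemma cyclic_extension:
  "\<exists>M. add_subgroup M \<and> H \<subseteq> M \<and> M \<subseteq> G \<and> g \<in> M \<and>
     (\<forall>\<theta> \<theta>'. add_char M \<theta> \<longrightarrow> add_char M \<theta>' \<longrightarrow> (\<forall>x\<in>H. \<theta> x = \<theta>' x) \<longrightarrow> \<theta> g = \<theta>' g \<longrightarrow> \<theta> = \<theta>') \<and>
     (\<forall>\<theta>. add_char H \<theta> \<longrightarrow> finite {\<theta>'. add_char M \<theta>' \<and> (\<forall>x\<in>H. \<theta>' x = \<theta> x)} \<and>
        card {\<theta>'. add_char M \<theta>' \<and> (\<forall>x\<in>H. \<theta>' x = \<theta> x)} = subgroup_index M H)"
proof (intro exI[of _ M] conjI allI impI)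
  fix \<theta> \<theta>' assume c: "add_char M \<theta>" "add_char M \<theta>'" "\<forall>x\<in>H. \<theta> x = \<theta>' x" "\<theta> g = \<theta>' g"
  show "\<theta> = \<theta>'"
  proof (rule add_char_eqI[OF c(1,2)])
    fix x assume "x \<in> M"
    then obtain h k where x: "x = h + mul k" "h \<in> H" by (auto simp: M_def)
    have "h \<in> M" "mul k \<in> M" using x HM M_I[of 0 k] H by (auto simp: add_subgroup_zero)
    then show "\<theta> x = \<theta>' x" using x c
      by (simp add: add_char_add[OF c(1)] add_char_add[OF c(2)] char_mul)
  qed
next
  fix \<theta> assume c: "add_char H \<theta>"
  have "\<theta> (mul r) \<noteq> 0" using add_char_nonzero[OF c mul_r] .
  then have "card {z. z ^ r = \<theta> (mul r)} = r" "finite {z. z ^ r = \<theta> (mul r)}"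
    using r_pos by (auto intro!: card_nth_roots finite_nth_roots)
  then show "finite {\<theta>'. add_char M \<theta>' \<and> (\<forall>x\<in>H. \<theta>' x = \<theta> x)}"
    "card {\<theta>'. add_char M \<theta>' \<and> (\<forall>x\<in>H. \<theta>' x = \<theta> x)} = subgroup_index M H"
    using bij_betw_same_card[OF card_extensions_M[OF c]] bij_betw_finite[OF card_extensions_M[OF c]]
      index_M by simp_all
qed (use M_subgroup HM MG gM in auto)

end

text \<open>Induction on the index through a cyclic step \<open>M\<close>: every extension to
  \<open>M\<close> extends further to \<open>G\<close> in as many ways as the index of
  \<open>M\<close> in \<open>G\<close>, and indices multiply.\<close>

theorem card_char_extensions:
  assumes "add_subgroup G" "add_subgroup H" "H \<subseteq> G" "finite_index G H" "add_char H \<theta>"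
  shows "finite {\<theta>'. add_char G \<theta>' \<and> (\<forall>x\<in>H. \<theta>' x = \<theta> x)} \<and>
         card {\<theta>'. add_char G \<theta>' \<and> (\<forall>x\<in>H. \<theta>' x = \<theta> x)} = subgroup_index G H"
  using assms(2-)
proof (induction "subgroup_index G H" arbitrary: H \<theta> rule: less_induct)
  case less
  show ?case
  proof (cases "G = H")
    case True
    then have "{\<theta>'. add_char G \<theta>' \<and> (\<forall>x\<in>H. \<theta>' x = \<theta> x)} = {\<theta>}"
      using less.prems(4) by (auto intro: add_char_eqI[of H])
    then show ?thesis using subgroup_index_refl[OF assms(1)] True by simp
  next
    case False
    then obtain g where g: "g \<in> G" "g \<notin> H" using less.prems by blast
    from cyclic_extension[OF less.prems(1) assms(1) less.prems(2) g(1) less.prems(3)]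
    obtain M where ex: "add_subgroup M \<and> H \<subseteq> M \<and> M \<subseteq> G \<and> g \<in> M \<and>
     (\<forall>\<theta> \<theta>'. add_char M \<theta> \<longrightarrow> add_char M \<theta>' \<longrightarrow> (\<forall>x\<in>H. \<theta> x = \<theta>' x) \<longrightarrow> \<theta> g = \<theta>' g \<longrightarrow> \<theta> = \<theta>') \<and>
     (\<forall>\<theta>. add_char H \<theta> \<longrightarrow> finite {\<theta>'. add_char M \<theta>' \<and> (\<forall>x\<in>H. \<theta>' x = \<theta> x)} \<and>
        card {\<theta>'. add_char M \<theta>' \<and> (\<forall>x\<in>H. \<theta>' x = \<theta> x)} = subgroup_index M H)" by (rule exE)
    then have M: "add_subgroup M" "H \<subseteq> M" "M \<subseteq> G" "g \<in> M" by simp_all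
    have fin: "finite_index G M" "finite_index M H"
      using finite_index_mono[OF M(1) less.prems(1) M(3,2) less.prems(3)] by auto
    have mult: "subgroup_index G H = subgroup_index G M * subgroup_index M H"
      using subgroup_index_mult[OF assms(1) M(1) less.prems(1) M(3,2) fin] by simp
    have "subgroup_index M H \<noteq> 1" using subgroup_index_eq_1[OF M(1) less.prems(1) M(2)] M g by blast
    moreover have "subgroup_index M H > 0" "subgroup_index G M > 0"
      using subgroup_index_pos fin M g by blast+
    ultimately have lt: "subgroup_index G M < subgroup_index G H" unfolding mult by simp
    define E where "E = {\<theta>'. add_char M \<theta>' \<and> (\<forall>x\<in>H. \<theta>' x = \<theta> x)}"
    define F where "F \<mu> = {\<theta>'. add_char G \<theta>' \<and> (\<forall>x\<in>M. \<theta>' x = \<mu> x)}" for \<mu>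
    have E: "finite E" "card E = subgroup_index M H"
      using ex less.prems(4) unfolding E_def by simp_all
    have IH: "finite (F \<mu>)" "card (F \<mu>) = subgroup_index G M" if "\<mu> \<in> E" for \<mu>
      using less.hyps[OF lt M(1,3) fin(1), of \<mu>] that unfolding E_def F_def by auto
    \<comment> \<open>The extensions to \<open>G\<close> are grouped by their restriction to
      \<open>M\<close>.\<close>
    have U: "{\<theta>'. add_char G \<theta>' \<and> (\<forall>x\<in>H. \<theta>' x = \<theta> x)} = (\<Union>\<mu>\<in>E. F \<mu>)"
    proof (intro Set.set_eqI iffI)
      fix \<theta>' assume c: "\<theta>' \<in> {\<theta>'. add_char G \<theta>' \<and> (\<forall>x\<in>H. \<theta>' x = \<theta> x)}"
      then have "add_char M (\<lambda>x. if x \<in> M then \<theta>' x else 0)"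
        using add_char_restrict[OF _ M(3,1)] by blast
      then have "(\<lambda>x. if x \<in> M then \<theta>' x else 0) \<in> E"
        using c M(2) by (simp add: subset_iff E_def)
      moreover have "\<theta>' \<in> F (\<lambda>x. if x \<in> M then \<theta>' x else 0)" using c by (simp add: F_def)
      ultimately show "\<theta>' \<in> (\<Union>\<mu>\<in>E. F \<mu>)" by blast
    next
      fix \<theta>' assume "\<theta>' \<in> (\<Union>\<mu>\<in>E. F \<mu>)"
      then obtain \<mu> where "add_char M \<mu>" "\<forall>x\<in>H. \<mu> x = \<theta> x" "add_char G \<theta>'" "\<forall>x\<in>M. \<theta>' x = \<mu> x"
        unfolding E_def F_def by blast
      then show "\<theta>' \<in> {\<theta>'. add_char G \<theta>' \<and> (\<forall>x\<in>H. \<theta>' x = \<theta> x)}" using M(2) by auto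
    qed
    have disj: "F \<mu> \<inter> F \<nu> = {}" if "\<mu> \<in> E" "\<nu> \<in> E" "\<mu> \<noteq> \<nu>" for \<mu> \<nu>
    proof (rule ccontr)
      assume "F \<mu> \<inter> F \<nu> \<noteq> {}"
      then obtain \<theta>' where "\<forall>x\<in>M. \<theta>' x = \<mu> x" "\<forall>x\<in>M. \<theta>' x = \<nu> x" unfolding F_def by blast
      moreover have "add_char M \<mu>" "add_char M \<nu>" using that unfolding E_def by blast+
      ultimately have "\<mu> = \<nu>" by (intro add_char_eqI[of M]) auto
      then show False using that by blast
    qed
    have "card (\<Union>\<mu>\<in>E. F \<mu>) = (\<Sum>\<mu>\<in>E. card (F \<mu>))"
      using E IH disj by (intro card_UN_disjoint) auto
    also have "\<dots> = subgroup_index G H" using IH E mult by simp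
    finally show ?thesis unfolding U using E IH by simp
  qed
qed

lemma card_chars_trivial_on:
  assumes "add_subgroup G" "add_subgroup H" "H \<subseteq> G" "finite_index G H"
  shows "finite (chars_trivial_on G H)" "card (chars_trivial_on G H) = subgroup_index G H"
proof -
  have "add_char H (\<lambda>x. if x \<in> H then 1 else 0)"
    using assms(2) by (auto simp: add_char_def add_subgroup_closed)
  from card_char_extensions[OF assms this] show "finite (chars_trivial_on G H)"
    "card (chars_trivial_on G H) = subgroup_index G H"
    by (simp_all add: chars_trivial_on_def)
qed

lemma extend_char:
  assumes "add_subgroup G" "add_subgroup H" "H \<subseteq> G" "finite_index G H" "add_char H \<theta>"
  obtains \<theta>' where "add_char G \<theta>'" "\<And>x. x \<in> H \<Longrightarrow> \<theta>' x = \<theta> x"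
proof -
  have "subgroup_index G H > 0" using subgroup_index_pos[OF assms(4)] assms(1) add_subgroup_zero by blast
  then have "{\<theta>'. add_char G \<theta>' \<and> (\<forall>x\<in>H. \<theta>' x = \<theta> x)} \<noteq> {}"
    using card_char_extensions[OF assms] by (metis card.empty less_irrefl)
  then show ?thesis using that by blast
qed

text \<open>The subgroup generated by \<open>H\<close> and \<open>g\<close> already has more than
  one character trivial on \<open>H\<close>. One that differs from the trivial character must do so
  at \<open>g\<close>, and it extends to \<open>G\<close>.\<close>

lemma char_separates:
  assumes G: "add_subgroup G" and H: "add_subgroup H" "H \<subseteq> G" "finite_index G H" and g: "g \<in> G" "g \<notin> H"
  obtains \<theta> where "\<theta> \<in> chars_trivial_on G H" "\<theta> g \<noteq> 1"
proof -
  from cyclic_extension[OF H(1) G H(2) g(1) H(3)]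
  obtain M where ex: "add_subgroup M \<and> H \<subseteq> M \<and> M \<subseteq> G \<and> g \<in> M \<and>
     (\<forall>\<theta> \<theta>'. add_char M \<theta> \<longrightarrow> add_char M \<theta>' \<longrightarrow> (\<forall>x\<in>H. \<theta> x = \<theta>' x) \<longrightarrow> \<theta> g = \<theta>' g \<longrightarrow> \<theta> = \<theta>') \<and>
     (\<forall>\<theta>. add_char H \<theta> \<longrightarrow> finite {\<theta>'. add_char M \<theta>' \<and> (\<forall>x\<in>H. \<theta>' x = \<theta> x)} \<and>
        card {\<theta>'. add_char M \<theta>' \<and> (\<forall>x\<in>H. \<theta>' x = \<theta> x)} = subgroup_index M H)" by (rule exE)
  then have M: "add_subgroup M" "H \<subseteq> M" "M \<subseteq> G" "g \<in> M" by simp_all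
  have fin: "finite_index G M" "finite_index M H" using finite_index_mono[OF M(1) H(1) M(3,2) H(3)] by auto
  have "subgroup_index M H \<noteq> 1" using subgroup_index_eq_1[OF M(1) H(1) M(2)] M(4) g(2) by blast
  moreover have "subgroup_index M H > 0" using subgroup_index_pos[OF fin(2)] M(4) by blast
  ultimately have "card (chars_trivial_on M H) > 1" using card_chars_trivial_on[OF M(1) H(1) M(2) fin(2)] by simp
  then have "\<not> chars_trivial_on M H \<subseteq> {\<lambda>x. if x \<in> M then 1 else 0}"
    using card_mono[of "{\<lambda>x. if x \<in> M then 1 else (0::complex)}" "chars_trivial_on M H"] by auto
  then obtain \<mu> where \<mu>: "\<mu> \<in> chars_trivial_on M H" "\<mu> \<noteq> (\<lambda>x. if x \<in> M then 1 else 0)" by blast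
  have "\<mu> g \<noteq> 1"
  proof
    assume "\<mu> g = 1"
    have one: "add_char M (\<lambda>x. if x \<in> M then 1 else 0)" using M(1) by (auto simp: add_char_def add_subgroup_closed)
    have "\<mu> = (\<lambda>x. if x \<in> M then 1 else 0)"
    proof (rule ex[THEN conjunct2, THEN conjunct2, THEN conjunct2, THEN conjunct2, THEN conjunct1, rule_format, OF _ one])
      show "add_char M \<mu>" using \<mu>(1) by (simp add: chars_trivial_on_def)
      show "\<mu> g = (if g \<in> M then 1 else 0)" using \<open>\<mu> g = 1\<close> M(4) by simp
      fix x assume "x \<in> H"
      then show "\<mu> x = (if x \<in> M then 1 else 0)" using \<mu>(1) M(2) by (auto simp: chars_trivial_on_def)
    qed
    then show False using \<mu>(2) by blast
  qed
  have "add_char M \<mu>" "\<forall>x\<in>H. \<mu> x = 1" using \<mu>(1) by (auto simp: chars_trivial_on_def)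
  then obtain \<theta> where \<theta>: "add_char G \<theta>" "\<And>x. x \<in> M \<Longrightarrow> \<theta> x = \<mu> x"
    using extend_char[OF G M(1) M(3) fin(1)] by blast
  have "\<theta> \<in> chars_trivial_on G H"
    using \<theta> M(2) \<open>\<forall>x\<in>H. \<mu> x = 1\<close> unfolding chars_trivial_on_def by auto
  then show ?thesis using that \<theta>(2)[OF M(4)] \<open>\<mu> g \<noteq> 1\<close> by simp
qed

text \<open>Multiplication by a character whose value at \<open>g\<close> is not 1 permutes the
  summands, so the sum equals itself times a factor other than 1.\<close>

lemma sum_chars_trivial_on:
  assumes G: "add_subgroup G" and H: "add_subgroup H" "H \<subseteq> G" "finite_index G H" and g: "g \<in> G" "g \<notin> H"
  shows "(\<Sum>\<theta>\<in>chars_trivial_on G H. \<theta> g) = 0"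
proof -
  obtain \<mu> where \<mu>: "\<mu> \<in> chars_trivial_on G H" "\<mu> g \<noteq> 1" using char_separates[OF G H g] .
  have mult: "(\<lambda>x. \<mu>1 x * \<mu>2 x) \<in> chars_trivial_on G H"
    if "\<mu>1 \<in> chars_trivial_on G H" "\<mu>2 \<in> chars_trivial_on G H" for \<mu>1 \<mu>2
    using that by (auto simp: chars_trivial_on_def add_char_def)
  have inv: "(\<lambda>x. inverse (\<mu>1 x)) \<in> chars_trivial_on G H" if "\<mu>1 \<in> chars_trivial_on G H" for \<mu>1
    using that by (auto simp: chars_trivial_on_def add_char_def)
  have "bij_betw (\<lambda>\<theta> x. \<mu> x * \<theta> x) (chars_trivial_on G H) (chars_trivial_on G H)"
  proof (rule bij_betw_byWitness[where f' = "\<lambda>\<theta> x. inverse (\<mu> x) * \<theta> x"])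
    have nz: "\<mu> x \<noteq> 0" if "x \<in> G" for x using \<mu>(1) that by (auto simp: chars_trivial_on_def add_char_def)
    have out: "\<theta> x = 0" if "\<theta> \<in> chars_trivial_on G H" "x \<notin> G" for \<theta> x
      using that by (auto simp: chars_trivial_on_def add_char_def)
    show "\<forall>\<theta>\<in>chars_trivial_on G H. (\<lambda>x. inverse (\<mu> x) * (\<mu> x * \<theta> x)) = \<theta>"
    proof (intro ballI ext)
      fix \<theta> x assume "\<theta> \<in> chars_trivial_on G H"
      then show "inverse (\<mu> x) * (\<mu> x * \<theta> x) = \<theta> x" using nz[of x] out[of \<theta> x] by (cases "x \<in> G") auto
    qed
    show "\<forall>\<theta>\<in>chars_trivial_on G H. (\<lambda>x. \<mu> x * (inverse (\<mu> x) * \<theta> x)) = \<theta>"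
    proof (intro ballI ext)
      fix \<theta> x assume "\<theta> \<in> chars_trivial_on G H"
      then show "\<mu> x * (inverse (\<mu> x) * \<theta> x) = \<theta> x" using nz[of x] out[of \<theta> x] by (cases "x \<in> G") auto
    qed
  qed (use mult inv \<mu>(1) in blast)+
  then have "(\<Sum>\<theta>\<in>chars_trivial_on G H. \<theta> g) = (\<Sum>\<theta>\<in>chars_trivial_on G H. \<mu> g * \<theta> g)"
    by (rule sum.reindex_bij_betw[symmetric])
  then have "(\<Sum>\<theta>\<in>chars_trivial_on G H. \<theta> g) = \<mu> g * (\<Sum>\<theta>\<in>chars_trivial_on G H. \<theta> g)"
    unfolding sum_distrib_left .
  then show ?thesis using \<mu>(2) by (metis mult_cancel_right1)
qed

text \<open>The pairing embeds \<open>X\<close> modulo \<open>X0\<close> into the dual of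
  \<open>Y\<close> modulo \<open>Y0\<close>, which has as many elements as that quotient. Applied in
  both directions, this turns a nondegenerate pairing into an equality of indices.\<close>

lemma pairing_index_le:
  assumes X: "add_subgroup X0"
    and Y: "add_subgroup Y" "add_subgroup Y0" "Y0 \<subseteq> Y" "finite_index Y Y0"
    and p: "\<And>x. x \<in> X \<Longrightarrow> add_char Y (p x)" "\<And>x y. x \<in> X \<Longrightarrow> y \<in> Y0 \<Longrightarrow> p x y = 1"
    and inj: "\<And>x x'. x \<in> X \<Longrightarrow> x' \<in> X \<Longrightarrow> p x = p x' \<Longrightarrow> x - x' \<in> X0"
  shows "finite_index X X0" "subgroup_index X X0 \<le> subgroup_index Y Y0"
proof -
  obtain T where T: "transversal X X0 T" using obtain_transversal X by blast
  have sub: "p ` T \<subseteq> chars_trivial_on Y Y0" using T p by (auto simp: transversal_def chars_trivial_on_def)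
  have i: "inj_on p T"
  proof (rule inj_onI)
    fix s t assume st: "s \<in> T" "t \<in> T" "p s = p t"
    then have "s - t \<in> X0" using T inj[of s t] by (auto simp: transversal_def)
    then show "s = t" using T st by (auto simp: transversal_def)
  qed
  have "finite T" using sub i card_chars_trivial_on(1)[OF Y] by (meson finite_imageD finite_subset)
  then show "finite_index X X0" using transversal_index[OF X T] by simp
  show "subgroup_index X X0 \<le> subgroup_index Y Y0"
    using transversal_index(1)[OF X T] card_chars_trivial_on[OF Y] card_mono[OF _ sub] card_image[OF i]
    by simp
qed

lemma mult_image_subgroup:
  fixes a :: "'a::ring"
  assumes "add_subgroup A" shows "add_subgroup ((*) a ` A)"
  unfolding add_subgroup_def
proof (intro conjI ballI)
  show "0 \<in> (*) a ` A" using add_subgroup_zero[OF assms] by (intro image_eqI[of _ _ 0]) auto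
  fix x y assume "x \<in> (*) a ` A" "y \<in> (*) a ` A"
  then obtain u v where "x = a * u" "y = a * v" "u \<in> A" "v \<in> A" by blast
  then show "x - y \<in> (*) a ` A" using add_subgroup_diff[OF assms, of u v]
    by (intro image_eqI[of _ _ "u - v"]) (auto simp: right_diff_distrib)
qed

subsection \<open>Algebraic integers\<close>

definition int_span :: "'i set \<Rightarrow> ('i \<Rightarrow> complex) \<Rightarrow> complex set" where
  "int_span I g = {\<Sum>j\<in>I. of_int (u j) * g j | u. True}"

lemma int_spanI: "x = (\<Sum>j\<in>I. of_int (u j) * g j) \<Longrightarrow> x \<in> int_span I g"
  unfolding int_span_def by (rule CollectI) (intro exI conjI TrueI)

lemma int_span_subgroup: "add_subgroup (int_span I g)"
  unfolding add_subgroup_def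
proof (intro conjI ballI)
  show "0 \<in> int_span I g" unfolding int_span_def by (intro CollectI exI[of _ "\<lambda>_. 0"]) simp
  fix x y assume "x \<in> int_span I g" "y \<in> int_span I g"
  then obtain u v where "x = (\<Sum>j\<in>I. of_int (u j) * g j)" "y = (\<Sum>j\<in>I. of_int (v j) * g j)"
    by (auto simp: int_span_def)
  then have "x - y = (\<Sum>j\<in>I. of_int (u j - v j) * g j)"
    by (simp add: algebra_simps sum_subtractf)
  then show "x - y \<in> int_span I g" by (rule int_spanI)
qed

lemma int_span_mult_int: "x \<in> int_span I g \<Longrightarrow> of_int k * x \<in> int_span I g"
proof -
  assume "x \<in> int_span I g"
  then obtain u where "x = (\<Sum>j\<in>I. of_int (u j) * g j)" by (auto simp: int_span_def)
  then have "of_int k * x = (\<Sum>j\<in>I. of_int (k * u j) * g j)" by (simp add: sum_distrib_left algebra_simps)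
  then show ?thesis by (rule int_spanI)
qed

lemma int_span_gen:
  assumes "finite I" "i \<in> I" shows "g i \<in> int_span I g"
proof -
  have "(\<Sum>j\<in>I. of_int (if j = i then 1 else 0) * g j) = (\<Sum>j\<in>I. if j = i then g j else 0)"
    by (intro sum.cong) auto
  then have "g i = (\<Sum>j\<in>I. of_int (if j = i then 1 else 0) * g j)" using assms by simp
  then show ?thesis by (rule int_spanI)
qed

lemma int_span_mult_closed:
  assumes "\<And>i. i \<in> I \<Longrightarrow> x * g i \<in> int_span I g" "y \<in> int_span I g"
  shows "x * y \<in> int_span I g"
proof -
  obtain u where "y = (\<Sum>j\<in>I. of_int (u j) * g j)" using assms(2) by (auto simp: int_span_def)
  then have "x * y = (\<Sum>j\<in>I. of_int (u j) * (x * g j))" by (simp add: sum_distrib_left algebra_simps)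
  then show ?thesis
    using assms(1) by (auto intro!: add_subgroup_sum[OF int_span_subgroup] int_span_mult_int)
qed

text \<open>The characteristic polynomial of the multiplication by \<open>x\<close> is a monic integral equation.\<close>

lemma algebraic_int_if_int_span_closed:
  assumes "finite I" "i0 \<in> I" "g i0 \<noteq> 0" and closed: "\<And>i. i \<in> I \<Longrightarrow> x * g i \<in> int_span I g"
  shows "algebraic_int x"
proof -
  define n where "n = card I"
  obtain h where h: "bij_betw h {..<n} I"
    using ex_bij_betw_nat_finite[OF assms(1)] by (auto simp: n_def atLeast0LessThan)
  have "\<forall>i. \<exists>u. i \<in> I \<longrightarrow> x * g i = (\<Sum>j\<in>I. of_int (u j) * g j)"
    using closed by (auto simp: int_span_def)
  then obtain u where u: "\<And>i. i \<in> I \<Longrightarrow> x * g i = (\<Sum>j\<in>I. of_int (u i j) * g j)" by metis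
  define A :: "int mat" where "A = mat n n (\<lambda>(i, j). u (h i) (h j))"
  define v :: "complex vec" where "v = vec n (\<lambda>i. g (h i))"
  let ?A = "map_mat of_int A :: complex mat"
  have A: "A \<in> carrier_mat n n" "?A \<in> carrier_mat n n" by (auto simp: A_def)
  have hI: "h i \<in> I" if "i < n" for i using h that by (auto simp: bij_betw_def)
  have "?A *\<^sub>v v = x \<cdot>\<^sub>v v"
  proof (rule eq_vecI)
    fix i assume "i < dim_vec (x \<cdot>\<^sub>v v)"
    then have i: "i < n" by (simp add: v_def)
    then have "(?A *\<^sub>v v) $ i = (\<Sum>j<n. of_int (u (h i) (h j)) * g (h j))"
      by (simp add: A_def v_def scalar_prod_def atLeast0LessThan)
    also have "\<dots> = (\<Sum>j\<in>I. of_int (u (h i) j) * g j)"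
      using sum.reindex_bij_betw[OF h, of "\<lambda>j. of_int (u (h i) j) * g j"] by simp
    also have "\<dots> = (x \<cdot>\<^sub>v v) $ i" using u[OF hI[OF i]] i by (simp add: v_def)
    finally show "(?A *\<^sub>v v) $ i = (x \<cdot>\<^sub>v v) $ i" .
  qed (simp add: A_def v_def)
  moreover obtain k where "k < n" "h k = i0" using h assms(2) by (auto simp: bij_betw_def)
  then have "v $ k \<noteq> 0\<^sub>v n $ k" using assms(3) by (simp add: v_def)
  then have "v \<noteq> 0\<^sub>v n" by auto
  moreover have "v \<in> carrier_vec n" by (simp add: v_def)
  ultimately have "eigenvalue ?A x" using A unfolding eigenvalue_def eigenvector_def by auto
  then have "poly (char_poly ?A) x = 0" using eigenvalue_root_char_poly[OF A(2)] by simp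
  moreover have "char_poly ?A = map_poly of_int (char_poly A)" by (rule of_int_hom.char_poly_hom[OF A(1)])
  ultimately have "poly (map_poly of_int (char_poly A)) x = 0" by simp
  moreover have "lead_coeff (char_poly A) = 1" using degree_monic_char_poly[OF A(1)] by simp
  ultimately show ?thesis unfolding algebraic_int_altdef_ipoly by blast
qed

lemma monic_power_in_int_span:
  assumes "poly (map_poly of_int p) x = (0::complex)" "lead_coeff p = (1::int)"
  shows "x ^ degree p \<in> int_span {..<degree p} (\<lambda>i. x ^ i)"
proof -
  have "degree (map_poly of_int p :: complex poly) = degree p" by (simp add: degree_map_poly)
  then have "(\<Sum>i\<le>degree p. of_int (coeff p i) * x ^ i) = 0"
    using assms(1) by (simp add: poly_altdef coeff_map_poly)
  then have "x ^ degree p = (\<Sum>i<degree p. of_int (- coeff p i) * x ^ i)"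
    using assms(2) by (simp add: lessThan_Suc_atMost[symmetric] sum_negf algebra_simps eq_neg_iff_add_eq_0)
  then show ?thesis unfolding int_span_def by (intro CollectI exI[of _ "\<lambda>i. - coeff p i"]) simp
qed

text \<open>The monomials \<open>x ^ i * y ^ j\<close> with exponents below the two degrees span a
  finitely generated group that is stable under multiplication by \<open>x\<close> and by
  \<open>y\<close>, hence by their sum and product.\<close>

lemma algebraic_int_add_mult:
  assumes "algebraic_int x" "algebraic_int (y::complex)"
  shows "algebraic_int (x + y)" "algebraic_int (x * y)"
proof -
  obtain p q where p: "poly (map_poly of_int p) x = 0" "lead_coeff p = 1"
    and q: "poly (map_poly of_int q) y = 0" "lead_coeff q = 1"
    using assms by (auto simp: algebraic_int_altdef_ipoly)
  define I where "I = {..<degree p} \<times> {..<degree q}"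
  define g where "g = (\<lambda>(i, j). x ^ i * y ^ j)"
  have fin: "finite I" by (simp add: I_def)
  have pos: "degree p > 0" "degree q > 0"
    using p q by (auto intro!: Nat.gr0I elim!: degree_eq_zeroE)
  have x: "x * g k \<in> int_span I g" if k: "k \<in> I" for k
  proof -
    obtain i j where ij: "k = (i, j)" "i < degree p" "j < degree q" using k by (auto simp: I_def)
    show ?thesis
    proof (cases "Suc i < degree p")
      case True
      then show ?thesis using int_span_gen[OF fin, of "(Suc i, j)" g] ij
        by (simp add: g_def I_def mult.assoc)
    next
      \<comment> \<open>At the top exponent the monic equation of \<open>x\<close> rewrites
        \<open>x ^ degree p\<close> by lower powers.\<close>
      case False
      then have i: "Suc i = degree p" using ij by simp
      obtain u where u: "x ^ degree p = (\<Sum>i<degree p. of_int (u i) * x ^ i)"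
        using monic_power_in_int_span[OF p] by (auto simp: int_span_def)
      have "x * g k = x ^ degree p * y ^ j" using ij by (simp add: g_def i[symmetric] mult.assoc)
      also have "\<dots> = (\<Sum>i<degree p. of_int (u i) * g (i, j))"
        by (simp add: u g_def sum_distrib_right mult.assoc)
      finally have eq: "x * g k = (\<Sum>i<degree p. of_int (u i) * g (i, j))" .
      show ?thesis unfolding eq
      proof (rule add_subgroup_sum[OF int_span_subgroup])
        fix i assume "i \<in> {..<degree p}"
        then show "of_int (u i) * g (i, j) \<in> int_span I g"
          using ij by (intro int_span_mult_int int_span_gen fin) (simp add: I_def)
      qed
    qed
  qed
  have y: "y * g k \<in> int_span I g" if k: "k \<in> I" for k
  proof -
    obtain i j where ij: "k = (i, j)" "i < degree p" "j < degree q" using k by (auto simp: I_def)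
    show ?thesis
    proof (cases "Suc j < degree q")
      case True
      then show ?thesis using int_span_gen[OF fin, of "(i, Suc j)" g] ij
        by (simp add: g_def I_def mult_ac)
    next
      case False
      then have j: "Suc j = degree q" using ij by simp
      obtain u where u: "y ^ degree q = (\<Sum>i<degree q. of_int (u i) * y ^ i)"
        using monic_power_in_int_span[OF q] by (auto simp: int_span_def)
      have "y * g k = x ^ i * y ^ degree q" using ij by (simp add: g_def j[symmetric] mult_ac)
      also have "\<dots> = (\<Sum>j<degree q. of_int (u j) * g (i, j))"
        by (simp add: u g_def sum_distrib_left mult_ac)
      finally have eq: "y * g k = (\<Sum>j<degree q. of_int (u j) * g (i, j))" .
      show ?thesis unfolding eq
      proof (rule add_subgroup_sum[OF int_span_subgroup])
        fix j assume "j \<in> {..<degree q}"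
        then show "of_int (u j) * g (i, j) \<in> int_span I g"
          using ij by (intro int_span_mult_int int_span_gen fin) (simp add: I_def)
      qed
    qed
  qed
  have 1: "(0, 0) \<in> I" "g (0, 0) \<noteq> 0" using pos by (simp_all add: I_def g_def)
  show "algebraic_int (x + y)"
  proof (rule algebraic_int_if_int_span_closed[where g = g, OF fin 1])
    fix k assume "k \<in> I"
    then show "(x + y) * g k \<in> int_span I g"
      using add_subgroup_add[OF int_span_subgroup x y] by (simp add: distrib_right)
  qed
  show "algebraic_int (x * y)"
  proof (rule algebraic_int_if_int_span_closed[where g = g, OF fin 1])
    fix k assume "k \<in> I"
    then have "x * (y * g k) \<in> int_span I g" using int_span_mult_closed[OF x] y by simp
    then show "x * y * g k \<in> int_span I g" by (simp add: mult.assoc)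
  qed
qed

subsection \<open>Discrete valuation rings inside the complex numbers\<close>

text \<open>A discrete valuation ring with finite residue field. \<open>D_decomp\<close> plays the
  role of the valuation, and inverses are taken in the complex numbers.\<close>

locale dvr =
  fixes D :: "complex set" and \<pi> :: complex
  assumes D_one: "1 \<in> D" and D_diff: "x \<in> D \<Longrightarrow> y \<in> D \<Longrightarrow> x - y \<in> D"
    and D_mult: "x \<in> D \<Longrightarrow> y \<in> D \<Longrightarrow> x * y \<in> D"
    and \<pi>_D: "\<pi> \<in> D" and \<pi>_nonzero: "\<pi> \<noteq> 0" and \<pi>_nonunit: "inverse \<pi> \<notin> D"
    and D_decomp: "x \<in> D \<Longrightarrow> x \<noteq> 0 \<Longrightarrow> \<exists>u k. u \<in> D \<and> inverse u \<in> D \<and> u \<noteq> 0 \<and> x = u * \<pi> ^ k"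
    and D_fin: "finite_index D ((*) \<pi> ` D)"

text \<open>Two facts about rings of integers carry the localization: \<open>A_fin\<close>, the
  finiteness of quotients by nonzero principal ideals, and \<open>A_closed\<close>, integral
  closedness for the monic equations that come from two powers of a fraction being congruent modulo
  \<open>A\<close>.\<close>

locale prime_in_order =
  fixes A P :: "complex set"
  assumes A_one: "1 \<in> A" and A_diff: "x \<in> A \<Longrightarrow> y \<in> A \<Longrightarrow> x - y \<in> A"
    and A_mult: "x \<in> A \<Longrightarrow> y \<in> A \<Longrightarrow> x * y \<in> A"
    and A_fin: "a \<in> A \<Longrightarrow> a \<noteq> 0 \<Longrightarrow> finite_index A ((*) a ` A)"
    and A_closed: "a \<in> A \<Longrightarrow> b \<in> A \<Longrightarrow> b \<noteq> 0 \<Longrightarrow> i < j \<Longrightarrow> (a / b) ^ j - (a / b) ^ i \<in> A \<Longrightarrow> a / b \<in> A"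
    and P_sub: "P \<subseteq> A" and P_zero: "0 \<in> P" and P_diff: "x \<in> P \<Longrightarrow> y \<in> P \<Longrightarrow> x - y \<in> P"
    and P_mult: "a \<in> A \<Longrightarrow> x \<in> P \<Longrightarrow> a * x \<in> P"
    and P_one: "1 \<notin> P" and P_prime: "x \<in> A \<Longrightarrow> y \<in> A \<Longrightarrow> x * y \<in> P \<Longrightarrow> x \<in> P \<or> y \<in> P"
    and P_nonzero: "\<exists>a\<in>P. a \<noteq> 0"
begin

definition D :: "complex set" where "D = {a / s | a s. a \<in> A \<and> s \<in> A \<and> s \<notin> P}"

definition M :: "complex set" where "M = {a / s | a s. a \<in> P \<and> s \<in> A \<and> s \<notin> P}"

lemma A_subgroup: "add_subgroup A"
  using A_diff A_diff[OF A_one A_one] by (simp add: add_subgroup_def)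

lemma P_subgroup: "add_subgroup P"
  using P_diff P_zero by (simp add: add_subgroup_def)

lemma A_power: "x \<in> A \<Longrightarrow> x ^ k \<in> A"
  by (induction k) (auto simp: A_one A_mult)

lemma unit_nonzero: "s \<notin> P \<Longrightarrow> s \<noteq> 0"
  using P_zero by auto

lemma units_mult: "s \<in> A \<Longrightarrow> s \<notin> P \<Longrightarrow> t \<in> A \<Longrightarrow> t \<notin> P \<Longrightarrow> s * t \<in> A \<and> s * t \<notin> P"
  using P_prime A_mult by blast

lemma D_I: "a \<in> A \<Longrightarrow> s \<in> A \<Longrightarrow> s \<notin> P \<Longrightarrow> a / s \<in> D"
  by (auto simp: D_def)

lemma M_I: "a \<in> P \<Longrightarrow> s \<in> A \<Longrightarrow> s \<notin> P \<Longrightarrow> a / s \<in> M"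
  by (auto simp: M_def)

lemma D_E: assumes "x \<in> D" obtains a s where "x = a / s" "a \<in> A" "s \<in> A" "s \<notin> P" "s \<noteq> 0"
  using assms unit_nonzero by (auto simp: D_def)

lemma M_E: assumes "x \<in> M" obtains a s where "x = a / s" "a \<in> P" "s \<in> A" "s \<notin> P" "s \<noteq> 0"
  using assms unit_nonzero by (auto simp: M_def)

lemma A_sub_D: "A \<subseteq> D"
  using D_I[OF _ A_one P_one] by auto

lemma D_closed:
  assumes "x \<in> D" "y \<in> D" shows "x - y \<in> D" "x * y \<in> D"
proof -
  obtain a s where x: "x = a / s" "a \<in> A" "s \<in> A" "s \<notin> P" "s \<noteq> 0" using assms(1) by (rule D_E)
  obtain b t where y: "y = b / t" "b \<in> A" "t \<in> A" "t \<notin> P" "t \<noteq> 0" using assms(2) by (rule D_E)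
  have st: "s * t \<in> A" "s * t \<notin> P" using units_mult x y by auto
  have "x - y = (a * t - b * s) / (s * t)" using x y by (simp add: field_simps)
  moreover have "a * t - b * s \<in> A" using x y by (intro A_diff A_mult)
  ultimately show "x - y \<in> D" using D_I st by metis
  have "x * y = (a * b) / (s * t)" using x y by simp
  moreover have "a * b \<in> A" using x y by (intro A_mult)
  ultimately show "x * y \<in> D" using D_I st by metis
qed

lemma D_subgroup: "add_subgroup D"
  using D_closed(1) A_sub_D A_subgroup by (auto simp: add_subgroup_def)

lemma D_one: "1 \<in> D" using A_sub_D A_one by blast

lemma D_power: "x \<in> D \<Longrightarrow> x ^ k \<in> D"
  by (induction k) (auto simp: D_one D_closed)

lemma M_sub_D: "M \<subseteq> D" using P_sub by (auto simp: M_def D_def)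

lemma M_mult: assumes "x \<in> D" "y \<in> M" shows "x * y \<in> M"
proof -
  obtain a s where x: "x = a / s" "a \<in> A" "s \<in> A" "s \<notin> P" "s \<noteq> 0" using assms(1) by (rule D_E)
  obtain b t where y: "y = b / t" "b \<in> P" "t \<in> A" "t \<notin> P" "t \<noteq> 0" using assms(2) by (rule M_E)
  have "x * y = (a * b) / (s * t)" using x y by simp
  moreover have "a * b \<in> P" using x y by (intro P_mult)
  moreover have "s * t \<in> A" "s * t \<notin> P" using units_mult x y by auto
  ultimately show ?thesis using M_I by metis
qed

lemma M_diff: assumes "x \<in> M" "y \<in> M" shows "x - y \<in> M"
proof -
  obtain a s where x: "x = a / s" "a \<in> P" "s \<in> A" "s \<notin> P" "s \<noteq> 0" using assms(1) by (rule M_E)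
  obtain b t where y: "y = b / t" "b \<in> P" "t \<in> A" "t \<notin> P" "t \<noteq> 0" using assms(2) by (rule M_E)
  have "x - y = (t * a - s * b) / (s * t)" using x y by (simp add: field_simps)
  moreover have "t * a - s * b \<in> P" using x y by (intro P_diff P_mult)
  moreover have "s * t \<in> A" "s * t \<notin> P" using units_mult x y by auto
  ultimately show ?thesis using M_I by metis
qed

lemma A_Int_M: assumes "x \<in> A" "x \<in> M" shows "x \<in> P"
proof -
  obtain a s where x: "x = a / s" "a \<in> P" "s \<in> A" "s \<notin> P" "s \<noteq> 0" using assms(2) by (rule M_E)
  then have "x * s \<in> P" by simp
  then show ?thesis using P_prime[OF assms(1) x(3)] x by blast
qed

lemma P_sub_M: "P \<subseteq> M"
  using M_I[OF _ A_one P_one] by auto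

lemma M_zero: "0 \<in> M" using P_sub_M P_zero by blast

lemma M_subgroup: "add_subgroup M"
  using M_diff M_zero by (simp add: add_subgroup_def)

lemma one_notin_M: "1 \<notin> M" using A_Int_M[OF A_one] P_one by blast

lemma inverse_D: assumes "x \<in> D" "x \<notin> M" shows "inverse x \<in> D" "x \<noteq> 0"
proof -
  obtain a s where x: "x = a / s" "a \<in> A" "s \<in> A" "s \<notin> P" "s \<noteq> 0" using assms(1) by (rule D_E)
  have a: "a \<notin> P" using x assms(2) M_I by blast
  have "inverse x = s / a" unfolding x(1) by simp
  then show "inverse x \<in> D" using D_I x a by simp
  show "x \<noteq> 0" using assms(2) M_zero by blast
qed

lemmas dD_subgroup = mult_image_subgroup[OF D_subgroup] and aA_subgroup = mult_image_subgroup[OF A_subgroup]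

lemma dD_mult: "x \<in> D \<Longrightarrow> y \<in> (*) d ` D \<Longrightarrow> x * y \<in> (*) d ` D"
  using D_closed(2) by (auto simp: mult.left_commute)

text \<open>Reducing numerator and denominator modulo \<open>a\<close> changes a fraction by an
  element of a D. The denominator stays outside \<open>P\<close> because \<open>a\<close> is in
  \<open>P\<close>. So quotients of finitely many representatives meet every class.\<close>

lemma finite_index_D_A:
  assumes a: "a \<in> P" "a \<noteq> 0" shows "finite_index D ((*) a ` D)"
proof -
  have aA: "a \<in> A" using a P_sub by blast
  obtain T where T: "transversal A ((*) a ` A) T" using obtain_transversal[OF aA_subgroup] by blast
  have fT: "finite T" using transversal_index(2)[OF aA_subgroup T] A_fin[OF aA a(2)] by simp
  show ?thesis
  proof (rule finite_index_if_finite_reps[OF dD_subgroup])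
    show "finite ((\<lambda>(t, t'). t / t') ` (T \<times> T))" using fT by simp
    fix g assume "g \<in> D"
    then obtain b s where g: "g = b / s" "b \<in> A" "s \<in> A" "s \<notin> P" "s \<noteq> 0" by (rule D_E)
    obtain t where t: "t \<in> T" "b - t \<in> (*) a ` A" using transversal_ex[OF T g(2)] by blast
    then obtain y where "b - t = a * y" and yA: "y \<in> A" by blast
    then have y: "b = t + a * y" by (simp add: algebra_simps)
    obtain t' where t': "t' \<in> T" "s - t' \<in> (*) a ` A" using transversal_ex[OF T g(3)] by blast
    then obtain y' where "s - t' = a * y'" and y'A: "y' \<in> A" by blast
    then have y': "s = t' + a * y'" by (simp add: algebra_simps)
    have tA: "t \<in> A" "t' \<in> A" using T t t' by (auto simp: transversal_def)
    have "t' \<notin> P"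
    proof
      assume "t' \<in> P"
      moreover have "a * y' \<in> P" using P_mult[OF y'A a(1)] by (simp add: mult.commute)
      ultimately have "s \<in> P" unfolding y' by (rule add_subgroup_add[OF P_subgroup])
      then show False using g by blast
    qed
    then have nz: "t' \<noteq> 0" using unit_nonzero by blast
    have "b * t' - t * s = a * (y * t' - t * y')" unfolding y y' by (simp add: algebra_simps)
    then have "b / s - t / t' = a * ((y * t' - t * y') / (s * t'))"
      using g(5) nz by (simp add: divide_simps mult.commute)
    moreover have "(y * t' - t * y') / (s * t') \<in> D"
      using units_mult[of s t'] g tA \<open>t' \<notin> P\<close> yA y'A by (intro D_I A_diff A_mult) auto
    ultimately have "g - t / t' \<in> (*) a ` D" unfolding g(1) by (rule image_eqI)
    then show "\<exists>t\<in>(\<lambda>(t, t'). t / t') ` (T \<times> T). g - t \<in> (*) a ` D"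
      using t(1) t'(1) by (intro bexI[of _ "t / t'"]) auto
  qed
qed

lemma finite_index_D:
  assumes "d \<in> D" "d \<noteq> 0" shows "finite_index D ((*) d ` D)"
proof (cases "d \<in> M")
  case False
  have "(*) d ` D = D"
  proof
    show "(*) d ` D \<subseteq> D" using assms D_closed by auto
    show "D \<subseteq> (*) d ` D"
    proof
      fix x assume "x \<in> D"
      then have "inverse d * x \<in> D" using inverse_D[OF assms(1) False] D_closed by simp
      then show "x \<in> (*) d ` D" using assms by (intro image_eqI[of _ _ "inverse d * x"]) auto
    qed
  qed
  then show ?thesis using subgroup_index_refl[OF D_subgroup] by simp
next
  case True
  then obtain a s where d: "d = a / s" "a \<in> P" "s \<in> A" "s \<notin> P" "s \<noteq> 0" by (rule M_E)
  have "(*) a ` D \<subseteq> (*) d ` D"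
  proof
    fix x assume "x \<in> (*) a ` D"
    then obtain y where y: "x = a * y" "y \<in> D" by blast
    then have "x = d * (s * y)" using d by simp
    moreover have "s * y \<in> D" using d A_sub_D y by (auto intro: D_closed)
    ultimately show "x \<in> (*) d ` D" by blast
  qed
  moreover have "(*) d ` D \<subseteq> D" using assms D_closed by auto
  moreover have "finite_index D ((*) a ` D)" using finite_index_D_A d assms by auto
  ultimately show ?thesis using finite_index_mono(1)[OF dD_subgroup dD_subgroup] by blast
qed

text \<open>Two powers of \<open>y\<close> agree modulo \<open>d\<close>, so
  \<open>y ^ i * (y ^ (j - i) - 1)\<close> is a multiple of \<open>d\<close>. The second factor is a
  unit, because \<open>y\<close> lies in the maximal ideal.\<close>

lemma nilpotent:
  assumes "y \<in> M" "d \<in> D" "d \<noteq> 0" shows "\<exists>i. y ^ i \<in> (*) d ` D"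
proof -
  have yD: "y \<in> D" using assms M_sub_D by blast
  obtain i j where ij: "i < j" "y ^ j - y ^ i \<in> (*) d ` D"
    using finite_index_pigeonhole[OF dD_subgroup finite_index_D[OF assms(2,3)], of "\<lambda>k. y ^ k"] D_power[OF yD]
    by blast
  let ?u = "y ^ (j - i) - 1"
  have "y ^ (j - i) = y ^ (j - i - 1) * y" using ij by (metis Suc_diff_1 power_Suc2 zero_less_diff)
  then have yM: "y ^ (j - i) \<in> M" using M_mult[OF D_power[OF yD] assms(1)] by simp
  have "?u \<notin> M"
  proof
    assume "?u \<in> M"
    then have "y ^ (j - i) - ?u \<in> M" using yM M_diff by blast
    then show False using one_notin_M by simp
  qed
  moreover have "?u \<in> D" using yM M_sub_D D_one D_closed by blast
  ultimately have u: "inverse ?u \<in> D" "?u \<noteq> 0" using inverse_D by blast+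
  have "y ^ j = y ^ (j - i) * y ^ i" using ij by (simp flip: power_add)
  then have "y ^ i = inverse ?u * (y ^ j - y ^ i)" using u(2) by (simp add: field_simps)
  then show ?thesis using dD_mult[OF u(1) ij(2)] by metis
qed

text \<open>\<open>b\<close> is multiplied by the highest power of the new element that keeps it
  nonzero modulo \<open>a\<close>; this power exists by nilpotency. The elements treated before
  still annihilate the product modulo \<open>a\<close>.\<close>

lemma socle_finite:
  assumes "finite Y" "Y \<subseteq> M" and a: "a \<in> P" "a \<noteq> 0"
  shows "\<exists>b\<in>D. b \<notin> (*) a ` D \<and> (\<forall>y\<in>Y. b * y \<in> (*) a ` D)"
  using assms(1,2)
proof (induction Y)
  case empty
  have "1 \<notin> (*) a ` D"
  proof
    assume "1 \<in> (*) a ` D"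
    then obtain x where "1 = a * x" "x \<in> D" by blast
    then have "1 \<in> M" using M_mult[of x a] P_sub_M a by (auto simp: mult.commute)
    then show False using one_notin_M by blast
  qed
  then show ?case using D_one by auto
next
  case (insert y Y)
  then obtain b where b: "b \<in> D" "b \<notin> (*) a ` D" "\<forall>y\<in>Y. b * y \<in> (*) a ` D" by auto
  have y: "y \<in> M" "y \<in> D" using insert M_sub_D by auto
  have "\<exists>i. b * y ^ i \<in> (*) a ` D"
    using nilpotent[OF y(1), of a] dD_mult[OF b(1), of _ a] a P_sub A_sub_D by blast
  define i where "i = (LEAST i. b * y ^ i \<in> (*) a ` D)"
  have i: "b * y ^ i \<in> (*) a ` D" unfolding i_def by (rule LeastI_ex) fact
  have "i \<noteq> 0" using i b by (auto intro!: notI)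
  then obtain k where k: "i = Suc k" by (cases i) auto
  have nk: "b * y ^ k \<notin> (*) a ` D"
    using not_less_Least[of k "\<lambda>i. b * y ^ i \<in> (*) a ` D"] k unfolding i_def[symmetric] by simp
  have "(b * y ^ k) * z \<in> (*) a ` D" if "z \<in> insert y Y" for z
  proof (cases "z = y")
    case True then show ?thesis using i k by (simp add: mult_ac)
  next
    case False
    then have "b * z \<in> (*) a ` D" using that b by blast
    then have "y ^ k * (b * z) \<in> (*) a ` D" using dD_mult D_power[OF y(2)] by blast
    then show ?thesis by (simp add: mult_ac)
  qed
  then show ?case using nk D_closed(2)[OF b(1) D_power[OF y(2)]] by blast
qed

text \<open>This is a nonzero element of D modulo a that is killed by the maximal ideal. As the
  quotient is finite, killing the finitely many representatives in \<open>M\<close> is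
  enough.\<close>

lemma socle:
  assumes a: "a \<in> P" "a \<noteq> 0"
  shows "\<exists>b\<in>D. b \<notin> (*) a ` D \<and> (\<forall>y\<in>M. b * y \<in> (*) a ` D)"
proof -
  obtain T where T: "transversal D ((*) a ` D) T" using obtain_transversal[OF dD_subgroup] by blast
  then have "finite T" using transversal_index(2)[OF dD_subgroup T] finite_index_D_A[OF a] by simp
  then obtain b where b: "b \<in> D" "b \<notin> (*) a ` D" "\<forall>y\<in>T \<inter> M. b * y \<in> (*) a ` D"
    using socle_finite[of "T \<inter> M" a] a by auto
  have "b * y \<in> (*) a ` D" if "y \<in> M" for y
  proof -
    have "y \<in> D" using that M_sub_D by blast
    then obtain t where t: "t \<in> T" "y - t \<in> (*) a ` D" using transversal_ex[OF T] by blast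
    then have "y - t \<in> M" using M_mult[of _ a] P_sub_M a by (auto simp: mult.commute)
    then have "y - (y - t) \<in> M" using that M_diff by blast
    then have "b * t \<in> (*) a ` D" using b t by simp
    moreover have "b * (y - t) \<in> (*) a ` D" using dD_mult b t by blast
    ultimately have "b * t + b * (y - t) \<in> (*) a ` D" by (rule add_subgroup_add[OF dD_subgroup])
    then show ?thesis by (simp add: algebra_simps)
  qed
  then show ?thesis using b by blast
qed

lemma common_denominator:
  assumes "finite Y" "Y \<subseteq> M" shows "\<exists>s\<in>A. s \<notin> P \<and> (\<forall>y\<in>Y. s * y \<in> P)"
  using assms
proof (induction Y)
  case empty then show ?case using A_one P_one by auto
next
  case (insert y Y)
  then obtain s where s: "s \<in> A" "s \<notin> P" "\<forall>y\<in>Y. s * y \<in> P" by auto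
  have "y \<in> M" using insert by auto
  then obtain a t where y: "y = a / t" "a \<in> P" "t \<in> A" "t \<notin> P" "t \<noteq> 0" by (rule M_E)
  have "s * t * z \<in> P" if "z \<in> insert y Y" for z
  proof (cases "z = y")
    case True then show ?thesis using y s P_mult by simp
  next
    case False
    then have "t * (s * z) \<in> P" using that s y P_mult by blast
    then show ?thesis by (simp add: mult_ac)
  qed
  then show ?case using units_mult[OF s(1,2) y(3,4)] by blast
qed

text \<open>If \<open>x = b / a\<close> maps the maximal ideal into itself, the powers of a multiple \<open>X\<close> of \<open>x\<close> lie in
  \<open>A / a\<close>, and two of them agree modulo \<open>A\<close>; this is an integral equation for \<open>X\<close>.\<close>

lemma uniformizer_exists: "\<exists>\<pi>\<in>M. \<pi> \<noteq> 0 \<and> M = (*) \<pi> ` D"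
proof -
  obtain a where a: "a \<in> P" "a \<noteq> 0" using P_nonzero by blast
  have aA: "a \<in> A" using a P_sub by blast
  obtain b where b: "b \<in> D" "b \<notin> (*) a ` D" "\<forall>y\<in>M. b * y \<in> (*) a ` D" using socle[OF a] by blast
  define x where "x = b / a"
  have xD: "x \<notin> D" using b a by (auto simp: x_def image_iff)
  have xM: "x * y \<in> D" if "y \<in> M" for y using b that a by (auto simp: x_def)
  have "\<exists>y\<in>M. x * y \<notin> M"
  proof (rule ccontr)
    assume "\<not> (\<exists>y\<in>M. x * y \<notin> M)"
    then have all: "x * y \<in> M" if "y \<in> M" for y using that by blast
    obtain T where T: "transversal A ((*) a ` A) T" using obtain_transversal[OF aA_subgroup] by blast
    have fT: "finite T" using transversal_index(2)[OF aA_subgroup T] A_fin[OF aA a(2)] by simp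
    \<comment> \<open>\<open>s\<close> clears the denominators of \<open>x\<close> times
      \<open>a\<close> and of \<open>x\<close> times the representatives in \<open>P\<close>. These
      elements generate the ideal \<open>P\<close>, so \<open>s * x\<close> maps \<open>P\<close>
      into itself.\<close>
    obtain s where s: "s \<in> A" "s \<notin> P" "\<forall>y\<in>(*) x ` (insert a (T \<inter> P)). s * y \<in> P"
      using common_denominator[of "(*) x ` (insert a (T \<inter> P))"] fT all P_sub_M a by blast
    define X where "X = s * x"
    have XP: "X * y \<in> P" if yP: "y \<in> P" for y
    proof -
      obtain t where t: "t \<in> T" "y - t \<in> (*) a ` A" using transversal_ex[OF T] yP P_sub by blast
      then obtain z where z: "y - t = a * z" "z \<in> A" by blast
      then have "t = y - z * a" by (simp add: algebra_simps)
      then have "t \<in> P" using P_diff yP P_mult z a by simp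
      then have "X * t \<in> P" using s t by (simp add: X_def mult.assoc)
      moreover have "z * (X * a) \<in> P" using s z P_mult by (simp add: X_def mult.assoc)
      ultimately have "X * t + z * (X * a) \<in> P" by (rule add_subgroup_add[OF P_subgroup])
      moreover have "X * t + z * (X * a) = X * y" using z by (simp add: algebra_simps)
      ultimately show ?thesis by simp
    qed
    have "X ^ k * a \<in> P" for k
      by (induction k) (use a XP in \<open>auto simp: mult.assoc\<close>)
    then have "X ^ k * a \<in> A" for k using P_sub by blast
    then obtain i j where ij: "i < j" "X ^ j * a - X ^ i * a \<in> (*) a ` A"
      using finite_index_pigeonhole[OF aA_subgroup A_fin[OF aA a(2)], of "\<lambda>k. X ^ k * a"] by blast
    then obtain z where "X ^ j * a - X ^ i * a = a * z" "z \<in> A" by blast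
    then have "a * (X ^ j - X ^ i) = a * z" by (simp add: algebra_simps)
    then have "X ^ j - X ^ i = z" using a(2) by simp
    then have XA: "X ^ j - X ^ i \<in> A" using \<open>z \<in> A\<close> by simp
    obtain c t where c: "b = c / t" "c \<in> A" "t \<in> A" "t \<notin> P" "t \<noteq> 0" using b(1) by (rule D_E)
    have "X = (s * c) / (t * a)" using c by (simp add: X_def x_def)
    then have "X \<in> A"
      using A_closed[of "s * c" "t * a" i j] XA A_mult s c aA a ij(1) by simp
    then have "X / s \<in> D" using D_I s by blast
    moreover have "X / s = x" using unit_nonzero[OF s(2)] by (simp add: X_def)
    ultimately show False using xD by simp
  qed
  \<comment> \<open>Since \<open>x * y\<close> is a unit of \<open>D\<close>, the element
    \<open>y\<close> generates \<open>M\<close>: dividing \<open>z\<close> in \<open>M\<close> by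
    \<open>y\<close> amounts to dividing \<open>x * z\<close>, which lies in \<open>D\<close>, by
    this unit.\<close>
  then obtain y where y: "y \<in> M" "x * y \<notin> M" by blast
  have u: "inverse (x * y) \<in> D" "x * y \<noteq> 0" using inverse_D xM y by blast+
  have "M = (*) y ` D"
  proof
    show "(*) y ` D \<subseteq> M" using M_mult y by (auto simp: mult.commute)
    show "M \<subseteq> (*) y ` D"
    proof
      fix z assume "z \<in> M"
      then have "inverse (x * y) * (x * z) \<in> D" using u xM D_closed by blast
      moreover have "z = y * (inverse (x * y) * (x * z))" using u(2) by (simp add: field_simps)
      ultimately show "z \<in> (*) y ` D" by blast
    qed
  qed
  then show ?thesis using y u by auto
qed

definition \<pi> :: complex where "\<pi> = (SOME x. x \<in> M \<and> x \<noteq> 0 \<and> M = (*) x ` D)"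

lemma \<pi>: "\<pi> \<in> M" "\<pi> \<noteq> 0" "M = (*) \<pi> ` D"
proof -
  have "\<pi> \<in> M \<and> \<pi> \<noteq> 0 \<and> M = (*) \<pi> ` D"
    unfolding \<pi>_def by (rule someI_ex) (use uniformizer_exists in blast)
  then show "\<pi> \<in> M" "\<pi> \<noteq> 0" "M = (*) \<pi> ` D" by auto
qed

sublocale dvr D \<pi>
proof
  show "1 \<in> D" by (rule D_one)
  show "\<pi> \<in> D" "\<pi> \<noteq> 0" using \<pi> M_sub_D by auto
  show "inverse \<pi> \<notin> D"
  proof
    assume "inverse \<pi> \<in> D"
    then have "inverse \<pi> * \<pi> \<in> M" using \<pi> M_mult by blast
    then show False using \<pi> one_notin_M by simp
  qed
  show "finite_index D ((*) \<pi> ` D)" using finite_index_D \<pi> M_sub_D by blast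
next
  fix x y assume "x \<in> D" "y \<in> D"
  then show "x - y \<in> D" "x * y \<in> D" by (rule D_closed)+
next
  fix x assume x: "x \<in> D" "x \<noteq> 0"
  obtain i e where i: "\<pi> ^ i = x * e" "e \<in> D" using nilpotent[OF \<pi>(1) x] by blast
  \<comment> \<open>Otherwise all powers of \<open>\<pi>\<close> would divide \<open>x\<close>,
    whereas \<open>x\<close> divides \<open>\<pi> ^ i\<close>.\<close>
  have "\<exists>k. x \<in> (*) (\<pi> ^ k) ` D \<and> x \<notin> (*) (\<pi> ^ Suc k) ` D"
  proof (rule ccontr)
    assume neg: "\<not> ?thesis"
    have "x \<in> (*) (\<pi> ^ k) ` D" for k
      by (induction k) (use x neg in auto)
    then obtain f where f: "x = \<pi> ^ Suc i * f" "f \<in> D" by blast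
    then have "\<pi> ^ i = \<pi> ^ i * (\<pi> * (f * e))" using i by (simp add: mult_ac)
    then have "1 = (f * e) * \<pi>" using \<pi> by (simp add: mult_ac)
    then have "1 \<in> M" using M_mult[of "f * e" \<pi>] D_closed f i \<pi> by simp
    then show False using one_notin_M by blast
  qed
  then obtain k u where k: "x = \<pi> ^ k * u" "u \<in> D" "x \<notin> (*) (\<pi> ^ Suc k) ` D" by blast
  have "u \<notin> M"
  proof
    assume "u \<in> M"
    then obtain v where "u = \<pi> * v" "v \<in> D" using \<pi>(3) by blast
    then have "x = \<pi> ^ Suc k * v" using k by simp
    then show False using k(3) \<open>v \<in> D\<close> by blast
  qed
  then show "\<exists>u k. u \<in> D \<and> inverse u \<in> D \<and> u \<noteq> 0 \<and> x = u * \<pi> ^ k"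
    using inverse_D[of u] k by (auto simp: mult.commute)
qed

text \<open>Powers of \<open>s\<close> repeat modulo a nonzero element of \<open>P\<close>. As
  \<open>s ^ i\<close> is outside the prime \<open>P\<close>, it can be cancelled, and a positive
  power of \<open>s\<close> is 1 modulo \<open>P\<close>.\<close>

lemma unit_mod_P: assumes "s \<in> A" "s \<notin> P" obtains t e where "t \<in> A" "e \<in> P" "s * t + e = 1"
proof -
  obtain a where a: "a \<in> P" "a \<noteq> 0" using P_nonzero by blast
  then have aA: "a \<in> A" using P_sub by blast
  obtain i j where ij: "i < j" "s ^ j - s ^ i \<in> (*) a ` A"
    using finite_index_pigeonhole[OF aA_subgroup A_fin[OF aA a(2)], of "\<lambda>k. s ^ k"] A_power[OF assms(1)]
    by blast
  then have "s ^ j - s ^ i \<in> P" using P_mult a by (auto simp: mult.commute)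
  moreover have "s ^ j - s ^ i = s ^ i * (s ^ (j - i) - 1)" using ij
    by (simp add: right_diff_distrib flip: power_add)
  ultimately have *: "s ^ i * (s ^ (j - i) - 1) \<in> P" by simp
  have "s ^ k \<notin> P" for k
    by (induction k) (use assms P_one P_prime A_power in auto)
  then have "s ^ (j - i) - 1 \<in> P"
    using P_prime[OF A_power[OF assms(1)] A_diff[OF A_power[OF assms(1)] A_one] *] by blast
  then have "- (s ^ (j - i) - 1) \<in> P" using P_subgroup by (rule add_subgroup_uminus[rotated])
  moreover have "s ^ (j - i) = s * s ^ (j - i - 1)" using ij by (metis Suc_diff_1 power_Suc zero_less_diff)
  ultimately show ?thesis
    using that[of "s ^ (j - i - 1)" "- (s ^ (j - i) - 1)"] A_power assms by auto
qed

text \<open>\<open>1 - e ^ k\<close> is a multiple of \<open>1 - e\<close>, so an inverse of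
  \<open>s\<close> modulo \<open>P\<close> yields one modulo the \<open>k\<close>-th power of an
  element of \<open>P\<close>.\<close>

lemma unit_mod_P_power:
  assumes "s \<in> A" "s \<notin> P" obtains t e where "t \<in> A" "e \<in> P" "s * t + e ^ k = 1"
proof -
  obtain t e where te: "t \<in> A" "e \<in> P" "s * t + e = 1" using unit_mod_P[OF assms] by blast
  have "e \<in> A" using te P_sub by blast
  then have "(\<Sum>i<k. e ^ i) \<in> A" using A_power by (intro add_subgroup_sum[OF A_subgroup]) auto
  moreover have "1 - e ^ k = (1 - e) * (\<Sum>i<k. e ^ i)" by (rule one_diff_power_eq)
  moreover have "1 - e = s * t" using te(3) by (simp add: diff_eq_eq)
  ultimately have "s * (t * (\<Sum>i<k. e ^ i)) + e ^ k = 1" "(\<Sum>i<k. e ^ i) \<in> A"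
    by (simp_all add: diff_eq_eq mult.assoc)
  then show ?thesis using that te A_mult by blast
qed

lemma M_power: "e \<in> M \<Longrightarrow> e ^ k \<in> (*) (\<pi> ^ k) ` D"
proof -
  assume "e \<in> M"
  then obtain v where "e = \<pi> * v" "v \<in> D" using \<pi>(3) by blast
  then show ?thesis using D_power by (auto simp: power_mult_distrib)
qed

text \<open>The denominator of \<open>x\<close> is inverted modulo the \<open>k\<close>-th power of
  an element of \<open>P\<close>. Hence \<open>A\<close> maps onto the residue rings of
  \<open>D\<close>.\<close>

lemma approx_D: assumes "x \<in> D" shows "\<exists>y\<in>A. y - x \<in> (*) (\<pi> ^ k) ` D"
proof -
  obtain a s where x: "x = a / s" "a \<in> A" "s \<in> A" "s \<notin> P" "s \<noteq> 0" using assms by (rule D_E)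
  obtain t e where te: "t \<in> A" "e \<in> P" "s * t + e ^ k = 1" using unit_mod_P_power x by metis
  then have "e ^ k = 1 - s * t" by (simp add: eq_diff_eq add.commute)
  moreover have "a * t - x = (- x) * (1 - s * t)" unfolding x(1) using x(5) by (simp add: field_simps)
  ultimately have "a * t - x = (- x) * e ^ k" by simp
  moreover have "e ^ k \<in> (*) (\<pi> ^ k) ` D" using M_power te P_sub_M by blast
  ultimately have "a * t - x \<in> (*) (\<pi> ^ k) ` D"
    using dD_mult[OF add_subgroup_uminus[OF D_subgroup assms]] by metis
  then show ?thesis using A_mult x te by blast
qed

text \<open>Clearing denominators in \<open>\<pi> ^ k\<close> exhibits \<open>z\<close>, up to a
  factor outside \<open>P\<close>, as a multiple of the \<open>k\<close>-th power of an element of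
  \<open>P\<close>. In this form membership in the ideal power can be recognised.\<close>

lemma power_form:
  assumes "z \<in> A" "z \<in> (*) (\<pi> ^ k) ` D"
  shows "\<exists>s\<in>A. \<exists>a\<in>P. \<exists>b\<in>A. s \<notin> P \<and> s * z = a ^ k * b"
proof -
  obtain w where w: "z = \<pi> ^ k * w" "w \<in> D" using assms(2) by blast
  obtain b t where b: "w = b / t" "b \<in> A" "t \<in> A" "t \<notin> P" "t \<noteq> 0" using w(2) by (rule D_E)
  obtain a s where a: "\<pi> = a / s" "a \<in> P" "s \<in> A" "s \<notin> P" "s \<noteq> 0" using \<pi>(1) by (rule M_E)
  have "s ^ k \<notin> P" by (induction k) (use a P_one P_prime A_power in auto)
  then have "s ^ k * t \<in> A \<and> s ^ k * t \<notin> P" using units_mult A_power a b by blast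
  moreover have "s ^ k * t * z = a ^ k * b" using w a b by (simp add: power_divide)
  ultimately show ?thesis using a b by blast
qed

lemma index_residue: "subgroup_index D ((*) \<pi> ` D) = subgroup_index A P"
proof (rule subgroup_index_cong(1)[symmetric, where f = "\<lambda>x. x"])
  show "x - y \<in> P \<longleftrightarrow> x - y \<in> (*) \<pi> ` D" if "x \<in> A" "y \<in> A" for x y
    using \<pi>(3) A_Int_M[of "x - y"] A_diff that P_sub_M by blast
  show "\<exists>x\<in>A. z - x \<in> (*) \<pi> ` D" if z: "z \<in> D" for z
  proof -
    obtain x where "x \<in> A" "x - z \<in> (*) \<pi> ` D" using approx_D[OF z, where k = 1] by auto
    then show ?thesis using add_subgroup_diff_swap[OF dD_subgroup] by blast
  qed
qed (use P_subgroup dD_subgroup A_sub_D in auto)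

end

subsection \<open>Rings of integers of number fields\<close>

lemma complex_ring_simps [simp]:
  "carrier complex_ring = UNIV" "mult complex_ring = (*)" "one complex_ring = 1"
  "zero complex_ring = 0" "add complex_ring = (+)"
  by (simp_all add: complex_ring_def)

lemma complex_ring_field: "field complex_ring"
  using class_field[where 'a = complex] by (simp add: complex_ring_def)

interpretation complex_ring: field complex_ring by (rule complex_ring_field)

lemma complex_ring_a_inv: "a_inv complex_ring x = - x"
  by (rule complex_ring.minus_equality) auto

lemma subfield_closed:
  assumes K: "subfield K complex_ring"
  shows "1 \<in> K" "x \<in> K \<Longrightarrow> y \<in> K \<Longrightarrow> x - y \<in> K" "x \<in> K \<Longrightarrow> y \<in> K \<Longrightarrow> x * y \<in> K"
    "x \<in> K \<Longrightarrow> y \<in> K \<Longrightarrow> x / y \<in> K"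
proof -
  have s: "subring K complex_ring" using K by (simp add: subfield_def subdomain_def subcring_def)
  show "1 \<in> K" using subringE(3)[OF s] by simp
  show "x - y \<in> K" if "x \<in> K" "y \<in> K" for x y
    using subringE(7)[OF s, of x "- y"] subringE(5)[OF s, of y] that by (simp add: complex_ring_a_inv)
  show mult: "x * y \<in> K" if "x \<in> K" "y \<in> K" for x y
    using subringE(6)[OF s that] by simp
  show "x / y \<in> K" if xy: "x \<in> K" "y \<in> K" for x y
  proof (cases "y = 0")
    case False
    then have "y \<in> Units (complex_ring \<lparr>carrier := K\<rparr>)"
      using subfield.subfield_Units[OF K] xy by simp
    then obtain z where z: "z \<in> K" "z * y = 1" unfolding Units_def by auto
    from z(2) have "y * z = 1" by (simp only: mult.commute)
    then have "z = inverse y" by (rule inverse_unique[symmetric])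
    then show ?thesis using mult[OF xy(1) z(1)] by (simp add: divide_inverse)
  qed (use subringE(2)[OF s] in simp)
qed

interpretation rat_span: vector_space "\<lambda>(r::rat) (x::complex). of_rat r * x"
  by unfold_locales (simp_all add: algebra_simps of_rat_add of_rat_mult)

lemma dimension_finite_span:
  assumes "ring.dimension complex_ring n K E" "K = \<rat>"
  shows "\<exists>B. finite B \<and> E \<subseteq> rat_span.span B"
  using assms
proof (induction rule: complex_ring.dimension.induct)
  case (zero_dim K)
  have "{\<zero>\<^bsub>complex_ring\<^esub>} \<subseteq> rat_span.span {}" by simp
  then show ?case by blast
next
  case (Suc_dim v E n K)
  then obtain B where B: "finite B" "E \<subseteq> rat_span.span B" by blast
  have K: "K = \<rat>" by fact
  have "complex_ring.line_extension K v E \<subseteq> rat_span.span (insert v B)"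
  proof
    fix x assume "x \<in> complex_ring.line_extension K v E"
    then have "\<exists>k\<in>K. \<exists>e\<in>E. x = k * v + e"
      unfolding complex_ring.line_extension_mem_iff complex_ring_simps .
    then obtain k e where x: "x = k * v + e" "k \<in> K" "e \<in> E" by blast
    then obtain r where r: "k = of_rat r" unfolding K using Rats_cases by blast
    have "of_rat r * v \<in> rat_span.span (insert v B)"
      by (intro rat_span.span_scale rat_span.span_base) simp
    moreover have "e \<in> rat_span.span (insert v B)"
      using B(2) x(3) rat_span.span_mono[of B "insert v B"] by blast
    ultimately show "x \<in> rat_span.span (insert v B)"
      unfolding x(1) r by (rule rat_span.span_add)
  qed
  then show ?case using B(1) by blast
qed

definition int_independent :: "complex set \<Rightarrow> bool" where
  "int_independent S \<longleftrightarrow> (\<forall>u. (\<Sum>v\<in>S. of_int (u v) * v) = 0 \<longrightarrow> (\<forall>v\<in>S. u v = 0))"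

lemma common_int_denominator:
  assumes "finite S"
  shows "\<exists>N::int. N > 0 \<and> (\<forall>v\<in>S. \<exists>k. of_int k = of_int N * (u v :: rat))"
  using assms
proof (induction S)
  case empty then show ?case by (intro exI[of _ 1]) auto
next
  case (insert x S)
  then obtain N where N: "N > 0" "\<And>v. v \<in> S \<Longrightarrow> \<exists>k. of_int k = of_int N * u v" by blast
  obtain a b where ab: "u x = of_int a / of_int b" "b > 0" by (cases "u x") (auto simp: Fract_of_int_quotient)
  have "\<exists>k. of_int k = of_int (N * b) * u v" if v: "v \<in> insert x S" for v
  proof (cases "v = x")
    case True
    then show ?thesis using ab by (intro exI[of _ "N * a"]) simp
  next
    case False
    then obtain k where "of_int k = of_int N * u v" using N(2) v by blast
    then have "of_int (b * k) = of_int (N * b) * u v" by simp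
    then show ?thesis by blast
  qed
  then show ?case using N ab by (intro exI[of _ "N * b"]) auto
qed

text \<open>Clearing denominators turns a rational relation into an integral one. Integrally
  independent sets are therefore rationally independent and no larger than a finite spanning
  set.\<close>

lemma number_field_rank:
  assumes "number_field K"
  obtains n where "\<And>S. finite S \<Longrightarrow> S \<subseteq> K \<Longrightarrow> int_independent S \<Longrightarrow> card S \<le> n"
proof -
  obtain n where "ring.dimension complex_ring n \<rat> K"
    using assms by (auto simp: number_field_def complex_ring.finite_dimension_def)
  then obtain B where B: "finite B" "K \<subseteq> rat_span.span B" using dimension_finite_span[OF _ refl] by blast
  have "card S \<le> card B" if S: "finite S" "S \<subseteq> K" "int_independent S" for S
  proof -
    have "rat_span.independent S"
    proof (rule ccontr)
      assume "\<not> rat_span.independent S"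
      then obtain u where u: "\<exists>v\<in>S. u v \<noteq> 0" "(\<Sum>v\<in>S. of_rat (u v) * v) = 0"
        using rat_span.dependent_finite[OF S(1)] by blast
      obtain N where N: "N > 0" "\<And>v. v \<in> S \<Longrightarrow> \<exists>k. of_int k = of_int N * u v"
        using common_int_denominator[OF S(1)] by blast
      then obtain w where w: "\<And>v. v \<in> S \<Longrightarrow> of_int (w v) = of_int N * u v" by metis
      have w': "complex_of_int (w v) = of_int N * of_rat (u v)" if "v \<in> S" for v
        using arg_cong[OF w[OF that], of "of_rat :: rat \<Rightarrow> complex"] by (simp add: of_rat_mult)
      have "(\<Sum>v\<in>S. of_int (w v) * v) = of_int N * (\<Sum>v\<in>S. of_rat (u v) * v)"
        using w' by (simp add: sum_distrib_left mult.assoc)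
      then have "(\<Sum>v\<in>S. of_int (w v) * v) = 0" using u by simp
      then have "\<forall>v\<in>S. w v = 0" using S(3) unfolding int_independent_def by blast
      then show False using u(1) w N(1) by fastforce
    qed
    then show ?thesis using rat_span.independent_span_bound[OF B(1)] S B by blast
  qed
  then show ?thesis by (rule that)
qed

text \<open>A set that is maximal among the sets that are linearly independent modulo \<open>l\<close> spans modulo \<open>l\<close>.\<close>

lemma finite_index_prime_multiple:
  assumes A: "add_subgroup A" and l: "prime l"
    and rank: "\<And>S. finite S \<Longrightarrow> S \<subseteq> A \<Longrightarrow> int_independent S \<Longrightarrow> card S \<le> n"
  shows "finite_index A ((*) (of_nat l) ` A)"
proof -
  let ?lA = "(*) (of_nat l) ` A"
  have lA: "add_subgroup ?lA" by (rule mult_image_subgroup[OF A])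
  have int_mult: "of_int k * x \<in> A" if "x \<in> A" for k x
  proof -
    have "of_nat k * x \<in> A" for k
      by (induction k) (use A that in \<open>auto simp: algebra_simps add_subgroup_closed\<close>)
    then show ?thesis using add_subgroup_uminus[OF A]
      by (cases k) (auto simp del: of_nat_Suc simp: mult_minus_left)
  qed
  define indep where "indep S \<longleftrightarrow> (\<forall>u. (\<Sum>v\<in>S. of_int (u v) * v) \<in> ?lA \<longrightarrow> (\<forall>v\<in>S. int l dvd u v))" for S
  have l0: "l > 1" using prime_gt_1_nat[OF l] .
  have indep_rank: "card S \<le> n" if S: "finite S" "S \<subseteq> A" "indep S" for S
  proof (rule rank[OF S(1,2)])
    \<comment> \<open>Descent: the coefficients of a relation are divisible by \<open>l\<close>, and
      dividing by \<open>l\<close> leaves a relation. Only 0 is divisible by all powers of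
      \<open>l\<close>, so independence modulo \<open>l\<close> implies integral
      independence.\<close>
    have dvd: "(\<Sum>v\<in>S. of_int (u v) * v) = 0 \<Longrightarrow> v \<in> S \<Longrightarrow> int l ^ k dvd u v" for u v k
    proof (induction k arbitrary: u v)
      case (Suc k)
      have "\<forall>v\<in>S. int l dvd u v" using S(3) Suc.prems(1) add_subgroup_zero[OF lA] unfolding indep_def by metis
      then obtain w where w: "\<And>v. v \<in> S \<Longrightarrow> u v = int l * w v" unfolding dvd_def by metis
      then have "of_nat l * (\<Sum>v\<in>S. of_int (w v) * v) = 0"
        using Suc.prems(1) by (simp add: sum_distrib_left mult.assoc)
      then have "(\<Sum>v\<in>S. of_int (w v) * v) = 0" using l0 by simp
      then have "int l ^ k dvd w v" using Suc by blast
      then show ?case using w Suc.prems by simp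
    qed simp
    show "int_independent S" unfolding int_independent_def
    proof (intro allI impI ballI)
      fix u v assume uv: "(\<Sum>v\<in>S. of_int (u v) * v) = 0" "v \<in> S"
      show "u v = 0"
      proof (rule ccontr)
        assume "u v \<noteq> 0"
        moreover have "int l ^ nat \<bar>u v\<bar> dvd u v" using dvd uv by blast
        ultimately have "int l ^ nat \<bar>u v\<bar> \<le> \<bar>u v\<bar>" using zdvd_imp_le[of "int l ^ nat \<bar>u v\<bar>" "\<bar>u v\<bar>"] by simp
        moreover have "nat \<bar>u v\<bar> < l ^ nat \<bar>u v\<bar>" using l0 by (simp add: power_gt_expt)
        then have "int (nat \<bar>u v\<bar>) < int l ^ nat \<bar>u v\<bar>" by (metis of_nat_less_iff of_nat_power)
        ultimately show False by simp
      qed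
    qed
  qed
  define P where "P S \<longleftrightarrow> finite S \<and> S \<subseteq> A \<and> indep S" for S
  have "P {}" by (simp add: P_def indep_def)
  then have "\<exists>S. P S \<and> (\<forall>S'. P S' \<longrightarrow> card S' \<le> card S)"
    by (rule ex_has_greatest_nat[where b = "Suc n"]) (use indep_rank in \<open>auto simp: P_def less_Suc_eq_le\<close>)
  then obtain S where S: "P S" "\<And>S'. P S' \<Longrightarrow> card S' \<le> card S" by blast
  then have S': "finite S" "S \<subseteq> A" "indep S" by (auto simp: P_def)
  define T where "T = (\<lambda>u. \<Sum>v\<in>S. of_int (u v) * v) ` (S \<rightarrow>\<^sub>E {0..<int l})"
  have span: "\<exists>w. x - (\<Sum>v\<in>S. of_int (w v) * v) \<in> ?lA" if x: "x \<in> A" for x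
  proof (cases "x \<in> S")
    case True
    have "(\<Sum>v\<in>S. of_int (if v = x then 1 else 0) * v) = (\<Sum>v\<in>S. if v = x then v else 0)"
      by (intro sum.cong) auto
    also have "\<dots> = x" using True S'(1) by simp
    finally show ?thesis using add_subgroup_zero[OF lA] by (intro exI[of _ "\<lambda>v. if v = x then 1 else 0"]) simp
  next
    case False
    then have "\<not> P (insert x S)" using S(2)[of "insert x S"] S'(1) by auto
    then have "\<not> indep (insert x S)" using S' x by (simp add: P_def)
    then obtain u where u: "(\<Sum>v\<in>insert x S. of_int (u v) * v) \<in> ?lA" "\<exists>v\<in>insert x S. \<not> int l dvd u v"
      unfolding indep_def by blast
    then have sum: "of_int (u x) * x + (\<Sum>v\<in>S. of_int (u v) * v) \<in> ?lA" using False S'(1) by simp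
    have nd: "\<not> int l dvd u x"
    proof
      assume "int l dvd u x"
      then obtain k where k: "u x = int l * k" by (elim dvdE)
      have "of_nat l * (of_int k * x) \<in> ?lA" using int_mult[OF x] by blast
      then have "of_int (u x) * x \<in> ?lA" using k by (simp add: mult.assoc)
      from add_subgroup_diff[OF lA sum this] have "(\<Sum>v\<in>S. of_int (u v) * v) \<in> ?lA"
        by (simp only: add_diff_cancel_left')
      then have "\<forall>v\<in>S. int l dvd u v" using S'(3) unfolding indep_def by blast
      then show False using u(2) \<open>int l dvd u x\<close> by blast
    qed
    have "prime (int l)" using l by simp
    then have "coprime (int l) (u x)" using nd by (rule prime_imp_coprime)
    then have "gcd (u x) (int l) = 1" by (simp add: coprime_iff_gcd_eq_1 gcd.commute)
    \<comment> \<open>The coefficient of \<open>x\<close> is prime to \<open>l\<close>. Multiplying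
      the relation by \<open>c\<close> makes it 1 modulo \<open>l\<close> and expresses
      \<open>x\<close> by the elements of \<open>S\<close>.\<close>
    then obtain c e where ce: "c * u x + e * int l = 1" using bezout_int[of "u x" "int l"] by auto
    have "complex_of_int (c * u x + e * int l) = 1" by (simp only: ce of_int_1)
    then have ce': "of_int c * of_int (u x) = 1 - of_int e * (of_nat l :: complex)" by (simp add: eq_diff_eq)
    have "of_int c * (of_int (u x) * x + (\<Sum>v\<in>S. of_int (u v) * v)) \<in> ?lA"
    proof -
      obtain y where "of_int (u x) * x + (\<Sum>v\<in>S. of_int (u v) * v) = of_nat l * y" "y \<in> A" using sum by blast
      then show ?thesis using int_mult[of y c] by (auto simp: mult.left_commute)
    qed
    moreover have "of_nat l * (of_int e * x) \<in> ?lA" using int_mult[OF x] by blast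
    ultimately have "of_int c * (of_int (u x) * x + (\<Sum>v\<in>S. of_int (u v) * v)) + of_nat l * (of_int e * x) \<in> ?lA"
      by (rule add_subgroup_add[OF lA])
    also have "of_int c * (of_int (u x) * x + (\<Sum>v\<in>S. of_int (u v) * v)) + of_nat l * (of_int e * x)
      = (of_int c * of_int (u x)) * x + of_nat l * (of_int e * x) + of_int c * (\<Sum>v\<in>S. of_int (u v) * v)"
      by (simp add: algebra_simps)
    also have "\<dots> = x - (\<Sum>v\<in>S. of_int (- c * u v) * v)"
      unfolding ce' by (simp add: algebra_simps sum_distrib_left sum_negf)
    finally show ?thesis by (rule exI[of _ "\<lambda>v. - c * u v"])
  qed
  show ?thesis
  proof (rule finite_index_if_finite_reps[OF lA])
    show "finite T" unfolding T_def using S'(1) by (intro finite_imageI finite_PiE) auto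
    fix x assume "x \<in> A"
    then obtain w where w: "x - (\<Sum>v\<in>S. of_int (w v) * v) \<in> ?lA" using span by blast
    \<comment> \<open>The coefficients count only modulo \<open>l\<close>, which leaves finitely
      many combinations.\<close>
    define w' where "w' = (\<lambda>v\<in>S. w v mod int l)"
    have "(\<Sum>v\<in>S. of_int (w v) * v) - (\<Sum>v\<in>S. of_int (w' v) * v) = (\<Sum>v\<in>S. of_nat l * (of_int (w v div int l) * v))"
      unfolding sum_subtractf[symmetric]
    proof (rule sum.cong)
      fix v assume "v \<in> S"
      have "complex_of_int (w v) = of_int (int l * (w v div int l) + w v mod int l)" by simp
      also have "\<dots> = of_nat l * of_int (w v div int l) + of_int (w' v)"
        using \<open>v \<in> S\<close> by (simp only: of_int_add of_int_mult of_int_of_nat_eq w'_def restrict_apply if_True)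
      finally show "of_int (w v) * v - of_int (w' v) * v = of_nat l * (of_int (w v div int l) * v)"
        by (simp add: algebra_simps)
    qed simp
    also have "\<dots> \<in> ?lA"
    proof (rule add_subgroup_sum[OF lA])
      fix v assume "v \<in> S"
      then show "of_nat l * (of_int (w v div int l) * v) \<in> ?lA" using S'(2) int_mult by blast
    qed
    finally have "x - (\<Sum>v\<in>S. of_int (w' v) * v) \<in> ?lA" using add_subgroup_diff_trans[OF lA w] by blast
    moreover have "w' \<in> S \<rightarrow>\<^sub>E {0..<int l}" using l0 by (auto simp: w'_def)
    ultimately show "\<exists>t\<in>T. x - t \<in> ?lA" unfolding T_def by blast
  qed
qed

lemma poly_of_int_mem:
  assumes "add_subgroup A" "1 \<in> A" "\<And>x y. x \<in> A \<Longrightarrow> y \<in> A \<Longrightarrow> x * y \<in> A" "(a::complex) \<in> A"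
  shows "poly (map_poly of_int p) a \<in> A"
proof (induction p)
  case 0 then show ?case using assms(1) by (simp add: add_subgroup_zero)
next
  case (pCons c p)
  have nat: "of_nat k \<in> A" for k
    by (induction k) (use assms(1,2) in \<open>auto simp: add_subgroup_closed\<close>)
  have "complex_of_int c \<in> A"
    using nat[of "nat \<bar>c\<bar>"] add_subgroup_uminus[OF assms(1), of "of_nat (nat \<bar>c\<bar>)"]
    by (cases "c \<ge> 0") (auto simp del: of_nat_nat simp: of_nat_nat)
  then show ?case using pCons assms(3)[OF assms(4)] by (simp add: map_poly_pCons add_subgroup_add[OF assms(1)])
qed

text \<open>The lowest nonzero coefficient of an integral equation of \<open>a\<close> is, up to
  sign, \<open>a\<close> times an integral polynomial in \<open>a\<close>. Zero constant
  coefficients are dropped first, by dividing the equation by \<open>a\<close>.\<close>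

lemma algebraic_int_dvd_nat:
  assumes A: "add_subgroup A" "1 \<in> A" "\<And>x y. x \<in> A \<Longrightarrow> y \<in> A \<Longrightarrow> x * y \<in> A"
    and a: "(a::complex) \<in> A" "a \<noteq> 0" "algebraic_int a"
  shows "\<exists>N>0. \<exists>y\<in>A. of_nat N = a * y"
proof -
  obtain p where p: "poly (map_poly of_int p) a = 0" "lead_coeff p = 1"
    using a(3) by (auto simp: algebraic_int_altdef_ipoly)
  have "p \<noteq> 0" using p(2) by auto
  have "\<exists>N>0. \<exists>y\<in>A. of_nat N = a * y" if "p \<noteq> 0" "poly (map_poly of_int p) a = 0" for p :: "int poly"
    using that
  proof (induction p)
    case (pCons c p)
    have eq: "of_int c + a * poly (map_poly of_int p) a = 0"
      using pCons.prems(2) pCons.hyps by (simp add: map_poly_pCons)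
    let ?y = "poly (map_poly of_int p) a"
    have y: "?y \<in> A" by (rule poly_of_int_mem[OF A a(1)])
    show ?case
    proof (cases "c = 0")
      case True
      then have "p \<noteq> 0" using pCons.hyps by simp
      moreover have "?y = 0" using eq True a(2) by simp
      ultimately show ?thesis using pCons.IH by blast
    next
      case False
      show ?thesis
      proof (cases "c > 0")
        case True
        have "complex_of_nat (nat c) = a * (- ?y)" using eq True by (simp add: eq_neg_iff_add_eq_0)
        then show ?thesis using True add_subgroup_uminus[OF A(1) y]
          by (intro exI[of _ "nat c"] conjI bexI[of _ "- ?y"]) auto
      next
        case False
        then have "complex_of_nat (nat (- c)) = a * ?y" using eq by (simp add: neg_eq_iff_add_eq_0)
        then show ?thesis using False \<open>c \<noteq> 0\<close> y by (intro exI[of _ "nat (- c)"]) auto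
      qed
    qed
  qed simp
  then show ?thesis using p(1) \<open>p \<noteq> 0\<close> by blast
qed

locale number_field_prime =
  fixes K p :: "complex set"
  assumes number_field: "number_field K" and nonzero_prime: "nonzero_prime K p"
begin

abbreviation "OK \<equiv> {x \<in> K. algebraic_int x}"

lemma ring_of_integers_simps [simp]:
  "carrier (ring_of_integers K) = OK" "mult (ring_of_integers K) = (*)" "one (ring_of_integers K) = 1"
  "zero (ring_of_integers K) = 0" "add (ring_of_integers K) = (+)"
  by (simp_all add: ring_of_integers_def complex_ring_def)

lemmas K_closed = subfield_closed[OF conjunct1[OF number_field[unfolded number_field_def]]]

lemma OK_closed: "1 \<in> OK" "x \<in> OK \<Longrightarrow> y \<in> OK \<Longrightarrow> x - y \<in> OK" "x \<in> OK \<Longrightarrow> y \<in> OK \<Longrightarrow> x * y \<in> OK"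
  using K_closed(1-3) algebraic_int_add_mult(2)[of x y] algebraic_int_add_mult(1)[of x "- y"]
  by auto

lemma OK_subgroup: "add_subgroup OK"
  using OK_closed(2) OK_closed(2)[OF OK_closed(1,1)] unfolding add_subgroup_def by auto

text \<open>Splitting off a prime factor \<open>l\<close> with \<open>N = l * N'\<close> reduces to
  two cases: the index of l OK is finite by rank, and l OK modulo N OK is a copy of OK modulo N'
  OK.\<close>

lemma finite_index_multiple: "N > 0 \<Longrightarrow> finite_index OK ((*) (of_nat N) ` OK)"
proof (induction N rule: less_induct)
  case (less N)
  show ?case
  proof (cases "N = 1")
    case True
    have "(*) (of_nat N) ` OK = OK" using True by (simp add: image_def)
    then show ?thesis using subgroup_index_refl[OF OK_subgroup] by simp
  next
    case False
    then obtain l where l: "prime l" "l dvd N" using prime_factor_nat by blast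
    then obtain N' where N': "N = l * N'" by blast
    have pos: "N' > 0" "N' < N" using less.prems N' prime_gt_1_nat[OF l(1)] by auto
    note sub = mult_image_subgroup[OF OK_subgroup]
    obtain n where n: "\<And>S. finite S \<Longrightarrow> S \<subseteq> K \<Longrightarrow> int_independent S \<Longrightarrow> card S \<le> n"
      using number_field_rank[OF number_field] by blast
    have "finite_index OK ((*) (of_nat l) ` OK)"
      by (rule finite_index_prime_multiple[OF OK_subgroup l(1), where n = n]) (use n in auto)
    moreover have "finite_index OK ((*) (of_nat N') ` OK)" using less.IH pos by blast
    then have "finite_index ((*) (of_nat l) ` OK) ((*) (of_nat N) ` OK)"
    proof (subst subgroup_index_cong(2)[where G = OK and H = "(*) (of_nat N') ` OK" and f = "(*) (of_nat l)", symmetric])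
      fix x y :: complex
      have nz: "of_nat l \<noteq> (0::complex)" using prime_gt_0_nat[OF l(1)] by simp
      show "x - y \<in> (*) (of_nat N') ` OK \<longleftrightarrow> of_nat l * x - of_nat l * y \<in> (*) (of_nat N) ` OK"
      proof
        assume "x - y \<in> (*) (of_nat N') ` OK"
        then obtain z where z: "x - y = of_nat N' * z" "z \<in> OK" by blast
        have "of_nat l * x - of_nat l * y = of_nat l * (x - y)" by (simp add: algebra_simps)
        then have "of_nat l * x - of_nat l * y = of_nat N * z" by (simp add: z(1) N')
        then show "of_nat l * x - of_nat l * y \<in> (*) (of_nat N) ` OK" using z(2) by blast
      next
        assume "of_nat l * x - of_nat l * y \<in> (*) (of_nat N) ` OK"
        then obtain z where z: "of_nat l * x - of_nat l * y = of_nat N * z" "z \<in> OK" by blast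
        then have "of_nat l * (x - y) = of_nat l * (of_nat N' * z)" by (simp add: algebra_simps N')
        then have "x - y = of_nat N' * z" by (rule mult_left_cancel[OF nz, THEN iffD1])
        then show "x - y \<in> (*) (of_nat N') ` OK" using z(2) by blast
      qed
    next
      fix z :: complex assume "z \<in> (*) (of_nat l) ` OK"
      then obtain x where "x \<in> OK" "z = of_nat l * x" by blast
      then show "\<exists>x\<in>OK. z - of_nat l * x \<in> (*) (of_nat N) ` OK"
        using add_subgroup_zero[OF sub] by (intro bexI[of _ x]) auto
    qed (use sub in auto)
    moreover have mult_sub: "(*) (of_nat l) ` OK \<subseteq> OK"
    proof -
      have "of_nat l \<in> OK" by (induction l) (use add_subgroup_add[OF OK_subgroup OK_closed(1)] add_subgroup_zero[OF OK_subgroup] in auto)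
      then show ?thesis using OK_closed(3) by blast
    qed
    moreover have "(*) (of_nat N) ` OK \<subseteq> (*) (of_nat l) ` OK"
    proof
      fix x :: complex assume "x \<in> (*) (of_nat N) ` OK"
      then obtain z where "x = of_nat N * z" "z \<in> OK" by blast
      then have z: "x = of_nat l * (of_nat N' * z)" "z \<in> OK" by (simp_all add: N' mult.assoc)
      have "of_nat N' \<in> OK" by (induction N') (use add_subgroup_add[OF OK_subgroup OK_closed(1)] add_subgroup_zero[OF OK_subgroup] in auto)
      then have "of_nat N' * z \<in> OK" using z OK_closed(3) by blast
      then show "x \<in> (*) (of_nat l) ` OK" using z(1) by blast
    qed
    ultimately show ?thesis using subgroup_index_mult(1)[OF OK_subgroup sub sub] by blast
  qed
qed

lemma prime_ideal: "primeideal p (ring_of_integers K)"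
  using nonzero_prime by (simp add: nonzero_prime_def)

lemma p_facts:
  "p \<subseteq> OK" "0 \<in> p" "x \<in> p \<Longrightarrow> y \<in> p \<Longrightarrow> x + y \<in> p" "a \<in> OK \<Longrightarrow> x \<in> p \<Longrightarrow> a * x \<in> p"
proof -
  interpret primeideal p "ring_of_integers K" by (rule prime_ideal)
  show "p \<subseteq> OK" using a_subset by simp
  show "0 \<in> p" using additive_subgroup.zero_closed[OF additive_subgroup_axioms] by simp
  show "x \<in> p \<Longrightarrow> y \<in> p \<Longrightarrow> x + y \<in> p"
    using additive_subgroup.a_closed[OF additive_subgroup_axioms, of x y] by simp
  show "a \<in> OK \<Longrightarrow> x \<in> p \<Longrightarrow> a * x \<in> p" using I_l_closed[of x a] by simp
qed

text \<open>The monic polynomial \<open>monom 1 j - monom 1 i\<close> takes an algebraic integer as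
  its value at \<open>x\<close>.\<close>

lemma algebraic_int_of_power_diff:
  assumes "algebraic_int (x ^ j - x ^ i)" "i < j" shows "algebraic_int (x::complex)"
proof (rule algebraic_int_root[OF assms(1), of "monom 1 j - monom 1 i"])
  have "degree (monom 1 j + - monom 1 i :: complex poly) = degree (monom 1 j :: complex poly)"
    by (rule degree_add_eq_left) (use assms(2) in \<open>simp add: degree_monom_eq\<close>)
  then have deg: "degree (monom 1 j - monom 1 i :: complex poly) = j" by (simp add: degree_monom_eq)
  show "degree (monom 1 j - monom 1 i :: complex poly) > 0" using assms(2) deg by simp
  show "lead_coeff (monom 1 j - monom 1 i :: complex poly) = 1" unfolding deg using assms(2) by simp
qed (auto simp: poly_monom)

text \<open>Finiteness of the quotient by \<open>a\<close> comes from a positive integer that is a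
  multiple of \<open>a\<close>; integral closedness comes from \<open>OK\<close> being all algebraic
  integers of the field.\<close>

sublocale prime_in_order OK p
proof
  show "\<exists>a\<in>p. a \<noteq> 0" using nonzero_prime p_facts(2) by (auto simp: nonzero_prime_def)
  show "1 \<in> OK" by (rule OK_closed)
  show "p \<subseteq> OK" "0 \<in> p" by (rule p_facts)+
  show "1 \<notin> p"
  proof
    assume "1 \<in> p"
    then have "x \<in> p" if "x \<in> OK" for x using p_facts(4)[OF that, of 1] by simp
    then have "OK = p" using p_facts(1) by blast
    then show False using primeideal.I_notcarr[OF prime_ideal] by simp
  qed
next
  fix x y assume "x \<in> OK" "y \<in> OK"
  then show "x - y \<in> OK" "x * y \<in> OK" by (rule OK_closed)+
next
  fix x y assume xy: "x \<in> p" "y \<in> p"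
  have "(- 1) * y \<in> p" by (rule p_facts(4)[OF _ xy(2)]) (rule add_subgroup_uminus[OF OK_subgroup OK_closed(1)])
  then show "x - y \<in> p" using p_facts(3)[OF xy(1), of "- y"] by simp
next
  fix a x assume "a \<in> OK" "x \<in> p" then show "a * x \<in> p" by (rule p_facts(4))
next
  fix x y assume "x \<in> OK" "y \<in> OK" "x * y \<in> p"
  then show "x \<in> p \<or> y \<in> p" using primeideal.I_prime[OF prime_ideal, of x y] by simp
next
  fix a b i j assume *: "a \<in> OK" "b \<in> OK" "b \<noteq> 0" "i < (j::nat)" "(a / b) ^ j - (a / b) ^ i \<in> OK"
  then have "a / b \<in> K" using K_closed(4) by blast
  then show "a / b \<in> OK" using algebraic_int_of_power_diff[of "a / b" j i] * by simp
next
  fix a assume a: "a \<in> OK" "a \<noteq> 0"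
  then obtain N y where N: "N > 0" "y \<in> OK" "of_nat N = a * y"
    using algebraic_int_dvd_nat[OF OK_subgroup OK_closed(1,3) a] by blast
  note sub = mult_image_subgroup[OF OK_subgroup]
  have "(*) (of_nat N) ` OK \<subseteq> (*) a ` OK"
  proof
    fix x assume "x \<in> (*) (of_nat N) ` OK"
    then obtain z where z: "z \<in> OK" "x = a * (y * z)" by (auto simp: N(3))
    have "y * z \<in> OK" by (rule OK_closed(3)[OF N(2) z(1)])
    then show "x \<in> (*) a ` OK" using z(2) by blast
  qed
  moreover have "(*) a ` OK \<subseteq> OK" using OK_closed(3)[OF a(1)] by blast
  ultimately show "finite_index OK ((*) a ` OK)"
    using finite_index_mono(1)[OF sub sub] finite_index_multiple[OF N(1)] by blast
qed

end

section \<open>Residue classes of the localization, and the completion\<close>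

context prime_in_order
begin

text \<open>An element of the quotient by the \<open>k\<close>-th power of the prime, a coset in
  \<open>A\<close>, but labelled by an element of the localization. Every label in \<open>D\<close>
  gives a nonempty class by \<open>approx_D\<close>.\<close>

definition res_class :: "nat \<Rightarrow> complex \<Rightarrow> complex set" where
  "res_class k x = {y \<in> A. y - x \<in> (*) (\<pi> ^ k) ` D}"

lemma res_class_nonempty: "x \<in> D \<Longrightarrow> \<exists>y\<in>A. y \<in> res_class k x"
  using approx_D[of x k] by (auto simp: res_class_def)

lemma res_class_eq_iff:
  assumes "x \<in> D" "y \<in> D"
  shows "res_class k x = res_class k y \<longleftrightarrow> x - y \<in> (*) (\<pi> ^ k) ` D"
proof -
  define I where "I = (*) (\<pi> ^ k) ` D"
  have I: "add_subgroup I" unfolding I_def by (rule dD_subgroup)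
  have res: "res_class k u = {z \<in> A. z - u \<in> I}" for u by (simp add: res_class_def I_def)
  obtain z where z: "z \<in> A" "z - x \<in> I" using res_class_nonempty[OF assms(1), of k] unfolding res by blast
  have "res_class k x = res_class k y \<longleftrightarrow> x - y \<in> I"
  proof
    assume "res_class k x = res_class k y"
    then have "z - y \<in> I" using z unfolding res by blast
    then show "x - y \<in> I"
      using add_subgroup_diff_trans[OF I, of x z y] add_subgroup_diff_swap[OF I, of x z] z(2) by simp
  next
    assume *: "x - y \<in> I"
    have "w - x \<in> I \<longleftrightarrow> w - y \<in> I" for w
      using add_subgroup_diff_trans[OF I, of w x y] add_subgroup_diff_trans[OF I, of w y x]
        * add_subgroup_diff_swap[OF I, of x y] by metis
    then show "res_class k x = res_class k y" unfolding res by simp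
  qed
  then show ?thesis by (simp only: I_def)
qed

lemma res_class_self: "y \<in> A \<Longrightarrow> y \<in> res_class k y"
  using add_subgroup_zero[OF dD_subgroup] by (simp add: res_class_def)

lemma res_class_of_mem:
  assumes "x \<in> D" "y \<in> res_class k x" shows "res_class k y = res_class k x" "y \<in> A" "y \<in> D"
  using assms res_class_eq_iff[of y x k] A_sub_D by (auto simp: res_class_def)

lemma \<pi>_power_Suc_sub: "(*) (\<pi> ^ Suc k) ` D \<subseteq> (*) (\<pi> ^ k) ` D"
proof
  fix x assume "x \<in> (*) (\<pi> ^ Suc k) ` D"
  then obtain y where "x = \<pi> ^ k * (\<pi> * y)" "y \<in> D" by (auto simp: mult_ac)
  moreover have "\<pi> * y \<in> D" using D_mult[OF \<pi>_D \<open>y \<in> D\<close>] .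
  ultimately show "x \<in> (*) (\<pi> ^ k) ` D" by blast
qed

text \<open>In the definition of the completion, inclusion of cosets encodes the transition maps. On
  labels it becomes congruence modulo \<open>\<pi> ^ k\<close>.\<close>

lemma res_class_Suc_sub:
  assumes "x \<in> D" "y \<in> D"
  shows "res_class (Suc k) x \<subseteq> res_class k y \<longleftrightarrow> res_class k x = res_class k y"
proof
  assume sub: "res_class (Suc k) x \<subseteq> res_class k y"
  obtain z where z: "z \<in> res_class (Suc k) x" using res_class_nonempty[OF assms(1)] by blast
  then have "z \<in> res_class k x" using \<pi>_power_Suc_sub by (auto simp: res_class_def)
  moreover have "z \<in> res_class k y" using z sub by blast
  ultimately show "res_class k x = res_class k y"
    using res_class_of_mem(1)[OF assms(1)] res_class_of_mem(1)[OF assms(2)] by metis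
next
  assume "res_class k x = res_class k y"
  moreover have "res_class (Suc k) x \<subseteq> res_class k x" using \<pi>_power_Suc_sub by (auto simp: res_class_def)
  ultimately show "res_class (Suc k) x \<subseteq> res_class k y" by simp
qed

text \<open>Sums and products in a quotient ring are unions over representatives. This lemma and the
  next evaluate such unions on labels.\<close>

lemma res_class_add:
  assumes "x \<in> D" "y \<in> D"
  shows "(\<Union>a\<in>res_class k x. \<Union>b\<in>res_class k y. {a + b}) = res_class k (x + y)"
proof (intro subset_antisym subsetI)
  fix z assume "z \<in> (\<Union>a\<in>res_class k x. \<Union>b\<in>res_class k y. {a + b})"
  then obtain a b where ab: "z = a + b" "a \<in> res_class k x" "b \<in> res_class k y" by blast
  then have "(a - x) + (b - y) \<in> (*) (\<pi> ^ k) ` D"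
    by (intro add_subgroup_add[OF dD_subgroup]) (simp_all add: res_class_def)
  then show "z \<in> res_class k (x + y)"
    using ab add_subgroup_add[OF A_subgroup, of a b] by (simp add: res_class_def algebra_simps)
next
  fix z assume z: "z \<in> res_class k (x + y)"
  obtain a where a: "a \<in> res_class k x" using res_class_nonempty[OF assms(1)] by blast
  have "(z - (x + y)) - (a - x) \<in> (*) (\<pi> ^ k) ` D"
    by (rule add_subgroup_diff[OF dD_subgroup]) (use z a in \<open>simp_all add: res_class_def\<close>)
  moreover have "(z - (x + y)) - (a - x) = z - a - y" by simp
  ultimately have "z - a \<in> res_class k y"
    using z a add_subgroup_diff[OF A_subgroup, of z a] by (simp add: res_class_def)
  then show "z \<in> (\<Union>a\<in>res_class k x. \<Union>b\<in>res_class k y. {a + b})"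
    using a by (intro UN_I[of a] UN_I[of "z - a"]) auto
qed

lemma res_class_mult:
  assumes "x \<in> D" "y \<in> D"
  shows "(\<Union>a\<in>res_class k x. \<Union>b\<in>res_class k y. res_class k (a * b)) = res_class k (x * y)"
proof -
  have eq: "res_class k (a * b) = res_class k (x * y)" if a: "a \<in> res_class k x" and b: "b \<in> res_class k y" for a b
  proof -
    have D: "a \<in> D" "b \<in> D" using res_class_of_mem(3)[OF assms(1) a] res_class_of_mem(3)[OF assms(2) b] by simp_all
    have "b * (a - x) \<in> (*) (\<pi> ^ k) ` D" using a by (intro dD_mult D(2)) (simp add: res_class_def)
    moreover have "x * (b - y) \<in> (*) (\<pi> ^ k) ` D" using b by (intro dD_mult assms(1)) (simp add: res_class_def)
    ultimately have "b * (a - x) + x * (b - y) \<in> (*) (\<pi> ^ k) ` D" by (rule add_subgroup_add[OF dD_subgroup])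
    moreover have "b * (a - x) + x * (b - y) = a * b - x * y" by (simp add: algebra_simps)
    ultimately show ?thesis using res_class_eq_iff D_mult D assms by simp
  qed
  obtain a b where "a \<in> res_class k x" "b \<in> res_class k y" using res_class_nonempty[OF assms(1)] res_class_nonempty[OF assms(2)] by blast
  then show ?thesis using eq by auto
qed

end

text \<open>What is used of the completion of the localization \<open>D\<close>: its elements are coherent sequences of
  residue classes of elements of \<open>D\<close>.\<close>

locale dvr_completion = dvr D \<pi> for D \<pi> +
  fixes R :: "(nat \<Rightarrow> 'c) ring" and T :: "(nat \<Rightarrow> 'c) topology" and res :: "nat \<Rightarrow> complex \<Rightarrow> 'c"
  assumes res_in_R: "x \<in> D \<Longrightarrow> (\<lambda>k. res k x) \<in> carrier R"
    and R_res: "f \<in> carrier R \<Longrightarrow> \<exists>x\<in>D. f k = res k x"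
    and res_eq_iff: "x \<in> D \<Longrightarrow> y \<in> D \<Longrightarrow> res k x = res k y \<longleftrightarrow> x - y \<in> (*) (\<pi> ^ k) ` D"
    and R_coherent: "f \<in> carrier R \<Longrightarrow> x \<in> D \<Longrightarrow> f (Suc k) = res (Suc k) x \<Longrightarrow> f k = res k x"
    and R_add_closed: "f \<in> carrier R \<Longrightarrow> g \<in> carrier R \<Longrightarrow> f \<oplus>\<^bsub>R\<^esub> g \<in> carrier R"
    and R_mult_closed: "f \<in> carrier R \<Longrightarrow> g \<in> carrier R \<Longrightarrow> f \<otimes>\<^bsub>R\<^esub> g \<in> carrier R"
    and R_add: "f \<in> carrier R \<Longrightarrow> g \<in> carrier R \<Longrightarrow> x \<in> D \<Longrightarrow> y \<in> D \<Longrightarrow> f k = res k x \<Longrightarrow> g k = res k y \<Longrightarrow>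
      (f \<oplus>\<^bsub>R\<^esub> g) k = res k (x + y)"
    and R_mult: "f \<in> carrier R \<Longrightarrow> g \<in> carrier R \<Longrightarrow> x \<in> D \<Longrightarrow> y \<in> D \<Longrightarrow> f k = res k x \<Longrightarrow> g k = res k y \<Longrightarrow>
      (f \<otimes>\<^bsub>R\<^esub> g) k = res k (x * y)"
    and topspace_T: "topspace T = carrier R"
    and open_class: "f \<in> carrier R \<Longrightarrow> openin T {g \<in> carrier R. g k = f k}"
    and open_contains_class: "openin T U \<Longrightarrow> f \<in> U \<Longrightarrow> \<exists>k. \<forall>g\<in>carrier R. g k = f k \<longrightarrow> g \<in> U"

context number_field_prime
begin

text \<open>For the harder inclusion, \<open>z\<close> satisfies \<open>s * z = a ^ k * b\<close>
  with \<open>s\<close> outside and \<open>a\<close> inside \<open>p\<close>. With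
  \<open>s * t + e ^ k = 1\<close> and \<open>e\<close> in \<open>p\<close>, it follows that
  \<open>z\<close> equals \<open>t * (s * z) + z * e ^ k\<close>, a sum of two elements of the ideal
  power.\<close>

lemma ideal_power_eq:
  "p [^]\<^bsub>ideals_set (ring_of_integers K)\<^esub> k = OK \<inter> (*) (\<pi> ^ k) ` D" (is "?I k = _")
proof -
  let ?R = "ring_of_integers K"
  interpret R: primeideal p ?R by (rule prime_ideal)
  have I_Suc: "?I (Suc k) = ideal_prod ?R (?I k) p" and zero: "?I 0 = OK" for k
    by (simp_all add: nat_pow_def ideals_set_def)
  have ideal: "ideal (?I k) ?R" for k
  proof (induction k)
    case 0 then show ?case unfolding zero using R.oneideal by simp
  next
    case (Suc k) then show ?case unfolding I_Suc
      by (rule R.ideal_prod_is_ideal) (rule R.is_ideal)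
  qed
  have I_mult: "a * x \<in> ?I k" if "a \<in> OK" "x \<in> ?I k" for a x k
    using ideal.I_l_closed[OF ideal that(2)] that(1) by simp
  have I_add: "x + y \<in> ?I k" if "x \<in> ?I k" "y \<in> ?I k" for x y k
    using additive_subgroup.a_closed[OF ideal.axioms(1)[OF ideal] that] by simp
  have sub: "?I k \<subseteq> OK \<inter> (*) (\<pi> ^ k) ` D" for k
  proof (induction k)
    case 0 show ?case unfolding zero using A_sub_D by auto
  next
    case (Suc k)
    have "x \<in> OK \<inter> (*) (\<pi> ^ Suc k) ` D" if "x \<in> ideal_prod ?R (?I k) p" for x
      using that
    proof (induction x rule: ideal_prod.induct)
      case (prod i j)
      then have i: "i \<in> OK" "i \<in> (*) (\<pi> ^ k) ` D" using Suc by auto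
      have "j \<in> (*) \<pi> ` D" using prod P_sub_M \<pi>(3) by blast
      then obtain u v where uv: "i = \<pi> ^ k * u" "j = \<pi> * v" "u \<in> D" "v \<in> D" using i(2) by blast
      then have "i * j = \<pi> ^ Suc k * (u * v)" by (simp add: mult_ac)
      moreover have "u * v \<in> D" using D_mult[OF uv(3,4)] .
      moreover have "i * j \<in> OK" using OK_closed(3)[OF i(1), of j] prod(2) P_sub by blast
      ultimately have "i * j \<in> OK \<inter> (*) (\<pi> ^ Suc k) ` D" by blast
      then show ?case by (simp only: ring_of_integers_simps)
    next
      case (sum s t)
      then show ?case
        using add_subgroup_add[OF OK_subgroup, of s t] add_subgroup_add[OF dD_subgroup, of s _ t] by simp
    qed
    then show ?case unfolding I_Suc by blast
  qed
  have pow: "e ^ k \<in> ?I k" if "e \<in> p" for e k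
  proof (induction k)
    case 0 show ?case unfolding zero using OK_closed(1) by simp
  next
    case (Suc k)
    have "e ^ k \<otimes>\<^bsub>?R\<^esub> e \<in> ideal_prod ?R (?I k) p" using Suc that by (rule ideal_prod.prod)
    then show ?case unfolding I_Suc by (simp add: mult.commute)
  qed
  have "z \<in> ?I k" if z: "z \<in> OK" "z \<in> (*) (\<pi> ^ k) ` D" for z
  proof -
    obtain s a b where s: "s \<in> OK" "a \<in> p" "b \<in> OK" "s \<notin> p" "s * z = a ^ k * b"
      using power_form[OF z] by blast
    obtain t e where te: "t \<in> OK" "e \<in> p" "s * t + e ^ k = 1" using unit_mod_P_power[OF s(1,4)] by blast
    have "s * z \<in> ?I k" using I_mult[OF s(3) pow[OF s(2)]] s(5) by (simp add: mult.commute)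
    then have "t * (s * z) + z * e ^ k \<in> ?I k"
      by (rule I_add[OF I_mult[OF te(1)] I_mult[OF z(1) pow[OF te(2)]]])
    moreover have "t * (s * z) + z * e ^ k = z * (s * t + e ^ k)" by (simp add: algebra_simps)
    ultimately show ?thesis using te(3) by simp
  qed
  with sub show ?thesis by blast
qed

abbreviation "Q \<equiv> quotient_by_power K p"

lemma coset_eq_res_class: "a \<in> OK \<Longrightarrow> (OK \<inter> (*) (\<pi> ^ k) ` D) +>\<^bsub>ring_of_integers K\<^esub> a = res_class k a"
proof (intro subset_antisym subsetI)
  fix z assume a: "a \<in> OK" and "z \<in> (OK \<inter> (*) (\<pi> ^ k) ` D) +>\<^bsub>ring_of_integers K\<^esub> a"
  then obtain h where "h \<in> OK" "h \<in> (*) (\<pi> ^ k) ` D" "z = h + a" by (auto simp: a_r_coset_def')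
  then show "z \<in> res_class k a" using a add_subgroup_add[OF OK_subgroup] by (simp add: res_class_def)
next
  fix z assume a: "a \<in> OK" and "z \<in> res_class k a"
  then have z: "z \<in> OK" "z - a \<in> (*) (\<pi> ^ k) ` D" by (simp_all add: res_class_def)
  then have "z - a \<in> OK \<inter> (*) (\<pi> ^ k) ` D" using OK_closed(2)[OF z(1) a] by blast
  then show "z \<in> (OK \<inter> (*) (\<pi> ^ k) ` D) +>\<^bsub>ring_of_integers K\<^esub> a"
    unfolding a_r_coset_def' by (intro UN_I[of "z - a"]) auto
qed

lemma carrier_Q: "carrier (Q k) = res_class k ` D"
proof -
  have "carrier (Q k) = res_class k ` OK"
  proof -
    have "carrier (Q k) = (\<Union>a\<in>OK. {(OK \<inter> (*) (\<pi> ^ k) ` D) +>\<^bsub>ring_of_integers K\<^esub> a})"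
      by (simp add: quotient_by_power_def ideal_power_eq FactRing_def A_RCOSETS_def')
    also have "\<dots> = (\<Union>a\<in>OK. {res_class k a})"
      by (intro SUP_cong refl) (simp only: coset_eq_res_class)
    finally show ?thesis by (simp only: UNION_singleton_eq_range)
  qed
  also have "\<dots> = res_class k ` D"
  proof
    show "res_class k ` OK \<subseteq> res_class k ` D" by (rule image_mono[OF A_sub_D])
    show "res_class k ` D \<subseteq> res_class k ` OK"
    proof
      fix C assume "C \<in> res_class k ` D"
      then obtain x where x: "x \<in> D" "C = res_class k x" by blast
      obtain y where y: "y \<in> res_class k x" using res_class_nonempty[OF x(1), of k] by (elim bexE)
      show "C \<in> res_class k ` OK"
        unfolding x(2) by (rule image_eqI[where f = "res_class k", OF res_class_of_mem(1)[OF x(1) y, symmetric] res_class_of_mem(2)[OF x(1) y]])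
    qed
  qed
  finally show ?thesis .
qed

lemma Q_add: "x \<in> D \<Longrightarrow> y \<in> D \<Longrightarrow> res_class k x \<oplus>\<^bsub>Q k\<^esub> res_class k y = res_class k (x + y)"
  using res_class_add[of x y k] by (simp add: quotient_by_power_def FactRing_def set_add_def')

lemma Q_mult:
  assumes "x \<in> D" "y \<in> D" shows "res_class k x \<otimes>\<^bsub>Q k\<^esub> res_class k y = res_class k (x * y)"
proof -
  have "res_class k x \<otimes>\<^bsub>Q k\<^esub> res_class k y
      = (\<Union>a\<in>res_class k x. \<Union>b\<in>res_class k y. (OK \<inter> (*) (\<pi> ^ k) ` D) +>\<^bsub>ring_of_integers K\<^esub> (a * b))"
    by (simp add: quotient_by_power_def FactRing_def rcoset_mult_def ideal_power_eq)
  also have "\<dots> = (\<Union>a\<in>res_class k x. \<Union>b\<in>res_class k y. res_class k (a * b))"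
  proof (intro SUP_cong refl)
    fix a b assume "a \<in> res_class k x" "b \<in> res_class k y"
    then have "a * b \<in> OK"
      by (intro OK_closed(3) res_class_of_mem(2)[OF assms(1)] res_class_of_mem(2)[OF assms(2)])
    then show "(OK \<inter> (*) (\<pi> ^ k) ` D) +>\<^bsub>ring_of_integers K\<^esub> (a * b) = res_class k (a * b)"
      by (rule coset_eq_res_class)
  qed
  finally show ?thesis using res_class_mult[OF assms] by simp
qed

lemma carrier_completion:
  "f \<in> carrier (completion K p) \<longleftrightarrow> (\<forall>k. f k \<in> res_class k ` D \<and> f (Suc k) \<subseteq> f k)"
  by (simp add: completion_def carrier_Q)

lemma completion_coherent:
  assumes "f \<in> carrier (completion K p)" "x \<in> D" "f (Suc k) = res_class (Suc k) x"
  shows "f k = res_class k x"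
proof -
  obtain y where y: "y \<in> D" "f k = res_class k y" using assms(1) carrier_completion by blast
  have "f (Suc k) \<subseteq> f k" using assms(1) carrier_completion by blast
  then show ?thesis using assms(2,3) y res_class_Suc_sub by simp
qed

lemma completion_coherent_le:
  assumes "f \<in> carrier (completion K p)" "x \<in> D" "k \<le> l" "f l = res_class l x"
  shows "f k = res_class k x"
  using assms(3,4)
proof (induction l rule: dec_induct)
  case (step l)
  then show ?case using completion_coherent[OF assms(1,2) step.prems] by blast
qed

lemma completion_op_closed:
  assumes f: "f \<in> carrier (completion K p)" and g: "g \<in> carrier (completion K p)"
    and D: "\<And>x y. x \<in> D \<Longrightarrow> y \<in> D \<Longrightarrow> op2 x y \<in> D"
    and h: "\<And>k x y. x \<in> D \<Longrightarrow> y \<in> D \<Longrightarrow> f k = res_class k x \<Longrightarrow> g k = res_class k y \<Longrightarrow> h k = res_class k (op2 x y)"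
  shows "h \<in> carrier (completion K p)"
  unfolding carrier_completion
proof
  fix k
  obtain x where x: "x \<in> D" "f (Suc k) = res_class (Suc k) x" using f carrier_completion by blast
  obtain y where y: "y \<in> D" "g (Suc k) = res_class (Suc k) y" using g carrier_completion by blast
  have "h (Suc k) = res_class (Suc k) (op2 x y)" by (rule h[OF x(1) y(1) x(2) y(2)])
  moreover have "h k = res_class k (op2 x y)"
    by (rule h[OF x(1) y(1) completion_coherent[OF f x] completion_coherent[OF g y]])
  ultimately show "h k \<in> res_class k ` D \<and> h (Suc k) \<subseteq> h k"
    using D[OF x(1) y(1)] res_class_Suc_sub[OF D[OF x(1) y(1)] D[OF x(1) y(1)], of k] by simp
qed

lemma completion_add:
  assumes "x \<in> D" "y \<in> D" "f k = res_class k x" "g k = res_class k y"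
  shows "(f \<oplus>\<^bsub>completion K p\<^esub> g) k = res_class k (x + y)"
  using Q_add[OF assms(1,2), of k] assms(3,4) by (simp add: completion_def)

lemma completion_mult:
  assumes "x \<in> D" "y \<in> D" "f k = res_class k x" "g k = res_class k y"
  shows "(f \<otimes>\<^bsub>completion K p\<^esub> g) k = res_class k (x * y)"
  using Q_mult[OF assms(1,2), of k] assms(3,4) by (simp add: completion_def)

sublocale dvr_completion D \<pi> "completion K p" "completion_topology K p" res_class
proof
  let ?X = "product_topology (\<lambda>k. discrete_topology (carrier (Q k))) (UNIV :: nat set)"
  have sub: "carrier (completion K p) \<subseteq> topspace ?X" by (auto simp: completion_def PiE_def)
  show top: "topspace (completion_topology K p) = carrier (completion K p)"
    using sub unfolding completion_topology_def by (simp add: Int_absorb1)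
  show "openin (completion_topology K p) {g \<in> carrier (completion K p). g k = f k}"
    if f: "f \<in> carrier (completion K p)" for f k
  proof -
    have "continuous_map ?X (discrete_topology (carrier (Q k))) (\<lambda>g. g k)"
      by (rule continuous_map_product_projection) simp
    moreover have "openin (discrete_topology (carrier (Q k))) {f k}"
      using f by (auto simp: carrier_completion carrier_Q)
    ultimately have "openin ?X {g \<in> topspace ?X. g k \<in> {f k}}" by (rule openin_continuous_map_preimage)
    moreover have "{g \<in> carrier (completion K p). g k = f k} = {g \<in> topspace ?X. g k \<in> {f k}} \<inter> carrier (completion K p)"
      using sub by blast
    ultimately show ?thesis unfolding completion_topology_def openin_subtopology by blast
  qed
  show "\<exists>k. \<forall>g\<in>carrier (completion K p). g k = f k \<longrightarrow> g \<in> U"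
    if U: "openin (completion_topology K p) U" and f: "f \<in> U" for U f
  proof -
    obtain V where V: "openin ?X V" "U = V \<inter> carrier (completion K p)"
      using U unfolding completion_topology_def openin_subtopology by blast
    then obtain W where W: "finite {i. W i \<noteq> carrier (Q i)}" "f \<in> Pi\<^sub>E UNIV W" "Pi\<^sub>E UNIV W \<subseteq> V"
      using V(1) f unfolding openin_product_topology_alt by auto
    \<comment> \<open>A basic open set restricts finitely many coordinates, and coordinate
      \<open>N\<close> of a coherent sequence determines all earlier ones.\<close>
    obtain N where N: "\<forall>i\<in>{i. W i \<noteq> carrier (Q i)}. i \<le> N"
      using W(1) finite_nat_set_iff_bounded_le by blast
    have fc: "f \<in> carrier (completion K p)" using f V by blast
    obtain x where x: "x \<in> D" "f N = res_class N x" using fc carrier_completion by blast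
    have "g \<in> U" if g: "g \<in> carrier (completion K p)" and eq: "g N = f N" for g
    proof -
      have "g i \<in> W i" for i
      proof (cases "i \<le> N")
        case True
        then have "g i = f i"
          using completion_coherent_le[OF fc x(1) True x(2)] completion_coherent_le[OF g x(1) True] eq x(2) by simp
        then show ?thesis using W(2) by (auto simp: PiE_def)
      next
        case False
        then have "W i = carrier (Q i)" using N by blast
        then show ?thesis using g by (auto simp: carrier_completion carrier_Q)
      qed
      then have "g \<in> V" using W(3) by (auto simp: PiE_def)
      then show ?thesis using g V by blast
    qed
    then show ?thesis by blast
  qed
next
  fix x k assume x: "x \<in> D"
  then show "(\<lambda>k. res_class k x) \<in> carrier (completion K p)"
    unfolding carrier_completion using res_class_Suc_sub[OF x x] by simp
next
  fix f k assume "f \<in> carrier (completion K p)"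
  then show "\<exists>x\<in>D. f k = res_class k x" unfolding carrier_completion by blast
next
  fix x y k assume "x \<in> D" "y \<in> D"
  then show "res_class k x = res_class k y \<longleftrightarrow> x - y \<in> (*) (\<pi> ^ k) ` D" by (rule res_class_eq_iff)
next
  fix f x k assume "f \<in> carrier (completion K p)" "x \<in> D" "f (Suc k) = res_class (Suc k) x"
  then show "f k = res_class k x" by (rule completion_coherent)
next
  fix f g assume fg: "f \<in> carrier (completion K p)" "g \<in> carrier (completion K p)"
  show "f \<oplus>\<^bsub>completion K p\<^esub> g \<in> carrier (completion K p)"
    by (rule completion_op_closed[OF fg, where ?op2.0 = "(+)"])
      (rule add_subgroup_add[OF D_subgroup] completion_add; assumption)+
  show "f \<otimes>\<^bsub>completion K p\<^esub> g \<in> carrier (completion K p)"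
    by (rule completion_op_closed[OF fg, where ?op2.0 = "(*)"])
      (rule D_mult completion_mult; assumption)+
qed (rule completion_add completion_mult; assumption)+

lemma residue_cardinality_index: "residue_cardinality K p = subgroup_index OK p"
proof -
  have "carrier (ring_of_integers K Quot p) = cosets_in OK p"
    unfolding FactRing_def A_RCOSETS_def' cosets_in_def
  proof -
    have "p +>\<^bsub>ring_of_integers K\<^esub> a = {y \<in> OK. y - a \<in> p}" if "a \<in> OK" for a
    proof (intro subset_antisym subsetI)
      fix z assume "z \<in> p +>\<^bsub>ring_of_integers K\<^esub> a"
      then obtain h where "h \<in> p" "z = h + a" by (auto simp: a_r_coset_def')
      then show "z \<in> {y \<in> OK. y - a \<in> p}" using that P_sub add_subgroup_add[OF OK_subgroup, of h a] by auto
    next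
      fix z assume "z \<in> {y \<in> OK. y - a \<in> p}"
      then show "z \<in> p +>\<^bsub>ring_of_integers K\<^esub> a"
        unfolding a_r_coset_def' by (intro UN_I[of "z - a"]) auto
    qed
    then show "carrier \<lparr>carrier = \<Union>a\<in>carrier (ring_of_integers K). {p +>\<^bsub>ring_of_integers K\<^esub> a},
       mult = rcoset_mult (ring_of_integers K) p, one = p +>\<^bsub>ring_of_integers K\<^esub> \<one>\<^bsub>ring_of_integers K\<^esub>,
       zero = p, add = (<+>\<^bsub>ring_of_integers K\<^esub>)\<rparr> = (\<lambda>x. {y \<in> OK. y - x \<in> p}) ` OK"
      by auto
  qed
  then show ?thesis by (simp only: residue_cardinality_def subgroup_index_def)
qed

lemma residue_cardinality_eq: "residue_cardinality K p = subgroup_index D ((*) \<pi> ` D)"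
  unfolding residue_cardinality_index index_residue ..

end

subsection \<open>Irreducible sets of matrices\<close>

abbreviation subspace_vec :: "nat \<Rightarrow> complex vec set \<Rightarrow> bool" where
  "subspace_vec d W \<equiv> Module.submodule W complex_ring (module_vec TYPE(complex) d)"

lemma module_vec_complex: "Module.module complex_ring (module_vec TYPE(complex) d)"
  using vec_module[where 'a = complex and n = d] by (simp add: complex_ring_def)

lemma subspace_vecI:
  assumes "W \<subseteq> carrier_vec d" "0\<^sub>v d \<in> W" "\<And>v w. v \<in> W \<Longrightarrow> w \<in> W \<Longrightarrow> v + w \<in> W"
    "\<And>c v. v \<in> W \<Longrightarrow> c \<cdot>\<^sub>v v \<in> W"
  shows "subspace_vec d W"
proof -
  interpret V: Module.module complex_ring "module_vec TYPE(complex) d" by (rule module_vec_complex)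
  show ?thesis
  proof (rule V.submoduleI)
    fix v assume v: "v \<in> W"
    then have "v \<in> carrier_vec d" using assms(1) by blast
    then have "(- 1) \<cdot>\<^sub>v v + v = 0\<^sub>v d" by (intro eq_vecI) auto
    then have "\<ominus>\<^bsub>module_vec TYPE(complex) d\<^esub> v = (- 1) \<cdot>\<^sub>v v"
      using \<open>v \<in> carrier_vec d\<close> by (intro V.minus_equality) (auto simp: module_vec_simps)
    then show "\<ominus>\<^bsub>module_vec TYPE(complex) d\<^esub> v \<in> W" using assms(4)[OF v] by simp
  qed (use assms in \<open>auto simp: module_vec_simps\<close>)
qed

lemma subspace_vecD:
  assumes "subspace_vec d W"
  shows "W \<subseteq> carrier_vec d" "0\<^sub>v d \<in> W" "v \<in> W \<Longrightarrow> w \<in> W \<Longrightarrow> v + w \<in> W" "v \<in> W \<Longrightarrow> c \<cdot>\<^sub>v v \<in> W"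
proof -
  interpret V: Module.module complex_ring "module_vec TYPE(complex) d" by (rule module_vec_complex)
  note E = V.submoduleE[OF assms, unfolded module_vec_simps complex_ring_simps]
  show W: "W \<subseteq> carrier_vec d" by (rule E(1))
  show add: "v \<in> W \<Longrightarrow> w \<in> W \<Longrightarrow> v + w \<in> W" by (rule E(5))
  show smult: "v \<in> W \<Longrightarrow> c \<cdot>\<^sub>v v \<in> W" for c v using E(4)[OF UNIV_I] .
  obtain w where w: "w \<in> W" using E(2) by blast
  then have "0 \<cdot>\<^sub>v w = 0\<^sub>v d" using W by (intro eq_vecI) auto
  then show "0\<^sub>v d \<in> W" using smult[OF w, of 0] by simp
qed

definition irreducible_mats :: "nat \<Rightarrow> complex mat set \<Rightarrow> bool" where
  "irreducible_mats d S \<longleftrightarrow> d > 0 \<and>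
     (\<forall>W. subspace_vec d W \<and> (\<forall>M\<in>S. \<forall>w\<in>W. M *\<^sub>v w \<in> W) \<longrightarrow> W = {0\<^sub>v d} \<or> W = carrier_vec d)"

lemma irreducible_representation_iff:
  "irreducible_representation G d \<rho> \<longleftrightarrow> irreducible_mats d (\<rho> ` carrier G)"
  by (simp add: irreducible_representation_def irreducible_mats_def)

text \<open>Defined by coordinates, so that moving matrices and scalars inside reduces to sums of
  complex numbers.\<close>

definition vec_sum :: "nat \<Rightarrow> 'i set \<Rightarrow> ('i \<Rightarrow> complex vec) \<Rightarrow> complex vec" where
  "vec_sum d I f = vec d (\<lambda>k. \<Sum>i\<in>I. f i $ k)"

lemma vec_sum_dim [simp]: "vec_sum d I f \<in> carrier_vec d" "dim_vec (vec_sum d I f) = d"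
  by (simp_all add: vec_sum_def)

lemma vec_sum_insert:
  assumes "finite I" "i \<notin> I" "f i \<in> carrier_vec d"
  shows "vec_sum d (insert i I) f = f i + vec_sum d I f"
  using assms by (intro eq_vecI) (auto simp: vec_sum_def)

lemma vec_sum_empty: "vec_sum d {} f = 0\<^sub>v d"
  by (auto simp: vec_sum_def)

lemma vec_sum_mem:
  assumes "subspace_vec d W" "finite I" "\<And>i. i \<in> I \<Longrightarrow> f i \<in> W"
  shows "vec_sum d I f \<in> W"
  using assms(2,3)
proof (induction I)
  case empty then show ?case using subspace_vecD(2)[OF assms(1)] by (simp add: vec_sum_empty)
next
  case (insert i I)
  then have "f i \<in> carrier_vec d" using subspace_vecD(1)[OF assms(1)] by blast
  then have "vec_sum d (insert i I) f = f i + vec_sum d I f" using insert.hyps by (intro vec_sum_insert)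
  then show ?case using insert by (simp add: subspace_vecD(3)[OF assms(1)])
qed

lemma mult_vec_sum:
  assumes M: "M \<in> carrier_mat d d" and f: "\<And>i. i \<in> I \<Longrightarrow> f i \<in> carrier_vec d"
  shows "M *\<^sub>v vec_sum d I f = vec_sum d I (\<lambda>i. M *\<^sub>v f i)"
proof (rule eq_vecI)
  fix k assume "k < dim_vec (vec_sum d I (\<lambda>i. M *\<^sub>v f i))"
  then have k: "k < d" by simp
  have "(M *\<^sub>v vec_sum d I f) $ k = (\<Sum>l<d. M $$ (k, l) * (\<Sum>i\<in>I. f i $ l))"
    using M k by (simp add: scalar_prod_def vec_sum_def atLeast0LessThan)
  also have "\<dots> = (\<Sum>i\<in>I. \<Sum>l<d. M $$ (k, l) * f i $ l)"
    unfolding sum_distrib_left by (rule sum.swap)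
  also have "\<dots> = (\<Sum>i\<in>I. (M *\<^sub>v f i) $ k)"
    using M k carrier_vecD[OF f] by (intro sum.cong refl) (simp add: scalar_prod_def atLeast0LessThan)
  finally show "(M *\<^sub>v vec_sum d I f) $ k = vec_sum d I (\<lambda>i. M *\<^sub>v f i) $ k"
    using k by (simp add: vec_sum_def)
qed (use M in simp)

lemma smult_vec_sum:
  assumes "\<And>i. i \<in> I \<Longrightarrow> f i \<in> carrier_vec d"
  shows "c \<cdot>\<^sub>v vec_sum d I f = vec_sum d I (\<lambda>i. c \<cdot>\<^sub>v f i)"
proof (rule eq_vecI)
  fix k assume "k < dim_vec (vec_sum d I (\<lambda>i. c \<cdot>\<^sub>v f i))"
  then have k: "k < d" by simp
  have "(\<Sum>i\<in>I. (c \<cdot>\<^sub>v f i) $ k) = (\<Sum>i\<in>I. c * f i $ k)"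
    using carrier_vecD[OF assms] k by (intro sum.cong refl) simp
  then show "(c \<cdot>\<^sub>v vec_sum d I f) $ k = vec_sum d I (\<lambda>i. c \<cdot>\<^sub>v f i) $ k"
    using k by (simp add: vec_sum_def sum_distrib_left)
qed simp

lemma add_vec_sum:
  assumes "\<And>i. i \<in> I \<Longrightarrow> f i \<in> carrier_vec d" "\<And>i. i \<in> I \<Longrightarrow> g i \<in> carrier_vec d"
  shows "vec_sum d I f + vec_sum d I g = vec_sum d I (\<lambda>i. f i + g i)"
proof (rule eq_vecI)
  fix k assume "k < dim_vec (vec_sum d I (\<lambda>i. f i + g i))"
  then have k: "k < d" by simp
  have "(\<Sum>i\<in>I. (f i + g i) $ k) = (\<Sum>i\<in>I. f i $ k + g i $ k)"
    using carrier_vecD[OF assms(1)] carrier_vecD[OF assms(2)] k by (intro sum.cong refl) simp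
  then show "(vec_sum d I f + vec_sum d I g) $ k = vec_sum d I (\<lambda>i. f i + g i) $ k"
    using k by (simp add: vec_sum_def sum.distrib)
qed simp

lemma smult_one_mat_vec:
  assumes "v \<in> carrier_vec d" shows "(c \<cdot>\<^sub>m 1\<^sub>m d) *\<^sub>v v = c \<cdot>\<^sub>v (v :: complex vec)"
proof (rule eq_vecI)
  fix i assume "i < dim_vec (c \<cdot>\<^sub>v v)"
  then have i: "i < d" using assms by simp
  have "((c \<cdot>\<^sub>m 1\<^sub>m d) *\<^sub>v v) $ i = (\<Sum>j<d. c * (if j = i then 1 else 0) * v $ j)"
    using assms i by (simp add: scalar_prod_def atLeast0LessThan)
  also have "\<dots> = (\<Sum>j<d. (if j = i then c * v $ j else 0))" by (intro sum.cong) auto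
  finally show "((c \<cdot>\<^sub>m 1\<^sub>m d) *\<^sub>v v) $ i = (c \<cdot>\<^sub>v v) $ i" using assms i by simp
qed (use assms in simp)

lemma mat_eq_if_mult_vec:
  assumes "X \<in> carrier_mat d d" "Y \<in> carrier_mat d d"
    and "\<And>v. v \<in> carrier_vec d \<Longrightarrow> X *\<^sub>v v = Y *\<^sub>v (v :: complex vec)"
  shows "X = Y"
proof (rule eq_matI)
  fix i j assume "i < dim_row Y" "j < dim_col Y"
  then have ij: "i < d" "j < d" using assms by auto
  have "X *\<^sub>v unit_vec d j = Y *\<^sub>v unit_vec d j" by (rule assms(3)) simp
  then have "(X *\<^sub>v unit_vec d j) $ i = (Y *\<^sub>v unit_vec d j) $ i" by simp
  then show "X $$ (i, j) = Y $$ (i, j)" using assms(1,2) ij by simp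
qed (use assms in auto)

text \<open>Schur's lemma.\<close>

lemma schur:
  assumes irr: "irreducible_mats d S" and S: "S \<subseteq> carrier_mat d d" and X: "X \<in> carrier_mat d d"
    and comm: "\<And>M. M \<in> S \<Longrightarrow> M * X = X * M"
  obtains c where "X = c \<cdot>\<^sub>m 1\<^sub>m d"
proof -
  have d: "d > 0" using irr by (simp add: irreducible_mats_def)
  obtain c where "eigenvalue X c" using spectrum_non_empty[OF X d] by (auto simp: spectrum_def)
  then obtain v where v: "v \<in> carrier_vec d" "v \<noteq> 0\<^sub>v d" "X *\<^sub>v v = c \<cdot>\<^sub>v v"
    using X by (auto simp: eigenvalue_def eigenvector_def)
  define W where "W = {w \<in> carrier_vec d. X *\<^sub>v w = c \<cdot>\<^sub>v w}"
  have "subspace_vec d W"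
  proof (rule subspace_vecI)
    show "0\<^sub>v d \<in> W" using X by (auto simp: W_def)
    show "v + w \<in> W" if "v \<in> W" "w \<in> W" for v w
      using that X by (auto simp: W_def mult_add_distrib_mat_vec[OF X] smult_add_distrib_vec)
    show "a \<cdot>\<^sub>v w \<in> W" if "w \<in> W" for a w
      using that X by (auto simp: W_def mult_mat_vec[OF X] smult_smult_assoc mult.commute)
  qed (auto simp: W_def)
  moreover have "M *\<^sub>v w \<in> W" if M: "M \<in> S" and w: "w \<in> W" for M w
  proof -
    have MC: "M \<in> carrier_mat d d" using M S by blast
    have w': "w \<in> carrier_vec d" "X *\<^sub>v w = c \<cdot>\<^sub>v w" using w by (auto simp: W_def)
    have "X *\<^sub>v (M *\<^sub>v w) = (X * M) *\<^sub>v w" using assoc_mult_mat_vec[OF X MC w'(1)] by simp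
    also have "\<dots> = M *\<^sub>v (X *\<^sub>v w)" using assoc_mult_mat_vec[OF MC X w'(1)] comm[OF M] by simp
    also have "\<dots> = c \<cdot>\<^sub>v (M *\<^sub>v w)" using mult_mat_vec[OF MC w'(1)] w' by simp
    finally show ?thesis using MC w' by (auto simp: W_def)
  qed
  ultimately have "W = {0\<^sub>v d} \<or> W = carrier_vec d" using irr unfolding irreducible_mats_def by blast
  moreover have "v \<in> W" using v by (simp add: W_def)
  ultimately have "W = carrier_vec d" using v by auto
  then have "X = c \<cdot>\<^sub>m 1\<^sub>m d"
    by (intro mat_eq_if_mult_vec[OF X]) (auto simp: W_def smult_one_mat_vec)
  then show ?thesis using that by blast
qed

text \<open>Joint eigenvectors for distinct systems of eigenvalues can be separated inside an invariant
  subspace. With the zero subspace this is linear independence.\<close>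

lemma separate_eigenvectors:
  assumes W: "subspace_vec d W" and inv: "\<And>a w. a \<in> A \<Longrightarrow> w \<in> W \<Longrightarrow> \<Phi> a *\<^sub>v w \<in> W"
    and \<Phi>: "\<And>a. a \<in> A \<Longrightarrow> \<Phi> a \<in> carrier_mat d d"
  assumes "finite T" "\<And>t. t \<in> T \<Longrightarrow> f t \<in> carrier_vec d"
    and "\<And>t a. t \<in> T \<Longrightarrow> a \<in> A \<Longrightarrow> \<Phi> a *\<^sub>v f t = ev t a \<cdot>\<^sub>v f t"
    and "\<And>s t. s \<in> T \<Longrightarrow> t \<in> T \<Longrightarrow> s \<noteq> t \<Longrightarrow> \<exists>a\<in>A. ev s a \<noteq> ev t a"
    and "vec_sum d T f \<in> W"
  shows "\<forall>t\<in>T. f t \<in> W"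
  using assms(4-8)
proof (induction T arbitrary: f rule: finite_induct)
  case (insert u T)
  have sum: "vec_sum d (insert u T) f = f u + vec_sum d T f"
    using insert.hyps insert.prems(1) by (intro vec_sum_insert) auto
  have *: "f t \<in> W" if t: "t \<in> T" for t
  proof -
    have "t \<noteq> u" using t insert.hyps by blast
    then obtain a where a: "a \<in> A" "ev t a \<noteq> ev u a" using insert.prems(3)[of t u] t by blast
    \<comment> \<open>The matrix \<open>\<Phi> a\<close> minus the scalar \<open>ev u a\<close>
      kills the summand at \<open>u\<close> and rescales the others, which leaves a shorter sum in
      \<open>W\<close>.\<close>
    define g where "g s = (ev s a - ev u a) \<cdot>\<^sub>v f s" for s
    have fC: "f s \<in> carrier_vec d" if "s \<in> insert u T" for s using insert.prems(1) that .
    have "\<Phi> a *\<^sub>v vec_sum d (insert u T) f + (- ev u a) \<cdot>\<^sub>v vec_sum d (insert u T) f \<in> W"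
      using insert.prems(4) a inv by (intro subspace_vecD(3,4)[OF W]) auto
    also have "\<Phi> a *\<^sub>v vec_sum d (insert u T) f + (- ev u a) \<cdot>\<^sub>v vec_sum d (insert u T) f
      = vec_sum d (insert u T) (\<lambda>s. \<Phi> a *\<^sub>v f s + (- ev u a) \<cdot>\<^sub>v f s)"
    proof -
      have 1: "\<Phi> a *\<^sub>v vec_sum d (insert u T) f = vec_sum d (insert u T) (\<lambda>s. \<Phi> a *\<^sub>v f s)"
        by (rule mult_vec_sum[OF \<Phi>[OF a(1)]]) (rule fC)
      have 2: "(- ev u a) \<cdot>\<^sub>v vec_sum d (insert u T) f = vec_sum d (insert u T) (\<lambda>s. (- ev u a) \<cdot>\<^sub>v f s)"
        by (rule smult_vec_sum) (rule fC)
      show ?thesis unfolding 1 2 by (rule add_vec_sum) (use fC \<Phi>[OF a(1)] in auto)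
    qed
    also have "\<dots> = vec_sum d (insert u T) g"
    proof -
      have "\<Phi> a *\<^sub>v f s + (- ev u a) \<cdot>\<^sub>v f s = g s" if "s \<in> insert u T" for s
        using insert.prems(2)[OF that a(1)] fC[OF that] by (intro eq_vecI) (auto simp: g_def algebra_simps)
      then show ?thesis unfolding vec_sum_def by (intro arg_cong[of _ _ "vec d"] ext sum.cong refl) simp
    qed
    also have "\<dots> = g u + vec_sum d T g"
      using insert.hyps fC by (intro vec_sum_insert) (auto simp: g_def)
    also have "g u = 0\<^sub>v d" using fC[of u] by (intro eq_vecI) (auto simp: g_def)
    finally have gW: "vec_sum d T g \<in> W" by simp
    have "\<forall>t\<in>T. g t \<in> W"
    proof (rule insert.IH[OF _ _ _ gW])
      show "g s \<in> carrier_vec d" if "s \<in> T" for s using fC that by (simp add: g_def)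
      show "\<Phi> b *\<^sub>v g s = ev s b \<cdot>\<^sub>v g s" if "s \<in> T" "b \<in> A" for s b
        using insert.prems(2)[of s b] that fC[of s] mult_mat_vec[OF \<Phi>[OF that(2)], of "f s"]
        by (simp add: g_def smult_smult_assoc mult.commute)
      show "\<exists>a\<in>A. ev s a \<noteq> ev r a" if "s \<in> T" "r \<in> T" "s \<noteq> r" for s r
        using insert.prems(3) that by blast
    qed
    then have "inverse (ev t a - ev u a) \<cdot>\<^sub>v g t \<in> W" using t subspace_vecD(4)[OF W] by blast
    moreover have "inverse (ev t a - ev u a) \<cdot>\<^sub>v g t = f t"
      using a(2) by (simp add: g_def smult_smult_assoc)
    ultimately show ?thesis by simp
  qed
  have "vec_sum d T f \<in> W" by (rule vec_sum_mem[OF W insert.hyps(1) *])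
  then have "f u + vec_sum d T f + (- 1) \<cdot>\<^sub>v vec_sum d T f \<in> W"
    using insert.prems(4) sum by (intro subspace_vecD(3)[OF W _ subspace_vecD(4)[OF W]]) simp_all
  also have "f u + vec_sum d T f + (- 1) \<cdot>\<^sub>v vec_sum d T f = f u"
    using insert.prems(1)[of u] by (intro eq_vecI) auto
  finally show ?case using * by auto
qed simp

definition tr :: "complex mat \<Rightarrow> complex" where "tr M = (\<Sum>j<dim_row M. M $$ (j, j))"

lemma tr_mult_comm:
  assumes "X \<in> carrier_mat d d" "Y \<in> carrier_mat d d" shows "tr (X * Y) = tr (Y * X)"
proof -
  have "tr (X * Y) = (\<Sum>i<d. \<Sum>j<d. X $$ (i, j) * Y $$ (j, i))"
    using assms by (simp add: tr_def scalar_prod_def atLeast0LessThan)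
  also have "\<dots> = (\<Sum>j<d. \<Sum>i<d. Y $$ (j, i) * X $$ (i, j))"
    by (subst sum.swap) (simp add: mult.commute)
  also have "\<dots> = tr (Y * X)"
    using assms by (simp add: tr_def scalar_prod_def atLeast0LessThan)
  finally show ?thesis .
qed

lemma tr_smult: "X \<in> carrier_mat d d \<Longrightarrow> tr (c \<cdot>\<^sub>m X) = c * tr X"
  by (simp add: tr_def sum_distrib_left)

lemma tr_one: "tr (1\<^sub>m d) = of_nat d"
  by (simp add: tr_def)

subsection \<open>Representations of Heisenberg groups\<close>

locale heisenberg =
  fixes A :: "'a::ab_group_add set" and B :: "'b::ab_group_add set" and C :: "'c::ab_group_add set"
    and \<beta> :: "'a \<Rightarrow> 'b \<Rightarrow> 'c"
  assumes A: "add_subgroup A" and B: "add_subgroup B" and C: "add_subgroup C"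
    and \<beta>_C: "a \<in> A \<Longrightarrow> b \<in> B \<Longrightarrow> \<beta> a b \<in> C"
    and \<beta>_add_left: "a \<in> A \<Longrightarrow> a' \<in> A \<Longrightarrow> b \<in> B \<Longrightarrow> \<beta> (a + a') b = \<beta> a b + \<beta> a' b"
    and \<beta>_add_right: "a \<in> A \<Longrightarrow> b \<in> B \<Longrightarrow> b' \<in> B \<Longrightarrow> \<beta> a (b + b') = \<beta> a b + \<beta> a b'"
begin

lemmas zeros = add_subgroup_zero[OF A] add_subgroup_zero[OF B] add_subgroup_zero[OF C]

lemma \<beta>_zero: "a \<in> A \<Longrightarrow> \<beta> a 0 = 0" "b \<in> B \<Longrightarrow> \<beta> 0 b = 0"
  using \<beta>_add_right[of a 0 0] \<beta>_add_left[of 0 0 b] zeros by auto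

lemma \<beta>_diff_right: "a \<in> A \<Longrightarrow> b \<in> B \<Longrightarrow> b' \<in> B \<Longrightarrow> \<beta> a (b - b') = \<beta> a b - \<beta> a b'"
  using \<beta>_add_right[of a "b - b'" b'] add_subgroup_diff[OF B, of b b'] by (simp add: eq_diff_eq)

lemma \<beta>_diff_left: "a \<in> A \<Longrightarrow> a' \<in> A \<Longrightarrow> b \<in> B \<Longrightarrow> \<beta> (a - a') b = \<beta> a b - \<beta> a' b"
  using \<beta>_add_left[of "a - a'" a' b] add_subgroup_diff[OF A, of a a'] by (simp add: eq_diff_eq)

lemma \<beta>_uminus: "a \<in> A \<Longrightarrow> b \<in> B \<Longrightarrow> \<beta> a (- b) = - \<beta> a b" "a \<in> A \<Longrightarrow> b \<in> B \<Longrightarrow> \<beta> (- a) b = - \<beta> a b"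
  using \<beta>_diff_right[of a 0 b] \<beta>_diff_left[of 0 a b] zeros by (simp_all add: \<beta>_zero)

text \<open>Together with \<open>rad2\<close>, the left and right kernel of the pairing of
  \<open>A\<close> and \<open>B\<close> given by \<open>\<beta>\<close> and \<open>\<psi>\<close>.
  When \<open>\<psi>\<close> is the central character of an irreducible representation, elements
  with coordinates in both kernels act by scalars.\<close>

definition rad1 :: "('c \<Rightarrow> complex) \<Rightarrow> 'a set" where
  "rad1 \<psi> = {a \<in> A. \<forall>b\<in>B. \<psi> (\<beta> a b) = 1}"

definition rad2 :: "('c \<Rightarrow> complex) \<Rightarrow> 'b set" where
  "rad2 \<psi> = {b \<in> B. \<forall>a\<in>A. \<psi> (\<beta> a b) = 1}"

lemma rad1_subgroup: assumes "add_char C \<psi>" shows "add_subgroup (rad1 \<psi>)"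
  unfolding add_subgroup_def
proof (intro conjI ballI)
  show "0 \<in> rad1 \<psi>" using zeros add_char_zero[OF assms C] by (simp add: rad1_def \<beta>_zero)
  fix x y assume xy: "x \<in> rad1 \<psi>" "y \<in> rad1 \<psi>"
  then have "x \<in> A" "y \<in> A" by (simp_all add: rad1_def)
  then show "x - y \<in> rad1 \<psi>"
    using xy add_subgroup_diff[OF A] \<beta>_C by (simp add: rad1_def \<beta>_diff_left add_char_diff[OF assms C])
qed

lemma rad2_subgroup: assumes "add_char C \<psi>" shows "add_subgroup (rad2 \<psi>)"
  unfolding add_subgroup_def
proof (intro conjI ballI)
  show "0 \<in> rad2 \<psi>" using zeros add_char_zero[OF assms C] by (simp add: rad2_def \<beta>_zero)
  fix x y assume xy: "x \<in> rad2 \<psi>" "y \<in> rad2 \<psi>"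
  then have "x \<in> B" "y \<in> B" by (simp_all add: rad2_def)
  then show "x - y \<in> rad2 \<psi>"
    using xy add_subgroup_diff[OF B] \<beta>_C by (simp add: rad2_def \<beta>_diff_right add_char_diff[OF assms C])
qed

text \<open>A representation of the group on \<open>A \<times> B \<times> C\<close> with multiplication
  \<open>(a, b, c) (a', b', c') = (a + a', b + b', c + c' + \<beta> a b')\<close>, given in coordinates.\<close>

definition matrix_rep :: "nat \<Rightarrow> ('a \<Rightarrow> 'b \<Rightarrow> 'c \<Rightarrow> complex mat) \<Rightarrow> bool" where
  "matrix_rep d \<rho> \<longleftrightarrow> \<rho> 0 0 0 = 1\<^sub>m d \<and>
     (\<forall>a\<in>A. \<forall>b\<in>B. \<forall>c\<in>C. \<rho> a b c \<in> carrier_mat d d) \<and>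
     (\<forall>a\<in>A. \<forall>b\<in>B. \<forall>c\<in>C. \<forall>a'\<in>A. \<forall>b'\<in>B. \<forall>c'\<in>C.
        \<rho> (a + a') (b + b') (c + c' + \<beta> a b') = \<rho> a b c * \<rho> a' b' c')"

definition rep_image :: "('a \<Rightarrow> 'b \<Rightarrow> 'c \<Rightarrow> complex mat) \<Rightarrow> complex mat set" where
  "rep_image \<rho> = {\<rho> a b c | a b c. a \<in> A \<and> b \<in> B \<and> c \<in> C}"

definition trivial_on :: "'a set \<Rightarrow> 'b set \<Rightarrow> 'c set \<Rightarrow> nat \<Rightarrow> ('a \<Rightarrow> 'b \<Rightarrow> 'c \<Rightarrow> complex mat) \<Rightarrow> bool" where
  "trivial_on A0 B0 C0 d \<rho> \<longleftrightarrow> (\<forall>a\<in>A0. \<forall>b\<in>B0. \<forall>c\<in>C0. \<rho> a b c = 1\<^sub>m d)"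

text \<open>For irreducible \<open>\<rho>\<close> the matrix \<open>\<rho> 0 0 c\<close> is scalar
  by Schur's lemma, and the entry at \<open>(0, 0)\<close> is the scalar. The value 0 outside
  \<open>C\<close> fits the convention of \<open>add_char\<close>.\<close>

definition central_char :: "('a \<Rightarrow> 'b \<Rightarrow> 'c \<Rightarrow> complex mat) \<Rightarrow> 'c \<Rightarrow> complex" where
  "central_char \<rho> c = (if c \<in> C then \<rho> 0 0 c $$ (0, 0) else 0)"

end

text \<open>The subgroups describe a level: a congruence subgroup on which representations are
  required to be trivial. This is the algebraic substitute for continuity.\<close>

locale heisenberg_level = heisenberg A B C \<beta>
  for A :: "'a::ab_group_add set" and B :: "'b::ab_group_add set" and C :: "'c::ab_group_add set" and \<beta> +
  fixes A0 B0 C0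
  assumes A0: "add_subgroup A0" "A0 \<subseteq> A" "finite_index A A0"
    and B0: "add_subgroup B0" "B0 \<subseteq> B" "finite_index B B0"
    and C0: "add_subgroup C0" "C0 \<subseteq> C"

locale heisenberg_irrep = heisenberg_level A B C \<beta> A0 B0 C0
  for A :: "'a::ab_group_add set" and B :: "'b::ab_group_add set" and C :: "'c::ab_group_add set"
    and \<beta> A0 B0 C0 +
  fixes d \<rho>
  assumes rep: "matrix_rep d \<rho>" and irr: "irreducible_mats d (rep_image \<rho>)"
    and level: "trivial_on A0 B0 C0 d \<rho>"
begin

lemma d_pos: "d > 0" using irr by (simp add: irreducible_mats_def)

lemma \<rho>_carrier: "a \<in> A \<Longrightarrow> b \<in> B \<Longrightarrow> c \<in> C \<Longrightarrow> \<rho> a b c \<in> carrier_mat d d"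
  using rep by (simp add: matrix_rep_def)

lemma \<rho>_one: "\<rho> 0 0 0 = 1\<^sub>m d"
  using rep by (simp add: matrix_rep_def)

lemma \<rho>_mult: "a \<in> A \<Longrightarrow> b \<in> B \<Longrightarrow> c \<in> C \<Longrightarrow> a' \<in> A \<Longrightarrow> b' \<in> B \<Longrightarrow> c' \<in> C \<Longrightarrow>
    \<rho> a b c * \<rho> a' b' c' = \<rho> (a + a') (b + b') (c + c' + \<beta> a b')"
  using rep by (simp add: matrix_rep_def)

lemma schur_rep:
  assumes "X \<in> carrier_mat d d"
    "\<And>a b c. a \<in> A \<Longrightarrow> b \<in> B \<Longrightarrow> c \<in> C \<Longrightarrow> \<rho> a b c * X = X * \<rho> a b c"
  obtains x where "X = x \<cdot>\<^sub>m 1\<^sub>m d"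
  by (rule schur[OF irr _ assms(1)]) (use assms(2) \<rho>_carrier in \<open>auto simp: rep_image_def\<close>)

definition \<psi> :: "'c \<Rightarrow> complex" where "\<psi> = central_char \<rho>"

lemma central: assumes "c \<in> C" shows "\<rho> 0 0 c = \<psi> c \<cdot>\<^sub>m 1\<^sub>m d"
proof -
  obtain x where x: "\<rho> 0 0 c = x \<cdot>\<^sub>m 1\<^sub>m d"
    by (rule schur_rep[of "\<rho> 0 0 c"])
      (use assms zeros in \<open>auto simp: \<rho>_carrier \<rho>_mult \<beta>_zero add.commute\<close>)
  then show ?thesis using assms d_pos by (simp add: \<psi>_def central_char_def)
qed

lemma \<psi>_char: "add_char C \<psi>"
  unfolding add_char_def
proof (intro conjI ballI allI impI)
  have mult: "\<psi> (x + y) = \<psi> x * \<psi> y" if "x \<in> C" "y \<in> C" for x y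
  proof -
    have "\<rho> 0 0 (x + y) = \<rho> 0 0 x * \<rho> 0 0 y" using that zeros by (simp add: \<rho>_mult \<beta>_zero)
    then have "\<psi> (x + y) \<cdot>\<^sub>m 1\<^sub>m d = (\<psi> x \<cdot>\<^sub>m 1\<^sub>m d) * (\<psi> y \<cdot>\<^sub>m 1\<^sub>m d)"
      using that add_subgroup_add[OF C] by (simp add: central)
    also have "\<dots> = (\<psi> x * \<psi> y) \<cdot>\<^sub>m 1\<^sub>m d"
      by (simp add: mult_smult_assoc_mat[where nr = d and n = d and nc = d]) (intro eq_matI, auto)
    finally have "(\<psi> (x + y) \<cdot>\<^sub>m 1\<^sub>m d) $$ (0, 0) = ((\<psi> x * \<psi> y) \<cdot>\<^sub>m 1\<^sub>m d) $$ (0, 0)" by simp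
    then show ?thesis using d_pos by simp
  qed
  then show "\<psi> (x + y) = \<psi> x * \<psi> y" if "x \<in> C" "y \<in> C" for x y using that .
  have one: "\<psi> 0 = 1" using \<rho>_one d_pos zeros by (simp add: \<psi>_def central_char_def)
  show "\<psi> x \<noteq> 0" if "x \<in> C" for x
    using mult[OF that add_subgroup_uminus[OF C that]] one by auto
  show "\<psi> x = 0" if "x \<notin> C" for x using that by (simp add: \<psi>_def central_char_def)
qed

lemma \<psi>_level: assumes "c \<in> C0" shows "\<psi> c = 1"
proof -
  have "\<rho> 0 0 c = 1\<^sub>m d"
    using level assms add_subgroup_zero[OF A0(1)] add_subgroup_zero[OF B0(1)] by (simp add: trivial_on_def)
  then show ?thesis using assms C0 d_pos by (auto simp: \<psi>_def central_char_def)
qed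

lemma \<rho>_central_mult:
  assumes "a \<in> A" "b \<in> B" "c \<in> C" "c' \<in> C"
  shows "\<rho> a b (c + c') = \<psi> c \<cdot>\<^sub>m \<rho> a b c'"
proof -
  have "\<rho> a b (c + c') = \<rho> 0 0 c * \<rho> a b c'" using assms zeros by (simp add: \<rho>_mult \<beta>_zero)
  also have "\<dots> = \<psi> c \<cdot>\<^sub>m (1\<^sub>m d * \<rho> a b c')"
    unfolding central[OF assms(3)] by (rule mult_smult_assoc_mat[OF one_carrier_mat \<rho>_carrier[OF assms(1,2,4)]])
  finally show ?thesis using left_mult_one_mat[OF \<rho>_carrier[OF assms(1,2,4)]] by simp
qed

text \<open>The commutator of the two group elements is central, with third coordinate
  \<open>\<beta> a b' - \<beta> a' b\<close>.\<close>

lemma commutation: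
  assumes "a \<in> A" "b \<in> B" "c \<in> C" "a' \<in> A" "b' \<in> B" "c' \<in> C"
  shows "\<rho> a b c * \<rho> a' b' c' = (\<psi> (\<beta> a b') / \<psi> (\<beta> a' b)) \<cdot>\<^sub>m (\<rho> a' b' c' * \<rho> a b c)"
proof -
  have cl: "a + a' \<in> A" "b + b' \<in> B" "\<beta> a b' \<in> C" "\<beta> a' b \<in> C" "c' + c + \<beta> a' b \<in> C"
    using assms by (auto intro!: add_subgroup_add[OF A] add_subgroup_add[OF B] add_subgroup_add[OF C] \<beta>_C)
  have "\<rho> a b c * \<rho> a' b' c' = \<rho> (a + a') (b + b') ((\<beta> a b' - \<beta> a' b) + (c' + c + \<beta> a' b))"
    using assms by (simp add: \<rho>_mult algebra_simps)
  also have "\<dots> = \<psi> (\<beta> a b' - \<beta> a' b) \<cdot>\<^sub>m \<rho> (a + a') (b + b') (c' + c + \<beta> a' b)"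
    using cl add_subgroup_diff[OF C] by (intro \<rho>_central_mult) auto
  also have "\<rho> (a + a') (b + b') (c' + c + \<beta> a' b) = \<rho> a' b' c' * \<rho> a b c"
    using assms by (simp add: \<rho>_mult add.commute)
  finally show ?thesis using cl by (simp add: add_char_diff[OF \<psi>_char C])
qed

text \<open>On the radicals the factor in the commutation relation is 1, so the matrix commutes with
  the whole image and Schur's lemma applies.\<close>

lemma scalar_on_rad:
  assumes "a \<in> rad1 \<psi>" "b \<in> rad2 \<psi>" "c \<in> C"
  obtains x where "\<rho> a b c = x \<cdot>\<^sub>m 1\<^sub>m d"
proof -
  have ab: "a \<in> A" "b \<in> B" using assms by (auto simp: rad1_def rad2_def)
  show ?thesis
  proof (rule schur_rep[of "\<rho> a b c", OF _ _ that])
    show "\<rho> a b c \<in> carrier_mat d d" using ab assms(3) by (rule \<rho>_carrier)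
    fix a' b' c' assume *: "a' \<in> A" "b' \<in> B" "c' \<in> C"
    have "\<psi> (\<beta> a' b) / \<psi> (\<beta> a b') = 1" using assms * by (simp add: rad1_def rad2_def)
    then have "\<rho> a' b' c' * \<rho> a b c = 1 \<cdot>\<^sub>m (\<rho> a b c * \<rho> a' b' c')"
      using commutation[OF * ab assms(3)] by simp
    also have "\<dots> = \<rho> a b c * \<rho> a' b' c'" by (intro eq_matI) auto
    finally show "\<rho> a' b' c' * \<rho> a b c = \<rho> a b c * \<rho> a' b' c'" .
  qed
qed

text \<open>A suitable conjugation multiplies the matrix by a factor other than 1 but preserves the
  trace.\<close>

lemma trace_off_rad:
  assumes "a \<in> A" "b \<in> B" "c \<in> C" "\<not> (a \<in> rad1 \<psi> \<and> b \<in> rad2 \<psi>)"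
  shows "tr (\<rho> a b c) = 0"
proof -
  have "\<exists>a'\<in>A. \<exists>b'\<in>B. \<psi> (\<beta> a b') / \<psi> (\<beta> a' b) \<noteq> 1"
  proof (cases "a \<in> rad1 \<psi>")
    case True
    then obtain a' where "a' \<in> A" "\<psi> (\<beta> a' b) \<noteq> 1" using assms by (auto simp: rad2_def)
    then show ?thesis using assms zeros add_char_zero[OF \<psi>_char C]
      by (intro bexI[of _ a'] bexI[of _ 0]) (auto simp: \<beta>_zero)
  next
    case False
    then obtain b' where "b' \<in> B" "\<psi> (\<beta> a b') \<noteq> 1" using assms by (auto simp: rad1_def)
    then show ?thesis using assms zeros add_char_zero[OF \<psi>_char C]
      by (intro bexI[of _ 0] bexI[of _ b']) (auto simp: \<beta>_zero)
  qed
  then obtain a' b' where *: "a' \<in> A" "b' \<in> B" and ne: "\<psi> (\<beta> a b') / \<psi> (\<beta> a' b) \<noteq> 1" by blast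
  let ?X = "\<rho> a b c" and ?Y = "\<rho> a' b' 0" and ?Z = "\<rho> (- a') (- b') (\<beta> a' b')"
  define e where "e = \<psi> (\<beta> a b') / \<psi> (\<beta> a' b)"
  have m: "- a' \<in> A" "- b' \<in> B" "\<beta> a' b' \<in> C"
    using * add_subgroup_uminus[OF A] add_subgroup_uminus[OF B] \<beta>_C by auto
  have car: "?X \<in> carrier_mat d d" "?Y \<in> carrier_mat d d" "?Z \<in> carrier_mat d d"
    using \<rho>_carrier assms * m zeros by auto
  have YZ: "?Y * ?Z = 1\<^sub>m d" using * m zeros by (simp add: \<rho>_mult \<beta>_uminus \<rho>_one)
  have ZY: "?Z * ?Y = 1\<^sub>m d" using * m zeros by (simp add: \<rho>_mult \<beta>_uminus \<rho>_one)
  have "tr ?X = tr (?X * (?Y * ?Z))" using YZ car by simp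
  also have "?X * (?Y * ?Z) = (?X * ?Y) * ?Z" using car by (simp add: assoc_mult_mat[of _ d d _ d _ d])
  also have "?X * ?Y = e \<cdot>\<^sub>m (?Y * ?X)" using commutation[OF assms(1-3) * zeros(3)] by (simp add: e_def)
  also have "tr (e \<cdot>\<^sub>m (?Y * ?X) * ?Z) = tr (?Z * (e \<cdot>\<^sub>m (?Y * ?X)))"
    using car by (intro tr_mult_comm[where d = d]) auto
  also have "?Z * (e \<cdot>\<^sub>m (?Y * ?X)) = e \<cdot>\<^sub>m (?Z * (?Y * ?X))"
    using car by (intro mult_smult_distrib[where nr = d and n = d and nc = d]) auto
  also have "?Z * (?Y * ?X) = (?Z * ?Y) * ?X" using car by (simp add: assoc_mult_mat[of _ d d _ d _ d])
  also have "\<dots> = ?X" using ZY car by simp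
  also have "tr (e \<cdot>\<^sub>m ?X) = e * tr ?X" using car by (intro tr_smult[where d = d])
  finally show ?thesis using ne by (metis e_def mult_cancel_right1)
qed

text \<open>Averaging the orbit of a vector against the characters of \<open>A\<close> trivial on
  \<open>A0\<close> yields joint eigenvectors \<open>w \<theta>\<close>. By orthogonality the
  averages do not all vanish, since they add up to a nonzero multiple of the vector.\<close>

lemma joint_eigenvector:
  obtains v \<mu> where "v \<in> carrier_vec d" "v \<noteq> 0\<^sub>v d" "\<And>a. a \<in> A \<Longrightarrow> \<rho> a 0 0 *\<^sub>v v = \<mu> a \<cdot>\<^sub>v v"
proof -
  obtain T where T: "transversal A A0 T" using obtain_transversal[OF A0(1)] by blast
  then have finT: "finite T" using transversal_index(2)[OF A0(1) T] A0(3) by simp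
  have TA: "T \<subseteq> A" using T by (rule transversal_sub)
  define X where "X = chars_trivial_on A A0"
  have X: "finite X" "card X > 0"
    using card_chars_trivial_on[OF A A0] subgroup_index_pos[OF A0(3)] zeros by (auto simp: X_def)
  have Xc: "add_char A \<theta>" "\<And>a. a \<in> A0 \<Longrightarrow> \<theta> a = 1" if "\<theta> \<in> X" for \<theta>
    using that by (auto simp: X_def chars_trivial_on_def)
  define u :: "complex vec" where "u = unit_vec d 0"
  have u: "u \<in> carrier_vec d" "u $ 0 = 1" using d_pos by (auto simp: u_def)
  let ?P = "\<lambda>a. \<rho> a 0 0"
  have P: "?P a \<in> carrier_mat d d" if "a \<in> A" for a using \<rho>_carrier that zeros by blast
  have P_add: "?P a * ?P a' = ?P (a + a')" if "a \<in> A" "a' \<in> A" for a a'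
    using that zeros by (simp add: \<rho>_mult \<beta>_zero)
  have P_level: "?P (a + a') = ?P a" if "a \<in> A" "a' \<in> A0" for a a'
  proof -
    have "?P a' = 1\<^sub>m d"
      using level that(2) add_subgroup_zero[OF B0(1)] add_subgroup_zero[OF C0(1)] by (simp add: trivial_on_def)
    then show ?thesis using P_add[of a a'] that A0(2) P[of a] by auto
  qed
  define f where "f \<theta> a = inverse (\<theta> a) \<cdot>\<^sub>v (?P a *\<^sub>v u)" for \<theta> :: "'a \<Rightarrow> complex" and a
  have fC: "f \<theta> a \<in> carrier_vec d" if "a \<in> A" for \<theta> a using P[OF that] u by (simp add: f_def)
  have f_level: "f \<theta> (a + a') = f \<theta> a" if "\<theta> \<in> X" "a \<in> A" "a' \<in> A0" for \<theta> a a'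
    using that Xc[OF that(1)] A0(2) by (auto simp: f_def P_level add_char_add[OF Xc(1)[OF that(1)]])
  define w where "w \<theta> = vec_sum d T (f \<theta>)" for \<theta>
  have eig: "?P a *\<^sub>v w \<theta> = \<theta> a \<cdot>\<^sub>v w \<theta>" if \<theta>: "\<theta> \<in> X" and a: "a \<in> A" for \<theta> a
  proof -
    have shift: "?P a *\<^sub>v f \<theta> t = \<theta> a \<cdot>\<^sub>v f \<theta> (a + t)" if "t \<in> A" for t
    proof -
      have "?P a *\<^sub>v f \<theta> t = inverse (\<theta> t) \<cdot>\<^sub>v (?P a *\<^sub>v (?P t *\<^sub>v u))"
        unfolding f_def using P[OF a] P[OF that] u by (intro mult_mat_vec) auto
      also have "?P a *\<^sub>v (?P t *\<^sub>v u) = ?P (a + t) *\<^sub>v u"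
        using assoc_mult_mat_vec[OF P[OF a] P[OF that] u(1)] P_add[OF a that] by simp
      also have "inverse (\<theta> t) = \<theta> a * inverse (\<theta> (a + t))"
        using add_char_add[OF Xc(1)[OF \<theta>] a that] add_char_nonzero[OF Xc(1)[OF \<theta>] a] by simp
      finally show ?thesis by (simp add: f_def smult_smult_assoc)
    qed
    \<comment> \<open>Translation by \<open>a\<close> permutes the classes of \<open>A0\<close>;
      \<open>\<tau>\<close> is the permutation of their representatives.\<close>
    define \<tau> where "\<tau> t = (SOME s. s \<in> T \<and> a + t - s \<in> A0)" for t
    have \<tau>: "\<tau> t \<in> T" "a + t - \<tau> t \<in> A0" if "t \<in> T" for t
    proof -
      have "\<exists>s. s \<in> T \<and> a + t - s \<in> A0"
        using transversal_ex[OF T, of "a + t"] add_subgroup_add[OF A a] that TA by blast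
      from someI_ex[OF this] show "\<tau> t \<in> T" "a + t - \<tau> t \<in> A0" by (simp_all add: \<tau>_def)
    qed
    have "inj_on \<tau> T"
    proof (rule inj_onI)
      fix s t assume st: "s \<in> T" "t \<in> T" "\<tau> s = \<tau> t"
      have "(a + s - \<tau> s) - (a + t - \<tau> t) \<in> A0" by (rule add_subgroup_diff[OF A0(1) \<tau>(2)[OF st(1)] \<tau>(2)[OF st(2)]])
      then have "s - t \<in> A0" using st(3) by (simp add: algebra_simps)
      then show "s = t" by (rule transversal_unique[OF T st(1,2)])
    qed
    moreover have "\<tau> ` T \<subseteq> T" using \<tau> by blast
    ultimately have bij: "bij_betw \<tau> T T" using endo_inj_surj[OF finT] by (simp add: bij_betw_def)
    have "f \<theta> (a + t) = f \<theta> (\<tau> t)" if "t \<in> T" for t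
      using f_level[OF \<theta>, of "\<tau> t" "a + t - \<tau> t"] \<tau>[OF that] TA by auto
    then have "vec_sum d T (\<lambda>t. f \<theta> (a + t)) = vec_sum d T (\<lambda>t. f \<theta> (\<tau> t))"
      unfolding vec_sum_def by (intro arg_cong[of _ _ "vec d"] ext sum.cong refl) simp
    also have "\<dots> = w \<theta>"
      unfolding vec_sum_def w_def
      by (intro arg_cong[of _ _ "vec d"] ext sum.reindex_bij_betw[OF bij])
    finally have sh: "vec_sum d T (\<lambda>t. f \<theta> (a + t)) = w \<theta>" .
    have "?P a *\<^sub>v w \<theta> = vec_sum d T (\<lambda>t. ?P a *\<^sub>v f \<theta> t)"
      unfolding w_def using fC TA by (intro mult_vec_sum[OF P[OF a]]) blast
    also have "\<dots> = vec_sum d T (\<lambda>t. \<theta> a \<cdot>\<^sub>v f \<theta> (a + t))"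
      unfolding vec_sum_def using shift TA by (intro arg_cong[of _ _ "vec d"] ext sum.cong refl) auto
    also have "\<dots> = \<theta> a \<cdot>\<^sub>v vec_sum d T (\<lambda>t. f \<theta> (a + t))"
      using fC TA add_subgroup_add[OF A a] by (intro smult_vec_sum[symmetric]) blast
    finally show ?thesis unfolding sh .
  qed
  have "\<exists>\<theta>\<in>X. w \<theta> \<noteq> 0\<^sub>v d"
  proof (rule ccontr)
    assume neg: "\<not> ?thesis"
    obtain t0 where t0: "t0 \<in> T" "0 - t0 \<in> A0" using transversal_ex[OF T zeros(1)] by blast
    then have t0': "t0 \<in> A0" using add_subgroup_uminus[OF A0(1), of "0 - t0"] by simp
    \<comment> \<open>Comparing coordinate 0 is enough. There the sum of all
      \<open>w \<theta>\<close> is \<open>card X\<close>, because orthogonality leaves only the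
      representative \<open>t0\<close> of the trivial class and \<open>u $ 0\<close> is 1.\<close>
    have "0 = (\<Sum>\<theta>\<in>X. w \<theta> $ 0)" using neg d_pos by simp
    also have "\<dots> = (\<Sum>\<theta>\<in>X. \<Sum>t\<in>T. inverse (\<theta> t) * (?P t *\<^sub>v u) $ 0)"
    proof (intro sum.cong refl)
      fix \<theta>
      have "(inverse (\<theta> t) \<cdot>\<^sub>v (?P t *\<^sub>v u)) $ 0 = inverse (\<theta> t) * (?P t *\<^sub>v u) $ 0" if "t \<in> T" for t
        using carrier_matD(1)[OF P[of t]] that TA d_pos by auto
      then show "w \<theta> $ 0 = (\<Sum>t\<in>T. inverse (\<theta> t) * (?P t *\<^sub>v u) $ 0)"
        using d_pos by (simp add: w_def vec_sum_def f_def)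
    qed
    also have "\<dots> = (\<Sum>t\<in>T. (\<Sum>\<theta>\<in>X. \<theta> (- t)) * (?P t *\<^sub>v u) $ 0)"
      unfolding sum_distrib_right using TA add_char_uminus[OF Xc(1) A]
      by (subst sum.swap) (intro sum.cong refl, auto)
    also have "\<dots> = (\<Sum>t\<in>T. if t = t0 then of_nat (card X) else 0)"
    proof (intro sum.cong refl)
      fix t assume t: "t \<in> T"
      show "(\<Sum>\<theta>\<in>X. \<theta> (- t)) * (?P t *\<^sub>v u) $ 0 = (if t = t0 then of_nat (card X) else 0)"
      proof (cases "t = t0")
        case True
        have "?P t = 1\<^sub>m d" using P_level[OF zeros(1) t0'] \<rho>_one True by simp
        moreover have "\<theta> (- t) = 1" if "\<theta> \<in> X" for \<theta> using Xc(2)[OF that, of "- t"] t0(2) True by simp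
        then have "(\<Sum>\<theta>\<in>X. \<theta> (- t)) = (\<Sum>\<theta>\<in>X. 1)" by (rule sum.cong[OF refl])
        ultimately show ?thesis using True u by simp
      next
        case False
        have "- t \<notin> A0"
        proof
          assume "- t \<in> A0"
          then have "t \<in> A0" using add_subgroup_uminus[OF A0(1), of "- t"] by simp
          then have "t - t0 \<in> A0" using add_subgroup_diff[OF A0(1)] t0' by blast
          then show False using transversal_unique[OF T t t0(1)] False by blast
        qed
        then have "(\<Sum>\<theta>\<in>X. \<theta> (- t)) = 0"
          unfolding X_def using t TA add_subgroup_uminus[OF A] by (intro sum_chars_trivial_on[OF A A0]) auto
        then show ?thesis using False by simp
      qed
    qed
    also have "\<dots> = of_nat (card X)" using finT t0(1) by simp
    finally show False using X by simp
  qed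
  then obtain \<theta> where "\<theta> \<in> X" "w \<theta> \<noteq> 0\<^sub>v d" by blast
  then show ?thesis using that[of "w \<theta>" \<theta>] eig by (simp add: w_def)
qed

end

lemma finite_index_Times:
  assumes "add_subgroup A0" "add_subgroup B0" "finite_index A A0" "finite_index B B0"
  shows "finite_index (A \<times> B) (A0 \<times> B0)"
proof -
  obtain S where S: "transversal A A0 S" using obtain_transversal[OF assms(1)] by blast
  obtain T where T: "transversal B B0 T" using obtain_transversal[OF assms(2)] by blast
  show ?thesis
  proof (rule finite_index_if_finite_reps)
    show "add_subgroup (A0 \<times> B0)" using assms(1,2) by (auto simp: add_subgroup_def zero_prod_def)
    show "finite (S \<times> T)"
      using transversal_index(2)[OF assms(1) S] transversal_index(2)[OF assms(2) T] assms by simp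
    fix g assume "g \<in> A \<times> B"
    then obtain a b where g: "g = (a, b)" "a \<in> A" "b \<in> B" by auto
    obtain s where "s \<in> S" "a - s \<in> A0" using transversal_ex[OF S g(2)] by blast
    moreover obtain t where "t \<in> T" "b - t \<in> B0" using transversal_ex[OF T g(3)] by blast
    ultimately show "\<exists>t\<in>S \<times> T. g - t \<in> A0 \<times> B0" using g by (intro bexI[of _ "(s, t)"]) auto
  qed
qed

context heisenberg_irrep
begin

lemma \<rho>_level: "a \<in> A0 \<Longrightarrow> b \<in> B0 \<Longrightarrow> c \<in> C0 \<Longrightarrow> \<rho> a b c = 1\<^sub>m d"
  using level by (simp add: trivial_on_def)

lemma smult_inverse_pair:
  fixes X Y :: "complex mat"
  assumes "X * Y = 1\<^sub>m d" "X \<in> carrier_mat d d" "Y \<in> carrier_mat d d" "X = e \<cdot>\<^sub>m X"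
  shows "e = 1"
proof -
  have "1\<^sub>m d = (e \<cdot>\<^sub>m X) * Y" using assms(1,4) by simp
  also have "\<dots> = e \<cdot>\<^sub>m 1\<^sub>m d" using mult_smult_assoc_mat[OF assms(2,3)] assms(1) by simp
  finally have "1\<^sub>m d $$ (0, 0) = (e \<cdot>\<^sub>m 1\<^sub>m d) $$ (0, 0)" by simp
  then show ?thesis using d_pos by simp
qed

lemma inverse_pair:
  assumes "a \<in> A" "b \<in> B" shows "\<rho> a b 0 * \<rho> (- a) (- b) (\<beta> a b) = 1\<^sub>m d"
  using assms zeros add_subgroup_uminus[OF A] add_subgroup_uminus[OF B] \<beta>_C
  by (simp add: \<rho>_mult \<beta>_uminus \<rho>_one)

lemma level_zeros: "0 \<in> A0" "0 \<in> B0" "0 \<in> C0"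
  using add_subgroup_zero A0(1) B0(1) C0(1) by auto

text \<open>\<open>\<rho> 0 b 0\<close> is the identity, so the commutation relation says that the
  invertible matrix \<open>\<rho> a 0 0\<close> equals \<open>\<psi> (\<beta> a b)\<close> times
  itself.\<close>

lemma B0_rad2: "B0 \<subseteq> rad2 \<psi>"
proof
  fix b assume b: "b \<in> B0"
  then have bB: "b \<in> B" using B0 by blast
  have "\<psi> (\<beta> a b) = 1" if a: "a \<in> A" for a
  proof (rule smult_inverse_pair[OF inverse_pair[OF a zeros(2)]])
    show c: "\<rho> a 0 0 \<in> carrier_mat d d" using a zeros by (intro \<rho>_carrier)
    show "\<rho> (- a) (- 0) (\<beta> a 0) \<in> carrier_mat d d"
      using a zeros add_subgroup_uminus[OF A] by (intro \<rho>_carrier) (auto simp: \<beta>_zero)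
    have "\<rho> a 0 0 * \<rho> 0 b 0 = (\<psi> (\<beta> a b) / \<psi> (\<beta> 0 0)) \<cdot>\<^sub>m (\<rho> 0 b 0 * \<rho> a 0 0)"
      by (rule commutation) (use a bB zeros in auto)
    moreover have "\<rho> 0 b 0 = 1\<^sub>m d" using \<rho>_level b level_zeros by blast
    ultimately show "\<rho> a 0 0 = \<psi> (\<beta> a b) \<cdot>\<^sub>m \<rho> a 0 0"
      using c zeros by (simp add: \<beta>_zero add_char_zero[OF \<psi>_char C])
  qed
  then show "b \<in> rad2 \<psi>" using bB by (simp add: rad2_def)
qed

lemma A0_rad1: "A0 \<subseteq> rad1 \<psi>"
proof
  fix a assume a: "a \<in> A0"
  then have aA: "a \<in> A" using A0 by blast
  have "\<psi> (\<beta> a b) = 1" if b: "b \<in> B" for b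
  proof (rule smult_inverse_pair[OF inverse_pair[OF zeros(1) b]])
    show c: "\<rho> 0 b 0 \<in> carrier_mat d d" using b zeros by (intro \<rho>_carrier)
    show "\<rho> (- 0) (- b) (\<beta> 0 b) \<in> carrier_mat d d"
      using b zeros add_subgroup_uminus[OF B] by (intro \<rho>_carrier) (auto simp: \<beta>_zero)
    have "\<rho> a 0 0 * \<rho> 0 b 0 = (\<psi> (\<beta> a b) / \<psi> (\<beta> 0 0)) \<cdot>\<^sub>m (\<rho> 0 b 0 * \<rho> a 0 0)"
      by (rule commutation) (use aA b zeros in auto)
    moreover have "\<rho> a 0 0 = 1\<^sub>m d" using \<rho>_level a level_zeros by blast
    ultimately show "\<rho> 0 b 0 = \<psi> (\<beta> a b) \<cdot>\<^sub>m \<rho> 0 b 0"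
      using c zeros by (simp add: \<beta>_zero add_char_zero[OF \<psi>_char C])
  qed
  then show "a \<in> rad1 \<psi>" using aA by (simp add: rad1_def)
qed

lemma finite_index_rad: "finite_index A (rad1 \<psi>)" "finite_index B (rad2 \<psi>)"
proof -
  have "rad1 \<psi> \<subseteq> A" "rad2 \<psi> \<subseteq> B" by (auto simp: rad1_def rad2_def)
  then show "finite_index A (rad1 \<psi>)" "finite_index B (rad2 \<psi>)"
    using finite_index_mono(1)[OF rad1_subgroup[OF \<psi>_char] A0(1) _ A0_rad1 A0(3)]
      finite_index_mono(1)[OF rad2_subgroup[OF \<psi>_char] B0(1) _ B0_rad2 B0(3)] by auto
qed

text \<open>The translates of a joint eigenvector of the \<open>\<rho> a 0 0\<close> by a transversal of \<open>rad2 \<psi>\<close> have pairwise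
  distinct systems of eigenvalues and span an invariant subspace, so they form a basis.\<close>

theorem degree_eq_index: "d = subgroup_index B (rad2 \<psi>)"
proof -
  obtain v \<mu> where v: "v \<in> carrier_vec d" "v \<noteq> 0\<^sub>v d" "\<And>a. a \<in> A \<Longrightarrow> \<rho> a 0 0 *\<^sub>v v = \<mu> a \<cdot>\<^sub>v v"
    using joint_eigenvector by blast
  note rad = rad2_subgroup[OF \<psi>_char]
  obtain T where T: "transversal B (rad2 \<psi>) T" using obtain_transversal[OF rad] by blast
  then have finT: "finite T" using transversal_index(2)[OF rad T] finite_index_rad by simp
  have TB: "T \<subseteq> B" using T by (rule transversal_sub)
  define w where "w b = \<rho> 0 b 0 *\<^sub>v v" for b
  have P: "\<rho> a 0 0 \<in> carrier_mat d d" if "a \<in> A" for a using that zeros by (intro \<rho>_carrier)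
  have Q: "\<rho> 0 b 0 \<in> carrier_mat d d" if "b \<in> B" for b using that zeros by (intro \<rho>_carrier)
  have wC: "w b \<in> carrier_vec d" if "b \<in> B" for b using Q[OF that] v by (simp add: w_def)
  have w_nz: "w b \<noteq> 0\<^sub>v d" if b: "b \<in> B" for b
  proof
    assume z: "w b = 0\<^sub>v d"
    have mb: "- b \<in> B" using b by (rule add_subgroup_uminus[OF B])
    have "\<rho> 0 (- b) 0 * \<rho> 0 b 0 = 1\<^sub>m d" using b mb zeros by (simp add: \<rho>_mult \<beta>_zero \<rho>_one)
    then have "v = \<rho> 0 (- b) 0 *\<^sub>v w b" using assoc_mult_mat_vec[OF Q[OF mb] Q[OF b] v(1)] v(1) by (simp add: w_def)
    then show False using z v(2) Q[OF mb] by auto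
  qed
  have eig: "\<rho> a 0 0 *\<^sub>v w b = (\<psi> (\<beta> a b) * \<mu> a) \<cdot>\<^sub>v w b" if a: "a \<in> A" and b: "b \<in> B" for a b
  proof -
    have "\<rho> a 0 0 * \<rho> 0 b 0 = (\<psi> (\<beta> a b) / \<psi> (\<beta> 0 0)) \<cdot>\<^sub>m (\<rho> 0 b 0 * \<rho> a 0 0)"
      by (rule commutation) (use a b zeros in auto)
    then have comm: "\<rho> a 0 0 * \<rho> 0 b 0 = \<psi> (\<beta> a b) \<cdot>\<^sub>m (\<rho> 0 b 0 * \<rho> a 0 0)"
      using zeros by (simp add: \<beta>_zero add_char_zero[OF \<psi>_char C])
    have "\<rho> a 0 0 *\<^sub>v w b = (\<psi> (\<beta> a b) \<cdot>\<^sub>m (\<rho> 0 b 0 * \<rho> a 0 0)) *\<^sub>v v"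
      unfolding w_def comm[symmetric] using assoc_mult_mat_vec[OF P[OF a] Q[OF b] v(1)] by simp
    also have "\<dots> = \<psi> (\<beta> a b) \<cdot>\<^sub>v ((\<rho> 0 b 0 * \<rho> a 0 0) *\<^sub>v v)"
    proof -
      have M: "\<rho> 0 b 0 * \<rho> a 0 0 \<in> carrier_mat d d" using P[OF a] Q[OF b] by simp
      have "(\<psi> (\<beta> a b) \<cdot>\<^sub>m (\<rho> 0 b 0 * \<rho> a 0 0)) = (\<psi> (\<beta> a b) \<cdot>\<^sub>m 1\<^sub>m d) * (\<rho> 0 b 0 * \<rho> a 0 0)"
        using mult_smult_assoc_mat[OF one_carrier_mat M, of "\<psi> (\<beta> a b)"] left_mult_one_mat[OF M] by simp
      then show ?thesis
        using assoc_mult_mat_vec[OF _ M v(1), of "\<psi> (\<beta> a b) \<cdot>\<^sub>m 1\<^sub>m d" d] M v(1) by (simp add: smult_one_mat_vec)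
    qed
    also have "(\<rho> 0 b 0 * \<rho> a 0 0) *\<^sub>v v = \<mu> a \<cdot>\<^sub>v w b"
      using assoc_mult_mat_vec[OF Q[OF b] P[OF a] v(1)] v(3)[OF a] mult_mat_vec[OF Q[OF b] v(1)] by (simp add: w_def)
    finally show ?thesis by (simp add: smult_smult_assoc)
  qed
  have \<mu>_nz: "\<mu> a \<noteq> 0" if a: "a \<in> A" for a
  proof
    assume z: "\<mu> a = 0"
    have ma: "- a \<in> A" using a by (rule add_subgroup_uminus[OF A])
    have "\<rho> (- a) 0 0 * \<rho> a 0 0 = 1\<^sub>m d" using a ma zeros by (simp add: \<rho>_mult \<beta>_zero \<rho>_one)
    then have "v = \<rho> (- a) 0 0 *\<^sub>v (\<rho> a 0 0 *\<^sub>v v)"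
      using assoc_mult_mat_vec[OF P[OF ma] P[OF a] v(1)] v(1) by simp
    also have "\<rho> a 0 0 *\<^sub>v v = 0\<^sub>v d" using v z a by auto
    finally show False using v(2) P[OF ma] by auto
  qed
  have distinct: "\<exists>a\<in>A. \<psi> (\<beta> a s) * \<mu> a \<noteq> \<psi> (\<beta> a t) * \<mu> a" if st: "s \<in> T" "t \<in> T" "s \<noteq> t" for s t
  proof (rule ccontr)
    assume neg: "\<not> ?thesis"
    have "\<psi> (\<beta> a (s - t)) = 1" if a: "a \<in> A" for a
    proof -
      have "\<psi> (\<beta> a s) = \<psi> (\<beta> a t)" using neg a \<mu>_nz by auto
      moreover have "\<beta> a s \<in> C" "\<beta> a t \<in> C" using a st(1,2) TB \<beta>_C by blast+
      moreover have "\<beta> a (s - t) = \<beta> a s - \<beta> a t" using a st(1,2) TB by (intro \<beta>_diff_right) auto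
      ultimately show ?thesis using add_char_nonzero[OF \<psi>_char] by (simp add: add_char_diff[OF \<psi>_char C])
    qed
    moreover have "s - t \<in> B" by (rule add_subgroup_diff[OF B]) (use st(1,2) TB in auto)
    ultimately have "s - t \<in> rad2 \<psi>" by (simp add: rad2_def)
    then show False using transversal_unique[OF T] st by blast
  qed
  \<comment> \<open>Translates by elements of the same class of \<open>rad2 \<psi>\<close> are
    proportional, because \<open>\<rho> 0 (b - t') 0\<close> is scalar.\<close>
  have shift: "\<exists>x t'. t' \<in> T \<and> w b = x \<cdot>\<^sub>v w t'" if b: "b \<in> B" for b
  proof -
    obtain t' where t': "t' \<in> T" "b - t' \<in> rad2 \<psi>" using transversal_ex[OF T b] by blast
    then have tB: "t' \<in> B" "b - t' \<in> B" using TB by (auto simp: rad2_def)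
    have "0 \<in> rad1 \<psi>" using add_subgroup_zero[OF rad1_subgroup[OF \<psi>_char]] .
    then obtain x where x: "\<rho> 0 (b - t') 0 = x \<cdot>\<^sub>m 1\<^sub>m d" using scalar_on_rad t'(2) zeros(3) by blast
    have "\<rho> 0 t' 0 * \<rho> 0 (b - t') 0 = \<rho> 0 b 0" using tB zeros by (simp add: \<rho>_mult \<beta>_zero)
    then have "w b = \<rho> 0 t' 0 *\<^sub>v (\<rho> 0 (b - t') 0 *\<^sub>v v)"
      using assoc_mult_mat_vec[OF Q[OF tB(1)] Q[OF tB(2)] v(1)] by (simp add: w_def)
    also have "\<dots> = x \<cdot>\<^sub>v w t'"
      unfolding x using v(1) mult_mat_vec[OF Q[OF tB(1)] v(1)] by (simp add: smult_one_mat_vec w_def)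
    finally show ?thesis using t' by blast
  qed
  define W where "W = {vec_sum d T (\<lambda>t. x t \<cdot>\<^sub>v w t) | x. True}"
  have xwC: "x \<cdot>\<^sub>v w t \<in> carrier_vec d" if "t \<in> T" for x t using wC that TB by auto
  have W_mem: "vec_sum d T (\<lambda>t. x t \<cdot>\<^sub>v w t) \<in> W" for x unfolding W_def by blast
  have W: "subspace_vec d W"
  proof (rule subspace_vecI)
    show "W \<subseteq> carrier_vec d" by (auto simp: W_def)
    have "vec_sum d T (\<lambda>t. 0 \<cdot>\<^sub>v w t) = 0\<^sub>v d"
    proof (rule eq_vecI)
      fix i assume "i < dim_vec (0\<^sub>v d :: complex vec)"
      then have i: "i < d" by simp
      then have "(\<Sum>t\<in>T. (0 \<cdot>\<^sub>v w t) $ i) = (\<Sum>t\<in>T. 0)"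
        using carrier_vecD[OF wC] TB by (intro sum.cong refl) auto
      then show "vec_sum d T (\<lambda>t. 0 \<cdot>\<^sub>v w t) $ i = 0\<^sub>v d $ i" using i by (simp add: vec_sum_def)
    qed simp
    then show "0\<^sub>v d \<in> W" using W_mem[of "\<lambda>_. 0"] by simp
  next
    fix u u' assume "u \<in> W" "u' \<in> W"
    then obtain x y where xy: "u = vec_sum d T (\<lambda>t. x t \<cdot>\<^sub>v w t)" "u' = vec_sum d T (\<lambda>t. y t \<cdot>\<^sub>v w t)"
      by (auto simp: W_def)
    have "u + u' = vec_sum d T (\<lambda>t. x t \<cdot>\<^sub>v w t + y t \<cdot>\<^sub>v w t)"
      unfolding xy by (rule add_vec_sum) (rule xwC, assumption)+
    also have "\<dots> = vec_sum d T (\<lambda>t. (x t + y t) \<cdot>\<^sub>v w t)" by (simp add: add_smult_distrib_vec)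
    finally show "u + u' \<in> W" using W_mem by simp
  next
    fix c u assume "u \<in> W"
    then obtain x where x: "u = vec_sum d T (\<lambda>t. x t \<cdot>\<^sub>v w t)" by (auto simp: W_def)
    have "c \<cdot>\<^sub>v u = vec_sum d T (\<lambda>t. c \<cdot>\<^sub>v (x t \<cdot>\<^sub>v w t))"
      unfolding x by (rule smult_vec_sum) (rule xwC)
    also have "\<dots> = vec_sum d T (\<lambda>t. (c * x t) \<cdot>\<^sub>v w t)" by (simp add: smult_smult_assoc)
    finally show "c \<cdot>\<^sub>v u \<in> W" using W_mem by simp
  qed
  have w_in_W: "w t \<in> W" if t: "t \<in> T" for t
  proof -
    have wt: "w t \<in> carrier_vec d" using wC t TB by blast
    have "vec_sum d T (\<lambda>s. (if s = t then 1 else 0) \<cdot>\<^sub>v w s) = w t"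
    proof (rule eq_vecI)
      fix i assume "i < dim_vec (w t)"
      then have i: "i < d" using wt by simp
      have "(\<Sum>s\<in>T. ((if s = t then 1 else 0) \<cdot>\<^sub>v w s) $ i) = (\<Sum>s\<in>T. if s = t then w s $ i else 0)"
        using carrier_vecD[OF wC] TB i by (intro sum.cong refl) auto
      then show "vec_sum d T (\<lambda>s. (if s = t then 1 else 0) \<cdot>\<^sub>v w s) $ i = w t $ i"
        using i t finT by (simp add: vec_sum_def)
    qed (use wt in simp)
    then show ?thesis using W_mem[of "\<lambda>s. if s = t then 1 else 0"] by simp
  qed
  have W_inv: "M *\<^sub>v u \<in> W" if M: "M \<in> rep_image \<rho>" and u: "u \<in> W" for M u
  proof -
    obtain a b c where abc: "M = \<rho> a b c" "a \<in> A" "b \<in> B" "c \<in> C" using M by (auto simp: rep_image_def)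
    have MC: "M \<in> carrier_mat d d" using abc \<rho>_carrier by simp
    have M_eq: "M = \<psi> c \<cdot>\<^sub>m (\<rho> 0 b 0 * \<rho> a 0 0)"
    proof -
      have "\<rho> 0 b 0 * \<rho> a 0 0 = \<rho> a b 0" using abc zeros by (simp add: \<rho>_mult \<beta>_zero)
      then show ?thesis using \<rho>_central_mult[OF abc(2-4) zeros(3)] abc by simp
    qed
    have Mw: "M *\<^sub>v w t \<in> W" if t: "t \<in> T" for t
    proof -
      have tB: "t \<in> B" "b + t \<in> B" using t TB abc add_subgroup_add[OF B] by auto
      have bb: "\<rho> 0 b 0 *\<^sub>v w t = w (b + t)"
      proof -
        have "\<rho> 0 b 0 * \<rho> 0 t 0 = \<rho> 0 (b + t) 0" using abc tB zeros by (simp add: \<rho>_mult \<beta>_zero)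
        then show ?thesis using assoc_mult_mat_vec[OF Q[OF abc(3)] Q[OF tB(1)] v(1)] by (simp add: w_def)
      qed
      have N: "\<rho> 0 b 0 * \<rho> a 0 0 \<in> carrier_mat d d" using P[OF abc(2)] Q[OF abc(3)] by simp
      have "M = (\<psi> c \<cdot>\<^sub>m 1\<^sub>m d) * (\<rho> 0 b 0 * \<rho> a 0 0)"
        unfolding M_eq using mult_smult_assoc_mat[OF one_carrier_mat N, of "\<psi> c"] left_mult_one_mat[OF N] by simp
      then have "M *\<^sub>v w t = (\<psi> c \<cdot>\<^sub>m 1\<^sub>m d) *\<^sub>v ((\<rho> 0 b 0 * \<rho> a 0 0) *\<^sub>v w t)"
        using assoc_mult_mat_vec[OF _ N wC[OF tB(1)], of "\<psi> c \<cdot>\<^sub>m 1\<^sub>m d" d] by simp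
      also have "(\<rho> 0 b 0 * \<rho> a 0 0) *\<^sub>v w t = \<rho> 0 b 0 *\<^sub>v ((\<psi> (\<beta> a t) * \<mu> a) \<cdot>\<^sub>v w t)"
        using assoc_mult_mat_vec[OF Q[OF abc(3)] P[OF abc(2)] wC[OF tB(1)]] eig[OF abc(2) tB(1)] by simp
      also have "\<dots> = (\<psi> (\<beta> a t) * \<mu> a) \<cdot>\<^sub>v w (b + t)"
        using mult_mat_vec[OF Q[OF abc(3)] wC[OF tB(1)]] bb by simp
      finally have e: "M *\<^sub>v w t = \<psi> c \<cdot>\<^sub>v ((\<psi> (\<beta> a t) * \<mu> a) \<cdot>\<^sub>v w (b + t))"
        using wC[OF tB(2)] by (simp add: smult_one_mat_vec)
      obtain x t' where "t' \<in> T" "w (b + t) = x \<cdot>\<^sub>v w t'" using shift[OF tB(2)] by blast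
      then show ?thesis unfolding e using w_in_W subspace_vecD(4)[OF W] by simp
    qed
    obtain x where x: "u = vec_sum d T (\<lambda>t. x t \<cdot>\<^sub>v w t)" using u by (auto simp: W_def)
    have "M *\<^sub>v u = vec_sum d T (\<lambda>t. M *\<^sub>v (x t \<cdot>\<^sub>v w t))"
      unfolding x by (rule mult_vec_sum[OF MC]) (rule xwC)
    also have "\<dots> \<in> W"
    proof (rule vec_sum_mem[OF W finT])
      fix t assume t: "t \<in> T"
      then have "M *\<^sub>v (x t \<cdot>\<^sub>v w t) = x t \<cdot>\<^sub>v (M *\<^sub>v w t)" using mult_mat_vec[OF MC wC] TB by blast
      then show "M *\<^sub>v (x t \<cdot>\<^sub>v w t) \<in> W" using Mw[OF t] subspace_vecD(4)[OF W] by simp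
    qed
    finally show ?thesis .
  qed
  obtain t0 where t0: "t0 \<in> T" using transversal_ex[OF T zeros(2)] by blast
  have "W = {0\<^sub>v d} \<or> W = carrier_vec d"
    using irr W W_inv unfolding irreducible_mats_def by blast
  moreover have "w t0 \<in> W" "w t0 \<noteq> 0\<^sub>v d" using w_in_W[OF t0] w_nz[of t0] t0 TB by auto
  ultimately have full: "W = carrier_vec d" by auto
  have indep: "y t = 0" if y: "\<And>i. i < d \<Longrightarrow> (\<Sum>s\<in>T. y s * w s $ i) = 0" and t: "t \<in> T" for y t
  proof -
    have "vec_sum d T (\<lambda>s. y s \<cdot>\<^sub>v w s) = 0\<^sub>v d"
    proof (rule eq_vecI)
      fix i assume "i < dim_vec (0\<^sub>v d :: complex vec)"
      then have i: "i < d" by simp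
      have "(\<Sum>s\<in>T. (y s \<cdot>\<^sub>v w s) $ i) = (\<Sum>s\<in>T. y s * w s $ i)"
        using carrier_vecD[OF wC] TB i by (intro sum.cong refl) auto
      then show "vec_sum d T (\<lambda>s. y s \<cdot>\<^sub>v w s) $ i = 0\<^sub>v d $ i" using y i by (simp add: vec_sum_def)
    qed simp
    then have z: "vec_sum d T (\<lambda>s. y s \<cdot>\<^sub>v w s) \<in> {0\<^sub>v d}" by simp
    have zero: "subspace_vec d {0\<^sub>v d}" by (rule subspace_vecI) auto
    have "\<forall>t\<in>T. y t \<cdot>\<^sub>v w t \<in> {0\<^sub>v d}"
    proof (rule separate_eigenvectors[where \<Phi> = "\<lambda>a. \<rho> a 0 0" and A = A and ev = "\<lambda>t a. \<psi> (\<beta> a t) * \<mu> a", OF zero _ _ finT _ _ _ z])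
      show "\<rho> a 0 0 *\<^sub>v u \<in> {0\<^sub>v d}" if "a \<in> A" "u \<in> {0\<^sub>v d}" for a u using that P[OF that(1)] by auto
      show "\<rho> a 0 0 \<in> carrier_mat d d" if "a \<in> A" for a using P that .
      show "y s \<cdot>\<^sub>v w s \<in> carrier_vec d" if "s \<in> T" for s using xwC that .
      show "\<rho> a 0 0 *\<^sub>v (y s \<cdot>\<^sub>v w s) = (\<psi> (\<beta> a s) * \<mu> a) \<cdot>\<^sub>v (y s \<cdot>\<^sub>v w s)" if "s \<in> T" "a \<in> A" for s a
        using mult_mat_vec[OF P[OF that(2)] wC, of s "y s"] eig[OF that(2), of s] that TB
        by (auto simp: smult_smult_assoc mult_ac)
      show "\<exists>a\<in>A. \<psi> (\<beta> a s) * \<mu> a \<noteq> \<psi> (\<beta> a r) * \<mu> a" if "s \<in> T" "r \<in> T" "s \<noteq> r" for s r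
        using distinct that .
    qed
    then have e: "y t \<cdot>\<^sub>v w t = 0\<^sub>v d" using t by blast
    have wt: "w t \<in> carrier_vec d" "w t \<noteq> 0\<^sub>v d" using wC w_nz t TB by auto
    then obtain i where i: "i < d" "w t $ i \<noteq> 0" by (metis carrier_vecD eq_vecI index_zero_vec)
    have "(y t \<cdot>\<^sub>v w t) $ i = 0" using e i by simp
    then show "y t = 0" using i wt by simp
  qed
  have "\<exists>x. unit_vec d k = vec_sum d T (\<lambda>t. x t \<cdot>\<^sub>v w t)" for k
  proof -
    have "unit_vec d k \<in> W" using full by simp
    then show ?thesis by (auto simp: W_def)
  qed
  then obtain x where x: "\<And>k. unit_vec d k = vec_sum d T (\<lambda>t. x k t \<cdot>\<^sub>v w t)" by metis
  have xsum: "(\<Sum>t\<in>T. x k t * w t $ i) = (if i = k then 1 else 0)" if "k < d" "i < d" for k i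
  proof -
    have "unit_vec d k $ i = (\<Sum>t\<in>T. (x k t \<cdot>\<^sub>v w t) $ i)" unfolding x using that by (simp add: vec_sum_def)
    also have "\<dots> = (\<Sum>t\<in>T. x k t * w t $ i)"
      using carrier_vecD[OF wC] TB that by (intro sum.cong refl) auto
    finally show ?thesis using that by simp
  qed
  \<comment> \<open>Writing \<open>w t\<close> in unit vectors and these again in the translates
    gives a relation between translates; by independence the coefficient at \<open>t\<close> is
    1.\<close>
  have dual: "(\<Sum>k<d. x k t * w t $ k) = 1" if t: "t \<in> T" for t
  proof -
    define y where "y s = (\<Sum>k<d. x k s * w t $ k) - (if s = t then 1 else 0)" for s
    have "(\<Sum>s\<in>T. y s * w s $ i) = 0" if i: "i < d" for i
    proof -
      have "(\<Sum>s\<in>T. (\<Sum>k<d. x k s * w t $ k) * w s $ i) = (\<Sum>k<d. w t $ k * (\<Sum>s\<in>T. x k s * w s $ i))"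
        unfolding sum_distrib_left sum_distrib_right by (subst sum.swap) (simp add: mult_ac)
      also have "\<dots> = (\<Sum>k<d. if i = k then w t $ k else 0)" using xsum i by (intro sum.cong refl) auto
      also have "\<dots> = w t $ i" using i by simp
      finally have 1: "(\<Sum>s\<in>T. (\<Sum>k<d. x k s * w t $ k) * w s $ i) = w t $ i" .
      have "(\<Sum>s\<in>T. (if s = t then 1 else 0) * w s $ i) = (\<Sum>s\<in>T. if s = t then w s $ i else 0)"
        by (intro sum.cong) auto
      also have "\<dots> = w t $ i" using finT t by simp
      finally show ?thesis using 1 by (simp add: y_def left_diff_distrib sum_subtractf)
    qed
    then have "y t = 0" using indep t by blast
    then show ?thesis by (simp add: y_def)
  qed
  \<comment> \<open>The coefficients \<open>x\<close> and the entries of the \<open>w t\<close> form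
    mutually inverse matrices. Computing the trace of their product in the two orders gives
    \<open>d\<close> and \<open>card T\<close>.\<close>
  have "of_nat d = (\<Sum>k<d. \<Sum>t\<in>T. x k t * w t $ k)" using xsum by simp
  also have "\<dots> = (\<Sum>t\<in>T. \<Sum>k<d. x k t * w t $ k)" by (rule sum.swap)
  also have "\<dots> = (of_nat (card T) :: complex)" using dual by simp
  finally have "d = card T" using of_nat_eq_iff by blast
  then show ?thesis using transversal_index(1)[OF rad T] by simp
qed

text \<open>The scalar by which \<open>(a, b, 0)\<close> acts when both coordinates lie in the
  radicals. It is multiplicative there because the correction \<open>\<psi> (\<beta> a b')\<close>
  is 1.\<close>

definition scalar_char :: "'a \<times> 'b \<Rightarrow> complex" where
  "scalar_char = (\<lambda>(a, b). if a \<in> rad1 \<psi> \<and> b \<in> rad2 \<psi> then \<rho> a b 0 $$ (0, 0) else 0)"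

lemma scalar_char:
  assumes "a \<in> rad1 \<psi>" "b \<in> rad2 \<psi>" shows "\<rho> a b 0 = scalar_char (a, b) \<cdot>\<^sub>m 1\<^sub>m d"
proof -
  obtain x where "\<rho> a b 0 = x \<cdot>\<^sub>m 1\<^sub>m d" using scalar_on_rad[OF assms zeros(3)] by blast
  then show ?thesis using assms d_pos by (simp add: scalar_char_def)
qed

lemma add_char_scalar_char: "add_char (rad1 \<psi> \<times> rad2 \<psi>) scalar_char"
proof -
  have AB: "a \<in> A \<and> b \<in> B" if "a \<in> rad1 \<psi>" "b \<in> rad2 \<psi>" for a b
    using that by (simp add: rad1_def rad2_def)
  have mult: "scalar_char (a + a', b + b') = scalar_char (a, b) * scalar_char (a', b')"
    if r: "a \<in> rad1 \<psi>" "b \<in> rad2 \<psi>" "a' \<in> rad1 \<psi>" "b' \<in> rad2 \<psi>" for a b a' b'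
  proof -
    have ab: "a \<in> A" "b \<in> B" "a' \<in> A" "b' \<in> B" using AB r by auto
    have s: "a + a' \<in> A" "b + b' \<in> B" using add_subgroup_add[OF A] add_subgroup_add[OF B] ab by auto
    have "\<rho> a b 0 * \<rho> a' b' 0 = \<rho> (a + a') (b + b') (\<beta> a b' + 0)" using ab zeros by (simp add: \<rho>_mult)
    also have "\<dots> = \<psi> (\<beta> a b') \<cdot>\<^sub>m \<rho> (a + a') (b + b') 0"
      by (rule \<rho>_central_mult) (use ab s \<beta>_C zeros in auto)
    also have "\<psi> (\<beta> a b') = 1" using r ab by (simp add: rad1_def)
    finally have "\<rho> a b 0 * \<rho> a' b' 0 = 1 \<cdot>\<^sub>m \<rho> (a + a') (b + b') 0" .
    moreover have "a + a' \<in> rad1 \<psi>" "b + b' \<in> rad2 \<psi>"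
      using r add_subgroup_add[OF rad1_subgroup[OF \<psi>_char]] add_subgroup_add[OF rad2_subgroup[OF \<psi>_char]] by auto
    ultimately have "(scalar_char (a, b) \<cdot>\<^sub>m 1\<^sub>m d) * (scalar_char (a', b') \<cdot>\<^sub>m 1\<^sub>m d) = 1 \<cdot>\<^sub>m (scalar_char (a + a', b + b') \<cdot>\<^sub>m 1\<^sub>m d)"
      using r by (simp only: scalar_char)
    then have "((scalar_char (a, b) \<cdot>\<^sub>m 1\<^sub>m d) * (scalar_char (a', b') \<cdot>\<^sub>m 1\<^sub>m d)) $$ (0, 0) = (1 \<cdot>\<^sub>m (scalar_char (a + a', b + b') \<cdot>\<^sub>m 1\<^sub>m d)) $$ (0, 0)"
      by simp
    moreover have "(scalar_char (a, b) \<cdot>\<^sub>m 1\<^sub>m d) * (scalar_char (a', b') \<cdot>\<^sub>m 1\<^sub>m d) = scalar_char (a, b) \<cdot>\<^sub>m (scalar_char (a', b') \<cdot>\<^sub>m 1\<^sub>m d)"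
      by (simp add: mult_smult_assoc_mat[where nr = d and n = d and nc = d])
    ultimately show ?thesis using d_pos by simp
  qed
  have one: "scalar_char (0, 0) = 1"
    using \<rho>_one d_pos add_subgroup_zero[OF rad1_subgroup[OF \<psi>_char]] add_subgroup_zero[OF rad2_subgroup[OF \<psi>_char]]
    by (simp add: scalar_char_def)
  have nz: "scalar_char (a, b) \<noteq> 0" if "a \<in> rad1 \<psi>" "b \<in> rad2 \<psi>" for a b
    using mult[OF that add_subgroup_uminus[OF rad1_subgroup[OF \<psi>_char] that(1)]
        add_subgroup_uminus[OF rad2_subgroup[OF \<psi>_char] that(2)]] one by auto
  show ?thesis
    unfolding add_char_def
  proof (intro conjI ballI allI impI)
    fix x y assume "x \<in> rad1 \<psi> \<times> rad2 \<psi>" "y \<in> rad1 \<psi> \<times> rad2 \<psi>"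
    then show "scalar_char (x + y) = scalar_char x * scalar_char y" using mult by auto
  next
    fix x assume "x \<in> rad1 \<psi> \<times> rad2 \<psi>" then show "scalar_char x \<noteq> 0" using nz by auto
  next
    fix x assume "x \<notin> rad1 \<psi> \<times> rad2 \<psi>" then show "scalar_char x = 0" by (auto simp: scalar_char_def split: prod.splits)
  qed
qed

text \<open>The trace vanishes off the radicals and is \<open>d\<close> times a scalar on them.
  Since \<open>d\<close> depends only on \<open>\<psi>\<close>, the character is determined by
  \<open>\<psi>\<close> and \<open>scalar_char\<close>.\<close>

lemma trace_eq:
  assumes "a \<in> A" "b \<in> B" "c \<in> C" shows "tr (\<rho> a b c) = of_nat d * \<psi> c * scalar_char (a, b)"
proof (cases "a \<in> rad1 \<psi> \<and> b \<in> rad2 \<psi>")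
  case True
  have "\<rho> a b c = \<psi> c \<cdot>\<^sub>m \<rho> a b 0" using \<rho>_central_mult[OF assms zeros(3)] by simp
  then have "tr (\<rho> a b c) = \<psi> c * tr (\<rho> a b 0)" using \<rho>_carrier[OF assms(1,2) zeros(3)] by (simp add: tr_smult)
  also have "tr (\<rho> a b 0) = scalar_char (a, b) * of_nat d"
    using True by (simp add: scalar_char tr_smult[OF one_carrier_mat] tr_one)
  finally show ?thesis by simp
next
  case False
  then show ?thesis using trace_off_rad[OF assms] by (auto simp: scalar_char_def)
qed

end

text \<open>Equal central characters force equal degrees and radicals. The quotient of the two
  scalar characters extends from the product of the radicals to \<open>A \<times> B\<close>, and
  outside that product both traces vanish.\<close>

lemma (in heisenberg_level) twist_exists:
  assumes "heisenberg_irrep A B C \<beta> A0 B0 C0 d \<rho>" "heisenberg_irrep A B C \<beta> A0 B0 C0 d' \<rho>'"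
    and eq: "central_char \<rho> = central_char \<rho>'"
  shows "\<exists>\<tau>. add_char (A \<times> B) \<tau> \<and> (\<forall>a\<in>A0. \<forall>b\<in>B0. \<tau> (a, b) = 1) \<and>
    (\<forall>a\<in>A. \<forall>b\<in>B. \<forall>c\<in>C. tr (\<rho> a b c) = \<tau> (a, b) * tr (\<rho>' a b c))"
proof -
  interpret R1: heisenberg_irrep A B C \<beta> A0 B0 C0 d \<rho> by fact
  interpret R2: heisenberg_irrep A B C \<beta> A0 B0 C0 d' \<rho>' by fact
  have \<psi>: "R2.\<psi> = R1.\<psi>" using eq by (simp add: R1.\<psi>_def R2.\<psi>_def)
  have d: "d' = d" using R1.degree_eq_index R2.degree_eq_index \<psi> by simp
  define N where "N = rad1 R1.\<psi> \<times> rad2 R1.\<psi>"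
  have N: "add_char N R1.scalar_char" "add_char N R2.scalar_char"
    using R1.add_char_scalar_char R2.add_char_scalar_char by (simp_all add: \<psi> N_def)
  have AB: "add_subgroup (A \<times> B)" using A B by (auto simp: add_subgroup_def zero_prod_def)
  have Ns: "add_subgroup N" "N \<subseteq> A \<times> B"
    using rad1_subgroup[OF R1.\<psi>_char] rad2_subgroup[OF R1.\<psi>_char]
    by (auto simp: N_def add_subgroup_def zero_prod_def rad1_def rad2_def)
  have Nf: "finite_index (A \<times> B) N"
    unfolding N_def by (intro finite_index_Times rad1_subgroup rad2_subgroup R1.\<psi>_char R1.finite_index_rad)
  define \<mu> where "\<mu> x = R1.scalar_char x / R2.scalar_char x" for x
  have "add_char N \<mu>"
    using N by (auto simp: add_char_def \<mu>_def)
  then obtain \<tau> where \<tau>: "add_char (A \<times> B) \<tau>" "\<And>x. x \<in> N \<Longrightarrow> \<tau> x = \<mu> x"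
    using extend_char[OF AB Ns Nf] by blast
  show ?thesis
  proof (intro exI[of _ \<tau>] conjI ballI \<tau>(1))
    fix a b assume ab: "a \<in> A0" "b \<in> B0"
    then have r: "a \<in> rad1 R1.\<psi>" "b \<in> rad2 R1.\<psi>" using R1.A0_rad1 R1.B0_rad2 by auto
    have "R1.scalar_char (a, b) = 1" "R2.scalar_char (a, b) = 1"
      using r R1.\<rho>_level[OF ab R1.level_zeros(3)] R2.\<rho>_level[OF ab R1.level_zeros(3)] R1.d_pos R2.d_pos
      by (simp_all add: R1.scalar_char_def R2.scalar_char_def \<psi>)
    then show "\<tau> (a, b) = 1" using \<tau>(2)[of "(a, b)"] r by (simp add: N_def \<mu>_def)
  next
    fix a b c assume abc: "a \<in> A" "b \<in> B" "c \<in> C"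
    show "tr (\<rho> a b c) = \<tau> (a, b) * tr (\<rho>' a b c)"
    proof (cases "(a, b) \<in> N")
      case True
      then have "R2.scalar_char (a, b) \<noteq> 0" using add_char_nonzero[OF N(2)] by blast
      then show ?thesis
        using \<tau>(2)[OF True] by (simp add: R1.trace_eq[OF abc] R2.trace_eq[OF abc] \<psi> d \<mu>_def)
    next
      case False
      then have "R1.scalar_char (a, b) = 0" "R2.scalar_char (a, b) = 0"
        using add_char_outside N by blast+
      then show ?thesis by (simp add: R1.trace_eq[OF abc] R2.trace_eq[OF abc])
    qed
  qed
qed

context heisenberg_level
begin

text \<open>The induced representation on functions \<open>f\<close> on the quotient by \<open>rad2 \<psi>\<close>, where \<open>(a, b, c)\<close> maps \<open>f\<close> to
  \<open>y \<mapsto> \<psi> (c - \<beta> a b - \<beta> a y) f (y + b)\<close>.\<close>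

lemma exists_irrep:
  assumes \<psi>: "add_char C \<psi>" "\<And>c. c \<in> C0 \<Longrightarrow> \<psi> c = 1" and rad: "A0 \<subseteq> rad1 \<psi>" "B0 \<subseteq> rad2 \<psi>"
  shows "\<exists>d \<rho>. heisenberg_irrep A B C \<beta> A0 B0 C0 d \<rho> \<and> central_char \<rho> = \<psi>"
proof -
  note r2 = rad2_subgroup[OF \<psi>(1)]
  have r2B: "rad2 \<psi> \<subseteq> B" by (auto simp: rad2_def)
  have fin: "finite_index B (rad2 \<psi>)"
    by (rule finite_index_mono(1)[OF r2 B0(1) r2B rad(2) B0(3)])
  obtain T where T: "transversal B (rad2 \<psi>) T" using obtain_transversal[OF r2] by blast
  have finT: "finite T" using transversal_index(2)[OF r2 T] fin by simp
  define d where "d = card T"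
  obtain h where h: "bij_betw h {..<d} T"
    using ex_bij_betw_nat_finite[OF finT] by (auto simp: d_def atLeast0LessThan)
  have hT: "h i \<in> T" "h i \<in> B" if "i < d" for i
    using h that transversal_sub[OF T] by (auto simp: bij_betw_def)
  have h_unique: "i = j" if "i < d" "j < d" "h i - h j \<in> rad2 \<psi>" for i j
  proof -
    have "h i = h j" using transversal_unique[OF T hT(1) hT(1) that(3)] that by blast
    then show ?thesis using h that by (auto simp: bij_betw_def inj_on_def)
  qed
  obtain t0 where "t0 \<in> T" using transversal_ex[OF T zeros(2)] by blast
  then have d: "d > 0" using finT by (auto simp: d_def card_gt_0_iff)
  \<comment> \<open>\<open>r b\<close> is the number of the representative of the class of
    \<open>b\<close>.\<close>
  define r where "r b = (SOME i. i < d \<and> b - h i \<in> rad2 \<psi>)" for b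
  have r: "r b < d" "b - h (r b) \<in> rad2 \<psi>" if b: "b \<in> B" for b
  proof -
    obtain t where t: "t \<in> T" "b - t \<in> rad2 \<psi>" using transversal_ex[OF T b] by blast
    then obtain i where "i < d" "h i = t" using h by (auto simp: bij_betw_def)
    then have "\<exists>i. i < d \<and> b - h i \<in> rad2 \<psi>" using t by blast
    from someI_ex[OF this] show "r b < d" "b - h (r b) \<in> rad2 \<psi>" by (simp_all add: r_def)
  qed
  have r_eq: "r b = i" if "b \<in> B" "i < d" "b - h i \<in> rad2 \<psi>" for b i
  proof (rule h_unique[OF r(1)[OF that(1)] that(2)])
    have "h (r b) - b \<in> rad2 \<psi>" using r(2)[OF that(1)] add_subgroup_diff_swap[OF r2] by blast
    then show "h (r b) - h i \<in> rad2 \<psi>" using that(3) by (rule add_subgroup_diff_trans[OF r2])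
  qed
  have r_shift: "r (h (r b) + b') = r (b + b')" if "b \<in> B" "b' \<in> B" for b b'
  proof -
    have BB: "b + b' \<in> B" "h (r b) + b' \<in> B" using that add_subgroup_add[OF B] hT r by auto
    have "(h (r b) + b') - (b + b') \<in> rad2 \<psi>" using r(2)[OF that(1)] add_subgroup_diff_swap[OF r2] by simp
    then have "(h (r b) + b') - h (r (b + b')) \<in> rad2 \<psi>"
      using r(2)[OF BB(1)] by (rule add_subgroup_diff_trans[OF r2])
    then show ?thesis using r_eq[OF BB(2) r(1)[OF BB(1)]] by blast
  qed
  \<comment> \<open>A monomial matrix: row \<open>i\<close> has its only nonzero entry in the column
    that belongs to the class of \<open>h i + b\<close>.\<close>
  define \<rho> where "\<rho> a b c = mat d d (\<lambda>(i, j). if j = r (h i + b) then \<psi> (c - \<beta> a b - \<beta> a (h i)) else 0)" for a b c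
  have \<rho>C: "\<rho> a b c \<in> carrier_mat d d" for a b c by (simp add: \<rho>_def)
  have entry: "\<rho> a b c $$ (i, j) = (if j = r (h i + b) then \<psi> (c - \<beta> a b - \<beta> a (h i)) else 0)"
    if "i < d" "j < d" for a b c i j using that by (simp add: \<rho>_def)
  have r_self: "r (h i + b) = i" if "i < d" "b \<in> rad2 \<psi>" for i b
    using that r2B by (intro r_eq add_subgroup_add[OF B] hT) auto
  have \<psi>0: "\<psi> 0 = 1" using add_char_zero[OF \<psi>(1) C] .
  have zero2: "0 \<in> rad2 \<psi>" using add_subgroup_zero[OF r2] .
  have rep: "matrix_rep d \<rho>"
    unfolding matrix_rep_def
  proof (intro conjI ballI)
    show "\<rho> 0 0 0 = 1\<^sub>m d"
    proof (rule eq_matI)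
      fix i j assume "i < dim_row (1\<^sub>m d :: complex mat)" "j < dim_col (1\<^sub>m d :: complex mat)"
      then have ij: "i < d" "j < d" by auto
      have "r (h i) = i" using r_self[OF ij(1) zero2] by simp
      then show "\<rho> 0 0 0 $$ (i, j) = 1\<^sub>m d $$ (i, j)" using ij hT zeros \<psi>0 by (auto simp: entry \<beta>_zero)
    qed (simp_all add: \<rho>_def)
  next
    fix a b c a' b' c'
    assume abc: "a \<in> A" "b \<in> B" "c \<in> C" "a' \<in> A" "b' \<in> B" "c' \<in> C"
    show "\<rho> (a + a') (b + b') (c + c' + \<beta> a b') = \<rho> a b c * \<rho> a' b' c'"
    proof (rule eq_matI)
      fix i k assume "i < dim_row (\<rho> a b c * \<rho> a' b' c')" "k < dim_col (\<rho> a b c * \<rho> a' b' c')"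
      then have ik: "i < d" "k < d" by (auto simp: \<rho>_def)
      have hb: "h i + b \<in> B" using hT ik abc add_subgroup_add[OF B] by blast
      define j where "j = r (h i + b)"
      have j: "j < d" "h i + b - h j \<in> rad2 \<psi>" using r[OF hb] by (simp_all add: j_def)
      have "(\<rho> a b c * \<rho> a' b' c') $$ (i, k) = (\<Sum>l<d. \<rho> a b c $$ (i, l) * \<rho> a' b' c' $$ (l, k))"
        using ik \<rho>C[THEN carrier_matD(1)] \<rho>C[THEN carrier_matD(2)] by (simp add: scalar_prod_def atLeast0LessThan)
      also have "\<dots> = (\<Sum>l<d. if l = j then \<psi> (c - \<beta> a b - \<beta> a (h i)) * \<rho> a' b' c' $$ (j, k) else 0)"
        using ik by (intro sum.cong refl) (auto simp: entry j_def)
      also have "\<dots> = \<psi> (c - \<beta> a b - \<beta> a (h i)) * \<rho> a' b' c' $$ (j, k)" using j by simp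
      finally have e: "(\<rho> a b c * \<rho> a' b' c') $$ (i, k) = \<psi> (c - \<beta> a b - \<beta> a (h i)) * \<rho> a' b' c' $$ (j, k)" .
      have rr: "r (h j + b') = r (h i + (b + b'))"
        using r_shift[OF hb abc(5)] by (simp add: j_def add.assoc)
      have m: "\<beta> a b \<in> C" "\<beta> a (h i) \<in> C" "\<beta> a' b' \<in> C" "\<beta> a' (h j) \<in> C" "\<beta> a' (h i + b) \<in> C" "\<beta> a b' \<in> C"
        using abc hT ik j hb \<beta>_C by auto
      \<comment> \<open>The second factor is evaluated at the representative \<open>h j\<close>
        instead of \<open>h i + b\<close>. They differ by an element of \<open>rad2 \<psi>\<close>,
        which \<open>\<psi>\<close> does not see.\<close>
      have "\<psi> (\<beta> a' (h i + b - h j)) = 1" using j abc by (simp add: rad2_def)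
      then have "\<psi> (\<beta> a' (h j)) = \<psi> (\<beta> a' (h i + b))"
        using m add_char_nonzero[OF \<psi>(1) m(4)]
        by (simp add: \<beta>_diff_right[OF abc(4) hb hT(2)[OF j(1)]] add_char_diff[OF \<psi>(1) C])
      then have "\<psi> (c' - \<beta> a' b' - \<beta> a' (h j)) = \<psi> (c' - \<beta> a' b' - \<beta> a' (h i + b))"
        using m abc add_subgroup_diff[OF C] by (simp add: add_char_diff[OF \<psi>(1) C])
      then have "\<psi> (c - \<beta> a b - \<beta> a (h i)) * \<psi> (c' - \<beta> a' b' - \<beta> a' (h j))
          = \<psi> ((c - \<beta> a b - \<beta> a (h i)) + (c' - \<beta> a' b' - \<beta> a' (h i + b)))"
        using m abc add_subgroup_diff[OF C] by (simp add: add_char_add[OF \<psi>(1)])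
      also have "(c - \<beta> a b - \<beta> a (h i)) + (c' - \<beta> a' b' - \<beta> a' (h i + b))
          = (c + c' + \<beta> a b') - \<beta> (a + a') (b + b') - \<beta> (a + a') (h i)"
        using abc hT(2)[OF ik(1)] add_subgroup_add[OF B] by (simp add: \<beta>_add_left \<beta>_add_right algebra_simps)
      finally show "\<rho> (a + a') (b + b') (c + c' + \<beta> a b') $$ (i, k) = (\<rho> a b c * \<rho> a' b' c') $$ (i, k)"
        unfolding e using ik j rr by (simp add: entry)
    qed (simp_all add: \<rho>_def)
  qed (rule \<rho>C)
  have level: "trivial_on A0 B0 C0 d \<rho>"
    unfolding trivial_on_def
  proof (intro ballI)
    fix a b c assume abc: "a \<in> A0" "b \<in> B0" "c \<in> C0"
    then have ab: "a \<in> rad1 \<psi>" "b \<in> rad2 \<psi>" "a \<in> A" "b \<in> B" "c \<in> C" using rad A0 B0 C0 by auto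
    show "\<rho> a b c = 1\<^sub>m d"
    proof (rule eq_matI)
      fix i j assume "i < dim_row (1\<^sub>m d :: complex mat)" "j < dim_col (1\<^sub>m d :: complex mat)"
      then have ij: "i < d" "j < d" by auto
      have "\<psi> (\<beta> a b) = 1" "\<psi> (\<beta> a (h i)) = 1" using ab hT ij by (auto simp: rad1_def)
      then have "\<psi> (c - \<beta> a b - \<beta> a (h i)) = 1"
        using \<psi>(2)[OF abc(3)] ab hT ij \<beta>_C add_subgroup_diff[OF C] by (simp add: add_char_diff[OF \<psi>(1) C])
      then show "\<rho> a b c $$ (i, j) = 1\<^sub>m d $$ (i, j)" using ij r_self[OF ij(1) ab(2)] by (auto simp: entry)
    qed (simp_all add: \<rho>_def)
  qed
  have unit_eig: "\<rho> a 0 0 *\<^sub>v unit_vec d j = \<psi> (- \<beta> a (h j)) \<cdot>\<^sub>v unit_vec d j" if a: "a \<in> A" and j: "j < d" for a j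
  proof (rule eq_vecI)
    fix i assume "i < dim_vec (\<psi> (- \<beta> a (h j)) \<cdot>\<^sub>v unit_vec d j)"
    then have i: "i < d" by simp
    have "(\<rho> a 0 0 *\<^sub>v unit_vec d j) $ i = \<rho> a 0 0 $$ (i, j)" using i j by (simp add: \<rho>_def)
    then show "(\<rho> a 0 0 *\<^sub>v unit_vec d j) $ i = (\<psi> (- \<beta> a (h j)) \<cdot>\<^sub>v unit_vec d j) $ i"
      using i j r_self[OF i zero2] a by (auto simp: entry \<beta>_zero)
  qed (simp add: \<rho>_def)
  have vec_units: "v = vec_sum d {..<d} (\<lambda>j. v $ j \<cdot>\<^sub>v unit_vec d j)" if v: "v \<in> carrier_vec d" for v
  proof (rule eq_vecI)
    fix i assume "i < dim_vec (vec_sum d {..<d} (\<lambda>j. v $ j \<cdot>\<^sub>v unit_vec d j))"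
    then have i: "i < d" by simp
    have "(\<Sum>j<d. (v $ j \<cdot>\<^sub>v unit_vec d j) $ i) = (\<Sum>j<d. if j = i then v $ j else 0)"
      using i by (intro sum.cong refl) auto
    then show "v $ i = vec_sum d {..<d} (\<lambda>j. v $ j \<cdot>\<^sub>v unit_vec d j) $ i" using i by (simp add: vec_sum_def)
  qed (use v in simp)
  have irr: "irreducible_mats d (rep_image \<rho>)"
    unfolding irreducible_mats_def
  proof (intro conjI allI impI d)
    fix W assume "subspace_vec d W \<and> (\<forall>M\<in>rep_image \<rho>. \<forall>w\<in>W. M *\<^sub>v w \<in> W)"
    then have W: "subspace_vec d W" and inv: "\<And>a b c w. a \<in> A \<Longrightarrow> b \<in> B \<Longrightarrow> c \<in> C \<Longrightarrow> w \<in> W \<Longrightarrow> \<rho> a b c *\<^sub>v w \<in> W"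
      by (auto simp: rep_image_def)
    show "W = {0\<^sub>v d} \<or> W = carrier_vec d"
    proof (cases "W \<subseteq> {0\<^sub>v d}")
      case True then show ?thesis using subspace_vecD(2)[OF W] by blast
    next
      case False
      then obtain f where f: "f \<in> W" "f \<noteq> 0\<^sub>v d" by blast
      then have fC: "f \<in> carrier_vec d" using subspace_vecD(1)[OF W] by blast
      then obtain i0 where i0: "i0 < d" "f $ i0 \<noteq> 0" using f(2) by (metis carrier_vecD eq_vecI index_zero_vec)
      have fW: "vec_sum d {..<d} (\<lambda>j. f $ j \<cdot>\<^sub>v unit_vec d j) \<in> W" using vec_units[OF fC] f(1) by simp
      \<comment> \<open>The unit vectors are joint eigenvectors with pairwise distinct systems of
        eigenvalues, so an invariant subspace contains every component of each of its
        vectors.\<close>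
      have "\<forall>j\<in>{..<d}. f $ j \<cdot>\<^sub>v unit_vec d j \<in> W"
      proof (rule separate_eigenvectors[where \<Phi> = "\<lambda>a. \<rho> a 0 0" and A = A and ev = "\<lambda>j a. \<psi> (- \<beta> a (h j))", OF W _ _ _ _ _ _ fW])
        show "\<rho> a 0 0 *\<^sub>v w \<in> W" if "a \<in> A" "w \<in> W" for a w using inv[OF that(1) zeros(2,3) that(2)] .
        show "\<rho> a 0 0 *\<^sub>v (f $ j \<cdot>\<^sub>v unit_vec d j) = \<psi> (- \<beta> a (h j)) \<cdot>\<^sub>v (f $ j \<cdot>\<^sub>v unit_vec d j)"
          if "j \<in> {..<d}" "a \<in> A" for j a
          using mult_mat_vec[OF \<rho>C unit_vec_carrier, of a 0 0 "f $ j" j] unit_eig[OF that(2), of j] that(1)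
          by (simp add: smult_smult_assoc mult.commute)
        show "\<exists>a\<in>A. \<psi> (- \<beta> a (h s)) \<noteq> \<psi> (- \<beta> a (h t))" if st: "s \<in> {..<d}" "t \<in> {..<d}" "s \<noteq> t" for s t
        proof (rule ccontr)
          assume neg: "\<not> ?thesis"
          have hB: "h s \<in> B" "h t \<in> B" using hT st by auto
          have "\<psi> (\<beta> a (h s - h t)) = 1" if a: "a \<in> A" for a
          proof -
            have m: "\<beta> a (h s) \<in> C" "\<beta> a (h t) \<in> C" using a hB \<beta>_C by auto
            have "\<psi> (- \<beta> a (h s)) = \<psi> (- \<beta> a (h t))" using neg a by blast
            then have "\<psi> (\<beta> a (h s)) = \<psi> (\<beta> a (h t))" using m by (simp add: add_char_uminus[OF \<psi>(1) C])
            then show ?thesis using m add_char_nonzero[OF \<psi>(1) m(2)]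
              by (simp add: \<beta>_diff_right[OF a hB] add_char_diff[OF \<psi>(1) C])
          qed
          then have "h s - h t \<in> rad2 \<psi>" using add_subgroup_diff[OF B hB] by (simp add: rad2_def)
          then show False using h_unique st by auto
        qed
      qed (use \<rho>C in auto)
      then have "inverse (f $ i0) \<cdot>\<^sub>v (f $ i0 \<cdot>\<^sub>v unit_vec d i0) \<in> W"
        using i0 subspace_vecD(4)[OF W] by blast
      then have u0: "unit_vec d i0 \<in> W" using i0 by (simp add: smult_smult_assoc)
      \<comment> \<open>The elements \<open>(0, b, 0)\<close> permute the unit vectors
        transitively.\<close>
      have units: "unit_vec d i \<in> W" if i: "i < d" for i
      proof -
        have hB: "h i0 \<in> B" "h i \<in> B" using hT i i0 by auto
        have "\<rho> 0 (h i0 - h i) 0 *\<^sub>v unit_vec d i0 = unit_vec d i"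
        proof (rule eq_vecI)
          fix k assume "k < dim_vec (unit_vec d i :: complex vec)"
          then have k: "k < d" by simp
          have hk: "h k \<in> B" "h k + (h i0 - h i) \<in> B"
            using hT[OF k] hB by (auto intro!: add_subgroup_add[OF B] add_subgroup_diff[OF B])
          have "i0 = r (h k + (h i0 - h i)) \<longleftrightarrow> k = i"
          proof
            assume "i0 = r (h k + (h i0 - h i))"
            then have "h k + (h i0 - h i) - h i0 \<in> rad2 \<psi>" using r(2)[OF hk(2)] by simp
            then have "h k - h i \<in> rad2 \<psi>" by simp
            then show "k = i" using h_unique k i by blast
          next
            assume "k = i"
            then have "h k + (h i0 - h i) = h i0 + 0" by simp
            then show "i0 = r (h k + (h i0 - h i))" using r_self[OF i0(1) zero2] by simp
          qed
          moreover have "(\<rho> 0 (h i0 - h i) 0 *\<^sub>v unit_vec d i0) $ k = \<rho> 0 (h i0 - h i) 0 $$ (k, i0)"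
            using k i0 by (simp add: \<rho>_def)
          ultimately show "(\<rho> 0 (h i0 - h i) 0 *\<^sub>v unit_vec d i0) $ k = unit_vec d i $ k"
            using k i i0 hk hB add_subgroup_diff[OF B hB] \<psi>0 by (simp add: entry \<beta>_zero)
        qed (simp add: \<rho>_def)
        then show ?thesis using inv[OF zeros(1) add_subgroup_diff[OF B hB] zeros(3) u0] by simp
      qed
      have "v \<in> W" if v: "v \<in> carrier_vec d" for v
      proof -
        have "vec_sum d {..<d} (\<lambda>j. v $ j \<cdot>\<^sub>v unit_vec d j) \<in> W"
          by (rule vec_sum_mem[OF W]) (use units subspace_vecD(4)[OF W] in auto)
        then show ?thesis using vec_units[OF v] by simp
      qed
      then show ?thesis using subspace_vecD(1)[OF W] by blast
    qed
  qed
  have "heisenberg_irrep A B C \<beta> A0 B0 C0 d \<rho>"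
    by unfold_locales (rule rep irr level)+
  moreover have "central_char \<rho> = \<psi>"
  proof
    fix c
    show "central_char \<rho> c = \<psi> c"
    proof (cases "c \<in> C")
      case True
      have "\<rho> 0 0 c $$ (0, 0) = \<psi> c" using d r_self[OF d zero2] hT[OF d] zeros by (simp add: entry \<beta>_zero)
      then show ?thesis using True by (simp add: central_char_def)
    next
      case False then show ?thesis using add_char_outside[OF \<psi>(1)] by (simp add: central_char_def)
    qed
  qed
  ultimately show ?thesis by blast
qed

end

subsection \<open>Lattices over a discrete valuation ring\<close>

context dvr
begin

lemma D_subgroup: "add_subgroup D"
  using D_diff D_diff[OF D_one D_one] by (simp add: add_subgroup_def)

lemma D_power: "x \<in> D \<Longrightarrow> x ^ k \<in> D"
  by (induction k) (auto simp: D_one D_mult)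

lemmas D_zero = add_subgroup_zero[OF D_subgroup]

abbreviation "P k \<equiv> (*) (\<pi> ^ k) ` D"

lemmas P_subgroup = mult_image_subgroup[OF D_subgroup]

lemma P_sub: "P k \<subseteq> D"
  using D_mult D_power[OF \<pi>_D] by auto

lemma P_mult: "x \<in> D \<Longrightarrow> y \<in> P k \<Longrightarrow> x * y \<in> P k"
  using D_mult by (auto simp: mult.left_commute)

lemma P_mono: "k \<le> l \<Longrightarrow> P l \<subseteq> P k"
proof
  fix x assume "k \<le> l" "x \<in> P l"
  then obtain y where "x = \<pi> ^ k * (\<pi> ^ (l - k) * y)" "y \<in> D"
    by (auto simp: mult.assoc[symmetric] power_add[symmetric])
  then show "x \<in> P k" using D_mult[OF D_power[OF \<pi>_D]] by blast
qed

definition q :: nat where "q = subgroup_index D ((*) \<pi> ` D)"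

text \<open>Multiplication by \<open>\<pi> ^ k\<close> identifies the residue field with the
  \<open>k\<close>-th layer of the filtration by powers of \<open>\<pi>\<close>.\<close>

lemma P_index: "finite_index D (P k)" "subgroup_index D (P k) = q ^ k"
proof (induction k)
  case 0
  have "P 0 = D" by simp
  then show "finite_index D (P 0)" "subgroup_index D (P 0) = q ^ 0"
    using subgroup_index_refl[OF D_subgroup] by simp_all
next
  case (Suc k)
  have iff: "x - y \<in> (*) \<pi> ` D \<longleftrightarrow> \<pi> ^ k * x - \<pi> ^ k * y \<in> P (Suc k)" for x y
  proof -
    have "\<pi> ^ k * x - \<pi> ^ k * y \<in> P (Suc k) \<longleftrightarrow> (\<exists>z\<in>D. \<pi> ^ k * (x - y) = \<pi> ^ k * (\<pi> * z))"
      by (auto simp: algebra_simps image_iff)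
    also have "\<dots> \<longleftrightarrow> (\<exists>z\<in>D. x - y = \<pi> * z)" using \<pi>_nonzero by simp
    finally show ?thesis by (auto simp: image_iff)
  qed
  have surj: "\<exists>x\<in>D. z - \<pi> ^ k * x \<in> P (Suc k)" if z: "z \<in> P k" for z
  proof -
    obtain x where "x \<in> D" "z = \<pi> ^ k * x" using z by blast
    then show ?thesis using add_subgroup_zero[OF P_subgroup] by (intro bexI[of _ x]) auto
  qed
  have c: "subgroup_index D ((*) \<pi> ` D) = subgroup_index (P k) (P (Suc k))"
    "finite_index D ((*) \<pi> ` D) \<longleftrightarrow> finite_index (P k) (P (Suc k))"
    by (rule subgroup_index_cong[where f = "(*) (\<pi> ^ k)", OF P_subgroup[of \<pi>] P_subgroup[of "\<pi> ^ Suc k"] _ iff surj]; blast)+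
  note m = subgroup_index_mult[OF D_subgroup P_subgroup P_subgroup P_sub P_mono[of k "Suc k"] Suc(1)]
  show "finite_index D (P (Suc k))" using m(1) c(2) D_fin by simp
  show "subgroup_index D (P (Suc k)) = q ^ Suc k" using m(2) c D_fin Suc(2) by (simp add: q_def)
qed

text \<open>The free module of vectors divisible by \<open>\<pi> ^ k\<close>. Vanishing outside
  \<open>I\<close> turns equality of vectors into equality of functions, and addition is
  pointwise.\<close>

definition lat :: "'i set \<Rightarrow> nat \<Rightarrow> ('i \<Rightarrow> complex) set" where
  "lat I k = {f. (\<forall>i\<in>I. f i \<in> P k) \<and> (\<forall>i. i \<notin> I \<longrightarrow> f i = 0)}"

lemma lat_subgroup: "add_subgroup (lat I k)"
  unfolding add_subgroup_def
proof (intro conjI ballI)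
  show "0 \<in> lat I k" using add_subgroup_zero[OF P_subgroup] by (simp add: lat_def)
  fix f g assume "f \<in> lat I k" "g \<in> lat I k"
  then show "f - g \<in> lat I k" using add_subgroup_diff[OF P_subgroup] by (simp add: lat_def)
qed

lemma lat_mono: "k \<le> l \<Longrightarrow> lat I l \<subseteq> lat I k"
  using subsetD[OF P_mono, of k l] unfolding lat_def by blast

lemma lat_0: "f \<in> lat I 0 \<longleftrightarrow> (\<forall>i\<in>I. f i \<in> D) \<and> (\<forall>i. i \<notin> I \<longrightarrow> f i = 0)"
  by (simp add: lat_def)

lemma lat_index:
  assumes "finite I"
  shows "finite_index (lat I 0) (lat I k)" "subgroup_index (lat I 0) (lat I k) = q ^ (k * card I)"
proof -
  obtain T where T: "transversal D (P k) T" using obtain_transversal[OF P_subgroup] by blast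
  have finT: "finite T" "card T = q ^ k" using transversal_index[OF P_subgroup T] P_index[of k] by auto
  define e where "e t i = (if i \<in> I then t i else 0)" for t :: "'a \<Rightarrow> complex" and i
  have tr: "transversal (lat I 0) (lat I k) (e ` (I \<rightarrow>\<^sub>E T))"
    unfolding transversal_def
  proof (intro conjI ballI impI)
    show "e ` (I \<rightarrow>\<^sub>E T) \<subseteq> lat I 0"
      using subsetD[OF transversal_sub[OF T]] by (auto simp: e_def lat_0 PiE_def Pi_def)
  next
    fix f assume f: "f \<in> lat I 0"
    have "\<forall>i\<in>I. \<exists>t\<in>T. f i - t \<in> P k" using f transversal_ex[OF T] by (simp add: lat_0)
    then obtain t where t: "\<And>i. i \<in> I \<Longrightarrow> t i \<in> T \<and> f i - t i \<in> P k" by metis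
    have "f - e (restrict t I) \<in> lat I k" using t f by (auto simp: lat_def e_def)
    moreover have "restrict t I \<in> I \<rightarrow>\<^sub>E T" using t by auto
    ultimately show "\<exists>t\<in>e ` (I \<rightarrow>\<^sub>E T). f - t \<in> lat I k" by blast
  next
    fix f g assume "f \<in> e ` (I \<rightarrow>\<^sub>E T)" "g \<in> e ` (I \<rightarrow>\<^sub>E T)" "f - g \<in> lat I k"
    then obtain s t where st: "f = e s" "g = e t" "s \<in> I \<rightarrow>\<^sub>E T" "t \<in> I \<rightarrow>\<^sub>E T" by blast
    have "s i = t i" if "i \<in> I" for i
    proof (rule transversal_unique[OF T])
      show "s i \<in> T" "t i \<in> T" using st that by auto
      have "(f - g) i \<in> P k" using \<open>f - g \<in> lat I k\<close> that by (simp add: lat_def)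
      then show "s i - t i \<in> P k" using st that by (simp add: e_def)
    qed
    then show "f = g" using st by (auto simp: e_def)
  qed
  have inj: "inj_on e (I \<rightarrow>\<^sub>E T)"
  proof (rule inj_onI)
    fix s t assume st: "s \<in> I \<rightarrow>\<^sub>E T" "t \<in> I \<rightarrow>\<^sub>E T" "e s = e t"
    have "s i = t i" if "i \<in> I" for i using fun_cong[OF st(3), of i] that by (simp add: e_def)
    then show "s = t" using st(1,2) by (intro PiE_ext) auto
  qed
  show "finite_index (lat I 0) (lat I k)"
    using transversal_index(2)[OF lat_subgroup tr] assms finT by (simp add: finite_PiE)
  show "subgroup_index (lat I 0) (lat I k) = q ^ (k * card I)"
    using transversal_index(1)[OF lat_subgroup tr] assms finT
    by (simp add: card_image[OF inj] card_PiE power_mult)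
qed

end

section \<open>The Heisenberg group over the localization as an approximation of the group of
  points\<close>

locale unipotent_completion = dvr_completion D \<pi> R T res
  for D \<pi> and R :: "(nat \<Rightarrow> 'c) ring" and T res +
  fixes m n :: nat
begin

definition outer :: "(nat \<Rightarrow> complex) \<Rightarrow> (nat \<Rightarrow> complex) \<Rightarrow> nat \<times> nat \<Rightarrow> complex" where
  "outer a b = (\<lambda>(i, j). a i * b j)"

abbreviation "VA \<equiv> lat {..<m}"
abbreviation "VB \<equiv> lat {..<n}"
abbreviation "VC \<equiv> lat ({..<m} \<times> {..<n})"

lemma outer_level:
  assumes "a \<in> VA 0" "b \<in> VB 0" "a \<in> VA k \<or> b \<in> VB k" shows "outer a b \<in> VC k"
proof -
  have "a i * b j \<in> P k" if "i < m" "j < n" for i j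
  proof (cases "a \<in> VA k")
    case True
    then have "b j * a i \<in> P k" using assms(2) that by (intro P_mult) (auto simp: lat_def)
    then show ?thesis by (simp add: mult.commute)
  next
    case False
    then show ?thesis using assms that by (intro P_mult) (auto simp: lat_def)
  qed
  then show ?thesis using assms by (auto simp: outer_def lat_def)
qed

sublocale heisenberg "VA 0" "VB 0" "VC 0" outer
proof
  show "outer a b \<in> VC 0" if "a \<in> VA 0" "b \<in> VB 0" for a b using that by (intro outer_level) auto
qed (auto simp: lat_subgroup outer_def algebra_simps)

lemma heisenberg_level: "heisenberg_level (VA 0) (VB 0) (VC 0) outer (VA k) (VB k) (VC k)"
  by unfold_locales (auto simp: lat_subgroup lat_index intro: subsetD[OF lat_mono[of 0 k]])

abbreviation "irrep k \<equiv> heisenberg_irrep (VA 0) (VB 0) (VC 0) outer (VA k) (VB k) (VC k)"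

abbreviation "G \<equiv> unipotent_group m n R"
abbreviation "TG \<equiv> unipotent_topology m n T"

text \<open>An element over the completion is approximated at level \<open>k\<close> by a triple
  over \<open>D\<close>. Approximants exist by \<open>close_ex\<close> and are unique up to level
  \<open>k\<close> by \<open>close_unique\<close>.\<close>

definition close :: "nat \<Rightarrow> (nat \<Rightarrow> 'c) triple \<Rightarrow> (nat \<Rightarrow> complex) \<Rightarrow> (nat \<Rightarrow> complex) \<Rightarrow> (nat \<times> nat \<Rightarrow> complex) \<Rightarrow> bool" where
  "close k = (\<lambda>(a, b, c) a0 b0 c0. (\<forall>i<m. a i k = res k (a0 i)) \<and> (\<forall>j<n. b j k = res k (b0 j)) \<and>
     (\<forall>i<m. \<forall>j<n. c (i, j) k = res k (c0 (i, j))))"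

definition emb :: "(nat \<Rightarrow> complex) \<Rightarrow> (nat \<Rightarrow> complex) \<Rightarrow> (nat \<times> nat \<Rightarrow> complex) \<Rightarrow> (nat \<Rightarrow> 'c) triple" where
  "emb a b c = (\<lambda>i\<in>{..<m}. \<lambda>k. res k (a i), \<lambda>j\<in>{..<n}. \<lambda>k. res k (b j), \<lambda>ij\<in>{..<m} \<times> {..<n}. \<lambda>k. res k (c ij))"

lemma carrier_G: "(a, b, c) \<in> carrier G \<longleftrightarrow> a \<in> {..<m} \<rightarrow>\<^sub>E carrier R \<and> b \<in> {..<n} \<rightarrow>\<^sub>E carrier R \<and>
    c \<in> {..<m} \<times> {..<n} \<rightarrow>\<^sub>E carrier R"
  by (simp add: unipotent_group_def)

lemma emb_carrier: "a \<in> VA 0 \<Longrightarrow> b \<in> VB 0 \<Longrightarrow> c \<in> VC 0 \<Longrightarrow> emb a b c \<in> carrier G"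
  by (auto simp: emb_def carrier_G lat_0 intro!: res_in_R)

lemma emb_close: "close k (emb a b c) a b c"
  by (simp add: close_def emb_def)

lemma emb_eqI:
  assumes "g \<in> carrier G" "\<And>k. close k g a b c" shows "g = emb a b c"
proof -
  obtain a' b' c' where g: "g = (a', b', c')" by (cases g) auto
  have "a' = (\<lambda>i\<in>{..<m}. \<lambda>k. res k (a i))"
    by (rule extensionalityI[of _ "{..<m}"])
      (use assms in \<open>auto simp: g close_def carrier_G PiE_def\<close>)
  moreover have "b' = (\<lambda>i\<in>{..<n}. \<lambda>k. res k (b i))"
    by (rule extensionalityI[of _ "{..<n}"])
      (use assms in \<open>auto simp: g close_def carrier_G PiE_def\<close>)
  moreover have "c' = (\<lambda>ij\<in>{..<m} \<times> {..<n}. \<lambda>k. res k (c ij))"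
    by (rule extensionalityI[of _ "{..<m} \<times> {..<n}"])
      (use assms in \<open>auto simp: g close_def carrier_G PiE_def\<close>)
  ultimately show ?thesis by (simp add: g emb_def)
qed

lemma close_ex:
  assumes "g \<in> carrier G" obtains a b c where "a \<in> VA 0" "b \<in> VB 0" "c \<in> VC 0" "close k g a b c"
proof -
  obtain a' b' c' where g: "g = (a', b', c')" by (cases g) auto
  define s where "s f = (SOME x. x \<in> D \<and> f k = res k x)" for f
  have s: "s f \<in> D" "f k = res k (s f)" if "f \<in> carrier R" for f
  proof -
    have "\<exists>x. x \<in> D \<and> f k = res k x" using R_res[OF that, of k] by blast
    from someI_ex[OF this] show "s f \<in> D" "f k = res k (s f)" by (simp_all add: s_def)
  qed
  have mem: "\<And>i. i < m \<Longrightarrow> a' i \<in> carrier R" "\<And>i. i < n \<Longrightarrow> b' i \<in> carrier R"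
    "\<And>i j. i < m \<Longrightarrow> j < n \<Longrightarrow> c' (i, j) \<in> carrier R"
    using assms by (auto simp: g carrier_G)
  show ?thesis
  proof (rule that)
    show "(\<lambda>i. if i < m then s (a' i) else 0) \<in> VA 0" using s mem by (simp add: lat_0)
    show "(\<lambda>i. if i < n then s (b' i) else 0) \<in> VB 0" using s mem by (simp add: lat_0)
    show "(\<lambda>(i, j). if i < m \<and> j < n then s (c' (i, j)) else 0) \<in> VC 0" using s mem by (auto simp: lat_0)
    show "close k g (\<lambda>i. if i < m then s (a' i) else 0) (\<lambda>i. if i < n then s (b' i) else 0)
        (\<lambda>(i, j). if i < m \<and> j < n then s (c' (i, j)) else 0)"
      unfolding close_def g using s(2) mem by simp
  qed
qed

lemma close_unique:
  assumes "a \<in> VA 0" "b \<in> VB 0" "c \<in> VC 0" "close k g a b c"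
    and "a' \<in> VA 0" "b' \<in> VB 0" "c' \<in> VC 0" "close k g a' b' c'"
  shows "a' - a \<in> VA k" "b' - b \<in> VB k" "c' - c \<in> VC k"
proof -
  obtain x y z where g: "g = (x, y, z)" by (cases g) auto
  have "a' i - a i \<in> P k" if "i < m" for i
    using assms that res_eq_iff[of "a' i" "a i" k] by (simp add: g close_def lat_0)
  then show "a' - a \<in> VA k" using assms(1,5) by (simp add: lat_def)
  have "b' i - b i \<in> P k" if "i < n" for i
    using assms that res_eq_iff[of "b' i" "b i" k] by (simp add: g close_def lat_0)
  then show "b' - b \<in> VB k" using assms(2,6) by (simp add: lat_def)
  have "c' (i, j) - c (i, j) \<in> P k" if "i < m" "j < n" for i j
    using assms that res_eq_iff[of "c' (i, j)" "c (i, j)" k] by (simp add: g close_def lat_0)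
  then show "c' - c \<in> VC k" using assms(3,7) by (auto simp: lat_def)
qed

lemma mult_close:
  assumes "g \<in> carrier G" "a \<in> VA 0" "b \<in> VB 0" "c \<in> VC 0" "close k g a b c"
    and "g' \<in> carrier G" "a' \<in> VA 0" "b' \<in> VB 0" "c' \<in> VC 0" "close k g' a' b' c'"
  shows "close k (g \<otimes>\<^bsub>G\<^esub> g') (a + a') (b + b') (c + c' + outer a b')"
proof -
  obtain x y z where g: "g = (x, y, z)" by (cases g) auto
  obtain x' y' z' where g': "g' = (x', y', z')" by (cases g') auto
  have mem: "\<And>i. i < m \<Longrightarrow> x i \<in> carrier R \<and> x' i \<in> carrier R \<and> a i \<in> D \<and> a' i \<in> D"
    "\<And>i. i < n \<Longrightarrow> y i \<in> carrier R \<and> y' i \<in> carrier R \<and> b i \<in> D \<and> b' i \<in> D"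
    "\<And>i j. i < m \<Longrightarrow> j < n \<Longrightarrow> z (i, j) \<in> carrier R \<and> z' (i, j) \<in> carrier R \<and> c (i, j) \<in> D \<and> c' (i, j) \<in> D"
    using assms by (auto simp: g g' carrier_G lat_0)
  have cl: "\<And>i. i < m \<Longrightarrow> x i k = res k (a i) \<and> x' i k = res k (a' i)"
    "\<And>i. i < n \<Longrightarrow> y i k = res k (b i) \<and> y' i k = res k (b' i)"
    "\<And>i j. i < m \<Longrightarrow> j < n \<Longrightarrow> z (i, j) k = res k (c (i, j)) \<and> z' (i, j) k = res k (c' (i, j))"
    using assms(5,10) by (auto simp: g g' close_def)
  have "(z (i, j) \<oplus>\<^bsub>R\<^esub> z' (i, j) \<oplus>\<^bsub>R\<^esub> x i \<otimes>\<^bsub>R\<^esub> y' j) k = res k (c (i, j) + c' (i, j) + a i * b' j)"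
    if "i < m" "j < n" for i j
    using mem cl that
    by (intro R_add R_mult R_add_closed R_mult_closed D_mult add_subgroup_add[OF D_subgroup]) auto
  moreover have "(x i \<oplus>\<^bsub>R\<^esub> x' i) k = res k (a i + a' i)" if "i < m" for i
    using mem cl that by (intro R_add) auto
  moreover have "(y i \<oplus>\<^bsub>R\<^esub> y' i) k = res k (b i + b' i)" if "i < n" for i
    using mem cl that by (intro R_add) auto
  ultimately show ?thesis by (simp add: g g' close_def unipotent_group_def outer_def)
qed

lemma mult_closed:
  assumes "g \<in> carrier G" "g' \<in> carrier G" shows "g \<otimes>\<^bsub>G\<^esub> g' \<in> carrier G"
proof -
  obtain x y z where g: "g = (x, y, z)" by (cases g) auto
  obtain x' y' z' where g': "g' = (x', y', z')" by (cases g') auto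
  have mem: "\<And>i. i < m \<Longrightarrow> x i \<in> carrier R \<and> x' i \<in> carrier R"
    "\<And>i. i < n \<Longrightarrow> y i \<in> carrier R \<and> y' i \<in> carrier R"
    "\<And>i j. i < m \<Longrightarrow> j < n \<Longrightarrow> z (i, j) \<in> carrier R \<and> z' (i, j) \<in> carrier R"
    using assms by (auto simp: g g' carrier_G)
  then show ?thesis
    by (auto simp: g g' unipotent_group_def intro!: R_add_closed R_mult_closed)
qed

lemma emb_mult:
  assumes "a \<in> VA 0" "b \<in> VB 0" "c \<in> VC 0" "a' \<in> VA 0" "b' \<in> VB 0" "c' \<in> VC 0"
  shows "emb a b c \<otimes>\<^bsub>G\<^esub> emb a' b' c' = emb (a + a') (b + b') (c + c' + outer a b')"
  using assms by (intro emb_eqI mult_closed mult_close emb_carrier emb_close)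

lemma closed_VABC:
  assumes "a \<in> VA 0" "b \<in> VB 0" "c \<in> VC 0" "a' \<in> VA 0" "b' \<in> VB 0" "c' \<in> VC 0"
  shows "a + a' \<in> VA 0" "b + b' \<in> VB 0" "c + c' + outer a b' \<in> VC 0" "a' - a \<in> VA 0" "b' - b \<in> VB 0"
    "c' - c - outer a (b' - b) \<in> VC 0" "- a \<in> VA 0" "- b \<in> VB 0" "outer a b - c \<in> VC 0"
  using assms
  by (auto intro!: add_subgroup_add[OF lat_subgroup] add_subgroup_diff[OF lat_subgroup]
      add_subgroup_uminus[OF lat_subgroup] \<beta>_C)

subsection \<open>Continuity\<close>

text \<open>These sets form a basis of open neighbourhoods of \<open>g\<close>, by
  \<open>open_same_class\<close> and \<open>open_contains_same_class\<close>.\<close>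

definition same_class :: "nat \<Rightarrow> (nat \<Rightarrow> 'c) triple \<Rightarrow> (nat \<Rightarrow> 'c) triple set" where
  "same_class k = (\<lambda>(a, b, c). PiE {..<m} (\<lambda>i. {h \<in> carrier R. h k = a i k}) \<times>
     PiE {..<n} (\<lambda>i. {h \<in> carrier R. h k = b i k}) \<times>
     PiE ({..<m} \<times> {..<n}) (\<lambda>i. {h \<in> carrier R. h k = c i k}))"

lemma topspace_TG: "topspace TG = carrier G"
  by (simp add: unipotent_topology_def topspace_T unipotent_group_def)

lemma same_class_self: "g \<in> carrier G \<Longrightarrow> g \<in> same_class k g"
  by (cases g) (auto simp: same_class_def carrier_G PiE_def Pi_def)

lemma same_class_carrier: "same_class k g \<subseteq> carrier G"
proof
  fix h assume "h \<in> same_class k g"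
  then show "h \<in> carrier G"
    by (cases g; cases h) (auto simp: same_class_def carrier_G PiE_def Pi_def)
qed

lemma same_class_close:
  assumes "h \<in> same_class k g" shows "close k h a b c \<longleftrightarrow> close k g a b c"
  using assms by (cases g; cases h) (auto simp: same_class_def close_def PiE_def Pi_def)

lemma open_same_class: assumes "g \<in> carrier G" shows "openin TG (same_class k g)"
proof -
  obtain a b c where g: "g = (a, b, c)" by (cases g) auto
  have *: "openin (product_topology (\<lambda>_. T) I) (PiE I (\<lambda>i. {h \<in> carrier R. h k = f i k}))"
    if "finite I" "f \<in> I \<rightarrow>\<^sub>E carrier R" for I :: "'i set" and f
    unfolding openin_PiE[OF that(1)] using open_class that(2) by (blast intro: PiE_mem)
  have mem: "a \<in> {..<m} \<rightarrow>\<^sub>E carrier R" "b \<in> {..<n} \<rightarrow>\<^sub>E carrier R" "c \<in> {..<m} \<times> {..<n} \<rightarrow>\<^sub>E carrier R"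
    using assms unfolding g carrier_G by blast+
  show ?thesis
    unfolding unipotent_topology_def same_class_def g prod.case openin_prod_Times_iff
    using *[OF _ mem(1)] *[OF _ mem(2)] *[OF _ mem(3)] by blast
qed

lemma coherent_le:
  assumes "f \<in> carrier R" "g \<in> carrier R" "k \<le> l" "f l = g l" shows "f k = g k"
  using assms(3,4)
proof (induction l rule: dec_induct)
  case (step l)
  obtain x where x: "x \<in> D" "f (Suc l) = res (Suc l) x" using R_res[OF assms(1)] by blast
  have "f l = res l x" by (rule R_coherent[OF assms(1) x])
  moreover have "g (Suc l) = res (Suc l) x" using x(2) step.prems by simp
  then have "g l = res l x" by (rule R_coherent[OF assms(2) x(1)])
  ultimately show ?case using step.IH by metis
qed

lemma product_open_contains:
  fixes I :: "'i set"
  assumes I: "finite I" and U: "openin (product_topology (\<lambda>_. T) I) U" "f \<in> U"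
  shows "\<exists>k. \<forall>l\<ge>k. PiE I (\<lambda>i. {h \<in> carrier R. h l = f i l}) \<subseteq> U"
proof -
  from U(1)[unfolded openin_product_topology_alt, rule_format, OF U(2)]
  obtain V where V: "\<forall>i\<in>I. openin T (V i)" "f \<in> PiE I V" "PiE I V \<subseteq> U"
    by (elim exE conjE) simp
  have ex: "\<exists>k. \<forall>g\<in>carrier R. g k = f i k \<longrightarrow> g \<in> V i" if i: "i \<in> I" for i
  proof (rule open_contains_class)
    show "openin T (V i)" using V(1) i by (rule bspec)
    show "f i \<in> V i" using V(2) i by (rule PiE_mem)
  qed
  define k where "k i = (SOME k. \<forall>g\<in>carrier R. g k = f i k \<longrightarrow> g \<in> V i)" for i
  have k: "g \<in> V i" if "i \<in> I" "g \<in> carrier R" "g (k i) = f i (k i)" for i g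
    using someI_ex[OF ex[OF that(1)]] that(2,3) unfolding k_def by blast
  have fR: "f i \<in> carrier R" if "i \<in> I" for i
  proof -
    have "V i \<subseteq> carrier R" using openin_subset[OF bspec[OF V(1) that]] topspace_T by simp
    then show ?thesis using PiE_mem[OF V(2) that] by blast
  qed
  \<comment> \<open>Any place beyond all \<open>k i\<close> will do, because coherence passes
    equality down to earlier places.\<close>
  have "PiE I (\<lambda>i. {h \<in> carrier R. h l = f i l}) \<subseteq> U" if l: "l \<ge> Max (k ` I)" for l
  proof
    fix g assume g: "g \<in> PiE I (\<lambda>i. {h \<in> carrier R. h l = f i l})"
    have "g i \<in> V i" if i: "i \<in> I" for i
    proof (rule k[OF i])
      have gi: "g i \<in> {h \<in> carrier R. h l = f i l}" using PiE_mem[OF g i] .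
      then show gR: "g i \<in> carrier R" by simp
      have "k i \<le> Max (k ` I)" using I i by (intro Max_ge) auto
      then have "k i \<le> l" using l by (rule order_trans)
      then show "g i (k i) = f i (k i)"
        by (rule coherent_le[OF gR fR[OF i]]) (use gi in blast)
    qed
    moreover have "g i = undefined" if "i \<notin> I" for i using PiE_arb[OF g that] .
    ultimately have "g \<in> PiE I V" by (intro PiE_I)
    then show "g \<in> U" using V(3) by (rule subsetD[rotated])
  qed
  then show ?thesis by blast
qed

lemma open_contains_same_class:
  assumes "openin TG U" "g \<in> U" shows "\<exists>k. same_class k g \<subseteq> U"
proof -
  obtain a b c where g: "g = (a, b, c)" by (cases g) auto
  obtain U1 V where 1: "openin (product_topology (\<lambda>_. T) {..<m}) U1" "a \<in> U1" "(b, c) \<in> V" "U1 \<times> V \<subseteq> U"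
    "openin (prod_topology (product_topology (\<lambda>_. T) {..<n}) (product_topology (\<lambda>_. T) ({..<m} \<times> {..<n}))) V"
    using assms(1)[unfolded unipotent_topology_def
        openin_prod_topology_alt[of "product_topology (\<lambda>_. T) {..<m}"], rule_format, OF assms(2)[unfolded g]]
    by (elim exE conjE) (rule that)
  obtain U2 U3 where 2: "openin (product_topology (\<lambda>_. T) {..<n}) U2" "b \<in> U2"
    "openin (product_topology (\<lambda>_. T) ({..<m} \<times> {..<n})) U3" "c \<in> U3" "U2 \<times> U3 \<subseteq> V"
    using 1(5)[unfolded openin_prod_topology_alt, rule_format, OF 1(3)] by (elim exE conjE) (rule that)
  obtain k1 where k1: "\<And>l. l \<ge> k1 \<Longrightarrow> PiE {..<m} (\<lambda>i. {h \<in> carrier R. h l = a i l}) \<subseteq> U1"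
    using product_open_contains[OF _ 1(1,2)] by blast
  obtain k2 where k2: "\<And>l. l \<ge> k2 \<Longrightarrow> PiE {..<n} (\<lambda>i. {h \<in> carrier R. h l = b i l}) \<subseteq> U2"
    using product_open_contains[OF _ 2(1,2)] by blast
  obtain k3 where k3: "\<And>l. l \<ge> k3 \<Longrightarrow> PiE ({..<m} \<times> {..<n}) (\<lambda>i. {h \<in> carrier R. h l = c i l}) \<subseteq> U3"
    using product_open_contains[OF _ 2(3,4)] by blast
  let ?k = "max k1 (max k2 k3)"
  have "same_class ?k g \<subseteq> U1 \<times> U2 \<times> U3"
    unfolding same_class_def g prod.case by (intro Sigma_mono k1 k2 k3) auto
  then show ?thesis using 1(4) 2(5) by blast
qed

lemma continuous_if_locally_constant:
  assumes "\<And>g h. g \<in> carrier G \<Longrightarrow> h \<in> same_class k g \<Longrightarrow> \<phi> h = \<phi> g"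
  shows "continuous_map TG euclidean (\<phi> :: _ \<Rightarrow> complex)"
  unfolding continuous_map_def topspace_TG
proof (intro conjI allI impI)
  show "\<phi> \<in> carrier G \<rightarrow> topspace euclidean" by simp
  fix U :: "complex set"
  show "openin TG {x \<in> carrier G. \<phi> x \<in> U}"
  proof (subst openin_subopen, intro ballI)
    fix g assume g: "g \<in> {x \<in> carrier G. \<phi> x \<in> U}"
    have "same_class k g \<subseteq> {x \<in> carrier G. \<phi> x \<in> U}"
    proof
      fix h assume h: "h \<in> same_class k g"
      then show "h \<in> {x \<in> carrier G. \<phi> x \<in> U}" using g assms[OF _ h] subsetD[OF same_class_carrier h] by auto
    qed
    then show "\<exists>V. openin TG V \<and> g \<in> V \<and> V \<subseteq> {x \<in> carrier G. \<phi> x \<in> U}"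
      using open_same_class[of g k] same_class_self[of g k] g by auto
  qed
qed

lemma continuous_near:
  assumes "continuous_map TG euclidean (\<phi> :: _ \<Rightarrow> complex)" "g \<in> carrier G" "e > 0"
  shows "\<exists>k. \<forall>h\<in>same_class k g. norm (\<phi> h - \<phi> g) < e"
proof -
  have "openin TG {x \<in> topspace TG. \<phi> x \<in> ball (\<phi> g) e}"
    by (rule openin_continuous_map_preimage[OF assms(1)]) simp
  moreover have "g \<in> {x \<in> topspace TG. \<phi> x \<in> ball (\<phi> g) e}" using assms by (simp add: topspace_TG)
  ultimately obtain k where "same_class k g \<subseteq> {x \<in> topspace TG. \<phi> x \<in> ball (\<phi> g) e}"
    using open_contains_same_class by blast
  then have "norm (\<phi> h - \<phi> g) < e" if "h \<in> same_class k g" for h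
    using that by (auto simp: dist_norm norm_minus_commute)
  then show ?thesis by blast
qed

lemma same_class_antimono:
  assumes "g \<in> carrier G" "k \<le> l" shows "same_class l g \<subseteq> same_class k g"
proof
  fix h assume h: "h \<in> same_class l g"
  obtain a b c where g: "g = (a, b, c)" by (cases g) auto
  have *: "f' \<in> PiE I (\<lambda>i. {h \<in> carrier R. h k = f i k})"
    if "f' \<in> PiE I (\<lambda>i. {h \<in> carrier R. h l = f i l})" "f \<in> I \<rightarrow>\<^sub>E carrier R" for I :: "'i set" and f f'
  proof (rule PiE_I)
    fix i assume i: "i \<in> I"
    then have "f' i \<in> carrier R" "f i \<in> carrier R" "f' i l = f i l" using that by auto
    then show "f' i \<in> {h \<in> carrier R. h k = f i k}" using coherent_le[OF _ _ assms(2)] by simp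
  qed (use that in \<open>auto simp: PiE_def extensional_def\<close>)
  show "h \<in> same_class k g"
    using h assms(1) unfolding same_class_def g prod.case carrier_G by (auto intro!: *)
qed

text \<open>Small subgroups: the entries of \<open>X = \<rho> h - 1\<close> satisfy \<open>2 X = (\<rho> (h\<^sup>2) - 1) - X\<^sup>2\<close>, so a uniform bound
  on them over a subgroup improves by a constant factor.\<close>

lemma continuous_rep_level:
  assumes \<rho>: "continuous_representation G TG d \<rho>"
  shows "\<exists>k. \<forall>h\<in>carrier G. close k h 0 0 0 \<longrightarrow> \<rho> h = 1\<^sub>m d"
proof -
  have hom: "\<rho> (g \<otimes>\<^bsub>G\<^esub> h) = \<rho> g * \<rho> h" if "g \<in> carrier G" "h \<in> carrier G" for g h
    using \<rho> that by (auto simp: continuous_representation_def hom_def units_of_def ring_mat_simps)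
  have car: "\<rho> g \<in> carrier_mat d d" if "g \<in> carrier G" for g
    using \<rho> that by (auto simp: continuous_representation_def hom_def units_of_def ring_mat_simps Units_def)
  have unit: "\<exists>Y\<in>carrier_mat d d. Y * \<rho> g = 1\<^sub>m d" if "g \<in> carrier G" for g
    using \<rho> that by (auto simp: continuous_representation_def hom_def units_of_def ring_mat_simps Units_def)
  define e where "e = emb 0 0 0"
  have e: "e \<in> carrier G" unfolding e_def by (intro emb_carrier zeros)
  have "e \<otimes>\<^bsub>G\<^esub> e = e" using emb_mult[OF zeros zeros] zeros by (simp add: e_def \<beta>_zero)
  then have ee: "\<rho> e * \<rho> e = \<rho> e" using hom[OF e e] by simp
  obtain Y where Y: "Y \<in> carrier_mat d d" "Y * \<rho> e = 1\<^sub>m d" using unit[OF e] by blast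
  \<comment> \<open>An idempotent that is invertible is the identity.\<close>
  have \<rho>e: "\<rho> e = 1\<^sub>m d"
  proof -
    have "Y * \<rho> e = Y * (\<rho> e * \<rho> e)" using ee by simp
    also have "\<dots> = (Y * \<rho> e) * \<rho> e" by (rule assoc_mult_mat[OF Y(1) car[OF e] car[OF e], symmetric])
    finally show ?thesis using Y car[OF e] by simp
  qed
  \<comment> \<open>Chosen so that \<open>d * d\<close> entries of size at most
    \<open>\<epsilon>\<close> add up to at most 1/4, whatever \<open>d\<close> is.\<close>
  define \<epsilon> :: real where "\<epsilon> = 1 / (4 * (real d * real d + 1))"
  have \<epsilon>: "\<epsilon> > 0" unfolding \<epsilon>_def by (intro divide_pos_pos) (simp_all add: add_nonneg_pos)
  have "\<exists>k. \<forall>h\<in>same_class k e. norm (\<rho> h $$ ij - \<rho> e $$ ij) < \<epsilon>" if ij: "ij \<in> {..<d} \<times> {..<d}" for ij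
  proof -
    have "continuous_map TG euclidean (\<lambda>g. \<rho> g $$ ij)"
      using \<rho> ij by (cases ij) (auto simp: continuous_representation_def)
    from continuous_near[OF this e \<epsilon>] show ?thesis .
  qed
  then obtain k where k: "\<And>ij h. ij \<in> {..<d} \<times> {..<d} \<Longrightarrow> h \<in> same_class (k ij) e \<Longrightarrow> norm (\<rho> h $$ ij - \<rho> e $$ ij) < \<epsilon>"
    by metis
  define K where "K = Max (insert 0 (k ` ({..<d} \<times> {..<d})))"
  define \<Gamma> where "\<Gamma> = {h \<in> carrier G. close K h 0 0 0}"
  define N where "N h = (\<Sum>i<d. \<Sum>j<d. norm (\<rho> h $$ (i, j) - 1\<^sub>m d $$ (i, j)))" for h
  have \<Gamma>_sub: "h \<in> same_class K e" if "h \<in> \<Gamma>" for h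
  proof -
    obtain a b c where h: "h = (a, b, c)" by (cases h) auto
    have "h \<in> carrier G" "close K h 0 0 0" using that by (auto simp: \<Gamma>_def)
    then show ?thesis unfolding h carrier_G close_def
      by (auto simp: same_class_def e_def emb_def PiE_iff)
  qed
  have small: "N h \<le> 1 / 4" if h: "h \<in> \<Gamma>" for h
  proof -
    have "norm (\<rho> h $$ (i, j) - 1\<^sub>m d $$ (i, j)) \<le> \<epsilon>" if "i < d" "j < d" for i j
    proof -
      have "k (i, j) \<le> K" unfolding K_def using that by (intro Max_ge) auto
      then have "h \<in> same_class (k (i, j)) e" using same_class_antimono[OF e] \<Gamma>_sub[OF h] by blast
      then show ?thesis using k[of "(i, j)" h] that \<rho>e by simp
    qed
    then have "N h \<le> (\<Sum>i<d. \<Sum>j<d. \<epsilon>)" unfolding N_def by (intro sum_mono) auto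
    also have "\<dots> = (real d * real d) / (4 * (real d * real d + 1))" by (simp add: \<epsilon>_def)
    also have "\<dots> \<le> 1 / 4" by (simp add: divide_simps add_nonneg_pos)
    finally show ?thesis .
  qed
  have \<Gamma>_sq: "h \<otimes>\<^bsub>G\<^esub> h \<in> \<Gamma>" if h: "h \<in> \<Gamma>" for h
    using h mult_closed[of h h] mult_close[of h 0 0 0 K h 0 0 0] zeros by (auto simp: \<Gamma>_def \<beta>_zero)
  have step: "2 * N h \<le> N (h \<otimes>\<^bsub>G\<^esub> h) + N h * N h" if h: "h \<in> \<Gamma>" for h
  proof -
    have hG: "h \<in> carrier G" using h by (simp add: \<Gamma>_def)
    define X where "X i j = \<rho> h $$ (i, j) - 1\<^sub>m d $$ (i, j)" for i j
    have sq: "2 * X i j = (\<rho> (h \<otimes>\<^bsub>G\<^esub> h) $$ (i, j) - 1\<^sub>m d $$ (i, j)) - (\<Sum>l<d. X i l * X l j)" if ij: "i < d" "j < d" for i j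
    proof -
      have entry: "\<rho> h $$ (i, j) = X i j + (if i = j then 1 else 0)" if "i < d" "j < d" for i j
        using that by (simp add: X_def)
      have "\<rho> (h \<otimes>\<^bsub>G\<^esub> h) $$ (i, j) = (\<Sum>l<d. \<rho> h $$ (i, l) * \<rho> h $$ (l, j))"
        using hom[OF hG hG] car[OF hG] ij by (simp add: scalar_prod_def atLeast0LessThan)
      also have "\<dots> = (\<Sum>l<d. X i l * X l j + (if i = l then X l j else 0) + (if l = j then X i l else 0)
          + (if i = l then (if l = j then 1 else 0) else 0))"
        using ij by (intro sum.cong refl) (simp add: entry algebra_simps)
      also have "\<dots> = (\<Sum>l<d. X i l * X l j) + X i j + X i j + (if i = j then 1 else 0)"
        using ij by (simp add: sum.distrib)
      finally show ?thesis using ij by simp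
    qed
    have "2 * N h = (\<Sum>i<d. \<Sum>j<d. norm (2 * X i j))"
      by (simp only: N_def X_def[symmetric] norm_mult norm_numeral sum_distrib_left)
    also have "\<dots> \<le> (\<Sum>i<d. \<Sum>j<d. norm (\<rho> (h \<otimes>\<^bsub>G\<^esub> h) $$ (i, j) - 1\<^sub>m d $$ (i, j)) + (\<Sum>l<d. norm (X i l) * norm (X l j)))"
    proof (intro sum_mono)
      fix i j assume "i \<in> {..<d}" "j \<in> {..<d}"
      then have ij: "i < d" "j < d" by auto
      have "norm (\<Sum>l<d. X i l * X l j) \<le> (\<Sum>l<d. norm (X i l) * norm (X l j))"
        by (rule order_trans[OF norm_sum]) (simp add: norm_mult)
      then show "norm (2 * X i j) \<le> norm (\<rho> (h \<otimes>\<^bsub>G\<^esub> h) $$ (i, j) - 1\<^sub>m d $$ (i, j)) + (\<Sum>l<d. norm (X i l) * norm (X l j))"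
        unfolding sq[OF ij] by (intro order_trans[OF norm_triangle_ineq4] add_left_mono)
    qed
    also have "\<dots> = N (h \<otimes>\<^bsub>G\<^esub> h) + (\<Sum>i<d. \<Sum>j<d. \<Sum>l<d. norm (X i l) * norm (X l j))"
      by (simp add: N_def sum.distrib)
    also have "(\<Sum>i<d. \<Sum>j<d. \<Sum>l<d. norm (X i l) * norm (X l j)) = (\<Sum>i<d. \<Sum>l<d. norm (X i l) * (\<Sum>j<d. norm (X l j)))"
      unfolding sum_distrib_left by (intro sum.cong refl sum.swap)
    also have "\<dots> \<le> (\<Sum>i<d. \<Sum>l<d. norm (X i l) * N h)"
    proof (intro sum_mono mult_left_mono)
      fix i l assume "l \<in> {..<d}"
      then show "(\<Sum>j<d. norm (X l j)) \<le> N h"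
        unfolding N_def X_def by (intro member_le_sum[where f = "\<lambda>i. \<Sum>j<d. norm (\<rho> h $$ (i, j) - 1\<^sub>m d $$ (i, j))"]) (auto intro: sum_nonneg)
    qed simp
    also have "\<dots> = N h * N h" by (simp add: N_def X_def sum_distrib_right)
    finally show ?thesis by simp
  qed
  have N0: "0 \<le> N h" for h unfolding N_def by (intro sum_nonneg) auto
  \<comment> \<open>While \<open>N h\<close> is at most 1/4, the quadratic term is at most a quarter
    of \<open>N h\<close>. Hence 7/4 times \<open>N h\<close> is bounded by \<open>N\<close> at the
    square of \<open>h\<close>, and each round gains the factor 4/7.\<close>
  have bound: "\<forall>h\<in>\<Gamma>. N h \<le> (4 / 7) ^ p" for p :: nat
  proof (induction p)
    case 0
    show ?case
    proof
      fix h assume "h \<in> \<Gamma>"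
      then show "N h \<le> (4 / 7) ^ 0" using order_trans[OF small, of h 1] by simp
    qed
  next
    case (Suc p)
    show ?case
    proof
      fix h assume h: "h \<in> \<Gamma>"
      have "N h * N h \<le> N h * (1 / 4)" using small[OF h] N0 by (intro mult_left_mono)
      moreover have "N (h \<otimes>\<^bsub>G\<^esub> h) \<le> (4 / 7) ^ p" using Suc \<Gamma>_sq[OF h] by blast
      ultimately show "N h \<le> (4 / 7) ^ Suc p" using step[OF h] by simp
    qed
  qed
  have "\<rho> h = 1\<^sub>m d" if h: "h \<in> \<Gamma>" for h
  proof -
    have "N h \<le> 0"
    proof (rule LIMSEQ_le_const)
      show "(\<lambda>p. (4 / 7 :: real) ^ p) \<longlonglongrightarrow> 0" by (rule LIMSEQ_power_zero) simp
      show "\<exists>N0. \<forall>p\<ge>N0. N h \<le> (4 / 7) ^ p" using bound h by blast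
    qed
    then have "N h = 0" using N0[of h] by simp
    then have "\<forall>i<d. \<forall>j<d. norm (\<rho> h $$ (i, j) - 1\<^sub>m d $$ (i, j)) = 0"
      unfolding N_def by (subst (asm) sum_nonneg_eq_0_iff) (auto simp: sum_nonneg_eq_0_iff sum_nonneg)
    then show ?thesis using car[of h] h by (intro eq_matI) (auto simp: \<Gamma>_def)
  qed
  then show ?thesis unfolding \<Gamma>_def by blast
qed

end

section \<open>Twist classes and central characters\<close>

context unipotent_completion
begin

lemma continuous_representationD:
  assumes "continuous_representation G TG d \<rho>"
  shows "g \<in> carrier G \<Longrightarrow> h \<in> carrier G \<Longrightarrow> \<rho> (g \<otimes>\<^bsub>G\<^esub> h) = \<rho> g * \<rho> h"
    and "g \<in> carrier G \<Longrightarrow> \<rho> g \<in> carrier_mat d d"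
    and "g \<in> carrier G \<Longrightarrow> \<exists>Y\<in>carrier_mat d d. Y * \<rho> g = 1\<^sub>m d"
  using assms by (auto simp: continuous_representation_def hom_def units_of_def ring_mat_simps Units_def)

lemma irrep_mono: assumes "irrep k d \<rho>" "k \<le> l" shows "irrep l d \<rho>"
proof -
  interpret heisenberg_irrep "VA 0" "VB 0" "VC 0" outer "VA k" "VB k" "VC k" d \<rho> by fact
  interpret L: heisenberg_level "VA 0" "VB 0" "VC 0" outer "VA l" "VB l" "VC l" by (rule heisenberg_level)
  show ?thesis
  proof
    show "trivial_on (VA l) (VB l) (VC l) d \<rho>"
      using level lat_mono[OF assms(2), of "{..<m}"] lat_mono[OF assms(2), of "{..<n}"]
        lat_mono[OF assms(2), of "{..<m} \<times> {..<n}"] unfolding trivial_on_def by (meson subsetD)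
  qed (rule rep irr)+
qed

text \<open>\<open>(a', b', c')\<close> is the product of \<open>(a, b, c)\<close> with an element
  of level \<open>k\<close>. The third coordinate of the latter contains the correction
  \<open>outer a (b' - b)\<close>, which is again of level \<open>k\<close>.\<close>

lemma irrep_close:
  assumes "irrep k d \<rho>" and abc: "a \<in> VA 0" "b \<in> VB 0" "c \<in> VC 0" "a' \<in> VA 0" "b' \<in> VB 0" "c' \<in> VC 0"
    and k: "a' - a \<in> VA k" "b' - b \<in> VB k" "c' - c \<in> VC k"
  shows "\<rho> a' b' c' = \<rho> a b c"
proof -
  interpret heisenberg_irrep "VA 0" "VB 0" "VC 0" outer "VA k" "VB k" "VC k" d \<rho> by fact
  note cl = closed_VABC[OF abc]
  have "outer a (b' - b) \<in> VC k" using abc cl k by (intro outer_level) auto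
  from add_subgroup_diff[OF lat_subgroup k(3) this] have "c' - c - outer a (b' - b) \<in> VC k" .
  then have "\<rho> (a' - a) (b' - b) (c' - c - outer a (b' - b)) = 1\<^sub>m d" using k by (intro \<rho>_level)
  moreover have "\<rho> a b c * \<rho> (a' - a) (b' - b) (c' - c - outer a (b' - b)) = \<rho> a' b' c'"
    using \<rho>_mult[OF abc(1-3) cl(4-6)] by simp
  ultimately show ?thesis using \<rho>_carrier[OF abc(1-3)] by simp
qed

text \<open>The dictionary between characters over the completion and representations over
  \<open>D\<close>: the value at \<open>g\<close> is the trace at any approximant of level
  \<open>k\<close>.\<close>

definition char_of :: "nat \<Rightarrow> ((nat \<Rightarrow> complex) \<Rightarrow> (nat \<Rightarrow> complex) \<Rightarrow> (nat \<times> nat \<Rightarrow> complex) \<Rightarrow> complex mat) \<Rightarrow>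
    ((nat \<Rightarrow> 'c) triple \<Rightarrow> complex) \<Rightarrow> bool" where
  "char_of k \<rho> \<theta> \<longleftrightarrow> (\<forall>g\<in>carrier G. \<forall>a\<in>VA 0. \<forall>b\<in>VB 0. \<forall>c\<in>VC 0. close k g a b c \<longrightarrow> \<theta> g = tr (\<rho> a b c))"

text \<open>A continuous representation is trivial on a congruence subgroup, so its value at
  \<open>g\<close> depends only on an approximant of \<open>g\<close>. Its restriction along
  \<open>emb\<close> therefore has the same image and remains irreducible.\<close>

lemma Irr_D:
  assumes "\<theta> \<in> Irr G TG d"
  obtains k \<rho> where "irrep k d \<rho>" "char_of k \<rho> \<theta>"
proof -
  obtain \<rho> where \<rho>: "continuous_representation G TG d \<rho>" "irreducible_representation G d \<rho>"
    and \<theta>: "\<theta> = (\<lambda>g\<in>carrier G. \<Sum>j<d. \<rho> g $$ (j, j))"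
    using assms by (auto simp: Irr_def)
  note hom = continuous_representationD(1)[OF \<rho>(1)] and car = continuous_representationD(2)[OF \<rho>(1)]
    and unit = continuous_representationD(3)[OF \<rho>(1)]
  obtain k where k: "\<And>h. h \<in> carrier G \<Longrightarrow> close k h 0 0 0 \<Longrightarrow> \<rho> h = 1\<^sub>m d"
    using continuous_rep_level[OF \<rho>(1)] by blast
  define \<rho>0 where "\<rho>0 a b c = \<rho> (emb a b c)" for a b c
  have eq: "\<rho> g = \<rho>0 a b c"
    if abc: "g \<in> carrier G" "a \<in> VA 0" "b \<in> VB 0" "c \<in> VC 0" "close k g a b c" for g a b c
  proof -
    \<comment> \<open>\<open>u\<close> is the inverse of \<open>emb a b c\<close>. Every element
      close to \<open>(a, b, c)\<close> has a product with \<open>u\<close> on which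
      \<open>\<rho>\<close> is trivial, so all these elements have the same image.\<close>
    define u where "u = emb (- a) (- b) (outer a b - c)"
    note cl = closed_VABC[OF abc(2-4) abc(2-4)]
    have u: "u \<in> carrier G" "close k u (- a) (- b) (outer a b - c)"
      unfolding u_def using cl by (auto intro: emb_carrier emb_close)
    have z: "outer a b - c + c + outer (- a) b = 0" using \<beta>_uminus(2)[OF abc(2,3)] by simp
    have ug: "\<rho> u * \<rho> g' = 1\<^sub>m d" if g': "g' \<in> carrier G" "close k g' a b c" for g'
    proof -
      have "close k (u \<otimes>\<^bsub>G\<^esub> g') (- a + a) (- b + b) (outer a b - c + c + outer (- a) b)"
        using u cl abc g' by (intro mult_close)
      then have "close k (u \<otimes>\<^bsub>G\<^esub> g') 0 0 0" unfolding z by simp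
      then show ?thesis using k[OF mult_closed[OF u(1) g'(1)]] hom[OF u(1) g'(1)] by simp
    qed
    have emb: "emb a b c \<in> carrier G" using abc by (intro emb_carrier)
    obtain Y where Y: "Y \<in> carrier_mat d d" "Y * \<rho> u = 1\<^sub>m d" using unit[OF u(1)] by blast
    have cancel: "\<rho> g' = Y" if g': "g' \<in> carrier G" "close k g' a b c" for g'
    proof -
      have "\<rho> g' = (Y * \<rho> u) * \<rho> g'" using Y car[OF g'(1)] by simp
      also have "\<dots> = Y * (\<rho> u * \<rho> g')" by (rule assoc_mult_mat[OF Y(1) car[OF u(1)] car[OF g'(1)]])
      finally show ?thesis using ug[OF g'] Y(1) by simp
    qed
    show ?thesis using cancel[OF abc(1,5)] cancel[OF emb emb_close] by (simp add: \<rho>0_def)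
  qed
  have img: "rep_image \<rho>0 = \<rho> ` carrier G"
  proof (intro subset_antisym subsetI)
    fix M assume "M \<in> rep_image \<rho>0"
    then show "M \<in> \<rho> ` carrier G" using emb_carrier by (auto simp: rep_image_def \<rho>0_def)
  next
    fix M assume "M \<in> \<rho> ` carrier G"
    then obtain g where g: "g \<in> carrier G" "M = \<rho> g" by blast
    obtain a b c where abc: "a \<in> VA 0" "b \<in> VB 0" "c \<in> VC 0" "close k g a b c" using close_ex[OF g(1)] .
    then show "M \<in> rep_image \<rho>0" using eq[OF g(1) abc] g(2) by (auto simp: rep_image_def)
  qed
  interpret L: heisenberg_level "VA 0" "VB 0" "VC 0" outer "VA k" "VB k" "VC k" by (rule heisenberg_level)
  have "irrep k d \<rho>0"
  proof
    show "matrix_rep d \<rho>0"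
      unfolding matrix_rep_def
    proof (intro conjI ballI)
      show "\<rho>0 0 0 0 = 1\<^sub>m d" unfolding \<rho>0_def by (rule k[OF emb_carrier[OF zeros] emb_close])
      show "\<rho>0 a b c \<in> carrier_mat d d" if "a \<in> VA 0" "b \<in> VB 0" "c \<in> VC 0" for a b c
        unfolding \<rho>0_def using that by (intro car emb_carrier)
      show "\<rho>0 (a + a') (b + b') (c + c' + outer a b') = \<rho>0 a b c * \<rho>0 a' b' c'"
        if "a \<in> VA 0" "b \<in> VB 0" "c \<in> VC 0" "a' \<in> VA 0" "b' \<in> VB 0" "c' \<in> VC 0" for a b c a' b' c'
        unfolding \<rho>0_def emb_mult[OF that, symmetric] using that by (intro hom emb_carrier)
    qed
    show "irreducible_mats d (rep_image \<rho>0)" unfolding img using \<rho>(2) by (simp add: irreducible_representation_iff)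
    show "trivial_on (VA k) (VB k) (VC k) d \<rho>0"
      unfolding trivial_on_def \<rho>0_def
    proof (intro ballI)
      fix a b c assume abc: "a \<in> VA k" "b \<in> VB k" "c \<in> VC k"
      then have abc0: "a \<in> VA 0" "b \<in> VB 0" "c \<in> VC 0" using lat_mono[of 0 k] by auto
      have "close k (emb a b c) 0 0 0"
      proof -
        have "res k (a i) = res k 0" if "i < m" for i
          using abc abc0 that res_eq_iff[of "a i" 0 k] D_zero by (simp add: lat_def)
        moreover have "res k (b i) = res k 0" if "i < n" for i
          using abc abc0 that res_eq_iff[of "b i" 0 k] D_zero by (simp add: lat_def)
        moreover have "res k (c (i, j)) = res k 0" if "i < m" "j < n" for i j
          using abc abc0 that res_eq_iff[of "c (i, j)" 0 k] D_zero by (simp add: lat_def)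
        ultimately show ?thesis by (simp add: close_def emb_def)
      qed
      then show "\<rho> (emb a b c) = 1\<^sub>m d" by (intro k emb_carrier abc0)
    qed
  qed
  moreover have "char_of k \<rho>0 \<theta>"
    unfolding char_of_def
  proof (intro ballI impI)
    fix g a b c assume *: "g \<in> carrier G" "a \<in> VA 0" "b \<in> VB 0" "c \<in> VC 0" "close k g a b c"
    show "\<theta> g = tr (\<rho>0 a b c)" using *(1) car[OF *(1)] eq[OF *] by (simp add: \<theta> tr_def)
  qed
  ultimately show ?thesis by (rule that)
qed

text \<open>A representation of level \<open>k\<close> depends only on residues and may be evaluated
  at a chosen approximant. The result is locally constant, hence continuous, and has the same
  image.\<close>

lemma Irr_I:
  assumes irrep: "irrep k d \<rho>0"
  obtains \<theta> where "\<theta> \<in> Irr G TG d" "char_of k \<rho>0 \<theta>"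
proof -
  interpret heisenberg_irrep "VA 0" "VB 0" "VC 0" outer "VA k" "VB k" "VC k" d \<rho>0 by fact
  define s where "s g = (SOME t. case t of (a, b, c) \<Rightarrow> a \<in> VA 0 \<and> b \<in> VB 0 \<and> c \<in> VC 0 \<and> close k g a b c)" for g
  define \<rho> where "\<rho> g = (case s g of (a, b, c) \<Rightarrow> \<rho>0 a b c)" for g
  have eq: "\<rho> g = \<rho>0 a b c"
    if *: "g \<in> carrier G" "a \<in> VA 0" "b \<in> VB 0" "c \<in> VC 0" "close k g a b c" for g a b c
  proof -
    obtain a' b' c' where s: "s g = (a', b', c')" by (cases "s g") auto
    have "case s g of (a, b, c) \<Rightarrow> a \<in> VA 0 \<and> b \<in> VB 0 \<and> c \<in> VC 0 \<and> close k g a b c"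
      unfolding s_def by (rule someI[of _ "(a, b, c)"]) (use * in simp)
    then have **: "a' \<in> VA 0" "b' \<in> VB 0" "c' \<in> VC 0" "close k g a' b' c'" by (simp_all add: s)
    have "\<rho>0 a' b' c' = \<rho>0 a b c"
      by (rule irrep_close[OF irrep *(2-4) **(1-3) close_unique[OF *(2-5) **]])
    then show ?thesis by (simp add: \<rho>_def s)
  qed
  have car: "\<rho> g \<in> carrier_mat d d" if g: "g \<in> carrier G" for g
  proof -
    obtain a b c where abc: "a \<in> VA 0" "b \<in> VB 0" "c \<in> VC 0" "close k g a b c" using close_ex[OF g] .
    then show ?thesis using eq[OF g abc] \<rho>_carrier by simp
  qed
  have hom: "\<rho> (g \<otimes>\<^bsub>G\<^esub> h) = \<rho> g * \<rho> h" if gh: "g \<in> carrier G" "h \<in> carrier G" for g h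
  proof -
    obtain a b c where abc: "a \<in> VA 0" "b \<in> VB 0" "c \<in> VC 0" "close k g a b c" using close_ex[OF gh(1)] .
    obtain a' b' c' where abc': "a' \<in> VA 0" "b' \<in> VB 0" "c' \<in> VC 0" "close k h a' b' c'" using close_ex[OF gh(2)] .
    have "\<rho> (g \<otimes>\<^bsub>G\<^esub> h) = \<rho>0 (a + a') (b + b') (c + c' + outer a b')"
      by (rule eq[OF mult_closed[OF gh] closed_VABC(1-3)[OF abc(1-3) abc'(1-3)] mult_close[OF gh(1) abc gh(2) abc']])
    then show ?thesis using eq[OF gh(1) abc] eq[OF gh(2) abc'] \<rho>_mult[OF abc(1-3) abc'(1-3)] by simp
  qed
  have units: "\<rho> g \<in> Units (ring_mat TYPE(complex) d ())" if g: "g \<in> carrier G" for g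
  proof -
    obtain a b c where abc: "a \<in> VA 0" "b \<in> VB 0" "c \<in> VC 0" "close k g a b c" using close_ex[OF g] .
    note cl = closed_VABC[OF abc(1-3) abc(1-3)]
    let ?Y = "\<rho>0 (- a) (- b) (outer a b - c)"
    have "\<rho>0 a b c * ?Y = 1\<^sub>m d" "?Y * \<rho>0 a b c = 1\<^sub>m d"
      using abc cl by (simp_all add: \<rho>_mult \<beta>_uminus \<rho>_one)
    moreover have "?Y \<in> carrier_mat d d" "\<rho>0 a b c \<in> carrier_mat d d" using abc cl by (auto intro: \<rho>_carrier)
    ultimately show ?thesis unfolding eq[OF g abc] by (auto simp: Units_def ring_mat_simps)
  qed
  have "continuous_representation G TG d \<rho>"
    unfolding continuous_representation_def
  proof (intro conjI allI impI)
    show "\<rho> \<in> hom G (units_of (ring_mat TYPE(complex) d ()))"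
      using units hom by (auto simp: hom_def units_of_def ring_mat_simps)
    fix i j
    show "continuous_map TG euclidean (\<lambda>g. \<rho> g $$ (i, j))"
    proof (rule continuous_if_locally_constant[where k = k])
      fix g h assume g: "g \<in> carrier G" and h: "h \<in> same_class k g"
      obtain a b c where abc: "a \<in> VA 0" "b \<in> VB 0" "c \<in> VC 0" "close k g a b c" using close_ex[OF g] .
      have hG: "h \<in> carrier G" by (rule subsetD[OF same_class_carrier h])
      have "close k h a b c" using abc(4) same_class_close[OF h] by blast
      then show "\<rho> h $$ (i, j) = \<rho> g $$ (i, j)" using eq[OF g abc] eq[OF hG abc(1-3)] by simp
    qed
  qed
  moreover have "irreducible_representation G d \<rho>"
  proof -
    have "\<rho> ` carrier G = rep_image \<rho>0"
    proof (intro subset_antisym subsetI)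
      fix M assume "M \<in> \<rho> ` carrier G"
      then obtain g where g: "g \<in> carrier G" "M = \<rho> g" by blast
      obtain a b c where abc: "a \<in> VA 0" "b \<in> VB 0" "c \<in> VC 0" "close k g a b c" using close_ex[OF g(1)] .
      then show "M \<in> rep_image \<rho>0" using eq[OF g(1) abc] g(2) by (auto simp: rep_image_def)
    next
      fix M assume "M \<in> rep_image \<rho>0"
      then obtain a b c where abc: "a \<in> VA 0" "b \<in> VB 0" "c \<in> VC 0" "M = \<rho>0 a b c" by (auto simp: rep_image_def)
      then show "M \<in> \<rho> ` carrier G" using eq[OF emb_carrier[OF abc(1-3)] abc(1-3) emb_close] emb_carrier[OF abc(1-3)]
        by (intro image_eqI[of _ _ "emb a b c"]) auto
    qed
    then show ?thesis using irr by (simp add: irreducible_representation_iff)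
  qed
  ultimately have "(\<lambda>g\<in>carrier G. \<Sum>j<d. \<rho> g $$ (j, j)) \<in> Irr G TG d" unfolding Irr_def by blast
  moreover have "char_of k \<rho>0 (\<lambda>g\<in>carrier G. \<Sum>j<d. \<rho> g $$ (j, j))"
    unfolding char_of_def
  proof (intro ballI impI)
    fix g a b c assume *: "g \<in> carrier G" "a \<in> VA 0" "b \<in> VB 0" "c \<in> VC 0" "close k g a b c"
    show "(\<lambda>g\<in>carrier G. \<Sum>j<d. \<rho> g $$ (j, j)) g = tr (\<rho>0 a b c)"
      using *(1) car[OF *(1)] eq[OF *] by (simp add: tr_def)
  qed
  ultimately show ?thesis by (rule that)
qed

text \<open>The central character recovered from the character alone: on the elements
  \<open>emb 0 0 c\<close> the trace is \<open>d\<close> times its value.\<close>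

definition centr :: "nat \<Rightarrow> ((nat \<Rightarrow> 'c) triple \<Rightarrow> complex) \<Rightarrow> (nat \<times> nat \<Rightarrow> complex) \<Rightarrow> complex" where
  "centr d \<theta> c = (if c \<in> VC 0 then \<theta> (emb 0 0 c) / of_nat d else 0)"

lemma centr_eq:
  assumes "irrep k d \<rho>" "char_of k \<rho> \<theta>" shows "centr d \<theta> = central_char \<rho>"
proof
  interpret heisenberg_irrep "VA 0" "VB 0" "VC 0" outer "VA k" "VB k" "VC k" d \<rho> by fact
  fix c
  show "centr d \<theta> c = central_char \<rho> c"
  proof (cases "c \<in> VC 0")
    case True
    have "\<theta> (emb 0 0 c) = tr (\<rho> 0 0 c)"
      using assms(2) emb_carrier[OF zeros(1,2) True] emb_close[of k 0 0 c] zeros True unfolding char_of_def by blast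
    also have "\<dots> = \<psi> c * of_nat d" using True by (simp add: central tr_smult[OF one_carrier_mat] tr_one)
    finally show ?thesis using True d_pos by (simp add: centr_def \<psi>_def)
  next
    case False then show ?thesis by (simp add: centr_def central_char_def)
  qed
qed

text \<open>The parameters of the twist classes of degree \<open>d\<close>. Triviality on some
  \<open>VC k\<close> expresses continuity.\<close>

definition central_chars :: "nat \<Rightarrow> ((nat \<times> nat \<Rightarrow> complex) \<Rightarrow> complex) \<Rightarrow> bool" where
  "central_chars d \<psi> \<longleftrightarrow> (\<exists>k. \<psi> \<in> chars_trivial_on (VC 0) (VC k)) \<and> subgroup_index (VB 0) (rad2 \<psi>) = d"

lemma centr_central_chars:
  assumes "\<theta> \<in> Irr G TG d" shows "central_chars d (centr d \<theta>)"
proof -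
  obtain k \<rho> where k: "irrep k d \<rho>" "char_of k \<rho> \<theta>" using Irr_D[OF assms] .
  interpret heisenberg_irrep "VA 0" "VB 0" "VC 0" outer "VA k" "VB k" "VC k" d \<rho> by fact
  show ?thesis
    unfolding centr_eq[OF k] central_chars_def \<psi>_def[symmetric]
    using \<psi>_char \<psi>_level degree_eq_index by (auto simp: chars_trivial_on_def)
qed

text \<open>The representation of \<open>exists_irrep\<close> has central character
  \<open>\<psi>\<close>, and its degree is forced by \<open>degree_eq_index\<close>.\<close>

lemma centr_surj:
  assumes "central_chars d \<psi>" obtains \<theta> where "\<theta> \<in> Irr G TG d" "centr d \<theta> = \<psi>"
proof -
  obtain k where k: "\<psi> \<in> chars_trivial_on (VC 0) (VC k)" using assms by (auto simp: central_chars_def)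
  then have \<psi>: "add_char (VC 0) \<psi>" "\<And>c. c \<in> VC k \<Longrightarrow> \<psi> c = 1" by (auto simp: chars_trivial_on_def)
  interpret L: heisenberg_level "VA 0" "VB 0" "VC 0" outer "VA k" "VB k" "VC k" by (rule heisenberg_level)
  have "VA k \<subseteq> rad1 \<psi>" "VB k \<subseteq> rad2 \<psi>"
    using lat_mono[of 0 k "{..<m}"] lat_mono[of 0 k "{..<n}"] \<psi>(2) outer_level
    unfolding rad1_def rad2_def by auto
  then obtain d' \<rho> where \<rho>: "irrep k d' \<rho>" "central_char \<rho> = \<psi>" using L.exists_irrep[OF \<psi>] by blast
  interpret heisenberg_irrep "VA 0" "VB 0" "VC 0" outer "VA k" "VB k" "VC k" d' \<rho> by fact
  have "d' = d" using degree_eq_index assms \<rho>(2) by (simp add: \<psi>_def central_chars_def)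
  obtain \<theta> where "\<theta> \<in> Irr G TG d'" "char_of k \<rho> \<theta>" using Irr_I[OF \<rho>(1)] .
  then show ?thesis using that centr_eq[OF \<rho>(1)] \<rho>(2) \<open>d' = d\<close> by blast
qed

text \<open>These supply the linear characters by which representations are twisted.\<close>

lemma irrep_degree_1:
  assumes \<tau>: "add_char (VA 0 \<times> VB 0) \<tau>" "\<And>a b. a \<in> VA k \<Longrightarrow> b \<in> VB k \<Longrightarrow> \<tau> (a, b) = 1"
  shows "irrep k 1 (\<lambda>a b c. mat 1 1 (\<lambda>_. \<tau> (a, b)))"
proof -
  interpret L: heisenberg_level "VA 0" "VB 0" "VC 0" outer "VA k" "VB k" "VC k" by (rule heisenberg_level)
  have AB: "add_subgroup (VA 0 \<times> VB 0)" using A B by (auto simp: add_subgroup_def zero_prod_def)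
  show ?thesis
  proof
    show "matrix_rep 1 (\<lambda>a b c. mat 1 1 (\<lambda>_. \<tau> (a, b)))"
      unfolding matrix_rep_def
    proof (intro conjI ballI)
      show "mat 1 1 (\<lambda>_. \<tau> (0, 0)) = 1\<^sub>m 1"
        using add_char_zero[OF \<tau>(1) AB] by (intro eq_matI) (auto simp: zero_prod_def)
      fix a b c a' b' c' assume *: "a \<in> VA 0" "b \<in> VB 0" "a' \<in> VA 0" "b' \<in> VB 0"
      have "\<tau> (a + a', b + b') = \<tau> (a, b) * \<tau> (a', b')" using add_char_add[OF \<tau>(1), of "(a, b)" "(a', b')"] * by simp
      then show "mat 1 1 (\<lambda>_. \<tau> (a + a', b + b')) = mat 1 1 (\<lambda>_. \<tau> (a, b)) * mat 1 1 (\<lambda>_. \<tau> (a', b'))"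
        by (intro eq_matI) (auto simp: scalar_prod_def)
    qed simp
    show "irreducible_mats 1 (rep_image (\<lambda>a b c. mat 1 1 (\<lambda>_. \<tau> (a, b))))"
      unfolding irreducible_mats_def
    proof (intro conjI allI impI)
      fix W assume "subspace_vec 1 W \<and> (\<forall>M\<in>rep_image (\<lambda>a b c. mat 1 1 (\<lambda>_. \<tau> (a, b))). \<forall>w\<in>W. M *\<^sub>v w \<in> W)"
      then have W: "subspace_vec 1 W" by blast
      show "W = {0\<^sub>v 1} \<or> W = carrier_vec 1"
      proof (cases "W \<subseteq> {0\<^sub>v 1}")
        case True then show ?thesis using subspace_vecD(2)[OF W] by blast
      next
        case False
        then obtain w where w: "w \<in> W" "w \<noteq> 0\<^sub>v 1" by blast
        then have wC: "w \<in> carrier_vec 1" using subspace_vecD(1)[OF W] by blast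
        have w0: "w $ 0 \<noteq> 0"
        proof
          assume "w $ 0 = 0"
          then have "w = 0\<^sub>v 1" using wC by (intro eq_vecI) auto
          then show False using w by blast
        qed
        have "v \<in> W" if v: "v \<in> carrier_vec 1" for v
        proof -
          have "(v $ 0 / w $ 0) \<cdot>\<^sub>v w \<in> W" using w(1) by (rule subspace_vecD(4)[OF W])
          moreover have "(v $ 0 / w $ 0) \<cdot>\<^sub>v w = v" using w0 v wC by (intro eq_vecI) auto
          ultimately show ?thesis by simp
        qed
        then show ?thesis using subspace_vecD(1)[OF W] by blast
      qed
    qed simp
    show "trivial_on (VA k) (VB k) (VC k) 1 (\<lambda>a b c. mat 1 1 (\<lambda>_. \<tau> (a, b)))"
      unfolding trivial_on_def using \<tau>(2) by (auto intro!: eq_matI)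
  qed
qed

lemma char_of_mono:
  assumes "char_of k \<rho> \<theta>" "irrep k d \<rho>" "k \<le> l" shows "char_of l \<rho> \<theta>"
  unfolding char_of_def
proof (intro ballI impI)
  fix g a b c assume *: "g \<in> carrier G" "a \<in> VA 0" "b \<in> VB 0" "c \<in> VC 0" "close l g a b c"
  obtain x y z where g: "g = (x, y, z)" by (cases g) auto
  have le: "f k = res k u" if "f \<in> carrier R" "u \<in> D" "f l = res l u" for f u
    using coherent_le[OF that(1) res_in_R[OF that(2)] assms(3)] that(3) by simp
  have mem: "\<And>i. i < m \<Longrightarrow> x i \<in> carrier R" "\<And>i. i < n \<Longrightarrow> y i \<in> carrier R"
    "\<And>i j. i < m \<Longrightarrow> j < n \<Longrightarrow> z (i, j) \<in> carrier R"
    using *(1) by (auto simp: g carrier_G)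
  have "close k g a b c"
    using *(2-5) le mem unfolding g close_def lat_0 by simp
  then show "\<theta> g = tr (\<rho> a b c)" using assms(1) * unfolding char_of_def by blast
qed

definition axis :: "nat \<Rightarrow> nat \<Rightarrow> complex" where "axis i = (\<lambda>l. if l = i then 1 else 0)"

definition row :: "nat \<Rightarrow> (nat \<times> nat \<Rightarrow> complex) \<Rightarrow> nat \<Rightarrow> complex" where "row i c = (\<lambda>j. c (i, j))"

lemma axis_VA: "i < m \<Longrightarrow> axis i \<in> VA 0"
  using D_one D_zero by (auto simp: lat_0 axis_def)

lemma row_VB: "i < m \<Longrightarrow> c \<in> VC k \<Longrightarrow> row i c \<in> VB k"
  by (auto simp: lat_def row_def)

text \<open>A matrix is the sum of its rows, each of which is an outer product with a unit
  vector.\<close>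

lemma add_char_rows:
  assumes "add_char (VC 0) \<psi>" "c \<in> VC 0" shows "\<psi> c = (\<Prod>i<m. \<psi> (outer (axis i) (row i c)))"
proof -
  have "c = (\<Sum>i<m. outer (axis i) (row i c))"
  proof
    fix ij :: "nat \<times> nat"
    obtain l j where ij: "ij = (l, j)" by (cases ij)
    have ap: "(\<Sum>i\<in>I. f i) x = (\<Sum>i\<in>I. f i x)" for f :: "nat \<Rightarrow> nat \<times> nat \<Rightarrow> complex" and I x
      by (induction I rule: infinite_finite_induct) auto
    have "(\<Sum>i<m. outer (axis i) (row i c)) ij = (\<Sum>i<m. if i = l then row i c j else 0)"
      unfolding ap ij by (intro sum.cong refl) (auto simp: outer_def axis_def)
    also have "\<dots> = (if l < m then row l c j else 0)" by simp
    also have "\<dots> = c ij" using assms(2) by (auto simp: ij row_def lat_0)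
    finally show "c ij = (\<Sum>i<m. outer (axis i) (row i c)) ij" by simp
  qed
  then have "\<psi> c = \<psi> (\<Sum>i<m. outer (axis i) (row i c))" by (rule arg_cong)
  also have "\<dots> = (\<Prod>i<m. \<psi> (outer (axis i) (row i c)))"
    using axis_VA row_VB assms(2) by (intro add_char_sum[OF assms(1) C] \<beta>_C) auto
  finally show ?thesis .
qed

text \<open>The outer products generate the matrices, so a trivial pairing comes from the trivial
  character. Consequently linear characters of the group are trivial on the central
  coordinate.\<close>

lemma commutator_span:
  assumes "add_char (VC 0) \<psi>" "rad2 \<psi> = VB 0" "c \<in> VC 0" shows "\<psi> c = 1"
  unfolding add_char_rows[OF assms(1,3)]
proof (rule prod.neutral, rule ballI)
  fix i assume "i \<in> {..<m}"
  then have "row i c \<in> rad2 \<psi>" "axis i \<in> VA 0" using axis_VA row_VB assms by auto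
  then show "\<psi> (outer (axis i) (row i c)) = 1" by (simp add: rad2_def)
qed

text \<open>A linear character is trivial on the central coordinate, so twisting keeps the central
  character. Conversely, \<open>twist_exists\<close> provides the twist once both representations
  are regarded at a common level.\<close>

lemma twist_relation_iff:
  assumes \<theta>: "\<theta>1 \<in> Irr G TG d" "\<theta>2 \<in> Irr G TG d"
  shows "(\<theta>1, \<theta>2) \<in> twist_relation G TG d \<longleftrightarrow> centr d \<theta>1 = centr d \<theta>2"
proof
  assume "(\<theta>1, \<theta>2) \<in> twist_relation G TG d"
  then obtain \<mu> where \<mu>: "\<mu> \<in> Irr G TG 1" "\<And>g. g \<in> carrier G \<Longrightarrow> \<theta>1 g = \<mu> g * \<theta>2 g"
    by (auto simp: twist_relation_def)
  have "central_chars 1 (centr 1 \<mu>)" by (rule centr_central_chars[OF \<mu>(1)])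
  then have c: "add_char (VC 0) (centr 1 \<mu>)" "subgroup_index (VB 0) (rad2 (centr 1 \<mu>)) = 1"
    by (auto simp: central_chars_def chars_trivial_on_def)
  have "rad2 (centr 1 \<mu>) \<subseteq> VB 0" by (auto simp: rad2_def)
  then have rad: "rad2 (centr 1 \<mu>) = VB 0"
    using subgroup_index_eq_1[OF B rad2_subgroup[OF c(1)] _ c(2)] by simp
  have "\<mu> (emb 0 0 x) = 1" if "x \<in> VC 0" for x
    using commutator_span[OF c(1) rad that] that by (simp add: centr_def)
  then show "centr d \<theta>1 = centr d \<theta>2"
    using \<mu>(2)[OF emb_carrier[OF zeros(1,2)]] by (auto simp: centr_def)
next
  assume eq: "centr d \<theta>1 = centr d \<theta>2"
  obtain k1 \<rho>1 where 1: "irrep k1 d \<rho>1" "char_of k1 \<rho>1 \<theta>1" using Irr_D[OF \<theta>(1)] .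
  obtain k2 \<rho>2 where 2: "irrep k2 d \<rho>2" "char_of k2 \<rho>2 \<theta>2" using Irr_D[OF \<theta>(2)] .
  define k where "k = max k1 k2"
  have i: "irrep k d \<rho>1" "irrep k d \<rho>2" "char_of k \<rho>1 \<theta>1" "char_of k \<rho>2 \<theta>2"
    using irrep_mono[OF 1(1)] irrep_mono[OF 2(1)] char_of_mono[OF 1(2,1)] char_of_mono[OF 2(2,1)]
    by (simp_all add: k_def)
  interpret L: heisenberg_level "VA 0" "VB 0" "VC 0" outer "VA k" "VB k" "VC k" by (rule heisenberg_level)
  have "central_char \<rho>1 = central_char \<rho>2" using eq centr_eq[OF i(1,3)] centr_eq[OF i(2,4)] by simp
  from L.twist_exists[OF i(1,2) this]
  obtain \<tau> where \<tau>: "add_char (VA 0 \<times> VB 0) \<tau>" "\<And>a b. a \<in> VA k \<Longrightarrow> b \<in> VB k \<Longrightarrow> \<tau> (a, b) = 1"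
    "\<And>a b c. a \<in> VA 0 \<Longrightarrow> b \<in> VB 0 \<Longrightarrow> c \<in> VC 0 \<Longrightarrow> tr (\<rho>1 a b c) = \<tau> (a, b) * tr (\<rho>2 a b c)"
    by blast
  obtain \<mu> where \<mu>: "\<mu> \<in> Irr G TG 1" "char_of k (\<lambda>a b c. mat 1 1 (\<lambda>_. \<tau> (a, b))) \<mu>"
    using Irr_I[OF irrep_degree_1[OF \<tau>(1,2)]] by blast
  have "\<theta>1 g = \<mu> g * \<theta>2 g" if g: "g \<in> carrier G" for g
  proof -
    obtain a b c where abc: "a \<in> VA 0" "b \<in> VB 0" "c \<in> VC 0" "close k g a b c" using close_ex[OF g] .
    have "\<theta>1 g = tr (\<rho>1 a b c)" "\<theta>2 g = tr (\<rho>2 a b c)" "\<mu> g = tr (mat 1 1 (\<lambda>_. \<tau> (a, b)))"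
      using i(3,4) \<mu>(2) g abc unfolding char_of_def by blast+
    then show ?thesis using \<tau>(3)[OF abc(1-3)] by (simp add: tr_def)
  qed
  then show "(\<theta>1, \<theta>2) \<in> twist_relation G TG d"
    unfolding twist_relation_def using \<theta> \<mu>(1) by blast
qed

lemma twist_class_eq:
  assumes "\<theta> \<in> Irr G TG d"
  shows "twist_relation G TG d `` {\<theta>} = {\<theta>' \<in> Irr G TG d. centr d \<theta>' = centr d \<theta>}"
proof (intro subset_antisym subsetI)
  fix \<theta>' assume "\<theta>' \<in> twist_relation G TG d `` {\<theta>}"
  then have *: "(\<theta>, \<theta>') \<in> twist_relation G TG d" by simp
  then have "\<theta>' \<in> Irr G TG d" unfolding twist_relation_def by blast
  then show "\<theta>' \<in> {\<theta>' \<in> Irr G TG d. centr d \<theta>' = centr d \<theta>}"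
    using twist_relation_iff[OF assms, of \<theta>'] * by simp
next
  fix \<theta>' assume "\<theta>' \<in> {\<theta>' \<in> Irr G TG d. centr d \<theta>' = centr d \<theta>}"
  then show "\<theta>' \<in> twist_relation G TG d `` {\<theta>}" using twist_relation_iff[OF assms, of \<theta>'] by simp
qed

text \<open>The twist classes are the fibres of \<open>centr\<close>, and every parameter is
  attained.\<close>

theorem twist_classes_bij:
  "bij_betw (\<lambda>\<psi>. {\<theta> \<in> Irr G TG d. centr d \<theta> = \<psi>}) {\<psi>. central_chars d \<psi>} (twist_classes G TG d)"
proof (rule bij_betwI')
  fix \<psi> \<psi>' assume *: "\<psi> \<in> {\<psi>. central_chars d \<psi>}" "\<psi>' \<in> {\<psi>. central_chars d \<psi>}"
  then have "central_chars d \<psi>" by simp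
  then obtain \<theta> where "\<theta> \<in> Irr G TG d" "centr d \<theta> = \<psi>" by (rule centr_surj)
  then show "({\<theta> \<in> Irr G TG d. centr d \<theta> = \<psi>} = {\<theta> \<in> Irr G TG d. centr d \<theta> = \<psi>'}) = (\<psi> = \<psi>')" by auto
next
  fix \<psi> assume "\<psi> \<in> {\<psi>. central_chars d \<psi>}"
  then have "central_chars d \<psi>" by simp
  then obtain \<theta> where \<theta>: "\<theta> \<in> Irr G TG d" "centr d \<theta> = \<psi>" by (rule centr_surj)
  show "{\<theta> \<in> Irr G TG d. centr d \<theta> = \<psi>} \<in> twist_classes G TG d"
    unfolding twist_classes_def \<theta>(2)[symmetric] twist_class_eq[OF \<theta>(1), symmetric]
    by (rule quotientI[OF \<theta>(1)])
next
  fix X assume "X \<in> twist_classes G TG d"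
  then obtain \<theta> where \<theta>: "\<theta> \<in> Irr G TG d" "X = twist_relation G TG d `` {\<theta>}"
    unfolding twist_classes_def by (rule quotientE)
  then have "X = {\<theta>' \<in> Irr G TG d. centr d \<theta>' = centr d \<theta>}"
    using twist_class_eq by simp
  then show "\<exists>\<psi>\<in>{\<psi>. central_chars d \<psi>}. X = {\<theta> \<in> Irr G TG d. centr d \<theta> = \<psi>}"
    using centr_central_chars[OF \<theta>(1)] by blast
qed

end

section \<open>Lattices cut down by characters, and the resulting count\<close>

context dvr
begin

definition smul :: "complex \<Rightarrow> ('i \<Rightarrow> complex) \<Rightarrow> 'i \<Rightarrow> complex" where "smul r x = (\<lambda>i. r * x i)"

lemma smul_simps: "smul r (x + y) = smul r x + smul r y" "smul r (x - y) = smul r x - smul r y"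
  "smul (r + s) x = smul r x + smul s x" "smul (r - s) x = smul r x - smul s x"
  "smul r (smul s x) = smul (r * s) x" "smul 0 x = 0" "smul r 0 = 0" "smul 1 x = x"
  by (auto simp: smul_def algebra_simps)

lemma smul_lat: "r \<in> D \<Longrightarrow> x \<in> lat I k \<Longrightarrow> smul r x \<in> lat I k"
  using P_mult by (auto simp: smul_def lat_def)

lemma smul_lat_power: "x \<in> lat I k \<Longrightarrow> smul (\<pi> ^ j) x \<in> lat I (k + j)"
proof -
  assume x: "x \<in> lat I k"
  have "\<pi> ^ j * x i \<in> P (k + j)" if i: "i \<in> I" for i
  proof -
    obtain y where "x i = \<pi> ^ k * y" "y \<in> D" using x i by (auto simp: lat_def)
    then show ?thesis by (auto simp: power_add mult_ac)
  qed
  then show ?thesis using x by (auto simp: smul_def lat_def)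
qed

lemma lat_eq_image: "lat I (k + j) = smul (\<pi> ^ j) ` lat I k"
proof (intro subset_antisym subsetI)
  fix x assume x: "x \<in> lat I (k + j)"
  have "\<exists>y\<in>P k. x i = \<pi> ^ j * y" if i: "i \<in> I" for i
  proof -
    have "x i \<in> P (k + j)" using x i by (auto simp: lat_def)
    then obtain z where "x i = \<pi> ^ (k + j) * z" "z \<in> D" by blast
    then show ?thesis by (intro bexI[of _ "\<pi> ^ k * z"]) (auto simp: power_add mult_ac)
  qed
  then obtain y where y: "\<And>i. i \<in> I \<Longrightarrow> y i \<in> P k \<and> x i = \<pi> ^ j * y i" by metis
  have "x = smul (\<pi> ^ j) (\<lambda>i. if i \<in> I then y i else 0)"
    using x y by (auto simp: smul_def lat_def)
  moreover have "(\<lambda>i. if i \<in> I then y i else 0) \<in> lat I k" using y by (auto simp: lat_def)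
  ultimately show "x \<in> smul (\<pi> ^ j) ` lat I k" by blast
qed (use smul_lat_power in blast)

text \<open>Containing some \<open>lat {..<n} k\<close> expresses full rank.\<close>

definition lattice :: "nat \<Rightarrow> (nat \<Rightarrow> complex) set \<Rightarrow> bool" where
  "lattice n \<Lambda> \<longleftrightarrow> add_subgroup \<Lambda> \<and> \<Lambda> \<subseteq> lat {..<n} 0 \<and> (\<forall>r\<in>D. \<forall>x\<in>\<Lambda>. smul r x \<in> \<Lambda>) \<and> (\<exists>k. lat {..<n} k \<subseteq> \<Lambda>)"

lemma lattice_finite_index: assumes "lattice n \<Lambda>" shows "finite_index (lat {..<n} 0) \<Lambda>"
proof -
  obtain k where k: "add_subgroup \<Lambda>" "\<Lambda> \<subseteq> lat {..<n} 0" "lat {..<n} k \<subseteq> \<Lambda>" using assms by (auto simp: lattice_def)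
  show ?thesis by (rule finite_index_mono(1)[OF k(1) lat_subgroup k(2,3)]) (simp add: lat_index)
qed

text \<open>Multiplication by \<open>\<pi> ^ j\<close> carries the full lattice and
  \<open>\<Lambda>\<close> to \<open>lat {..<n} j\<close> and the scaled lattice without changing
  the index, and \<open>lat {..<n} j\<close> has index \<open>q ^ (n * j)\<close>.\<close>

lemma lattice_index_scaled:
  assumes \<Lambda>: "lattice n \<Lambda>"
  shows "add_subgroup (smul (\<pi> ^ j) ` \<Lambda>)" "smul (\<pi> ^ j) ` \<Lambda> \<subseteq> \<Lambda>"
    "finite_index (lat {..<n} 0) (smul (\<pi> ^ j) ` \<Lambda>)" "\<exists>k. lat {..<n} k \<subseteq> smul (\<pi> ^ j) ` \<Lambda>"
    "subgroup_index (lat {..<n} 0) (smul (\<pi> ^ j) ` \<Lambda>) = subgroup_index (lat {..<n} 0) \<Lambda> * q ^ (n * j)"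
proof -
  let ?V = "lat {..<n}"
  obtain k where s: "add_subgroup \<Lambda>" "\<Lambda> \<subseteq> ?V 0" "\<And>r x. r \<in> D \<Longrightarrow> x \<in> \<Lambda> \<Longrightarrow> smul r x \<in> \<Lambda>" "?V k \<subseteq> \<Lambda>"
    using \<Lambda> by (auto simp: lattice_def)
  show sg: "add_subgroup (smul (\<pi> ^ j) ` \<Lambda>)"
    unfolding add_subgroup_def
  proof (intro conjI ballI)
    show "0 \<in> smul (\<pi> ^ j) ` \<Lambda>" using add_subgroup_zero[OF s(1)] by (intro image_eqI[of _ _ 0]) (auto simp: smul_simps)
    fix x y assume "x \<in> smul (\<pi> ^ j) ` \<Lambda>" "y \<in> smul (\<pi> ^ j) ` \<Lambda>"
    then obtain u v where "x = smul (\<pi> ^ j) u" "y = smul (\<pi> ^ j) v" "u \<in> \<Lambda>" "v \<in> \<Lambda>" by blast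
    then show "x - y \<in> smul (\<pi> ^ j) ` \<Lambda>" using add_subgroup_diff[OF s(1), of u v]
      by (intro image_eqI[of _ _ "u - v"]) (auto simp: smul_simps)
  qed
  show sub: "smul (\<pi> ^ j) ` \<Lambda> \<subseteq> \<Lambda>" by (intro image_subsetI s(3) D_power[OF \<pi>_D])
  have "?V (k + j) \<subseteq> smul (\<pi> ^ j) ` \<Lambda>" unfolding lat_eq_image by (rule image_mono[OF s(4)])
  then show "\<exists>k. ?V k \<subseteq> smul (\<pi> ^ j) ` \<Lambda>" by (rule exI)
  have Vj: "?V j = smul (\<pi> ^ j) ` ?V 0" using lat_eq_image[of "{..<n}" 0 j] by simp
  have iff: "x - y \<in> \<Lambda> \<longleftrightarrow> smul (\<pi> ^ j) x - smul (\<pi> ^ j) y \<in> smul (\<pi> ^ j) ` \<Lambda>" for x y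
  proof -
    have inj: "u = v" if "smul (\<pi> ^ j) u = smul (\<pi> ^ j) v" for u v :: "nat \<Rightarrow> complex"
    proof
      fix i show "u i = v i" using fun_cong[OF that, of i] \<pi>_nonzero by (simp add: smul_def)
    qed
    have "inj (smul (\<pi> ^ j) :: (nat \<Rightarrow> complex) \<Rightarrow> _)" by (rule injI) (rule inj)
    from inj_image_mem_iff[OF this] show ?thesis unfolding smul_simps(2)[symmetric] by simp
  qed
  have surj: "\<exists>x\<in>?V 0. z - smul (\<pi> ^ j) x \<in> smul (\<pi> ^ j) ` \<Lambda>" if z: "z \<in> ?V j" for z
  proof -
    obtain x where "z = smul (\<pi> ^ j) x" "x \<in> ?V 0" using z unfolding Vj by (rule imageE)
    then show ?thesis using add_subgroup_zero[OF sg] by (intro bexI[of _ x]) simp_all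
  qed
  have in_Vj: "smul (\<pi> ^ j) x \<in> ?V j" if "x \<in> ?V 0" for x unfolding Vj using that by (rule imageI)
  have c: "subgroup_index (?V 0) \<Lambda> = subgroup_index (?V j) (smul (\<pi> ^ j) ` \<Lambda>)"
    "finite_index (?V 0) \<Lambda> \<longleftrightarrow> finite_index (?V j) (smul (\<pi> ^ j) ` \<Lambda>)"
    by (rule subgroup_index_cong[where f = "smul (\<pi> ^ j)", OF s(1) sg in_Vj iff surj]; assumption)+
  have sub': "smul (\<pi> ^ j) ` \<Lambda> \<subseteq> ?V j" unfolding Vj by (rule image_mono[OF s(2)])
  note m = subgroup_index_mult[OF lat_subgroup lat_subgroup sg lat_mono sub' lat_index(1)]
  show "finite_index (?V 0) (smul (\<pi> ^ j) ` \<Lambda>)"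
    using m(1) c(2) lattice_finite_index[OF \<Lambda>] by simp
  show "subgroup_index (?V 0) (smul (\<pi> ^ j) ` \<Lambda>) = subgroup_index (?V 0) \<Lambda> * q ^ (n * j)"
    using m(2) c lattice_finite_index[OF \<Lambda>] lat_index(2)[of "{..<n}" j] by (simp add: mult.commute)
qed

lemma q_ge_2: "q \<ge> 2"
proof -
  have sub: "(*) \<pi> ` D \<subseteq> D" using D_mult[OF \<pi>_D] by (intro image_subsetI)
  have "q \<noteq> 1"
  proof
    assume "q = 1"
    then have 1: "subgroup_index D ((*) \<pi> ` D) = 1" unfolding q_def .
    have "1 \<in> (*) \<pi> ` D"
      by (rule equalityD1[OF subgroup_index_eq_1[OF D_subgroup P_subgroup sub 1], THEN subsetD, OF D_one])
    then obtain x where x: "1 = \<pi> * x" "x \<in> D" by (rule imageE)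
    have "inverse \<pi> = x" by (rule inverse_unique) (rule x(1)[symmetric])
    then show False using x(2) \<pi>_nonunit by simp
  qed
  moreover have "D \<noteq> {}" using D_one by blast
  then have "q > 0" unfolding q_def by (rule subgroup_index_pos[OF D_fin])
  ultimately show ?thesis by simp
qed

definition smooth_chars :: "nat \<Rightarrow> ((nat \<Rightarrow> complex) \<Rightarrow> complex) set" where
  "smooth_chars n = {\<theta>. \<exists>k. \<theta> \<in> chars_trivial_on (lat {..<n} 0) (lat {..<n} k)}"

text \<open>For a lattice \<open>\<Lambda>\<close>, the largest submodule over \<open>D\<close> on
  which \<open>\<theta>\<close> is trivial.\<close>

definition cut :: "((nat \<Rightarrow> complex) \<Rightarrow> complex) \<Rightarrow> (nat \<Rightarrow> complex) set \<Rightarrow> (nat \<Rightarrow> complex) set" where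
  "cut \<theta> \<Lambda> = {x \<in> \<Lambda>. \<forall>r\<in>D. \<theta> (smul r x) = 1}"

context
  fixes n :: nat and \<Lambda> \<theta>
  assumes \<Lambda>: "lattice n \<Lambda>" and \<theta>: "\<theta> \<in> smooth_chars n"
begin

private lemma \<Lambda>_facts: "add_subgroup \<Lambda>" "\<Lambda> \<subseteq> lat {..<n} 0" "r \<in> D \<Longrightarrow> x \<in> \<Lambda> \<Longrightarrow> smul r x \<in> \<Lambda>"
  using \<Lambda> by (auto simp: lattice_def)

private lemma \<theta>_char: "add_char (lat {..<n} 0) \<theta>"
  using \<theta> by (auto simp: smooth_chars_def chars_trivial_on_def)

private lemma lat_closed: "r \<in> D \<Longrightarrow> x \<in> \<Lambda> \<Longrightarrow> smul r x \<in> lat {..<n} 0"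
  using \<Lambda>_facts by blast

text \<open>The conductor exponent of \<open>\<theta>\<close> on \<open>\<Lambda>\<close>. It turns
  out to be the exponent of the index of the cut.\<close>

private definition J :: nat where "J = (LEAST j. \<forall>x\<in>\<Lambda>. \<theta> (smul (\<pi> ^ j) x) = 1)"

private lemma J_ex: "\<exists>j. \<forall>x\<in>\<Lambda>. \<theta> (smul (\<pi> ^ j) x) = 1"
proof -
  obtain k where k: "\<And>x. x \<in> lat {..<n} k \<Longrightarrow> \<theta> x = 1"
    using \<theta> by (auto simp: smooth_chars_def chars_trivial_on_def)
  have "\<theta> (smul (\<pi> ^ k) x) = 1" if "x \<in> \<Lambda>" for x
    using k smul_lat_power[of x "{..<n}" 0 k] that \<Lambda>_facts(2) by auto
  then show ?thesis by blast
qed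

private lemma J: "x \<in> \<Lambda> \<Longrightarrow> \<theta> (smul (\<pi> ^ J) x) = 1"
  using LeastI_ex[OF J_ex] unfolding J_def by blast

private lemma J_le_iff: "J \<le> j \<longleftrightarrow> (\<forall>x\<in>\<Lambda>. \<theta> (smul (\<pi> ^ j) x) = 1)"
proof
  assume le: "J \<le> j"
  show "\<forall>x\<in>\<Lambda>. \<theta> (smul (\<pi> ^ j) x) = 1"
  proof
    fix x assume x: "x \<in> \<Lambda>"
    have "smul (\<pi> ^ j) x = smul (\<pi> ^ J) (smul (\<pi> ^ (j - J)) x)"
      using le by (simp add: smul_simps flip: power_add)
    then show "\<theta> (smul (\<pi> ^ j) x) = 1" using J[OF \<Lambda>_facts(3)[OF D_power[OF \<pi>_D] x]] by simp
  qed
next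
  assume "\<forall>x\<in>\<Lambda>. \<theta> (smul (\<pi> ^ j) x) = 1"
  then show "J \<le> j" unfolding J_def by (rule Least_le)
qed

private lemma pair_char:
  "x \<in> \<Lambda> \<Longrightarrow> add_char D (\<lambda>r. if r \<in> D then \<theta> (smul r x) else 0)"
  "r \<in> D \<Longrightarrow> add_char \<Lambda> (\<lambda>x. if x \<in> \<Lambda> then \<theta> (smul r x) else 0)"
  unfolding add_char_def
  using add_subgroup_add[OF D_subgroup] add_subgroup_add[OF \<Lambda>_facts(1)] lat_closed
  by (auto simp: smul_simps add_char_add[OF \<theta>_char] add_char_nonzero[OF \<theta>_char])

lemma cut_subgroup: "add_subgroup (cut \<theta> \<Lambda>)"
  unfolding add_subgroup_def
proof (intro conjI ballI)
  show "0 \<in> cut \<theta> \<Lambda>"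
    using add_subgroup_zero[OF \<Lambda>_facts(1)] add_char_zero[OF \<theta>_char lat_subgroup] by (simp add: cut_def smul_simps)
  fix x y assume "x \<in> cut \<theta> \<Lambda>" "y \<in> cut \<theta> \<Lambda>"
  then show "x - y \<in> cut \<theta> \<Lambda>"
    using add_subgroup_diff[OF \<Lambda>_facts(1)] lat_closed
    by (auto simp: cut_def smul_simps add_char_diff[OF \<theta>_char lat_subgroup])
qed

lemma cut_lattice: "lattice n (cut \<theta> \<Lambda>)"
  unfolding lattice_def
proof (intro conjI ballI cut_subgroup)
  show "cut \<theta> \<Lambda> \<subseteq> lat {..<n} 0" using \<Lambda>_facts(2) by (auto simp: cut_def)
  show "smul r x \<in> cut \<theta> \<Lambda>" if "r \<in> D" "x \<in> cut \<theta> \<Lambda>" for r x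
    using that \<Lambda>_facts(3) D_mult by (auto simp: cut_def smul_simps)
  obtain k where k: "\<And>x. x \<in> lat {..<n} k \<Longrightarrow> \<theta> x = 1"
    using \<theta> by (auto simp: smooth_chars_def chars_trivial_on_def)
  obtain l where l: "lat {..<n} l \<subseteq> \<Lambda>" using \<Lambda> by (auto simp: lattice_def)
  have "lat {..<n} (max k l) \<subseteq> cut \<theta> \<Lambda>"
  proof
    fix x assume "x \<in> lat {..<n} (max k l)"
    then have "x \<in> lat {..<n} k" "x \<in> lat {..<n} l" using lat_mono[of k "max k l"] lat_mono[of l "max k l"] by auto
    then show "x \<in> cut \<theta> \<Lambda>" using k l smul_lat[of _ x "{..<n}" k] by (auto simp: cut_def)
  qed
  then show "\<exists>k. lat {..<n} k \<subseteq> cut \<theta> \<Lambda>" by blast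
qed

text \<open>The pairing \<open>(x, r) \<mapsto> \<theta> (r x)\<close> between \<open>\<Lambda>\<close> modulo \<open>cut \<theta> \<Lambda>\<close> and \<open>D\<close> modulo \<open>\<pi>\<^sup>J\<close> is nondegenerate on
  both sides.\<close>

private lemma cut_index_J: "finite_index \<Lambda> (cut \<theta> \<Lambda>)" "subgroup_index \<Lambda> (cut \<theta> \<Lambda>) = q ^ J"
proof -
  let ?p = "\<lambda>x r. if r \<in> D then \<theta> (smul r x) else 0"
  have inj: "x - x' \<in> cut \<theta> \<Lambda>" if "x \<in> \<Lambda>" "x' \<in> \<Lambda>" "?p x = ?p x'" for x x'
  proof -
    have "\<theta> (smul r (x - x')) = 1" if "r \<in> D" for r
      using fun_cong[OF \<open>?p x = ?p x'\<close>, of r] that lat_closed \<open>x \<in> \<Lambda>\<close> \<open>x' \<in> \<Lambda>\<close> add_char_nonzero[OF \<theta>_char]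
      by (simp add: smul_simps add_char_diff[OF \<theta>_char lat_subgroup])
    then show ?thesis using add_subgroup_diff[OF \<Lambda>_facts(1) that(1,2)] by (simp add: cut_def)
  qed
  have triv: "?p x r = 1" if x: "x \<in> \<Lambda>" and r: "r \<in> P J" for x r
  proof -
    obtain s where s: "r = \<pi> ^ J * s" "s \<in> D" using r by blast
    have "smul r x = smul (\<pi> ^ J) (smul s x)" by (simp add: s smul_simps)
    moreover have "r \<in> D" by (rule subsetD[OF P_sub r])
    ultimately show ?thesis using J[OF \<Lambda>_facts(3)[OF s(2) x]] by simp
  qed
  note le = pairing_index_le[where p = ?p and X = \<Lambda> and Y = D and ?Y0.0 = "P J", OF cut_subgroup D_subgroup P_subgroup P_sub P_index(1) pair_char(1) triv inj]
  have fin: "finite_index \<Lambda> (cut \<theta> \<Lambda>)" by (rule le(1))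
  have 1: "subgroup_index \<Lambda> (cut \<theta> \<Lambda>) \<le> q ^ J" by (rule le(2)[unfolded P_index(2)])
  let ?p' = "\<lambda>r x. if x \<in> \<Lambda> then \<theta> (smul r x) else 0"
  have inj': "r - r' \<in> P J" if rr: "r \<in> D" "r' \<in> D" "?p' r = ?p' r'" for r r'
  proof (cases "r = r'")
    case True then show ?thesis using add_subgroup_zero[OF P_subgroup] by simp
  next
    case False
    have s: "r - r' \<in> D" "r - r' \<noteq> 0" using D_diff that False by auto
    \<comment> \<open>The lattice is stable under the unit \<open>u\<close>, so triviality of
      \<open>\<theta>\<close> on the multiples by \<open>r - r'\<close> is triviality on those by
      \<open>\<pi> ^ e\<close>. This gives \<open>J \<le> e\<close>, that is, divisibility of
      \<open>r - r'\<close> by \<open>\<pi> ^ J\<close>.\<close>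
    obtain u e where u: "u \<in> D" "inverse u \<in> D" "u \<noteq> 0" "r - r' = u * \<pi> ^ e" using D_decomp[OF s] by blast
    have one: "\<theta> (smul (r - r') x) = 1" if x: "x \<in> \<Lambda>" for x
    proof -
      have l: "smul r x \<in> lat {..<n} 0" "smul r' x \<in> lat {..<n} 0" using lat_closed[OF _ x] rr(1,2) by simp_all
      have "\<theta> (smul r x) = \<theta> (smul r' x)" using fun_cong[OF rr(3), of x] x by simp
      then show ?thesis unfolding smul_simps add_char_diff[OF \<theta>_char lat_subgroup l]
        using add_char_nonzero[OF \<theta>_char l(2)] by simp
    qed
    have "\<theta> (smul (\<pi> ^ e) x) = 1" if x: "x \<in> \<Lambda>" for x
    proof -
      have e: "(r - r') * inverse u = \<pi> ^ e" unfolding u(4) using u(3) by simp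
      show ?thesis using one[OF \<Lambda>_facts(3)[OF u(2) x]] unfolding smul_simps(5) e .
    qed
    then have "J \<le> e" unfolding J_le_iff by blast
    then have e: "\<pi> ^ J * \<pi> ^ (e - J) = \<pi> ^ e" by (simp flip: power_add)
    have "r - r' = \<pi> ^ J * (\<pi> ^ (e - J) * u)" unfolding mult.assoc[symmetric] e u(4) by (rule mult.commute)
    moreover have "\<pi> ^ (e - J) * u \<in> D" by (intro D_mult D_power \<pi>_D u(1))
    ultimately show ?thesis by (rule image_eqI[where f = "(*) (\<pi> ^ J)"])
  qed
  have triv': "?p' r x = 1" if "r \<in> D" "x \<in> cut \<theta> \<Lambda>" for r x using that by (auto simp: cut_def)
  have sub: "cut \<theta> \<Lambda> \<subseteq> \<Lambda>" by (auto simp: cut_def)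
  note le' = pairing_index_le(2)[where p = ?p' and X = D and Y = \<Lambda> and ?X0.0 = "P J",
    OF P_subgroup \<Lambda>_facts(1) cut_subgroup sub fin pair_char(2) triv' inj']
  have "q ^ J \<le> subgroup_index \<Lambda> (cut \<theta> \<Lambda>)" by (rule le'[unfolded P_index(2)])
  then show "finite_index \<Lambda> (cut \<theta> \<Lambda>)" "subgroup_index \<Lambda> (cut \<theta> \<Lambda>) = q ^ J" using fin 1 by simp_all
qed

text \<open>The last clause trades a bound on the index for triviality on a fixed subgroup; the
  characters with this property can be counted.\<close>

lemma cut_index:
  "finite_index \<Lambda> (cut \<theta> \<Lambda>)"
  "\<exists>j. subgroup_index \<Lambda> (cut \<theta> \<Lambda>) = q ^ j"
  "subgroup_index \<Lambda> (cut \<theta> \<Lambda>) \<le> q ^ j \<longleftrightarrow> (\<forall>x\<in>smul (\<pi> ^ j) ` \<Lambda>. \<theta> x = 1)"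
  using cut_index_J J_le_iff[of j] q_ge_2 by auto

end

text \<open>The number of smooth characters that cut the full lattice of rank \<open>n\<close> by
  index exactly \<open>q ^ j\<close>.\<close>

definition kappa :: "nat \<Rightarrow> nat \<Rightarrow> nat" where
  "kappa n j = (case j of 0 \<Rightarrow> 1 | Suc i \<Rightarrow> q ^ (n * Suc i) - q ^ (n * i))"

text \<open>A cut of index at most \<open>q ^ j\<close> means triviality on \<open>\<pi> ^ j\<close>
  times \<open>\<Lambda>\<close>, and there are as many such characters as the index of that
  sublattice. Differences for consecutive \<open>j\<close> count the cuts of exact index.\<close>

lemma card_cut_index:
  assumes \<Lambda>: "lattice n \<Lambda>"
  shows "finite {\<theta> \<in> smooth_chars n. subgroup_index \<Lambda> (cut \<theta> \<Lambda>) = q ^ j}"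
    "card {\<theta> \<in> smooth_chars n. subgroup_index \<Lambda> (cut \<theta> \<Lambda>) = q ^ j} = subgroup_index (lat {..<n} 0) \<Lambda> * kappa n j"
proof -
  let ?V = "lat {..<n}"
  let ?N = "subgroup_index (?V 0) \<Lambda>"
  have \<Lambda>V: "\<Lambda> \<subseteq> ?V 0" using \<Lambda> by (auto simp: lattice_def)
  define S where "S j = {\<theta> \<in> smooth_chars n. subgroup_index \<Lambda> (cut \<theta> \<Lambda>) \<le> q ^ j}" for j
  have S: "S j = chars_trivial_on (?V 0) (smul (\<pi> ^ j) ` \<Lambda>)" for j
  proof (intro subset_antisym subsetI)
    fix \<theta> assume "\<theta> \<in> S j"
    then have "\<theta> \<in> smooth_chars n" "\<forall>x\<in>smul (\<pi> ^ j) ` \<Lambda>. \<theta> x = 1"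
      using cut_index(3)[OF \<Lambda>, of \<theta> j] by (auto simp: S_def)
    then show "\<theta> \<in> chars_trivial_on (?V 0) (smul (\<pi> ^ j) ` \<Lambda>)" by (auto simp: smooth_chars_def chars_trivial_on_def)
  next
    fix \<theta> assume t: "\<theta> \<in> chars_trivial_on (?V 0) (smul (\<pi> ^ j) ` \<Lambda>)"
    obtain k where "?V k \<subseteq> smul (\<pi> ^ j) ` \<Lambda>" using lattice_index_scaled(4)[OF \<Lambda>] by blast
    then have "\<theta> \<in> chars_trivial_on (?V 0) (?V k)" using t unfolding chars_trivial_on_def by blast
    then have "\<theta> \<in> smooth_chars n" by (auto simp: smooth_chars_def)
    then show "\<theta> \<in> S j" using cut_index(3)[OF \<Lambda>, of \<theta> j] t by (auto simp: S_def chars_trivial_on_def)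
  qed
  have card_S: "finite (S j)" "card (S j) = ?N * q ^ (n * j)" for j
    using card_chars_trivial_on[OF lat_subgroup lattice_index_scaled(1)[OF \<Lambda>] _ lattice_index_scaled(3)[OF \<Lambda>], of j]
      lattice_index_scaled(2)[OF \<Lambda>, of j] lattice_index_scaled(5)[OF \<Lambda>, of j] \<Lambda>V
    unfolding S by auto
  let ?E = "{\<theta> \<in> smooth_chars n. subgroup_index \<Lambda> (cut \<theta> \<Lambda>) = q ^ j}"
  have E: "?E = (case j of 0 \<Rightarrow> S 0 | Suc i \<Rightarrow> S (Suc i) - S i)"
  proof (intro Set.set_eqI)
    fix \<theta>
    show "\<theta> \<in> ?E \<longleftrightarrow> \<theta> \<in> (case j of 0 \<Rightarrow> S 0 | Suc i \<Rightarrow> S (Suc i) - S i)"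
    proof (cases "\<theta> \<in> smooth_chars n")
      case True
      obtain e where e: "subgroup_index \<Lambda> (cut \<theta> \<Lambda>) = q ^ e" using cut_index(2)[OF \<Lambda> True] by blast
      have S_mem: "\<theta> \<in> S i \<longleftrightarrow> e \<le> i" for i using True e q_ge_2 by (simp add: S_def)
      have E_mem: "\<theta> \<in> ?E \<longleftrightarrow> e = j" using True e q_ge_2 by simp
      show ?thesis unfolding E_mem by (cases j) (auto simp: S_mem)
    next
      case False
      then have S_mem: "\<theta> \<notin> S i" for i by (simp add: S_def)
      show ?thesis using False by (cases j) (auto simp: S_mem)
    qed
  qed
  show "finite ?E" unfolding E using card_S(1) by (auto split: nat.split)
  show "card ?E = ?N * kappa n j"
  proof (cases j)
    case 0 then show ?thesis unfolding E using card_S(2)[of 0] by (simp add: kappa_def)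
  next
    case (Suc i)
    have "q ^ i \<le> q ^ Suc i" using q_ge_2 by simp
    then have "S i \<subseteq> S (Suc i)" unfolding S_def using order_trans by blast
    then have "card (S (Suc i) - S i) = ?N * q ^ (n * Suc i) - ?N * q ^ (n * i)"
      using card_S by (simp add: card_Diff_subset)
    then show ?thesis unfolding E using Suc by (simp add: kappa_def diff_mult_distrib2)
  qed
qed

text \<open>Successive cuts, the head of the list coming last. Fed with the rows of a central
  character, this yields its radical (\<open>rad2_rad_list\<close>).\<close>

fun rad_list :: "nat \<Rightarrow> ((nat \<Rightarrow> complex) \<Rightarrow> complex) list \<Rightarrow> (nat \<Rightarrow> complex) set" where
  "rad_list n [] = lat {..<n} 0"
| "rad_list n (\<theta> # xs) = cut \<theta> (rad_list n xs)"

lemma rad_list_mem: "b \<in> rad_list n xs \<longleftrightarrow> b \<in> lat {..<n} 0 \<and> (\<forall>\<theta>\<in>set xs. \<forall>r\<in>D. \<theta> (smul r b) = 1)"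
  by (induction xs) (auto simp: cut_def)

lemma rad_list_lattice:
  assumes "set xs \<subseteq> smooth_chars n"
  shows "lattice n (rad_list n xs)" "\<exists>l. subgroup_index (lat {..<n} 0) (rad_list n xs) = q ^ l"
proof -
  have "lattice n (rad_list n xs) \<and> (\<exists>l. subgroup_index (lat {..<n} 0) (rad_list n xs) = q ^ l)"
    using assms
  proof (induction xs)
    case Nil
    have "lattice n (rad_list n [])" using smul_lat[of _ _ "{..<n}" 0] by (auto simp: lattice_def lat_subgroup)
    moreover have "\<exists>l. subgroup_index (lat {..<n} 0) (rad_list n []) = q ^ l"
      using subgroup_index_refl(1)[OF lat_subgroup] by (intro exI[of _ 0]) simp
    ultimately show ?case ..
  next
    case (Cons \<theta> xs)
    then have \<theta>: "\<theta> \<in> smooth_chars n" by simp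
    from Cons obtain l where IH: "lattice n (rad_list n xs)" "subgroup_index (lat {..<n} 0) (rad_list n xs) = q ^ l" by auto
    have "lattice n (rad_list n (\<theta> # xs))" using cut_lattice[OF IH(1) \<theta>] by simp
    moreover obtain j where j: "subgroup_index (rad_list n xs) (cut \<theta> (rad_list n xs)) = q ^ j"
      using cut_index(2)[OF IH(1) \<theta>] by blast
    have "subgroup_index (lat {..<n} 0) (cut \<theta> (rad_list n xs)) = q ^ l * q ^ j"
      unfolding IH(2)[symmetric] j[symmetric]
      by (rule subgroup_index_mult(2)[OF lat_subgroup _ cut_subgroup[OF IH(1) \<theta>] _ _ lattice_finite_index[OF IH(1)] cut_index(1)[OF IH(1) \<theta>]])
        (use IH(1) in \<open>auto simp: lattice_def cut_def\<close>)
    then have "\<exists>l. subgroup_index (lat {..<n} 0) (rad_list n (\<theta> # xs)) = q ^ l" by (auto simp: power_add[symmetric])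
    ultimately show ?case ..
  qed
  then show "lattice n (rad_list n xs)" "\<exists>l. subgroup_index (lat {..<n} 0) (rad_list n xs) = q ^ l" by auto
qed

definition tuples :: "nat \<Rightarrow> nat \<Rightarrow> nat \<Rightarrow> ((nat \<Rightarrow> complex) \<Rightarrow> complex) list set" where
  "tuples n m l = {xs. length xs = m \<and> set xs \<subseteq> smooth_chars n \<and>
     subgroup_index (lat {..<n} 0) (rad_list n xs) = q ^ l}"

lemma tuples_0: "tuples n 0 l = (if l = 0 then {[]} else {})"
proof -
  have "1 < q ^ l" if "l \<noteq> 0" using q_ge_2 that by (intro one_less_power) simp_all
  then have "1 \<noteq> q ^ l" if "l \<noteq> 0" using that by fastforce
  then show ?thesis
    unfolding tuples_def using subgroup_index_refl(1)[OF lat_subgroup, of "{..<n}" 0] by (cases "l = 0") auto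
qed

text \<open>Indices multiply, so the exponent \<open>l\<close> splits into \<open>l'\<close> for the
  tail of the list and \<open>l - l'\<close> for the cut by its head.\<close>

lemma tuples_Suc:
  "tuples n (Suc m) l = (\<Union>l'\<in>{..l}. (\<lambda>(xs, \<theta>). \<theta> # xs) `
     (SIGMA xs:tuples n m l'. {\<theta> \<in> smooth_chars n. subgroup_index (rad_list n xs) (cut \<theta> (rad_list n xs)) = q ^ (l - l')}))"
proof (intro Set.set_eqI)
  fix ys
  have key: "subgroup_index (lat {..<n} 0) (rad_list n (\<theta> # xs)) =
      subgroup_index (lat {..<n} 0) (rad_list n xs) * subgroup_index (rad_list n xs) (cut \<theta> (rad_list n xs))"
    if *: "\<theta> \<in> smooth_chars n" "set xs \<subseteq> smooth_chars n" for \<theta> xs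
  proof -
    note \<Lambda> = rad_list_lattice(1)[OF *(2)]
    show ?thesis unfolding rad_list.simps
      by (rule subgroup_index_mult(2)[OF lat_subgroup _ cut_subgroup[OF \<Lambda> *(1)] _ _ lattice_finite_index[OF \<Lambda>] cut_index(1)[OF \<Lambda> *(1)]])
        (use \<Lambda> in \<open>auto simp: lattice_def cut_def\<close>)
  qed
  show "ys \<in> tuples n (Suc m) l \<longleftrightarrow> ys \<in> (\<Union>l'\<in>{..l}. (\<lambda>(xs, \<theta>). \<theta> # xs) `
     (SIGMA xs:tuples n m l'. {\<theta> \<in> smooth_chars n. subgroup_index (rad_list n xs) (cut \<theta> (rad_list n xs)) = q ^ (l - l')}))"
  proof
    assume "ys \<in> tuples n (Suc m) l"
    then obtain \<theta> xs where ys: "ys = \<theta> # xs" "length xs = m" "\<theta> \<in> smooth_chars n" "set xs \<subseteq> smooth_chars n"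
      "subgroup_index (lat {..<n} 0) (rad_list n (\<theta> # xs)) = q ^ l"
      by (cases ys) (auto simp: tuples_def)
    obtain l' where l': "subgroup_index (lat {..<n} 0) (rad_list n xs) = q ^ l'" using rad_list_lattice(2)[OF ys(4)] by blast
    obtain j where j: "subgroup_index (rad_list n xs) (cut \<theta> (rad_list n xs)) = q ^ j"
      using cut_index(2)[OF rad_list_lattice(1)[OF ys(4)] ys(3)] by blast
    have "q ^ l = q ^ (l' + j)" using key[OF ys(3,4)] ys(5) l' j by (simp add: power_add)
    then have "l = l' + j" using q_ge_2 by simp
    then have "l' \<le> l" "j = l - l'" by auto
    then show "ys \<in> (\<Union>l'\<in>{..l}. (\<lambda>(xs, \<theta>). \<theta> # xs) `
     (SIGMA xs:tuples n m l'. {\<theta> \<in> smooth_chars n. subgroup_index (rad_list n xs) (cut \<theta> (rad_list n xs)) = q ^ (l - l')}))"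
      using ys l' j by (intro UN_I[of l'] image_eqI[of _ _ "(xs, \<theta>)"]) (auto simp: tuples_def)
  next
    assume "ys \<in> (\<Union>l'\<in>{..l}. (\<lambda>(xs, \<theta>). \<theta> # xs) `
     (SIGMA xs:tuples n m l'. {\<theta> \<in> smooth_chars n. subgroup_index (rad_list n xs) (cut \<theta> (rad_list n xs)) = q ^ (l - l')}))"
    then obtain l' xs \<theta> where *: "l' \<le> l" "ys = \<theta> # xs" "xs \<in> tuples n m l'" "\<theta> \<in> smooth_chars n"
      "subgroup_index (rad_list n xs) (cut \<theta> (rad_list n xs)) = q ^ (l - l')" by auto
    then show "ys \<in> tuples n (Suc m) l" using key[OF *(4), of xs] by (auto simp: tuples_def simp flip: power_add)
  qed
qed

text \<open>The number of admissible heads depends on the tail only through the index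
  \<open>q ^ l'\<close> of the lattice reached by it.\<close>

lemma card_tuples_Suc:
  "finite (tuples n m l)"
  "card (tuples n (Suc m) l) = (\<Sum>l'\<le>l. card (tuples n m l') * q ^ l' * kappa n (l - l'))"
proof -
  define E where "E xs j = {\<theta> \<in> smooth_chars n. subgroup_index (rad_list n xs) (cut \<theta> (rad_list n xs)) = q ^ j}" for xs j
  have E: "finite (E xs j)" "card (E xs j) = q ^ l' * kappa n j" if "xs \<in> tuples n m l'" for xs j l' m
  proof -
    have xs: "set xs \<subseteq> smooth_chars n" "subgroup_index (lat {..<n} 0) (rad_list n xs) = q ^ l'"
      using that by (auto simp: tuples_def)
    show "finite (E xs j)" "card (E xs j) = q ^ l' * kappa n j"
      using card_cut_index[OF rad_list_lattice(1)[OF xs(1)], of j] xs(2) unfolding E_def by auto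
  qed
  have tS: "tuples n (Suc m) l = (\<Union>l'\<in>{..l}. (\<lambda>(xs, \<theta>). \<theta> # xs) ` (SIGMA xs:tuples n m l'. E xs (l - l')))" for m l
    unfolding E_def by (rule tuples_Suc)
  have fin: "finite (tuples n m l)" for m l
  proof (induction m arbitrary: l)
    case 0 then show ?case by (simp add: tuples_0)
  next
    case (Suc m)
    show ?case unfolding tS
      by (intro finite_UN_I finite_imageI finite_SigmaI Suc E(1)) auto
  qed
  then show "finite (tuples n m l)" .
  have inj: "inj_on (\<lambda>(xs, \<theta>). \<theta> # xs) S" for S :: "(((nat \<Rightarrow> complex) \<Rightarrow> complex) list \<times> ((nat \<Rightarrow> complex) \<Rightarrow> complex)) set"
    by (auto simp: inj_on_def)
  have disj: "tuples n m l1 \<inter> tuples n m l2 = {}" if "l1 \<noteq> l2" for l1 l2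
    using that q_ge_2 by (auto simp: tuples_def)
  have "card (tuples n (Suc m) l) = (\<Sum>l'\<in>{..l}. card ((\<lambda>(xs, \<theta>). \<theta> # xs) ` (SIGMA xs:tuples n m l'. E xs (l - l'))))"
    unfolding tS
  proof (rule card_UN_disjoint)
    show "\<forall>i\<in>{..l}. finite ((\<lambda>(xs, \<theta>). \<theta> # xs) ` (SIGMA xs:tuples n m i. E xs (l - i)))"
      by (intro ballI finite_imageI finite_SigmaI fin E(1))
    show "\<forall>i\<in>{..l}. \<forall>j\<in>{..l}. i \<noteq> j \<longrightarrow> (\<lambda>(xs, \<theta>). \<theta> # xs) ` (SIGMA xs:tuples n m i. E xs (l - i)) \<inter>
        (\<lambda>(xs, \<theta>). \<theta> # xs) ` (SIGMA xs:tuples n m j. E xs (l - j)) = {}"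
    proof (intro ballI impI)
      fix i j :: nat assume "i \<noteq> j"
      then have "tuples n m i \<inter> tuples n m j = {}" by (rule disj)
      then show "(\<lambda>(xs, \<theta>). \<theta> # xs) ` (SIGMA xs:tuples n m i. E xs (l - i)) \<inter>
        (\<lambda>(xs, \<theta>). \<theta> # xs) ` (SIGMA xs:tuples n m j. E xs (l - j)) = {}" by auto
    qed
  qed simp
  also have "\<dots> = (\<Sum>l'\<le>l. card (tuples n m l') * q ^ l' * kappa n (l - l'))"
  proof (intro sum.cong refl)
    fix l'
    have "card ((\<lambda>(xs, \<theta>). \<theta> # xs) ` (SIGMA xs:tuples n m l'. E xs (l - l'))) = card (SIGMA xs:tuples n m l'. E xs (l - l'))"
      by (rule card_image[OF inj])
    also have "\<dots> = (\<Sum>xs\<in>tuples n m l'. card (E xs (l - l')))"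
      by (rule card_SigmaI) (use fin E(1) in auto)
    also have "\<dots> = (\<Sum>xs\<in>tuples n m l'. q ^ l' * kappa n (l - l'))" by (intro sum.cong refl E(2))
    finally show "card ((\<lambda>(xs, \<theta>). \<theta> # xs) ` (SIGMA xs:tuples n m l'. E xs (l - l'))) = card (tuples n m l') * q ^ l' * kappa n (l - l')"
      by simp
  qed
  finally show "card (tuples n (Suc m) l) = (\<Sum>l'\<le>l. card (tuples n m l') * q ^ l' * kappa n (l - l'))" .
qed

end

section \<open>Central characters as tuples of row characters\<close>

context unipotent_completion
begin

definition row_chars :: "((nat \<times> nat \<Rightarrow> complex) \<Rightarrow> complex) \<Rightarrow> ((nat \<Rightarrow> complex) \<Rightarrow> complex) list" where
  "row_chars \<psi> = map (\<lambda>i b. if b \<in> VB 0 then \<psi> (outer (axis i) b) else 0) [0..<m]"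

definition of_row_chars :: "((nat \<Rightarrow> complex) \<Rightarrow> complex) list \<Rightarrow> (nat \<times> nat \<Rightarrow> complex) \<Rightarrow> complex" where
  "of_row_chars xs c = (if c \<in> VC 0 then \<Prod>i<m. (xs ! i) (row i c) else 0)"

lemma outer_axis: "i < m \<Longrightarrow> b \<in> VB k \<Longrightarrow> outer (axis i) b \<in> VC k"
  using outer_level[OF axis_VA, of i b k] lat_mono[of 0 k "{..<n}"] by auto

lemma row_outer_axis: "row j (outer (axis i) b) = (if j = i then b else 0)"
  by (auto simp: row_def outer_def axis_def)

text \<open>Row \<open>i\<close> of \<open>outer a b\<close> is \<open>a i\<close> times
  \<open>b\<close>, and the entries of \<open>a\<close> vary freely in \<open>D\<close>. So pairing
  trivially with all \<open>a\<close> means being cut out by each row character separately.\<close>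

lemma rad2_rad_list:
  assumes \<psi>: "add_char (VC 0) \<psi>" shows "rad2 \<psi> = rad_list n (row_chars \<psi>)"
proof (intro Set.set_eqI)
  fix b
  have "(\<forall>a\<in>VA 0. \<psi> (outer a b) = 1) \<longleftrightarrow> (\<forall>i<m. \<forall>r\<in>D. \<psi> (outer (axis i) (smul r b)) = 1)" if b: "b \<in> VB 0"
  proof (intro iffI allI impI ballI)
    fix i r assume a: "\<forall>a\<in>VA 0. \<psi> (outer a b) = 1" and i: "i < m" "r \<in> D"
    have "outer (axis i) (smul r b) = outer (smul r (axis i)) b" by (auto simp: outer_def smul_def)
    then show "\<psi> (outer (axis i) (smul r b)) = 1" using a smul_lat[OF i(2) axis_VA[OF i(1)]] by simp
  next
    fix a assume r: "\<forall>i<m. \<forall>r\<in>D. \<psi> (outer (axis i) (smul r b)) = 1" and a: "a \<in> VA 0"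
    have "row i (outer a b) = smul (a i) b" for i by (auto simp: outer_def smul_def row_def)
    moreover have "\<forall>i<m. a i \<in> D" using a by (auto simp: lat_0)
    ultimately show "\<psi> (outer a b) = 1"
      unfolding add_char_rows[OF \<psi> \<beta>_C[OF a b]] using r by (intro prod.neutral) auto
  qed
  then show "b \<in> rad2 \<psi> \<longleftrightarrow> b \<in> rad_list n (row_chars \<psi>)"
    unfolding rad2_def rad_list_mem row_chars_def using smul_lat[of _ b "{..<n}" 0] by auto
qed

lemma row_chars_smooth:
  assumes "\<psi> \<in> chars_trivial_on (VC 0) (VC k)" shows "set (row_chars \<psi>) \<subseteq> smooth_chars n"
proof
  fix \<theta> assume "\<theta> \<in> set (row_chars \<psi>)"
  then obtain i where i: "i < m" "\<theta> = (\<lambda>b. if b \<in> VB 0 then \<psi> (outer (axis i) b) else 0)"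
    by (auto simp: row_chars_def)
  have \<psi>: "add_char (VC 0) \<psi>" "\<And>c. c \<in> VC k \<Longrightarrow> \<psi> c = 1" using assms by (auto simp: chars_trivial_on_def)
  have sum: "outer (axis i) (x + y) = outer (axis i) x + outer (axis i) y" for x y
    by (auto simp: outer_def algebra_simps)
  have "add_char (VB 0) \<theta>"
    unfolding add_char_def i(2)
    using add_subgroup_add[OF B] outer_axis[OF i(1), of _ 0] add_char_nonzero[OF \<psi>(1)]
    by (auto simp: sum add_char_add[OF \<psi>(1)])
  moreover have "\<theta> b = 1" if "b \<in> VB k" for b
    using that lat_mono[of 0 k "{..<n}"] \<psi>(2)[OF outer_axis[OF i(1) that]] by (auto simp: i(2))
  ultimately show "\<theta> \<in> smooth_chars n" by (auto simp: smooth_chars_def chars_trivial_on_def)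
qed

lemma of_row_chars_row_chars:
  assumes "add_char (VC 0) \<psi>" shows "of_row_chars (row_chars \<psi>) = \<psi>"
proof
  fix c
  show "of_row_chars (row_chars \<psi>) c = \<psi> c"
  proof (cases "c \<in> VC 0")
    case True
    then show ?thesis
      unfolding of_row_chars_def add_char_rows[OF assms True]
      using row_VB[OF _ True] by (auto simp: row_chars_def intro!: prod.cong)
  next
    case False then show ?thesis using add_char_outside[OF assms] by (simp add: of_row_chars_def)
  qed
qed

lemma of_row_chars_smooth:
  assumes "length xs = m" "set xs \<subseteq> smooth_chars n"
  shows "\<exists>k. of_row_chars xs \<in> chars_trivial_on (VC 0) (VC k)" "row_chars (of_row_chars xs) = xs"
proof -
  have "\<forall>i<m. \<exists>k. xs ! i \<in> chars_trivial_on (VB 0) (VB k)"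
  proof (intro allI impI)
    fix i assume "i < m"
    then have "xs ! i \<in> smooth_chars n" using assms nth_mem[of i xs] by auto
    then show "\<exists>k. xs ! i \<in> chars_trivial_on (VB 0) (VB k)" by (simp add: smooth_chars_def)
  qed
  then obtain k where k: "\<And>i. i < m \<Longrightarrow> xs ! i \<in> chars_trivial_on (VB 0) (VB (k i))" by metis
  have char: "add_char (VB 0) (xs ! i)" if "i < m" for i using k[OF that] by (auto simp: chars_trivial_on_def)
  define K where "K = Max (insert 0 (k ` {..<m}))"
  have triv: "(xs ! i) b = 1" if "i < m" "b \<in> VB K" for i b
  proof -
    have "k i \<le> K" unfolding K_def using that(1) by (intro Max_ge) auto
    then have "b \<in> VB (k i)" using lat_mono that(2) by blast
    then show ?thesis using k[OF that(1)] by (auto simp: chars_trivial_on_def)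
  qed
  have "of_row_chars xs \<in> chars_trivial_on (VC 0) (VC K)"
    unfolding chars_trivial_on_def add_char_def
  proof (intro CollectI conjI ballI allI impI)
    fix x y assume xy: "x \<in> VC 0" "y \<in> VC 0"
    have "(xs ! i) (row i (x + y)) = (xs ! i) (row i x) * (xs ! i) (row i y)" if "i < m" for i
    proof -
      have "row i (x + y) = row i x + row i y" by (auto simp: row_def)
      then show ?thesis using add_char_add[OF char[OF that] row_VB[OF that xy(1)] row_VB[OF that xy(2)]] by simp
    qed
    then show "of_row_chars xs (x + y) = of_row_chars xs x * of_row_chars xs y"
      using xy add_subgroup_add[OF C xy] by (simp add: of_row_chars_def prod.distrib)
  next
    fix x assume "x \<in> VC 0"
    then show "of_row_chars xs x \<noteq> 0"
      using add_char_nonzero[OF char row_VB] by (simp add: of_row_chars_def)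
  next
    fix x assume "x \<in> VC K"
    then show "of_row_chars xs x = 1"
      using triv row_VB lat_mono[of 0 K "{..<m} \<times> {..<n}"] by (auto simp: of_row_chars_def)
  qed (auto simp: of_row_chars_def)
  then show "\<exists>k. of_row_chars xs \<in> chars_trivial_on (VC 0) (VC k)" by (rule exI)
  show "row_chars (of_row_chars xs) = xs"
  proof (rule nth_equalityI)
    fix i assume "i < length (row_chars (of_row_chars xs))"
    then have i: "i < m" by (simp add: row_chars_def)
    have "(if b \<in> VB 0 then of_row_chars xs (outer (axis i) b) else 0) = (xs ! i) b" for b
    proof (cases "b \<in> VB 0")
      case True
      have "(\<Prod>j<m. (xs ! j) (row j (outer (axis i) b))) = (\<Prod>j<m. if j = i then (xs ! i) b else 1)"
        using add_char_zero[OF char B] by (intro prod.cong refl) (auto simp: row_outer_axis)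
      also have "\<dots> = (xs ! i) b" using i by simp
      finally show ?thesis using True outer_axis[OF i True] by (simp add: of_row_chars_def)
    next
      case False then show ?thesis using add_char_outside[OF char[OF i]] by simp
    qed
    then show "row_chars (of_row_chars xs) ! i = xs ! i" using i by (simp add: row_chars_def cong: if_cong)
  qed (simp add: row_chars_def assms)
qed

text \<open>Splitting a matrix into its rows identifies smooth characters of the matrices with
  \<open>m\<close>-tuples of smooth characters of the row space, and the radicals agree.\<close>

lemma central_chars_bij: "bij_betw row_chars {\<psi>. central_chars (q ^ l) \<psi>} (tuples n m l)"
proof (rule bij_betw_byWitness[where f' = of_row_chars])
  have char: "add_char (VC 0) \<psi>" if "central_chars d \<psi>" for \<psi> d
    using that by (auto simp: central_chars_def chars_trivial_on_def)
  show "\<forall>\<psi>\<in>{\<psi>. central_chars (q ^ l) \<psi>}. of_row_chars (row_chars \<psi>) = \<psi>"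
    using of_row_chars_row_chars char by simp
  show "\<forall>xs\<in>tuples n m l. row_chars (of_row_chars xs) = xs"
    using of_row_chars_smooth(2) by (simp add: tuples_def)
  show "row_chars ` {\<psi>. central_chars (q ^ l) \<psi>} \<subseteq> tuples n m l"
  proof (intro image_subsetI)
    fix \<psi> assume "\<psi> \<in> {\<psi>. central_chars (q ^ l) \<psi>}"
    then have c: "central_chars (q ^ l) \<psi>" by simp
    then obtain k where "\<psi> \<in> chars_trivial_on (VC 0) (VC k)" by (auto simp: central_chars_def)
    then show "row_chars \<psi> \<in> tuples n m l"
      using c row_chars_smooth rad2_rad_list[OF char[OF c]] by (simp add: tuples_def central_chars_def row_chars_def)
  qed
  show "of_row_chars ` tuples n m l \<subseteq> {\<psi>. central_chars (q ^ l) \<psi>}"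
  proof (intro image_subsetI CollectI)
    fix xs assume "xs \<in> tuples n m l"
    then have xs: "length xs = m" "set xs \<subseteq> smooth_chars n" "subgroup_index (VB 0) (rad_list n xs) = q ^ l"
      by (simp_all add: tuples_def)
    then obtain k where k: "of_row_chars xs \<in> chars_trivial_on (VC 0) (VC k)" using of_row_chars_smooth(1) by blast
    then have "add_char (VC 0) (of_row_chars xs)" by (simp add: chars_trivial_on_def)
    from rad2_rad_list[OF this] have "rad2 (of_row_chars xs) = rad_list n xs"
      using of_row_chars_smooth(2)[OF xs(1,2)] by simp
    then show "central_chars (q ^ l) (of_row_chars xs)" using k xs(3) by (auto simp: central_chars_def)
  qed
qed

text \<open>The radical is reached by successive cuts, each of index a power of
  \<open>q\<close>.\<close>

lemma central_chars_degree:
  assumes "central_chars d \<psi>" shows "\<exists>l. d = q ^ l"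
proof -
  obtain k where k: "\<psi> \<in> chars_trivial_on (VC 0) (VC k)" "subgroup_index (VB 0) (rad2 \<psi>) = d"
    using assms by (auto simp: central_chars_def)
  then have "add_char (VC 0) \<psi>" by (simp add: chars_trivial_on_def)
  then show ?thesis using rad_list_lattice(2)[OF row_chars_smooth[OF k(1)]] k(2) by (simp add: rad2_rad_list)
qed

theorem card_twist_classes:
  "finite (twist_classes G TG d)"
  "card (twist_classes G TG (q ^ l)) = card (tuples n m l)"
  "d \<notin> range ((^) q) \<Longrightarrow> card (twist_classes G TG d) = 0"
proof -
  show 1: "card (twist_classes G TG (q ^ l)) = card (tuples n m l)" for l
    using bij_betw_same_card[OF twist_classes_bij] bij_betw_same_card[OF central_chars_bij] by simp
  have 2: "twist_classes G TG d = {}" if "d \<notin> range ((^) q)"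
  proof -
    have "{\<psi>. central_chars d \<psi>} = {}" using central_chars_degree that by blast
    then show ?thesis using twist_classes_bij[of d] by (simp add: bij_betw_def)
  qed
  then show "d \<notin> range ((^) q) \<Longrightarrow> card (twist_classes G TG d) = 0" by simp
  show "finite (twist_classes G TG d)"
  proof (cases "d \<in> range ((^) q)")
    case True
    then obtain l where d: "d = q ^ l" by blast
    show ?thesis
      unfolding d using bij_betw_finite[OF twist_classes_bij] bij_betw_finite[OF central_chars_bij] card_tuples_Suc(1) by blast
  qed (use 2 in simp)
qed

end

section \<open>The generating function of the counts\<close>

context dvr
begin

text \<open>With \<open>u = of_nat q ^ n * t\<close> the terms after the first are
  \<open>(u - t) * u ^ j\<close>, a geometric series.\<close>

lemma kappa_sums:
  fixes t :: complex
  assumes "norm (of_nat q ^ n * t) < 1"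
  shows "(\<lambda>j. of_nat (kappa n j) * t ^ j) sums ((1 - t) / (1 - of_nat q ^ n * t))"
proof -
  define u where "u = of_nat q ^ n * t"
  have u: "norm u < 1" "1 - u \<noteq> 0" using assms by (auto simp: u_def)
  have "of_nat (kappa n (Suc j)) * t ^ Suc j = u * u ^ j - t * u ^ j" for j
  proof -
    define p :: complex where "p = of_nat q ^ n"
    have "q ^ (n * j) \<le> q ^ (n * Suc j)" using q_ge_2 by (intro power_increasing) auto
    then have k: "of_nat (kappa n (Suc j)) = p ^ Suc j - p ^ j"
      unfolding p_def power_mult[symmetric] by (simp add: kappa_def of_nat_diff)
    show ?thesis unfolding k u_def p_def[symmetric] by (simp add: power_mult_distrib algebra_simps)
  qed
  moreover have "(\<lambda>j. u * u ^ j - t * u ^ j) sums (u * (1 / (1 - u)) - t * (1 / (1 - u)))"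
    by (intro sums_diff sums_mult geometric_sums u)
  ultimately have "(\<lambda>j. of_nat (kappa n (Suc j)) * t ^ Suc j) sums (u * (1 / (1 - u)) - t * (1 / (1 - u)))"
    by simp
  from sums_Suc[where f = "\<lambda>j. of_nat (kappa n j) * t ^ j", OF this]
  have "(\<lambda>j. of_nat (kappa n j) * t ^ j) sums (u * (1 / (1 - u)) - t * (1 / (1 - u)) + 1)"
    by (simp add: kappa_def)
  also have "u * (1 / (1 - u)) - t * (1 / (1 - u)) + 1 = (u - t + (1 - u)) / (1 - u)"
    unfolding add_divide_distrib diff_divide_distrib[of u t] using u(2) by simp
  also have "u - t + (1 - u) = 1 - t" by simp
  finally show ?thesis unfolding u_def .
qed

text \<open>For nonnegative coefficients, convergence at \<open>norm t\<close> is absolute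
  convergence at \<open>t\<close>.\<close>

lemma summable_norm_power_series:
  fixes c :: "nat \<Rightarrow> nat" and t :: complex
  assumes "summable (\<lambda>l. of_nat (c l) * complex_of_real (norm t) ^ l)"
  shows "summable (\<lambda>l. norm (of_nat (c l) * t ^ l))"
proof -
  have "(\<lambda>l. of_nat (c l) * complex_of_real (norm t) ^ l) = (\<lambda>l. complex_of_real (norm (of_nat (c l) * t ^ l)))"
    by (simp add: norm_mult norm_power)
  then show ?thesis using assms by (simp add: summable_complex_of_real)
qed

text \<open>The recursion for the counts is a Cauchy product. The factor \<open>q ^ l'\<close>
  replaces \<open>t\<close> by q t in the series for \<open>m\<close>, and the new row contributes
  the series of \<open>kappa_sums\<close>. The shift by q raises every exponent of q in the known
  product by one.\<close>

lemma tuples_sums: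
  fixes t :: complex
  assumes "norm t * of_nat q ^ (n + m) < 1"
  shows "(\<lambda>l. of_nat (card (tuples n m l)) * t ^ l) sums
    (\<Prod>i<m. (1 - of_nat q ^ i * t) / (1 - of_nat q ^ (n + i) * t))"
  using assms
proof (induction m arbitrary: t)
  case 0
  have "(\<lambda>l. of_nat (card (tuples n 0 l)) * t ^ l) = (\<lambda>l. if l = 0 then 1 else 0)"
    by (auto simp: tuples_0)
  then show ?case using sums_If_finite[of "\<lambda>l. l = 0" "\<lambda>_. 1 :: complex"] by simp
next
  case (Suc m)
  let ?q = "of_nat q :: complex"
  let ?F = "\<lambda>t. \<Prod>i<m. (1 - ?q ^ i * t) / (1 - ?q ^ (n + i) * t)"
  define A where "A t l = of_nat (card (tuples n m l)) * (?q * t) ^ l" for t l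
  define K where "K t j = of_nat (kappa n j) * t ^ j" for t :: complex and j
  have q1: "1 \<le> real q ^ k" for k using q_ge_2 by (intro one_le_power) simp
  have ineq: "norm (?q * s) * of_nat q ^ (n + m) < 1" "norm (?q ^ n * s) < 1" if "norm s = norm t" for s
  proof -
    show "norm (?q * s) * of_nat q ^ (n + m) < 1" using Suc.prems that by (simp add: norm_mult mult_ac)
    have "real q ^ n * norm s \<le> real q ^ n * norm s * real q ^ Suc m"
      using mult_left_mono[OF q1[of "Suc m"], of "real q ^ n * norm s"] by simp
    also have "\<dots> < 1" using Suc.prems that by (simp add: power_add mult_ac)
    finally show "norm (?q ^ n * s) < 1" by (simp add: norm_mult norm_power)
  qed
  have A: "A s sums ?F (?q * s)" and K: "K s sums ((1 - s) / (1 - ?q ^ n * s))" if "norm s = norm t" for s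
    unfolding A_def K_def using Suc.IH[OF ineq(1)[OF that]] kappa_sums[OF ineq(2)[OF that]] by simp_all
  have A_norm: "summable (\<lambda>l. norm (A t l))"
  proof -
    have "summable (\<lambda>l. of_nat (card (tuples n m l)) * complex_of_real (norm (?q * t)) ^ l)"
      using sums_summable[OF A[of "of_real (norm t)"]] by (simp add: A_def[abs_def] norm_mult)
    from summable_norm_power_series[OF this] show ?thesis unfolding A_def .
  qed
  have K_norm: "summable (\<lambda>l. norm (K t l))"
  proof -
    have "summable (\<lambda>l. of_nat (kappa n l) * complex_of_real (norm t) ^ l)"
      using sums_summable[OF K[of "of_real (norm t)"]] by (simp add: K_def[abs_def])
    from summable_norm_power_series[OF this] show ?thesis unfolding K_def .
  qed
  have conv: "of_nat (card (tuples n (Suc m) l)) * t ^ l = (\<Sum>i\<le>l. A t i * K t (l - i))" for l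
  proof -
    have "A t i * K t (l - i) = of_nat (card (tuples n m i) * q ^ i * kappa n (l - i)) * t ^ l" if "i \<le> l" for i
    proof -
      have "t ^ l = t ^ i * t ^ (l - i)" using that by (simp flip: power_add)
      then show ?thesis by (simp add: A_def K_def power_mult_distrib)
    qed
    then show ?thesis by (simp add: card_tuples_Suc(2) sum_distrib_right)
  qed
  have "(\<lambda>l. \<Sum>i\<le>l. A t i * K t (l - i)) sums ((\<Sum>l. A t l) * (\<Sum>j. K t j))"
    by (rule Cauchy_product_sums[OF A_norm K_norm])
  moreover have "(\<Sum>l. A t l) = ?F (?q * t)" "(\<Sum>j. K t j) = (1 - t) / (1 - ?q ^ n * t)"
    using A[of t] K[of t] by (simp_all add: sums_iff)
  moreover have "?F (?q * t) * ((1 - t) / (1 - ?q ^ n * t)) =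
      (\<Prod>i<Suc m. (1 - ?q ^ i * t) / (1 - ?q ^ (n + i) * t))"
    unfolding prod.lessThan_Suc_shift by (simp add: mult_ac)
  ultimately show ?case unfolding conv by simp
qed

lemma powr_of_nat_power:
  assumes "q > 0" shows "(of_nat (q ^ l) :: complex) powr z = (of_nat q powr z) ^ l"
proof -
  have "Ln (of_nat (q ^ l)) = of_nat l * Ln (of_nat q)"
    using assms Ln_of_real[of "real (q ^ l)"] Ln_of_real[of "real q"] by (simp add: ln_realpow)
  then show ?thesis using assms by (simp add: powr_def exp_of_nat_mult[symmetric] mult_ac)
qed

end

context unipotent_completion
begin

text \<open>Only degrees that are powers of \<open>q\<close> contribute, so the Dirichlet series is
  the power series of \<open>tuples_sums\<close> in \<open>t\<close>.\<close>

theorem zeta_sums: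
  assumes "Re s > real n + real m"
  defines "t \<equiv> (of_nat q :: complex) powr (- s)"
  shows "norm t * of_nat q ^ (n + m) < 1"
    and "(\<lambda>d. of_nat (card (twist_classes G TG (Suc d))) * of_nat (Suc d) powr (- s)) sums
      (\<Prod>i<m. (1 - of_nat q ^ i * t) / (1 - of_nat q ^ (n + i) * t))"
proof -
  have q: "real q > 1" "q > 0" using q_ge_2 by auto
  have "norm t = real q powr (- Re s)" unfolding t_def using q by (subst norm_powr_real_powr) auto
  moreover have "real q ^ (n + m) = real q powr real (n + m)" using q by (intro powr_realpow[symmetric]) simp
  ultimately have "norm t * of_nat q ^ (n + m) = real q powr (- Re s + real (n + m))" unfolding powr_add[of _ "- Re s"] by simp
  also have "\<dots> < real q powr 0" by (rule powr_less_mono[OF _ q(1)]) (use assms(1) in simp)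
  finally show *: "norm t * of_nat q ^ (n + m) < 1" using q by simp
  define f where "f d = of_nat (card (twist_classes G TG (Suc d))) * (of_nat (Suc d) :: complex) powr (- s)" for d
  \<comment> \<open>The term with index \<open>d\<close> belongs to the degree \<open>Suc d\<close>,
    hence the shift by 1.\<close>
  define g where "g l = q ^ l - 1" for l :: nat
  have g: "Suc (g l) = q ^ l" for l using q by (simp add: g_def)
  have "strict_mono g"
  proof (rule strict_monoI)
    fix k l :: nat assume "k < l"
    then have "q ^ k < q ^ l" using q by (intro power_strict_increasing) auto
    then show "g k < g l" using g[of k] g[of l] by simp
  qed
  moreover have "f d = 0" if "d \<notin> range g" for d
  proof -
    have "Suc d \<notin> range ((^) q)"
    proof
      assume "Suc d \<in> range ((^) q)"
      then obtain l where "Suc d = Suc (g l)" unfolding g by blast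
      then show False using that by blast
    qed
    then show ?thesis using card_twist_classes(3) by (simp add: f_def)
  qed
  ultimately have "(\<lambda>l. f (g l)) sums c \<longleftrightarrow> f sums c" for c by (rule sums_mono_reindex)
  moreover have "f (g l) = of_nat (card (tuples n m l)) * t ^ l" for l
    unfolding f_def g card_twist_classes(2) powr_of_nat_power[OF q(2)] t_def ..
  ultimately show "(\<lambda>d. of_nat (card (twist_classes G TG (Suc d))) * of_nat (Suc d) powr (- s)) sums
      (\<Prod>i<m. (1 - of_nat q ^ i * t) / (1 - of_nat q ^ (n + i) * t))"
    using tuples_sums[OF *] unfolding f_def by simp
qed

end

subsection \<open>Evaluation of bivariate polynomials\<close>

text \<open>The common form of numerical evaluation and of the expansion in \<open>q - 1\<close>,
  from which both inherit the homomorphism laws.\<close>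

definition poly2_hom :: "(rat \<Rightarrow> 'b::comm_ring_1) \<Rightarrow> 'b \<Rightarrow> 'b \<Rightarrow> rat poly poly \<Rightarrow> 'b" where
  "poly2_hom f x y P = poly (map_poly (\<lambda>c. poly (map_poly f c) x) P) y"

lemma poly_map_poly_sum:
  fixes h :: "'a::zero \<Rightarrow> 'b::comm_ring_1"
  assumes "h 0 = 0" shows "poly (map_poly h p) x = (\<Sum>i\<le>degree p. h (coeff p i) * x ^ i)"
proof -
  have "poly (map_poly h p) x = (\<Sum>i\<le>degree (map_poly h p). h (coeff p i) * x ^ i)"
    using assms by (simp add: poly_altdef coeff_map_poly)
  also have "\<dots> = (\<Sum>i\<le>degree p. h (coeff p i) * x ^ i)"
  proof (rule sum.mono_neutral_left)
    show "\<forall>i\<in>{..degree p} - {..degree (map_poly h p)}. h (coeff p i) * x ^ i = 0"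
    proof
      fix i assume "i \<in> {..degree p} - {..degree (map_poly h p)}"
      then have "coeff (map_poly h p) i = 0" by (intro coeff_eq_0) simp
      then show "h (coeff p i) * x ^ i = 0" using assms by (simp add: coeff_map_poly)
    qed
  qed (auto simp: degree_map_poly_le)
  finally show ?thesis .
qed

lemma comm_ring_hom_poly_map:
  assumes "comm_ring_hom f" shows "comm_ring_hom (\<lambda>p. poly (map_poly f p) x)"
proof -
  interpret f: comm_ring_hom f by fact
  interpret mp: map_poly_comm_ring_hom f ..
  show ?thesis by unfold_locales (simp_all add: mp.hom_add mp.hom_mult)
qed

lemma comm_ring_hom_poly2:
  assumes "comm_ring_hom f" shows "comm_ring_hom (poly2_hom f x y)"
  unfolding poly2_hom_def by (intro comm_ring_hom_poly_map assms)

lemma comm_ring_hom_of_rat: "comm_ring_hom (of_rat :: rat \<Rightarrow> 'a::field_char_0)"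
  by unfold_locales (simp_all add: of_rat_add of_rat_mult)

lemma eval_poly2_eq: "eval_poly2 P x y = poly2_hom of_rat x y P"
  by (simp add: eval_poly2_def poly2_hom_def)

text \<open>The expansion sends \<open>X\<close> to the series of q and \<open>Y\<close> to the
  series of q to the power \<open>- s\<close>, since binomial series multiply by adding
  exponents.\<close>

lemma expand_poly2_eq:
  "expand_poly2 = poly2_hom (\<lambda>r. fls_const (of_rat r)) (fps_to_fls (fps_binomial 1)) (fps_to_fls (fps_binomial (- ratfun_s)))"
proof
  fix P
  have "fps_binomial (of_nat a - of_nat b * ratfun_s) = fps_binomial 1 ^ a * fps_binomial (- ratfun_s) ^ b" for a b
    by (simp add: fps_binomial_power flip: fps_binomial_add_mult)
  then show "expand_poly2 P = poly2_hom (\<lambda>r. fls_const (of_rat r)) (fps_to_fls (fps_binomial 1))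
      (fps_to_fls (fps_binomial (- ratfun_s))) P"
    by (simp add: expand_poly2_def poly2_hom_def poly_map_poly_sum fls_times_fps_to_fls fps_to_fls_power
        sum_distrib_right mult.assoc)
qed

lemma comm_ring_hom_fls_const: "comm_ring_hom (\<lambda>r. fls_const (of_rat r :: 'a::field_char_0))"
  by unfold_locales (simp_all add: of_rat_add of_rat_mult fls_const_mult_const fls_plus_const)

lemma comm_ring_hom_expand: "comm_ring_hom expand_poly2"
  unfolding expand_poly2_eq by (intro comm_ring_hom_poly2 comm_ring_hom_fls_const)

lemma comm_ring_hom_eval: "comm_ring_hom (\<lambda>P. eval_poly2 P x y)"
  unfolding eval_poly2_eq by (intro comm_ring_hom_poly2 comm_ring_hom_of_rat)

text \<open>The denominator in lowest terms divides \<open>M\<close>, so it does not vanish under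
  \<open>h\<close> where \<open>M\<close> does not; cross-multiplication then compares the two
  quotients.\<close>

lemma quot_of_fract_hom:
  fixes h :: "'a::{ring_gcd,idom_divide,semiring_gcd_mult_normalize} \<Rightarrow> 'b::field"
  assumes "comm_ring_hom h" and W: "W = to_fract N / to_fract M" and M: "h M \<noteq> 0"
  shows "h (fst (quot_of_fract W)) / h (snd (quot_of_fract W)) = h N / h M"
proof -
  interpret h: comm_ring_hom h by fact
  define a b where "a = fst (quot_of_fract W)" and "b = snd (quot_of_fract W)"
  have b: "b \<noteq> 0" and M0: "M \<noteq> 0" using M by (auto simp: b_def)
  have "to_fract a / to_fract b = W"
    unfolding a_def b_def by (metis Fract_conv_to_fract Fract_quot_of_fract)
  then have "to_fract (a * M) = to_fract (N * b)"
    using b M0 W by (simp add: field_simps)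
  then have eq: "a * M = N * b" by (simp only: to_fract_eq_iff)
  have "coprime a b" unfolding a_def b_def by (rule coprime_quot_of_fract)
  moreover have "b dvd a * M" unfolding eq by simp
  ultimately have "b dvd M" by (simp add: coprime_commute coprime_dvd_mult_right_iff)
  then have "h b \<noteq> 0" using M by (metis dvd_def h.hom_mult mult_zero_left)
  moreover have "h a * h M = h N * h b" using eq by (metis h.hom_mult)
  ultimately show ?thesis using M unfolding a_def b_def by (simp add: field_simps)
qed

text \<open>For each \<open>x\<close> in \<open>L\<close> the polynomial in \<open>y\<close> has
  infinitely many roots and is zero. So each coefficient vanishes on the infinite set
  \<open>L\<close>.\<close>

lemma eval_poly2_eq_0:
  assumes "infinite L" "\<And>x. x \<in> L \<Longrightarrow> infinite {y. eval_poly2 P x y = 0}"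
  shows "P = 0"
proof (rule poly_eqI)
  fix b
  have "poly (map_poly of_rat (coeff P b)) x = 0" if "x \<in> L" for x :: complex
  proof -
    have "map_poly (\<lambda>c. poly (map_poly of_rat c) x) P = 0"
      using assms(2)[OF that] poly_roots_finite unfolding eval_poly2_def by blast
    then have "coeff (map_poly (\<lambda>c. poly (map_poly of_rat c) x) P) b = 0" by simp
    then show ?thesis by (simp add: coeff_map_poly)
  qed
  then have "L \<subseteq> {x. poly (map_poly of_rat (coeff P b)) x = 0}" by blast
  then have "map_poly of_rat (coeff P b) = (0 :: complex poly)"
    using assms(1) poly_roots_finite finite_subset by blast
  then have "of_rat (coeff (coeff P b) a) = (0 :: complex)" for a
    by (metis coeff_0 coeff_map_poly of_rat_0)
  then show "coeff P b = coeff 0 b" by (intro poly_eqI) simp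
qed

subsection \<open>The zeta function as a rational function\<close>

definition binomial_factor :: "nat \<Rightarrow> rat poly poly" where
  "binomial_factor a = 1 - [:[:0, 1:]:] ^ a * [:0, 1:]"

definition zeta_ratfun :: "nat \<Rightarrow> nat \<Rightarrow> rat poly poly fract" where
  "zeta_ratfun m n = to_fract (\<Prod>i<m. binomial_factor i) / to_fract (\<Prod>i<m. binomial_factor (n + i))"

lemma to_fract_prod: "to_fract (prod f A) = (\<Prod>x\<in>A. to_fract (f x))"
  by (induction A rule: infinite_finite_induct) auto

lemma to_fract_binomial_factor: "to_fract (binomial_factor a) = 1 - ratfun_X ^ a * ratfun_Y"
proof -
  have "to_fract (x ^ a) = to_fract x ^ a" for x :: "rat poly poly" by (induction a) auto
  then show ?thesis unfolding binomial_factor_def ratfun_X_def ratfun_Y_def by (simp only: to_fract_diff to_fract_mult to_fract_1)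
qed

lemma cyclotomic_like_zeta: "cyclotomic_like_denominator (zeta_ratfun m n)"
  unfolding cyclotomic_like_denominator_def
proof (intro exI conjI)
  define es where "es = map (\<lambda>i. (int (n + i), 1 :: int)) [0..<m]"
  show "(0, 0) \<notin> set es" by (auto simp: es_def)
  have "(\<Prod>(a, b)\<leftarrow>es. 1 - ratfun_X powi a * ratfun_Y powi b) = (\<Prod>i\<leftarrow>[0..<m]. to_fract (binomial_factor (n + i)))"
    unfolding es_def by (simp add: o_def to_fract_binomial_factor power_int_add flip: power_int_of_nat)
  also have "\<dots> = to_fract (\<Prod>i<m. binomial_factor (n + i))"
    unfolding to_fract_prod by (simp add: prod.list_conv_set_nth lessThan_atLeast0)
  finally show "zeta_ratfun m n = to_fract (\<Prod>i<m. binomial_factor i) /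
      (\<Prod>(a, b)\<leftarrow>es. 1 - ratfun_X powi a * ratfun_Y powi b)"
    by (simp add: zeta_ratfun_def)
qed

lemma poly2_hom_binomial_factor:
  assumes "comm_ring_hom f" shows "poly2_hom f x y (binomial_factor a) = 1 - x ^ a * y"
proof -
  interpret f: comm_ring_hom f by fact
  interpret h: comm_ring_hom "poly2_hom f x y" by (rule comm_ring_hom_poly2[OF assms])
  have 1: "poly2_hom f x y [:[:0, 1:]:] = x" "poly2_hom f x y [:0, 1:] = y"
    by (simp_all add: poly2_hom_def map_poly_pCons)
  have "poly2_hom f x y (p ^ a) = poly2_hom f x y p ^ a" for p by (induction a) (simp_all add: h.hom_mult)
  then show ?thesis unfolding binomial_factor_def by (simp only: h.hom_minus h.hom_mult h.hom_one 1)
qed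

lemma poly2_hom_prod:
  fixes m :: nat
  assumes "comm_ring_hom f" shows "poly2_hom f x y (\<Prod>i<m. g i) = (\<Prod>i<m. poly2_hom f x y (g i))"
proof -
  interpret h: comm_ring_hom "poly2_hom f x y" by (rule comm_ring_hom_poly2[OF assms])
  show ?thesis by (induction m) (simp_all add: h.hom_mult)
qed

lemma eval_zeta_ratfun:
  assumes "\<And>i. i < m \<Longrightarrow> x ^ (n + i) * y \<noteq> 1"
  shows "eval_ratfun (zeta_ratfun m n) x y = (\<Prod>i<m. (1 - x ^ i * y) / (1 - x ^ (n + i) * y))"
proof -
  have e: "eval_poly2 (\<Prod>i<m. binomial_factor (k + i)) x y = (\<Prod>i<m. 1 - x ^ (k + i) * y)" for k
    by (simp add: eval_poly2_eq poly2_hom_prod poly2_hom_binomial_factor comm_ring_hom_of_rat)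
  have "eval_poly2 (\<Prod>i<m. binomial_factor (n + i)) x y \<noteq> 0" unfolding e using assms by fastforce
  from quot_of_fract_hom[OF comm_ring_hom_eval zeta_ratfun_def this] e[of 0] e[of n] show ?thesis
    by (simp add: eval_ratfun_def prod_dividef)
qed

text \<open>The series 1 minus q to the power \<open>a - s\<close> has constant term 0 and linear
  coefficient \<open>s - a\<close>. Each of the \<open>m\<close> factors above and below thus
  contributes one factor \<open>q - 1\<close>; these cancel, and the constant term is the quotient
  of the linear coefficients.\<close>

lemma expand_zeta_ratfun:
  "fls_subdegree (expand_ratfun (zeta_ratfun m n)) \<ge> 0"
  "fls_nth (expand_ratfun (zeta_ratfun m n)) 0 = (\<Prod>i<m. (ratfun_s - of_nat i) / (ratfun_s - of_nat n - of_nat i))"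
proof -
  \<comment> \<open>As \<open>s\<close> is an indeterminate, the linear coefficients are nonzero;
    those in the denominator can be inverted.\<close>
  have s: "ratfun_s - of_nat a \<noteq> 0" for a
  proof
    assume "ratfun_s - of_nat a = 0"
    moreover have "to_fract (of_nat a) = (of_nat a :: rat poly fract)" by (induction a) simp_all
    ultimately have "to_fract [:0, 1 :: rat:] = to_fract (of_nat a)" by (simp add: ratfun_s_def)
    then have "[:0, 1 :: rat:] = of_nat a" by (simp only: to_fract_eq_iff)
    then have "degree [:0, 1 :: rat:] = degree (of_nat a :: rat poly)" by simp
    then show False by simp
  qed
  define h :: "nat \<Rightarrow> rat poly fract fps" where "h a = fps_shift 1 (1 - fps_binomial (of_nat a - ratfun_s))" for a
  have h0: "h a $ 0 = ratfun_s - of_nat a" for a by (simp add: h_def)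
  have h: "1 - fps_binomial (of_nat a - ratfun_s) = fps_X * h a" for a
  proof (rule fps_ext)
    fix k show "(1 - fps_binomial (of_nat a - ratfun_s)) $ k = (fps_X * h a) $ k"
      by (cases k) (auto simp: h_def)
  qed
  have "expand_poly2 (binomial_factor a) = fps_to_fls (fps_X * h a)" for a
  proof -
    have "expand_poly2 (binomial_factor a) =
        1 - fps_to_fls (fps_binomial 1) ^ a * fps_to_fls (fps_binomial (- ratfun_s))"
      unfolding expand_poly2_eq by (rule poly2_hom_binomial_factor[OF comm_ring_hom_fls_const])
    also have "\<dots> = fps_to_fls (1 - fps_binomial 1 ^ a * fps_binomial (- ratfun_s))"
      by (simp add: fls_times_fps_to_fls fps_to_fls_power fps_to_fls_minus)
    also have "fps_binomial 1 ^ a * fps_binomial (- ratfun_s) = fps_binomial (of_nat a - ratfun_s)"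
      by (simp add: fps_binomial_power flip: fps_binomial_add_mult)
    finally show ?thesis by (simp only: h)
  qed
  then have prod: "expand_poly2 (\<Prod>i<m. binomial_factor (k + i)) = fps_to_fls (\<Prod>i<m. fps_X * h (k + i))" for k
  proof -
    have "expand_poly2 (\<Prod>i<m. binomial_factor (k + i)) = (\<Prod>i<m. expand_poly2 (binomial_factor (k + i)))"
      unfolding expand_poly2_eq by (rule poly2_hom_prod[OF comm_ring_hom_fls_const])
    moreover have "(\<Prod>i<m. fps_to_fls (fps_X * h (k + i))) = fps_to_fls (\<Prod>i<m. fps_X * h (k + i))"
      by (induction m) (simp_all only: prod.lessThan_Suc lessThan_0 prod.empty fps_one_to_fls fls_times_fps_to_fls)
    ultimately show ?thesis using \<open>\<And>a. expand_poly2 (binomial_factor a) = fps_to_fls (fps_X * h a)\<close> by simp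
  qed
  \<comment> \<open>The quotient after cancelling the factors \<open>fps_X\<close>: each
    \<open>h (n + i)\<close> has nonzero constant term and is an invertible power series.\<close>
  define H where "H = (\<Prod>i<m. h i * inverse (h (n + i)))"
  have "h a \<noteq> 0" for a using h0[of a] s[of a] by auto
  then have nz: "fps_to_fls (\<Prod>i<m. fps_X * h (n + i)) \<noteq> 0" by simp
  have "inverse (h a) * h a = 1" for a using h0[of a] s[of a] by (intro inverse_mult_eq_1) simp
  then have "(h i * inverse (h (n + i))) * (fps_X * h (n + i)) = fps_X * h i" for i
    by (metis (no_types, lifting) mult.assoc mult.commute mult.right_neutral)
  then have "(\<Prod>i<m. (h i * inverse (h (n + i))) * (fps_X * h (n + i))) = (\<Prod>i<m. fps_X * h i)"
    by (intro prod.cong refl)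
  then have "H * (\<Prod>i<m. fps_X * h (n + i)) = (\<Prod>i<m. fps_X * h i)"
    unfolding H_def prod.distrib[symmetric] .
  then have "fps_to_fls H * fps_to_fls (\<Prod>i<m. fps_X * h (n + i)) = fps_to_fls (\<Prod>i<m. fps_X * h i)"
    unfolding fls_times_fps_to_fls[symmetric] by (rule arg_cong)
  moreover have "expand_ratfun (zeta_ratfun m n) = fps_to_fls (\<Prod>i<m. fps_X * h i) / fps_to_fls (\<Prod>i<m. fps_X * h (n + i))"
    unfolding expand_ratfun_def
    using quot_of_fract_hom[OF comm_ring_hom_expand zeta_ratfun_def] nz prod[of 0] prod[of n] by simp
  ultimately have *: "expand_ratfun (zeta_ratfun m n) = fps_to_fls H"
    using nz by (metis nonzero_mult_div_cancel_right)
  show "fls_subdegree (expand_ratfun (zeta_ratfun m n)) \<ge> 0"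
    unfolding * by (simp add: fls_subdegree_fls_to_fps)
  have "H $ 0 = (\<Prod>i<m. h i $ 0 * inverse (h (n + i) $ 0))"
    unfolding H_def by (induction m) simp_all
  then show "fls_nth (expand_ratfun (zeta_ratfun m n)) 0 = (\<Prod>i<m. (ratfun_s - of_nat i) / (ratfun_s - of_nat n - of_nat i))"
    unfolding * by (simp add: h0 divide_inverse diff_diff_eq)
qed

section \<open>The rational primes as a source of infinitely many residue cardinalities\<close>

lemma rational_integers: "carrier (ring_of_integers \<rat>) = \<int>"
  unfolding ring_of_integers_def
  by (auto intro: rational_algebraic_int_is_int elim: Ints_cases)

lemma number_field_Rats: "number_field \<rat>"
  unfolding number_field_def
proof
  show sf: "subfield \<rat> complex_ring"
  proof (rule complex_ring.subfieldI')
    show "subring \<rat> complex_ring"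
      by (rule complex_ring.subringI) (auto simp: complex_ring_a_inv)
    fix k :: complex assume "k \<in> \<rat> - {\<zero>\<^bsub>complex_ring\<^esub>}"
    then have k: "k \<in> \<rat>" "k \<noteq> 0" by auto
    have "inv\<^bsub>complex_ring\<^esub> k = inverse k"
      by (rule complex_ring.comm_inv_char) (use k in auto)
    then show "inv\<^bsub>complex_ring\<^esub> k \<in> \<rat>" using k by simp
  qed
  show "ring.finite_dimension complex_ring \<rat> \<rat>"
  proof (rule complex_ring.finite_dimensionI)
    have "complex_ring.line_extension \<rat> 1 {0} = \<rat>"
    proof (intro Set.set_eqI)
      fix x :: complex show "x \<in> complex_ring.line_extension \<rat> 1 {0} \<longleftrightarrow> x \<in> \<rat>"
        unfolding complex_ring.line_extension_mem_iff by auto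
    qed
    moreover have "complex_ring.dimension (Suc 0) \<rat> (complex_ring.line_extension \<rat> 1 {0})"
      using complex_ring.zero_dim[of \<rat>]
      by (intro complex_ring.Suc_dim) auto
    ultimately show "complex_ring.dimension (Suc 0) \<rat> \<rat>" by simp
  qed
qed

definition rational_prime :: "nat \<Rightarrow> complex set" where
  "rational_prime l = (*) (of_nat l) ` \<int>"

lemma of_nat_dvd_rational_prime: "of_int k \<in> rational_prime l \<longleftrightarrow> int l dvd k"
proof
  assume "of_int k \<in> rational_prime l"
  then obtain z where "complex_of_int k = of_nat l * of_int z" by (auto simp: rational_prime_def elim: Ints_cases)
  then have "complex_of_int k = of_int (int l * z)" by simp
  then have "k = int l * z" by (simp only: of_int_eq_iff)
  then show "int l dvd k" by simp
next
  assume "int l dvd k"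
  then obtain z where "k = int l * z" by blast
  then show "of_int k \<in> rational_prime l" by (auto simp: rational_prime_def)
qed

lemma nonzero_prime_rational:
  assumes "prime l" shows "nonzero_prime \<rat> (rational_prime l)"
proof -
  let ?R = "ring_of_integers \<rat>"
  have ops: "mult ?R = (*)" "one ?R = 1" "zero ?R = 0" "add ?R = (+)"
    by (simp_all add: ring_of_integers_def)
  have car: "carrier ?R = \<int>" by (rule rational_integers)
  interpret R: cring ?R
  proof (rule cringI)
    show "abelian_group ?R"
    proof (rule abelian_groupI)
      show "\<exists>y\<in>carrier ?R. y \<oplus>\<^bsub>?R\<^esub> x = \<zero>\<^bsub>?R\<^esub>" if "x \<in> carrier ?R" for x
        using that unfolding ops car by (intro bexI[of _ "- x"]) auto
    qed (auto simp: ops car)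
    show "comm_monoid ?R" by (rule comm_monoidI) (auto simp: ops car)
  qed (auto simp: ops car algebra_simps)
  have l: "int l > 1" "prime (int l)" using assms prime_gt_1_nat by auto
  have sub: "rational_prime l \<subseteq> \<int>" by (auto simp: rational_prime_def)
  have "ideal (rational_prime l) ?R"
  proof (rule idealI)
    show "ring ?R" by (rule R.ring_axioms)
    show "subgroup (rational_prime l) (add_monoid ?R)"
    proof (rule subgroup.intro)
      show "rational_prime l \<subseteq> carrier (add_monoid ?R)" using sub by (simp add: car)
      show "x \<otimes>\<^bsub>add_monoid ?R\<^esub> y \<in> rational_prime l" if "x \<in> rational_prime l" "y \<in> rational_prime l" for x y
        using that by (auto simp: rational_prime_def ops distrib_left[symmetric])
      show "\<one>\<^bsub>add_monoid ?R\<^esub> \<in> rational_prime l" by (auto simp: ops rational_prime_def intro: image_eqI[of _ _ 0])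
      show "inv\<^bsub>add_monoid ?R\<^esub> x \<in> rational_prime l" if x: "x \<in> rational_prime l" for x
      proof -
        have "\<ominus>\<^bsub>?R\<^esub> x = - x" by (rule R.minus_equality) (use x sub in \<open>auto simp: ops car\<close>)
        moreover obtain z where "x = of_nat l * z" "z \<in> \<int>" using x by (auto simp: rational_prime_def)
        then have "- x = of_nat l * (- z)" "- z \<in> \<int>" by auto
        then have "- x \<in> rational_prime l" unfolding rational_prime_def by (rule image_eqI)
        ultimately show ?thesis by (simp add: a_inv_def)
      qed
    qed
    fix a x assume a: "a \<in> rational_prime l" and x: "x \<in> carrier ?R"
    obtain z where z: "a = of_nat l * z" "z \<in> \<int>" using a by (auto simp: rational_prime_def)
    have eq: "x * a = of_nat l * (x * z)" "a * x = of_nat l * (x * z)" using z(1) by auto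
    have "x * z \<in> \<int>" using x z(2) by (simp add: car)
    then have "of_nat l * (x * z) \<in> rational_prime l"
      unfolding rational_prime_def by (rule imageI[where f = "(*) (of_nat l)"])
    then show "x \<otimes>\<^bsub>?R\<^esub> a \<in> rational_prime l" and "a \<otimes>\<^bsub>?R\<^esub> x \<in> rational_prime l"
      by (simp_all only: ops eq)
  qed
  then have "primeideal (rational_prime l) ?R"
  proof (rule primeidealI[OF _ R.cring_axioms])
    have "1 \<notin> rational_prime l" using of_nat_dvd_rational_prime[of 1 l] l by auto
    then show "carrier ?R \<noteq> rational_prime l" unfolding car by (metis Ints_1)
    fix a b assume ab: "a \<in> carrier ?R" "b \<in> carrier ?R" "a \<otimes>\<^bsub>?R\<^esub> b \<in> rational_prime l"
    obtain i where i: "a = of_int i" using ab(1) unfolding car by (rule Ints_cases)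
    obtain j where j: "b = of_int j" using ab(2) unfolding car by (rule Ints_cases)
    have "of_int (i * j) \<in> rational_prime l" using ab(3) by (simp add: i j ops)
    then have "int l dvd i * j" unfolding of_nat_dvd_rational_prime .
    then have "int l dvd i \<or> int l dvd j" using l(2) prime_dvd_mult_iff by blast
    then show "a \<in> rational_prime l \<or> b \<in> rational_prime l" unfolding i j of_nat_dvd_rational_prime .
  qed
  moreover have "rational_prime l \<noteq> {0}"
  proof
    assume 0: "rational_prime l = {0}"
    have "of_int (int l) \<in> rational_prime l" unfolding of_nat_dvd_rational_prime by (rule dvd_refl)
    then have "of_int (int l) = (0 :: complex)" unfolding 0 by (rule singletonD)
    then show False using l(1) unfolding of_int_eq_0_iff by linarith
  qed
  ultimately show ?thesis by (simp add: nonzero_prime_def)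
qed

lemma residue_cardinality_rational:
  assumes "prime l" shows "residue_cardinality \<rat> (rational_prime l) = l"
proof -
  interpret number_field_prime \<rat> "rational_prime l"
    by unfold_locales (intro number_field_Rats nonzero_prime_rational[OF assms])+
  have sub: "add_subgroup (rational_prime l)"
    unfolding rational_prime_def by (rule mult_image_subgroup) (auto simp: add_subgroup_def)
  define T where "T = (\<lambda>k. of_int k :: complex) ` {0..<int l}"
  have l: "int l > 0" using assms prime_gt_0_nat by auto
  have "transversal \<int> (rational_prime l) T"
    unfolding transversal_def
  proof (intro conjI ballI impI)
    show "T \<subseteq> \<int>" by (auto simp: T_def)
    fix g :: complex assume "g \<in> \<int>"
    then obtain k where k: "g = of_int k" by (auto elim: Ints_cases)
    have "of_int (k - k mod int l) \<in> rational_prime l" unfolding of_nat_dvd_rational_prime by simp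
    then show "\<exists>t\<in>T. g - t \<in> rational_prime l"
      using l by (intro bexI[of _ "of_int (k mod int l)"]) (auto simp: k T_def)
  next
    fix s t assume "s \<in> T" "t \<in> T" and d: "s - t \<in> rational_prime l"
    then obtain i j where ij: "s = of_int i" "t = of_int j" "0 \<le> i" "i < int l" "0 \<le> j" "j < int l" by (auto simp: T_def)
    have "of_int (i - j) \<in> rational_prime l" using d by (simp add: ij)
    then have "i mod int l = j mod int l" unfolding of_nat_dvd_rational_prime mod_eq_dvd_iff .
    then show "s = t" using ij by simp
  qed
  then have "subgroup_index \<int> (rational_prime l) = card T" by (rule transversal_index(1)[OF sub])
  also have "card T = l" unfolding T_def by (subst card_image) (auto simp: inj_on_def)
  finally show ?thesis using residue_cardinality_index rational_integers by simp
qed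

section \<open>The zeta function at all primes, and uniqueness of the rational function\<close>

lemma unipotent_zeta:
  assumes "number_field K" "nonzero_prime K p"
  shows "finite (twist_classes (unipotent_group m n (completion K p)) (unipotent_topology m n (completion_topology K p)) d)"
    and "Re s > real n + real m \<Longrightarrow>
      (\<lambda>d. of_nat (card (twist_classes (unipotent_group m n (completion K p))
        (unipotent_topology m n (completion_topology K p)) (Suc d))) * of_nat (Suc d) powr (- s)) sums
      eval_ratfun (zeta_ratfun m n) (of_nat (residue_cardinality K p)) (of_nat (residue_cardinality K p) powr (- s))"
    and "Re s > real n + real m \<Longrightarrow> i < m \<Longrightarrow>
      of_nat (residue_cardinality K p) ^ (n + i) * of_nat (residue_cardinality K p) powr (- s) \<noteq> (1 :: complex)"
proof -
  interpret number_field_prime K p by (rule number_field_prime.intro) fact+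
  interpret U: unipotent_completion D \<pi> "completion K p" "completion_topology K p" res_class m n ..
  have q: "residue_cardinality K p = q" by (simp only: residue_cardinality_eq q_def)
  show "finite (twist_classes (unipotent_group m n (completion K p)) (unipotent_topology m n (completion_topology K p)) d)"
    by (rule U.card_twist_classes(1))
  define t where "t = (of_nat q :: complex) powr (- s)"
  \<comment> \<open>As \<open>n + i\<close> is below \<open>n + m\<close>, the bound that gives
    convergence also keeps the denominators away from 0.\<close>
  have ne: "of_nat q ^ (n + i) * t \<noteq> 1" if s: "Re s > real n + real m" and i: "i < m" for i
  proof
    assume "of_nat q ^ (n + i) * t = 1"
    then have "norm (of_nat q ^ (n + i) * t) = 1" by simp
    then have "1 = real q ^ (n + i) * norm t" by (simp add: norm_mult norm_power)
    also have "\<dots> \<le> real q ^ (n + m) * norm t"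
      using q_ge_2 i by (intro mult_right_mono power_increasing) auto
    also have "\<dots> < 1" using U.zeta_sums(1)[OF s] by (simp add: t_def mult.commute)
    finally show False by simp
  qed
  show "(\<lambda>d. of_nat (card (twist_classes (unipotent_group m n (completion K p))
        (unipotent_topology m n (completion_topology K p)) (Suc d))) * of_nat (Suc d) powr (- s)) sums
      eval_ratfun (zeta_ratfun m n) (of_nat (residue_cardinality K p)) (of_nat (residue_cardinality K p) powr (- s))"
    if s: "Re s > real n + real m"
    using U.zeta_sums(2)[OF s] eval_zeta_ratfun[of m "of_nat q" n t, OF ne[OF s]] unfolding q t_def by simp
  show "of_nat (residue_cardinality K p) ^ (n + i) * of_nat (residue_cardinality K p) powr (- s) \<noteq> (1 :: complex)"
    if "Re s > real n + real m" "i < m"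
    using ne[OF that] unfolding q t_def .
qed

lemma uniform_zeta:
  "uniform_representation_zeta (\<lambda>L r. unipotent_group m n (completion L r))
    (\<lambda>L r. unipotent_topology m n (completion_topology L r)) (zeta_ratfun m n)"
  unfolding uniform_representation_zeta_def has_representation_zeta_def Let_def
proof (intro conjI allI impI cyclotomic_like_zeta)
  fix K p d assume "number_field K \<and> nonzero_prime K p"
  then have Kp: "number_field K" "nonzero_prime K p" by auto
  show "finite (twist_classes (unipotent_group m n (completion K p)) (unipotent_topology m n (completion_topology K p)) d)"
    by (rule unipotent_zeta(1)[OF Kp])
next
  fix K p assume "number_field K \<and> nonzero_prime K p"
  then have Kp: "number_field K" "nonzero_prime K p" by auto
  show "\<exists>\<sigma>. \<forall>s. \<sigma> < Re s \<longrightarrow>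
      (\<lambda>d. of_nat (card (twist_classes (unipotent_group m n (completion K p))
        (unipotent_topology m n (completion_topology K p)) (Suc d))) * of_nat (Suc d) powr (- s)) sums
      eval_ratfun (zeta_ratfun m n) (of_nat (residue_cardinality K p)) (of_nat (residue_cardinality K p) powr (- s))"
    by (intro exI[of _ "real n + real m"] allI impI unipotent_zeta(2)[OF Kp])
qed

text \<open>At each rational prime both rational functions evaluate to the same zeta function, hence
  agree at infinitely many points in the second variable. As there are infinitely many primes, they
  are equal.\<close>

lemma uniform_zeta_unique:
  assumes W: "uniform_representation_zeta (\<lambda>L r. unipotent_group m n (completion L r))
    (\<lambda>L r. unipotent_topology m n (completion_topology L r)) W"
  shows "W = zeta_ratfun m n"
proof -
  define P Q where "P = fst (quot_of_fract W)" and "Q = snd (quot_of_fract W)"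
  define N M where "N = (\<Prod>i<m. binomial_factor i)" and "M = (\<Prod>i<m. binomial_factor (n + i))"
  \<comment> \<open>The extra factor \<open>Q\<close> makes \<open>R\<close> vanish also where the
    denominator of \<open>W\<close> does.\<close>
  define R where "R = (P * M - N * Q) * Q"
  have Q: "Q \<noteq> 0" by (simp add: Q_def)
  have "R = 0"
  proof (rule eval_poly2_eq_0)
    show "infinite ((of_nat :: nat \<Rightarrow> complex) ` {l. prime l})"
      using primes_infinite by (subst finite_image_iff) (auto simp: inj_on_def)
    fix x :: complex assume "x \<in> of_nat ` {l. prime l}"
    then obtain l :: nat where l: "prime l" "x = of_nat l" by blast
    note pr = number_field_Rats nonzero_prime_rational[OF l(1)]
    have "has_representation_zeta (unipotent_group m n (completion \<rat> (rational_prime l)))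
      (unipotent_topology m n (completion_topology \<rat> (rational_prime l)))
      (\<lambda>s. let q = of_nat (residue_cardinality \<rat> (rational_prime l)) in eval_ratfun W q (q powr (- s)))"
      by (rule conjunct2[OF W[unfolded uniform_representation_zeta_def], THEN spec, THEN spec, THEN mp]) (rule conjI[OF pr])
    then have "\<exists>\<sigma>. \<forall>s. Re s > \<sigma> \<longrightarrow>
      (\<lambda>d. of_nat (card (twist_classes (unipotent_group m n (completion \<rat> (rational_prime l)))
        (unipotent_topology m n (completion_topology \<rat> (rational_prime l))) (Suc d))) * of_nat (Suc d) powr (- s)) sums
      eval_ratfun W x (x powr (- s))"
      unfolding has_representation_zeta_def Let_def residue_cardinality_rational[OF l(1)] l(2)[symmetric] by (rule conjunct2)
    then obtain \<sigma> where "\<forall>s. Re s > \<sigma> \<longrightarrow>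
      (\<lambda>d. of_nat (card (twist_classes (unipotent_group m n (completion \<rat> (rational_prime l)))
        (unipotent_topology m n (completion_topology \<rat> (rational_prime l))) (Suc d))) * of_nat (Suc d) powr (- s)) sums
      eval_ratfun W x (x powr (- s))" by (rule exE)
    note \<sigma> = this[rule_format]
    \<comment> \<open>The test points are integers \<open>s = k\<close> beyond both abscissas of
      validity; they give pairwise distinct powers of the prime.\<close>
    define k0 where "k0 = nat \<lceil>max \<sigma> (real n + real m)\<rceil>"
    let ?y = "\<lambda>k::nat. x powr (- of_nat k)"
    have "eval_poly2 R x (?y k) = 0" if "k > k0" for k
    proof -
      have "max \<sigma> (real n + real m) < real k" using that unfolding k0_def by linarith
      then have k: "Re (of_nat k) > \<sigma>" "Re (of_nat k) > real n + real m" by simp_all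
      have ev: "comm_ring_hom (\<lambda>P. eval_poly2 P x (?y k))" by (rule comm_ring_hom_eval)
      interpret ev: comm_ring_hom "\<lambda>P. eval_poly2 P x (?y k)" by (rule ev)
      have "eval_poly2 M x (?y k) = (\<Prod>i<m. 1 - x ^ (n + i) * ?y k)"
        by (simp add: M_def eval_poly2_eq poly2_hom_prod poly2_hom_binomial_factor comm_ring_hom_of_rat)
      moreover have "x ^ (n + i) * ?y k \<noteq> 1" if "i < m" for i
        using unipotent_zeta(3)[OF pr k(2) that] residue_cardinality_rational[OF l(1)] by (simp add: l(2))
      ultimately have M: "eval_poly2 M x (?y k) \<noteq> 0" by fastforce
      have "eval_ratfun W x (?y k) = eval_ratfun (zeta_ratfun m n) x (?y k)"
        using sums_unique2[OF \<sigma>[OF k(1)]] unipotent_zeta(2)[OF pr k(2)] residue_cardinality_rational[OF l(1)]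
        by (simp add: l(2))
      also have "\<dots> = eval_poly2 N x (?y k) / eval_poly2 M x (?y k)"
        unfolding eval_ratfun_def
        by (rule quot_of_fract_hom[OF ev _ M]) (simp add: zeta_ratfun_def N_def M_def)
      finally have "eval_poly2 P x (?y k) / eval_poly2 Q x (?y k) = eval_poly2 N x (?y k) / eval_poly2 M x (?y k)"
        by (simp add: eval_ratfun_def P_def Q_def)
      then show ?thesis
        using M unfolding R_def ev.hom_mult ev.hom_minus by (cases "eval_poly2 Q x (?y k) = 0") (auto simp: field_simps)
    qed
    then have sub: "?y ` {k0<..} \<subseteq> {y. eval_poly2 R x y = 0}" by auto
    have "inj_on ?y {k0<..}"
    proof (rule inj_onI)
      fix i j assume "?y i = ?y j"
      then have "norm (?y i) = norm (?y j)" by simp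
      then have "real l powr (- real i) = real l powr (- real j)" using l by (simp add: norm_powr_real_powr)
      then show "i = j" using prime_gt_1_nat[OF l(1)] by (simp add: powr_inj)
    qed
    then have "infinite (?y ` {k0<..})" using infinite_Ioi[of k0] finite_image_iff by blast
    then show "infinite {y. eval_poly2 R x y = 0}" using sub finite_subset by blast
  qed
  then have "P * M = N * Q" using Q by (simp add: R_def)
  moreover have "M \<noteq> 0"
  proof
    assume "M = 0"
    then obtain i where i: "binomial_factor (n + i) = 0" by (auto simp: M_def)
    have "eval_poly2 (binomial_factor (n + i)) 0 0 = 1"
      by (simp add: eval_poly2_eq poly2_hom_binomial_factor comm_ring_hom_of_rat)
    then show False by (simp add: i eval_poly2_def)
  qed
  ultimately have "to_fract P / to_fract Q = to_fract N / to_fract M"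
    using Q by (simp add: field_simps flip: to_fract_mult)
  moreover have "W = to_fract P / to_fract Q"
    unfolding P_def Q_def by (metis Fract_conv_to_fract Fract_quot_of_fract)
  ultimately show ?thesis by (simp add: zeta_ratfun_def N_def M_def)
qed

theorem corollary1p6:
  fixes m n :: nat and K p :: "complex set"
  assumes "1 \<le> m" and "m \<le> n"
    and "number_field K" and "nonzero_prime K p"
  shows "has_topological_representation_zeta
           (\<lambda>L r. unipotent_group m n (completion L r))
           (\<lambda>L r. unipotent_topology m n (completion_topology L r))
           (\<Prod>i<m. (ratfun_s - of_nat i) / (ratfun_s - of_nat n - of_nat i))"
  unfolding has_topological_representation_zeta_def
proof (intro conjI allI impI)
  show "\<exists>W. uniform_representation_zeta (\<lambda>L r. unipotent_group m n (completion L r))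
      (\<lambda>L r. unipotent_topology m n (completion_topology L r)) W"
    by (rule exI) (rule uniform_zeta)
  fix W assume "uniform_representation_zeta (\<lambda>L r. unipotent_group m n (completion L r))
      (\<lambda>L r. unipotent_topology m n (completion_topology L r)) W"
  then have W: "W = zeta_ratfun m n" by (rule uniform_zeta_unique)
  show "0 \<le> fls_subdegree (expand_ratfun W)" unfolding W by (rule expand_zeta_ratfun(1))
  show "fls_nth (expand_ratfun W) 0 = (\<Prod>i<m. (ratfun_s - of_nat i) / (ratfun_s - of_nat n - of_nat i))"
    unfolding W by (rule expand_zeta_ratfun(2))
qed

end
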